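(* Let $N=2$. There exists $p^*>1$ such that for every $p>p^*$ the following holds. Let $\psi_p$ be any eigenfunction associated with the second variational eigenvalue $\lambda_2(B_1^{\pi/4};p)$ of the Dirichlet $p$-Laplacian on the sector $B_1^{\pi/4}$, and let $\hat\Psi_{4,2}$ be the function on the unit disk $B_1$ obtained from $\psi_p$ by successive odd reflections across the rays $\theta=j\pi/4$ (in polar coordinates: for $\theta\in(j\pi/4,(j+1)\pi/4)$, $j=0,\dots,7$, $\hat\Psi_{4,2}(\rho,\theta)=(-1)^j\psi_p(\rho,\theta-j\pi/4)$ if $j$ is even and $\hat\Psi_{4,2}(\rho,\theta)=(-1)^j\psi_p(\rho,(j+1)\pi/4-\theta)$ if $j$ is odd). Then the nodal set $\{x\in B_1:\hat\Psi_{4,2}(x)=0\}$ is neither a union of diameters of $B_1$, nor a union of circles centered at the origin, nor a union of diameters and circles centered at the origin; namely, it is the union of diameters together with a noncircular set.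
   Context: For a bounded Lipschitz domain $\Omega\subset\mathbb{R}^2$ and $p>1$, let $\mathcal{S}=\{u\in W_0^{1,p}(\Omega):\|u\|_{L^p(\Omega)}=1\}$ and let $\mathcal{F}_k$ be the family of sets $h(\mathcal{S}^{k-1})\subset\mathcal{S}$ with $\mathcal{S}^{k-1}$ the unit sphere of $\mathbb{R}^k$ and $h:\mathcal{S}^{k-1}\to\mathcal{S}$ continuous and odd; then $\lambda_k(\Omega;p)=\inf_{\mathcal{A}\in\mathcal{F}_k}\sup_{u\in\mathcal{A}}\int_\Omega|\nabla u|^p\,dx$ is an eigenvalue of $-\Delta_p u=\lambda|u|^{p-2}u$ in $\Omega$, $u=0$ on $\partial\Omega$, where $\Delta_p u=\mathrm{div}(|\nabla u|^{p-2}\nabla u)$. Here $B_1^{\pi/4}=\{(\rho\cos\theta,\rho\sin\theta):0<\rho<1,\ 0<\theta<\pi/4\}$. The function $\hat\Psi_{4,2}$ is an eigenfunction of the Dirichlet $p$-Laplacian on $B_1$ with eigenvalue $\lambda_2(B_1^{\pi/4};p)$. *)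

theory Defs
  imports "HOL-Analysis.Analysis"
begin

type_synonym R2 = "real^2"

definition polar :: "real \<Rightarrow> real \<Rightarrow> R2" where
  "polar \<rho> \<theta> = vector [\<rho> * cos \<theta>, \<rho> * sin \<theta>]"

definition sector :: "R2 set" where
  "sector = {polar \<rho> \<theta> | \<rho> \<theta>. 0 < \<rho> \<and> \<rho> < 1 \<and> 0 < \<theta> \<and> \<theta> < pi / 4}"

definition test_fun :: "R2 set \<Rightarrow> (R2 \<Rightarrow> real) \<Rightarrow> (R2 \<Rightarrow> R2) \<Rightarrow> bool" where
  "test_fun \<Omega> \<phi> G \<longleftrightarrow>
     (\<forall>x. (\<phi> has_derivative (\<lambda>h. G x \<bullet> h)) (at x)) \<and> continuous_on UNIV G \<and>
     compact (closure {x. \<phi> x \<noteq> 0}) \<and> closure {x. \<phi> x \<noteq> 0} \<subseteq> \<Omega>"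

definition sobolev0 :: "real \<Rightarrow> R2 set \<Rightarrow> (R2 \<Rightarrow> real) \<Rightarrow> (R2 \<Rightarrow> R2) \<Rightarrow> bool" where
  "sobolev0 p \<Omega> u g \<longleftrightarrow>
     set_borel_measurable lebesgue \<Omega> u \<and> set_borel_measurable lebesgue \<Omega> g \<and>
     (\<integral>\<^sup>+x\<in>\<Omega>. ennreal (\<bar>u x\<bar> powr p) \<partial>lebesgue) < \<infinity> \<and>
     (\<integral>\<^sup>+x\<in>\<Omega>. ennreal (norm (g x) powr p) \<partial>lebesgue) < \<infinity> \<and>
     (\<exists>\<phi> G. (\<forall>n. test_fun \<Omega> (\<phi> n) (G n)) \<and>
        (\<lambda>n. \<integral>\<^sup>+x\<in>\<Omega>. ennreal (\<bar>\<phi> n x - u x\<bar> powr p) \<partial>lebesgue) \<longlonglongrightarrow> 0 \<and>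
        (\<lambda>n. \<integral>\<^sup>+x\<in>\<Omega>. ennreal (norm (G n x - g x) powr p) \<partial>lebesgue) \<longlonglongrightarrow> 0)"

definition in_W0 :: "real \<Rightarrow> R2 set \<Rightarrow> (R2 \<Rightarrow> real) \<Rightarrow> bool" where
  "in_W0 p \<Omega> u \<longleftrightarrow> (\<exists>g. sobolev0 p \<Omega> u g)"

text \<open>The weak gradient (unique a.e.).\<close>
definition wgrad :: "real \<Rightarrow> R2 set \<Rightarrow> (R2 \<Rightarrow> real) \<Rightarrow> R2 \<Rightarrow> R2" where
  "wgrad p \<Omega> u = (SOME g. sobolev0 p \<Omega> u g)"

definition Lp_pow :: "real \<Rightarrow> R2 set \<Rightarrow> (R2 \<Rightarrow> real) \<Rightarrow> real" where
  "Lp_pow p \<Omega> u = enn2real (\<integral>\<^sup>+x\<in>\<Omega>. ennreal (\<bar>u x\<bar> powr p) \<partial>lebesgue)"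

definition energy :: "real \<Rightarrow> R2 set \<Rightarrow> (R2 \<Rightarrow> real) \<Rightarrow> real" where
  "energy p \<Omega> u = enn2real (\<integral>\<^sup>+x\<in>\<Omega>. ennreal (norm (wgrad p \<Omega> u x) powr p) \<partial>lebesgue)"

definition W_norm :: "real \<Rightarrow> R2 set \<Rightarrow> (R2 \<Rightarrow> real) \<Rightarrow> real" where
  "W_norm p \<Omega> u = (Lp_pow p \<Omega> u + energy p \<Omega> u) powr (1 / p)"

definition Ssph :: "real \<Rightarrow> R2 set \<Rightarrow> (R2 \<Rightarrow> real) set" where
  "Ssph p \<Omega> = {u. in_W0 p \<Omega> u \<and> Lp_pow p \<Omega> u = 1}"

text \<open>Admissible maps h : S^{k-1} \<rightarrow> \<S>, continuous (W^{1,p}-topology) and odd; here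
  S^{k-1} is the unit sphere of the euclidean space 'a (of dimension k).\<close>
definition admissible :: "'a::euclidean_space itself \<Rightarrow> real \<Rightarrow> R2 set \<Rightarrow> ('a \<Rightarrow> R2 \<Rightarrow> real) \<Rightarrow> bool" where
  "admissible _ p \<Omega> h \<longleftrightarrow>
     (\<forall>x\<in>sphere 0 1. h x \<in> Ssph p \<Omega>) \<and>
     (\<forall>x\<in>sphere 0 1. \<forall>y\<in>\<Omega>. h (- x) y = - h x y) \<and>
     (\<forall>x\<in>sphere 0 1. \<forall>e>0. \<exists>d>0. \<forall>y\<in>sphere 0 1. dist y x < d \<longrightarrow>
         W_norm p \<Omega> (\<lambda>z. h y z - h x z) < e)"

text \<open>Variational eigenvalue \<lambda>_k(\<Omega>;p), with k = DIM('a).\<close>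
definition var_eig :: "'a::euclidean_space itself \<Rightarrow> real \<Rightarrow> R2 set \<Rightarrow> real" where
  "var_eig T p \<Omega> = Inf {Sup ((\<lambda>x. energy p \<Omega> (h x)) ` sphere (0::'a) 1) | h. admissible T p \<Omega> h}"

abbreviation lambda2 :: "real \<Rightarrow> R2 set \<Rightarrow> real" where
  "lambda2 p \<Omega> \<equiv> var_eig TYPE(real^2) p \<Omega>"

definition eigenfunction :: "real \<Rightarrow> R2 set \<Rightarrow> real \<Rightarrow> (R2 \<Rightarrow> real) \<Rightarrow> bool" where
  "eigenfunction p \<Omega> lam u \<longleftrightarrow>
     in_W0 p \<Omega> u \<and> \<not> (AE x in lebesgue. x \<in> \<Omega> \<longrightarrow> u x = 0) \<and>
     (\<forall>\<phi> G. test_fun \<Omega> \<phi> G \<longrightarrow>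
        (\<integral>x\<in>\<Omega>. norm (wgrad p \<Omega> u x) powr (p - 2) * (wgrad p \<Omega> u x \<bullet> G x) \<partial>lebesgue)
        = lam * (\<integral>x\<in>\<Omega>. \<bar>u x\<bar> powr (p - 2) * u x * \<phi> x \<partial>lebesgue))"

text \<open>Odd reflection of \<psi> (given on the sector) to the unit disk; set to 0 on the rays
  \<theta> = j pi/4 and at the origin (the values of the continuous extension).\<close>
definition sector_data :: "R2 \<Rightarrow> real \<Rightarrow> real \<Rightarrow> nat \<Rightarrow> bool" where
  "sector_data x \<rho> \<theta> j \<longleftrightarrow> j < 8 \<and> 0 < \<rho> \<and> \<rho> < 1 \<and>
      real j * pi / 4 < \<theta> \<and> \<theta> < (real j + 1) * pi / 4 \<and> x = polar \<rho> \<theta>"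

definition reflect8 :: "(R2 \<Rightarrow> real) \<Rightarrow> R2 \<Rightarrow> real" where
  "reflect8 \<psi> x =
     (if \<exists>\<rho> \<theta> j. sector_data x \<rho> \<theta> j then
        (let (\<rho>, \<theta>, j) = (SOME (\<rho>, \<theta>, j). sector_data x \<rho> \<theta> j) in
          if even j then (-1) ^ j * \<psi> (polar \<rho> (\<theta> - real j * pi / 4))
          else (-1) ^ j * \<psi> (polar \<rho> ((real j + 1) * pi / 4 - \<theta>)))
      else 0)"

definition diameter :: "real \<Rightarrow> R2 set" where
  "diameter \<alpha> = {polar t \<alpha> | t. -1 < t \<and> t < 1}"

end

theory Submission imports Defs begin

text \<open>For large p the number lambda2^(1/p) is squeezed into an interval. Two disjoint discs in the
  sector give the upper bound, about 1/0.1805. For the lower bound, the mean of a function over a small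
  polar rectangle around the incentre is odd, so it vanishes somewhere on every admissible loop; a
  function with vanishing mean satisfies a Poincare inequality, which gives lambda2^(1/p) at least
  about 1/0.265.

  Suppose that the nodal set consists of diameters and circles. A zero ray or zero arc cuts off a piece
  of the sector that is covered by arcs and radii of length at most 0.1804 starting at a zero, so by the
  upper bound and the Poincare inequality psi vanishes on one side of it. Hence psi has one sign, and it
  is then nonzero everywhere because the gradient of ln psi is locally bounded in L^p. But for a positive
  eigenfunction Picone's inequality, tested with a bump supported in a disc of radius 0.27 around the
  incentre, bounds lambda2^(1/p) by about 1/0.267, which contradicts the lower bound.\<close>

section \<open>Integrals over the plane and polar coordinates\<close>

text \<open>Only the bases of p-th powers count: a factor that does not grow exponentially
  disappears under the p-th root, so factors such as 10^8 are generous while lengths have to be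
  sharp. For a zero arc at radius r the inside is reached by arcs of angle pi/8 from the two sides
  up to some radius x, then by radii down from the zero arc, and the outside by radii from both of
  its arcs. Balancing x * pi/8 = r - x = (1 - r)/2 gives lengths of about 0.18029, against 0.18096
  for two discs: this narrow window is the reason for 0.1804 < 0.1805 and for a bound on pi with
  four decimals. The inradius of the sector, sin(pi/8) / (1 + sin(pi/8)), is about 0.2768, so one
  bump has much more room than two. Hence the base of the lower bound only has to stay below 0.267.
  The averaging rectangle is there because the incentre is too far from the boundary to be reached
  by curves of length 0.265; it has to be small because the inequality for functions with mean zero
  and the subtraction of the mean each cost 2^p, so that its sides count four times.\<close>

lemma jensen_powr:
  fixes f :: "'a \<Rightarrow> real"
  assumes fin: "emeasure M (space M) < \<infinity>" and f: "f \<in> borel_measurable M"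
    and nn: "\<And>x. f x \<ge> 0" and int: "integrable M f" and p: "p \<ge> 1"
  shows "ennreal ((\<integral>x. f x \<partial>M) powr p) \<le> ennreal (measure M (space M) powr (p - 1)) * (\<integral>\<^sup>+x. ennreal (f x powr p) \<partial>M)"
proof (cases "(\<integral>\<^sup>+x. ennreal (f x powr p) \<partial>M) = \<infinity> \<or> (\<integral>x. f x \<partial>M) \<le> 0")
  case True
  define m where "m = measure M (space M)"
  have I0: "(\<integral>x. f x \<partial>M) \<ge> 0" by (simp add: nn integral_nonneg)
  show ?thesis
  proof (cases "(\<integral>x. f x \<partial>M) = 0")
    case True then show ?thesis using p by simp
  next
    case False
    then have inf: "(\<integral>\<^sup>+x. ennreal (f x powr p) \<partial>M) = \<infinity>" and I: "(\<integral>x. f x \<partial>M) > 0" using True I0 by auto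
    \<comment> \<open>In \<open>ennreal\<close> the product of 0 and infinity is 0, so a null
      measure has to be excluded before the infinite right-hand side settles this case.\<close>
    have "emeasure M (space M) \<noteq> 0"
    proof
      assume "emeasure M (space M) = 0"
      then have "AE x in M. f x = 0" by (intro AE_I[where N="space M"]) auto
      then have "(\<integral>x. f x \<partial>M) = 0" by (simp add: integral_eq_zero_AE)
      then show False using I by simp
    qed
    then have "m > 0" using fin by (simp add: m_def measure_def enn2real_positive_iff less_top zero_less_iff_neq_zero)
    then show ?thesis using inf by (simp add: m_def ennreal_mult_top)
  qed
next
  case False
  define m where "m = measure M (space M)"
  define I where "I = (\<integral>x. f x \<partial>M)"
  define J where "J = (\<integral>x. f x powr p \<partial>M)"
  have I: "I > 0" and Jf: "(\<integral>\<^sup>+x. ennreal (f x powr p) \<partial>M) < \<infinity>" using False by (auto simp: I_def less_top)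
  interpret finite_measure M using fin by (intro finite_measureI) auto
  have intp: "integrable M (\<lambda>x. f x powr p)" using f Jf by (intro integrableI_bounded) auto
  have m: "m > 0"
  proof (rule ccontr)
    assume "\<not> m > 0"
    then have "measure M (space M) = 0" using measure_nonneg[of M "space M"] unfolding m_def by linarith
    then have "emeasure M (space M) = 0" by (simp add: emeasure_eq_measure)
    then have "AE x in M. f x = 0" by (intro AE_I[where N="space M"]) auto
    then have "(\<integral>x. f x \<partial>M) = 0" by (simp add: integral_eq_zero_AE)
    then show False using I I_def by simp
  qed
  \<comment> \<open>The tangent of y powr p is taken at the mean value a of f; after integration its
    linear term vanishes because I = m * a.\<close>
  define a where "a = I / m"
  have a: "a > 0" using I m by (simp add: a_def)
  have tang: "y powr p \<ge> a powr p + p * a powr (p - 1) * (y - a)" if y: "y \<ge> 0" for y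
  proof (cases "y = 0")
    case True
    have "a powr p = a powr (p - 1) * a" using a by (simp add: powr_mult_base mult.commute)
    then show ?thesis using True p a by (simp add: algebra_simps)
  next
    case False
    then have y: "y > 0" using y by simp
    have "y powr p - a powr p \<ge> (p * a powr (p - 1)) * (y - a)"
    proof (rule convex_on_imp_above_tangent[where A = "{0<..}"])
      show "convex_on {0<..} (\<lambda>x. x powr p)" by (rule powr_convex[OF p])
      show "((\<lambda>x. x powr p) has_field_derivative p * a powr (p - 1)) (at a within {0<..})"
        using a by (auto intro!: derivative_eq_intros simp: field_simps powr_diff)
    qed (use a y in \<open>auto simp: interior_open connected_Ioi\<close>)
    then show ?thesis by simp
  qed
  have "(\<integral>x. a powr p + p * a powr (p - 1) * (f x - a) \<partial>M) \<le> J"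
    unfolding J_def by (intro integral_mono intp tang nn) (use int in auto)
  moreover have "(\<integral>x. a powr p + p * a powr (p - 1) * (f x - a) \<partial>M) = m * a powr p + p * a powr (p - 1) * (I - m * a)"
    using int by (simp add: I_def m_def algebra_simps)
  moreover have "I - m * a = 0" using m by (simp add: a_def)
  ultimately have "m * a powr p \<le> J" by simp
  then have "I powr p \<le> m powr (p - 1) * J"
    using m I by (simp add: a_def powr_divide powr_diff field_simps)
  moreover have "(\<integral>\<^sup>+x. ennreal (f x powr p) \<partial>M) = ennreal J"
    unfolding J_def by (intro nn_integral_eq_integral intp) auto
  ultimately show ?thesis
    by (simp add: I_def m_def ennreal_leI flip: ennreal_mult')
qed

text \<open>The difference is at most the integral of |f'| over the whole interval, wherever x and y
  lie, and Jensen turns this into a p-th power. Morrey's inequality and all Poincare inequalities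
  below are integrated versions of this bound.\<close>

lemma osc_le:
  fixes f f' :: "real \<Rightarrow> real"
  assumes ab: "a \<le> b" and p: "p \<ge> 1"
    and d: "\<And>x. x \<in> {a..b} \<Longrightarrow> (f has_real_derivative f' x) (at x)"
    and c: "continuous_on {a..b} f'" and x: "x \<in> {a..b}" and y: "y \<in> {a..b}"
  shows "ennreal (\<bar>f x - f y\<bar> powr p) \<le> ennreal ((b - a) powr (p - 1)) * (\<integral>\<^sup>+s\<in>{a..b}. ennreal (\<bar>f' s\<bar> powr p) \<partial>lborel)"
proof -
  define M where "M = restrict_space lborel {a..b}"
  have fin: "emeasure M (space M) = ennreal (b - a)" using ab
    by (simp add: M_def emeasure_restrict_space space_restrict_space)
  have ms: "measure M (space M) = b - a" using fin ab by (simp add: measure_def)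
  have ca: "continuous_on {a..b} (\<lambda>s. \<bar>f' s\<bar>)" using c by (intro continuous_intros)
  have si: "set_integrable lborel {a..b} (\<lambda>s. \<bar>f' s\<bar>)" using ca by (intro borel_integrable_atLeastAtMost')
  then have int: "integrable M (\<lambda>s. \<bar>f' s\<bar>)" unfolding M_def set_integrable_def
    by (subst integrable_restrict_space) auto
  have I: "(\<integral>s. \<bar>f' s\<bar> \<partial>M) = integral {a..b} (\<lambda>s. \<bar>f' s\<bar>)"
    unfolding M_def by (subst integral_restrict_space) (use si in \<open>auto simp: set_borel_integral_eq_integral(2)[OF si, symmetric] set_lebesgue_integral_def\<close>)
  have le: "\<bar>f x - f y\<bar> \<le> integral {a..b} (\<lambda>s. \<bar>f' s\<bar>)" if "x \<in> {a..b}" "y \<in> {a..b}" "y \<le> x" for x y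
  proof -
    have sub: "{y..x} \<subseteq> {a..b}" using that by auto
    have "(f' has_integral (f x - f y)) {y..x}"
      using that d by (intro fundamental_theorem_of_calculus) (auto simp: has_real_derivative_iff_has_vector_derivative[symmetric] intro: has_field_derivative_at_within)
    then have "\<bar>f x - f y\<bar> = \<bar>integral {y..x} f'\<bar>" by (simp add: integral_unique)
    also have "\<dots> \<le> integral {y..x} (\<lambda>s. \<bar>f' s\<bar>)"
      using integral_norm_bound_integral[of f' "{y..x}" "\<lambda>s. \<bar>f' s\<bar>"] continuous_on_subset[OF c sub] continuous_on_subset[OF ca sub]
      by (auto intro: integrable_continuous_real)
    also have "\<dots> \<le> integral {a..b} (\<lambda>s. \<bar>f' s\<bar>)"
      using continuous_on_subset[OF ca sub] ca sub by (intro integral_subset_le) (auto intro: integrable_continuous_real)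
    finally show ?thesis .
  qed
  have "\<bar>f x - f y\<bar> \<le> (\<integral>s. \<bar>f' s\<bar> \<partial>M)"
    using le[OF x y] le[OF y x] I by (cases "y \<le> x") auto
  then have "ennreal (\<bar>f x - f y\<bar> powr p) \<le> ennreal ((\<integral>s. \<bar>f' s\<bar> \<partial>M) powr p)"
    using p by (intro ennreal_leI powr_mono2) auto
  also have "\<dots> \<le> ennreal ((b - a) powr (p - 1)) * (\<integral>\<^sup>+s. ennreal (\<bar>f' s\<bar> powr p) \<partial>M)"
    using jensen_powr[of M "\<lambda>s. \<bar>f' s\<bar>" p] fin int p ms by (auto simp: less_top)
  also have "(\<integral>\<^sup>+s. ennreal (\<bar>f' s\<bar> powr p) \<partial>M) = (\<integral>\<^sup>+s\<in>{a..b}. ennreal (\<bar>f' s\<bar> powr p) \<partial>lborel)"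
    unfolding M_def by (subst nn_integral_restrict_space) auto
  finally show ?thesis .
qed

section \<open>Cartesian and polar coordinates of the plane\<close>

abbreviation vec2 :: "real \<Rightarrow> real \<Rightarrow> R2" where "vec2 a b \<equiv> vector [a, b]"

lemma R2_eqI: "x $ 1 = y $ 1 \<Longrightarrow> x $ 2 = y $ 2 \<Longrightarrow> x = (y::R2)"
  by (simp add: vec_eq_iff forall_2)

lemma continuous_on_vec2 [continuous_intros]:
  fixes f g :: "'a::topological_space \<Rightarrow> real"
  assumes "continuous_on S f" "continuous_on S g"
  shows "continuous_on S (\<lambda>x. vec2 (f x) (g x))"
proof -
  have "continuous_on S (\<lambda>x. \<chi> i. if i = (1::2) then f x else g x)"
    by (rule continuous_on_vec_lambda, rename_tac i, case_tac "i = (1::2)") (use assms in auto)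
  moreover have "(\<chi> i. if i = (1::2) then f x else g x) = vec2 (f x) (g x)" for x by (rule R2_eqI) auto
  ultimately show ?thesis by simp
qed

lemma measurable_vec2 [measurable]:
  "(\<lambda>z. vec2 (fst z) (snd z)) \<in> borel_measurable (borel \<Otimes>\<^sub>M borel)"
  unfolding borel_prod by (intro borel_measurable_continuous_onI continuous_intros)

lemma measurable_vec2' [measurable (raw)]:
  assumes "f \<in> borel_measurable M" "g \<in> borel_measurable M"
  shows "(\<lambda>z. vec2 (f z) (g z)) \<in> borel_measurable M"
  using measurable_compose[OF measurable_Pair[OF assms] measurable_vec2] by simp

text \<open>Both measures give a box the product of its side lengths, which characterises
  \<open>lborel\<close>. This brings Fubini to \<open>real^2\<close>.\<close>

lemma lborel_R2: "lborel = distr (lborel \<Otimes>\<^sub>M lborel) borel (\<lambda>z. vec2 (fst z) (snd z))"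
proof (rule lborel_eqI)
  fix l u :: R2 assume lu: "\<And>b. b \<in> Basis \<Longrightarrow> l \<bullet> b \<le> u \<bullet> b"
  have le: "l $ i \<le> u $ i" for i using lu[of "axis i 1"] by (simp add: cart_eq_inner_axis)
  have "emeasure (distr (lborel \<Otimes>\<^sub>M lborel) borel (\<lambda>z. vec2 (fst z) (snd z))) (box l u) =
    emeasure (lborel \<Otimes>\<^sub>M lborel) ({l$1<..<u$1} \<times> {l$2<..<u$2})"
  proof (subst emeasure_distr)
    show "(\<lambda>z. vec2 (fst z) (snd z)) \<in> lborel \<Otimes>\<^sub>M lborel \<rightarrow>\<^sub>M borel"
      using measurable_vec2 by (simp cong: measurable_cong_sets)
  qed (auto simp: space_pair_measure mem_box_cart forall_2 intro!: arg_cong[where f="emeasure _"])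
  also have "\<dots> = ennreal (u$1 - l$1) * ennreal (u$2 - l$2)"
    using le by (subst lborel.emeasure_pair_measure_Times) auto
  also have "\<dots> = ennreal (\<Prod>b\<in>Basis. (u - l) \<bullet> b)"
  proof -
    have "(\<Prod>b\<in>Basis. (u - l) \<bullet> b) = (\<Prod>i\<in>UNIV. (u - l) $ i)"
      by (simp add: Basis_vec_def prod.UNION_disjoint UNION_singleton_eq_range axis_eq_axis prod.reindex inj_on_def cart_eq_inner_axis)
    also have "\<dots> = (u$1 - l$1) * (u$2 - l$2)" by (simp add: UNIV_2)
    finally show ?thesis using le by (simp add: ennreal_mult)
  qed
  finally show "emeasure (distr (lborel \<Otimes>\<^sub>M lborel) borel (\<lambda>z. vec2 (fst z) (snd z))) (box l u) = ennreal (\<Prod>b\<in>Basis. (u - l) \<bullet> b)" .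
qed simp

lemma nn_integral_R2:
  assumes [measurable]: "f \<in> borel_measurable borel"
  shows "(\<integral>\<^sup>+x. f x \<partial>(lborel::R2 measure)) = (\<integral>\<^sup>+a. \<integral>\<^sup>+b. f (vec2 a b) \<partial>lborel \<partial>lborel)"
  by (subst lborel_R2, subst nn_integral_distr)
    (auto simp: lborel.nn_integral_fst[symmetric] cong: measurable_cong_sets)

lemma norm_R2: "norm (x::R2) = sqrt ((x$1)\<^sup>2 + (x$2)\<^sup>2)"
  by (simp add: norm_vec_def L2_set_def UNIV_2)

lemma norm_polar [simp]: "norm (polar \<rho> \<theta>) = \<bar>\<rho>\<bar>"
proof -
  have "(\<rho> * cos \<theta>)\<^sup>2 + (\<rho> * sin \<theta>)\<^sup>2 = \<rho>\<^sup>2 * ((sin \<theta>)\<^sup>2 + (cos \<theta>)\<^sup>2)"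
    unfolding power_mult_distrib distrib_left by (rule add.commute)
  then show ?thesis by (simp add: norm_R2 polar_def)
qed

lemma sin_less_cos: "0 < \<theta> \<Longrightarrow> \<theta> < pi / 4 \<Longrightarrow> 0 < sin \<theta> \<and> sin \<theta> < cos \<theta>"
proof
  assume a: "0 < \<theta>" "\<theta> < pi / 4"
  then show "0 < sin \<theta>" by (intro sin_gt_zero) auto
  have "sin \<theta> < sin (pi / 4)" using a by (intro sin_monotone_2pi) auto
  moreover have "cos (pi / 4) < cos \<theta>" using a by (intro cos_monotone_0_pi) auto
  ultimately show "sin \<theta> < cos \<theta>" by (simp add: sin_45 cos_45)
qed

lemma polar_surj:
  assumes "0 < x$2" "x$2 < x$1"
  obtains \<theta> where "0 < \<theta>" "\<theta> < pi / 4" "x = polar (norm x) \<theta>"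
proof -
  define \<theta> where "\<theta> = arctan (x$2 / x$1)"
  have x1: "x$1 > 0" using assms by simp
  have t: "0 < \<theta>" using assms by (simp add: \<theta>_def)
  have t2: "\<theta> < pi / 4" using assms x1 arctan_less_iff[of "x$2 / x$1" 1] by (simp add: \<theta>_def arctan_one)
  have s: "sqrt (1 + (x$2 / x$1)\<^sup>2) = norm x / x$1"
  proof -
    have "1 + (x$2 / x$1)\<^sup>2 = ((x$1)\<^sup>2 + (x$2)\<^sup>2) / (x$1)\<^sup>2" using x1 by (simp add: field_simps)
    then show ?thesis using x1 by (simp add: norm_R2 real_sqrt_divide)
  qed
  have n0: "norm x > 0" using x1 by auto
  have "x = polar (norm x) \<theta>"
    by (rule R2_eqI) (use x1 n0 in \<open>auto simp: polar_def \<theta>_def cos_arctan sin_arctan s\<close>)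
  then show ?thesis using that t t2 by blast
qed

lemma mem_sector: "x \<in> sector \<longleftrightarrow> 0 < x$2 \<and> x$2 < x$1 \<and> norm x < 1"
proof
  assume "x \<in> sector"
  then obtain \<rho> \<theta> where "x = polar \<rho> \<theta>" "0 < \<rho>" "\<rho> < 1" "0 < \<theta>" "\<theta> < pi / 4" by (auto simp: sector_def)
  then show "0 < x$2 \<and> x$2 < x$1 \<and> norm x < 1" using sin_less_cos[of \<theta>] by (simp add: polar_def norm_polar[unfolded polar_def])
next
  assume a: "0 < x$2 \<and> x$2 < x$1 \<and> norm x < 1"
  then obtain \<theta> where "0 < \<theta>" "\<theta> < pi / 4" "x = polar (norm x) \<theta>" using polar_surj by blast
  moreover have "norm x > 0" using a by auto
  ultimately show "x \<in> sector" using a unfolding sector_def by blast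
qed

lemma open_sector: "open sector"
proof -
  have "sector = {x. 0 < x$2} \<inter> {x. x$2 < x$1} \<inter> ball 0 1" by (auto simp: mem_sector)
  also have "open \<dots>" by (intro open_Int open_Collect_less continuous_intros) auto
  finally show ?thesis .
qed

lemma sector_borel [measurable]: "sector \<in> sets borel" using open_sector by auto

lemma polar_in_sector: "\<rho> > 0 \<Longrightarrow> 0 < \<theta> \<Longrightarrow> \<theta> < pi / 4 \<Longrightarrow> polar \<rho> \<theta> \<in> sector \<longleftrightarrow> \<rho> < 1"
  using sin_less_cos[of \<theta>] by (simp add: mem_sector norm_polar, simp add: polar_def)

text \<open>Uniqueness of the angle is taken from the argument of the complex number
  \<open>cis s\<close>.\<close>

lemma polar_inj:
  assumes "polar r s = polar r' s'" "r > 0" "r' > 0" "s \<in> {-pi<..pi}" "s' \<in> {-pi<..pi}"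
  shows "r = r' \<and> s = s'"
proof -
  have "norm (polar r s) = norm (polar r' s')" using assms(1) by (rule arg_cong)
  then have r: "r = r'" using assms(2,3) unfolding norm_polar by simp
  have e: "polar r s $ 1 = polar r' s' $ 1" "polar r s $ 2 = polar r' s' $ 2" using assms(1) by auto
  have "cos s = cos s'" "sin s = sin s'" using e assms(2,3) r by (auto simp: polar_def)
  then have "cis s = cis s'" by (simp add: complex_eq_iff)
  moreover have "Arg (cis s) = s" by (rule cis_Arg_unique) (use assms in \<open>auto simp: sgn_cis\<close>)
  moreover have "Arg (cis s') = s'" by (rule cis_Arg_unique) (use assms in \<open>auto simp: sgn_cis\<close>)
  ultimately show ?thesis using r by metis
qed

lemma continuous_on_polar [continuous_intros]:
  fixes f g :: "'a::t2_space \<Rightarrow> real"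
  assumes "continuous_on S f" "continuous_on S g"
  shows "continuous_on S (\<lambda>x. polar (f x) (g x))"
  unfolding polar_def by (intro continuous_intros assms)

lemma measurable_polar [measurable (raw)]:
  assumes [measurable]: "f \<in> borel_measurable M" "g \<in> borel_measurable M"
  shows "(\<lambda>z. polar (f z) (g z)) \<in> borel_measurable M"
  unfolding polar_def by measurable

text \<open>Polar coordinates by one-dimensional substitutions: the second coordinate is x1 * t,
  then t = tan \<theta>, then x1 = \<rho> * cos \<theta>. The three Jacobians x1, 1 / cos^2 and cos
  multiply to \<rho>. The order of integration is exchanged after the first substitution, so that
  the slope, and later the angle, is the outer variable.\<close>

lemma nn_integral_sector:
  assumes f[measurable]: "f \<in> borel_measurable borel"
  shows "(\<integral>\<^sup>+x\<in>sector. f x \<partial>lborel) =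
    (\<integral>\<^sup>+\<theta>. \<integral>\<^sup>+\<rho>. ennreal \<rho> * f (polar \<rho> \<theta>) * indicator ({0<..<1} \<times> {0<..<pi/4}) (\<rho>, \<theta>) \<partial>lborel \<partial>lborel)"
proof -
  define F where "F x = f x * indicator sector x" for x
  have F[measurable]: "F \<in> borel_measurable borel" unfolding F_def by measurable
  define H where "H t = (\<integral>\<^sup>+a. ennreal a * F (vec2 a (a * t)) * indicator {0<..} a \<partial>lborel)" for t
  have Hm[measurable]: "H \<in> borel_measurable borel" unfolding H_def by measurable
  \<comment> \<open>Slopes outside the open unit interval miss the sector; this cuts the range of t
    down to the interval from tan 0 to tan (pi/4).\<close>
  have H0: "H t = 0" if "\<not> (0 < t \<and> t < 1)" for t
  proof -
    have z: "ennreal a * F (vec2 a (a * t)) * indicator {0<..} a = 0" for a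
      using that by (auto simp: F_def mem_sector indicator_def zero_less_mult_iff)
    have "H t = (\<integral>\<^sup>+a. 0 \<partial>(lborel :: real measure))" unfolding H_def by (intro nn_integral_cong z)
    then show ?thesis by simp
  qed
  have "(\<integral>\<^sup>+x\<in>sector. f x \<partial>lborel) = (\<integral>\<^sup>+a. \<integral>\<^sup>+b. F (vec2 a b) \<partial>lborel \<partial>lborel)"
    unfolding F_def[symmetric] by (intro nn_integral_R2) simp
  also have "\<dots> = (\<integral>\<^sup>+a. \<integral>\<^sup>+t. ennreal a * F (vec2 a (a * t)) * indicator {0<..} a \<partial>lborel \<partial>lborel)"
  proof (rule nn_integral_cong)
    fix a :: real
    show "(\<integral>\<^sup>+b. F (vec2 a b) \<partial>lborel) = (\<integral>\<^sup>+t. ennreal a * F (vec2 a (a * t)) * indicator {0<..} a \<partial>lborel)"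
    proof (cases "a > 0")
      case True
      have "(\<integral>\<^sup>+b. F (vec2 a b) \<partial>lborel) = ennreal \<bar>a\<bar> * (\<integral>\<^sup>+t. F (vec2 a (0 + a * t)) \<partial>lborel)"
        using True by (intro nn_integral_real_affine) auto
      then show ?thesis using True by (simp add: nn_integral_cmult)
    next
      case False
      then have "F (vec2 a b) = 0" for b by (auto simp: F_def mem_sector indicator_def)
      then show ?thesis using False by simp
    qed
  qed
  also have "\<dots> = (\<integral>\<^sup>+t. H t \<partial>lborel)" unfolding H_def
    by (intro lborel_pair.Fubini') measurable
  also have "\<dots> = (\<integral>\<^sup>+t. H t * indicator {tan 0..tan (pi/4)} t \<partial>lborel)"
    by (intro nn_integral_cong) (use H0 in \<open>force simp: indicator_def tan_45\<close>)
  also have "\<dots> = (\<integral>\<^sup>+\<theta>. H (tan \<theta>) * ennreal (inverse ((cos \<theta>)\<^sup>2)) * indicator {0..pi/4} \<theta> \<partial>lborel)"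
  proof (intro nn_integral_substitution_aux)
    have c: "cos x \<noteq> 0" if "x \<in> {0..pi/4}" for x
    proof -
      have "- (pi / 2) < x" "x < pi / 2" using that pi_gt_zero unfolding atLeastAtMost_iff by linarith+
      then show ?thesis using cos_gt_zero_pi[of x] by auto
    qed
    show "(tan has_real_derivative inverse ((cos x)\<^sup>2)) (at x)" if "x \<in> {0..pi/4}" for x
      by (intro DERIV_tan c that)
    show "continuous_on {0..pi/4} (\<lambda>x. inverse ((cos x)\<^sup>2))" using c by (intro continuous_intros) auto
  qed auto
  also have "\<dots> = (\<integral>\<^sup>+\<theta>. \<integral>\<^sup>+\<rho>. ennreal \<rho> * f (polar \<rho> \<theta>) * indicator ({0<..<1} \<times> {0<..<pi/4}) (\<rho>, \<theta>) \<partial>lborel \<partial>lborel)"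
  proof (intro nn_integral_cong)
    fix \<theta> :: real
    show "H (tan \<theta>) * ennreal (inverse ((cos \<theta>)\<^sup>2)) * indicator {0..pi/4} \<theta> = (\<integral>\<^sup>+\<rho>. ennreal \<rho> * f (polar \<rho> \<theta>) * indicator ({0<..<1} \<times> {0<..<pi/4}) (\<rho>, \<theta>) \<partial>lborel)"
    proof (cases "0 < \<theta> \<and> \<theta> < pi/4")
      case False
      then have "\<theta> \<in> {0..pi/4} \<Longrightarrow> \<theta> = 0 \<or> \<theta> = pi/4" by auto
      then have "\<theta> \<in> {0..pi/4} \<Longrightarrow> tan \<theta> = 0 \<or> tan \<theta> = 1" using tan_45 tan_zero by metis
      then have "H (tan \<theta>) * ennreal (inverse ((cos \<theta>)\<^sup>2)) * indicator {0..pi/4} \<theta> = 0"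
        using H0[of "tan \<theta>"] by (cases "\<theta> \<in> {0..pi/4}") auto
      then show ?thesis using False by (auto simp: indicator_def)
    next
      case True
      then have c: "cos \<theta> > 0" using sin_less_cos[of \<theta>] by linarith
      have "H (tan \<theta>) = ennreal \<bar>cos \<theta>\<bar> * (\<integral>\<^sup>+\<rho>. ennreal (0 + cos \<theta> * \<rho>) * F (vec2 (0 + cos \<theta> * \<rho>) ((0 + cos \<theta> * \<rho>) * tan \<theta>)) * indicator {0<..} (0 + cos \<theta> * \<rho>) \<partial>lborel)"
        unfolding H_def using c by (intro nn_integral_real_affine) auto
      also have "(\<integral>\<^sup>+\<rho>. ennreal (0 + cos \<theta> * \<rho>) * F (vec2 (0 + cos \<theta> * \<rho>) ((0 + cos \<theta> * \<rho>) * tan \<theta>)) * indicator {0<..} (0 + cos \<theta> * \<rho>) \<partial>lborel)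
        = (\<integral>\<^sup>+\<rho>. ennreal (cos \<theta>) * (ennreal \<rho> * f (polar \<rho> \<theta>) * indicator ({0<..<1} \<times> {0<..<pi/4}) (\<rho>, \<theta>)) \<partial>lborel)"
      proof (intro nn_integral_cong)
        fix \<rho> :: real
        have e: "vec2 (0 + cos \<theta> * \<rho>) ((0 + cos \<theta> * \<rho>) * tan \<theta>) = polar \<rho> \<theta>"
          using c by (intro R2_eqI) (auto simp: polar_def tan_def)
        show "ennreal (0 + cos \<theta> * \<rho>) * F (vec2 (0 + cos \<theta> * \<rho>) ((0 + cos \<theta> * \<rho>) * tan \<theta>)) * indicator {0<..} (0 + cos \<theta> * \<rho>) =
          ennreal (cos \<theta>) * (ennreal \<rho> * f (polar \<rho> \<theta>) * indicator ({0<..<1} \<times> {0<..<pi/4}) (\<rho>, \<theta>))"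
          unfolding e using c True polar_in_sector[of \<rho> \<theta>]
          by (auto simp: indicator_def F_def zero_less_mult_iff ennreal_mult mult.assoc)
      qed
      also have "\<dots> = ennreal (cos \<theta>) * (\<integral>\<^sup>+\<rho>. (ennreal \<rho> * f (polar \<rho> \<theta>) * indicator ({0<..<1} \<times> {0<..<pi/4}) (\<rho>, \<theta>)) \<partial>lborel)"
        by (intro nn_integral_cmult) measurable
      finally have e: "H (tan \<theta>) = ennreal \<bar>cos \<theta>\<bar> * (ennreal (cos \<theta>) * (\<integral>\<^sup>+\<rho>. (ennreal \<rho> * f (polar \<rho> \<theta>) * indicator ({0<..<1} \<times> {0<..<pi/4}) (\<rho>, \<theta>)) \<partial>lborel))" .
      have "ennreal (inverse ((cos \<theta>)\<^sup>2)) * (ennreal \<bar>cos \<theta>\<bar> * ennreal (cos \<theta>)) = 1"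
        using c by (simp add: power2_eq_square field_simps flip: ennreal_mult)
      moreover have "H (tan \<theta>) * ennreal (inverse ((cos \<theta>)\<^sup>2)) = ennreal (inverse ((cos \<theta>)\<^sup>2)) * (ennreal \<bar>cos \<theta>\<bar> * ennreal (cos \<theta>)) *
        (\<integral>\<^sup>+\<rho>. (ennreal \<rho> * f (polar \<rho> \<theta>) * indicator ({0<..<1} \<times> {0<..<pi/4}) (\<rho>, \<theta>)) \<partial>lborel)"
        unfolding e by (simp only: mult_ac)
      ultimately show ?thesis using True by simp
    qed
  qed
  finally show ?thesis .
qed

section \<open>Polar rectangles: integrals, and oscillation along rays and arcs\<close>

definition rect_int :: "real \<Rightarrow> real \<Rightarrow> real \<Rightarrow> real \<Rightarrow> (R2 \<Rightarrow> ennreal) \<Rightarrow> ennreal" where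
  "rect_int a b c d F = (\<integral>\<^sup>+\<theta>\<in>{c..d}. (\<integral>\<^sup>+\<rho>\<in>{a..b}. ennreal \<rho> * F (polar \<rho> \<theta>) \<partial>lborel) \<partial>lborel)"

lemma rect_int_swap:
  assumes [measurable]: "F \<in> borel_measurable borel"
  shows "rect_int a b c d F = (\<integral>\<^sup>+\<rho>\<in>{a..b}. ennreal \<rho> * (\<integral>\<^sup>+\<theta>\<in>{c..d}. F (polar \<rho> \<theta>) \<partial>lborel) \<partial>lborel)"
proof -
  have "rect_int a b c d F = (\<integral>\<^sup>+\<theta>. \<integral>\<^sup>+\<rho>. ennreal \<rho> * F (polar \<rho> \<theta>) * indicator {a..b} \<rho> * indicator {c..d} \<theta> \<partial>lborel \<partial>lborel)"
    unfolding rect_int_def by (subst nn_integral_multc[symmetric]) auto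
  also have "\<dots> = (\<integral>\<^sup>+\<rho>. \<integral>\<^sup>+\<theta>. ennreal \<rho> * F (polar \<rho> \<theta>) * indicator {a..b} \<rho> * indicator {c..d} \<theta> \<partial>lborel \<partial>lborel)"
    by (intro lborel_pair.Fubini') measurable
  also have "\<dots> = (\<integral>\<^sup>+\<rho>\<in>{a..b}. ennreal \<rho> * (\<integral>\<^sup>+\<theta>\<in>{c..d}. F (polar \<rho> \<theta>) \<partial>lborel) \<partial>lborel)"
    by (intro nn_integral_cong, subst mult.assoc, subst nn_integral_cmult[symmetric], measurable,
        subst nn_integral_multc[symmetric], measurable) (auto intro!: nn_integral_cong simp: mult_ac)
  finally show ?thesis .
qed

lemma polar_axis: "polar \<rho> \<theta> = (\<rho> * cos \<theta>) *\<^sub>R axis 1 1 + (\<rho> * sin \<theta>) *\<^sub>R axis 2 1"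
  by (rule R2_eqI) (auto simp: polar_def axis_def)

lemma deriv_polar_radius:
  assumes "\<And>x. (\<phi> has_derivative (\<lambda>h. G x \<bullet> h)) (at x)"
  shows "((\<lambda>\<rho>. \<phi> (polar \<rho> \<theta>)) has_real_derivative G (polar \<rho> \<theta>) \<bullet> polar 1 \<theta>) (at \<rho>)"
proof -
  have "((\<lambda>\<rho>. polar \<rho> \<theta>) has_derivative (\<lambda>h. h *\<^sub>R polar 1 \<theta>)) (at \<rho>)"
    unfolding polar_axis by (auto intro!: derivative_eq_intros simp: algebra_simps)
  from has_derivative_compose[OF this assms] show ?thesis
    unfolding has_field_derivative_def by (rule has_derivative_eq_rhs) (auto simp: mult.commute)
qed

text \<open>\<open>polar \<rho> (\<theta> + pi/2)\<close> is the tangent vector of the circle. Its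
  length \<rho> is what turns angles into arc lengths in the estimates below.\<close>

lemma deriv_polar_angle:
  assumes "\<And>x. (\<phi> has_derivative (\<lambda>h. G x \<bullet> h)) (at x)"
  shows "((\<lambda>\<theta>. \<phi> (polar \<rho> \<theta>)) has_real_derivative G (polar \<rho> \<theta>) \<bullet> polar \<rho> (\<theta> + pi/2)) (at \<theta>)"
proof -
  have "((\<lambda>\<theta>. polar \<rho> \<theta>) has_derivative (\<lambda>h. h *\<^sub>R polar \<rho> (\<theta> + pi/2))) (at \<theta>)"
    unfolding polar_axis by (auto intro!: derivative_eq_intros simp: algebra_simps sin_add cos_add)
  from has_derivative_compose[OF this assms] show ?thesis
    unfolding has_field_derivative_def by (rule has_derivative_eq_rhs) (auto simp: mult.commute)
qed

lemma inner_polar_le: "\<bar>v \<bullet> polar \<rho> \<theta>\<bar> \<le> \<bar>\<rho>\<bar> * norm v"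
  using Cauchy_Schwarz_ineq2[of v "polar \<rho> \<theta>"] by (simp add: mult.commute)

lemma nn_integral_const_interval: "a \<le> b \<Longrightarrow> (\<integral>\<^sup>+x\<in>{a..b}. c \<partial>lborel) = c * ennreal (b - a)" for a b :: real
  by (simp add: nn_integral_cmult_indicator)

lemma C1_continuous:
  fixes \<phi> :: "R2 \<Rightarrow> real"
  assumes "\<And>x. (\<phi> has_derivative (\<lambda>h. G x \<bullet> h)) (at x)"
  shows "continuous_on UNIV \<phi>"
  by (meson assms has_derivative_continuous continuous_at_imp_continuous_on)

lemma C1_measurable:
  fixes \<phi> :: "R2 \<Rightarrow> real" and G :: "R2 \<Rightarrow> R2"
  assumes "\<And>x. (\<phi> has_derivative (\<lambda>h. G x \<bullet> h)) (at x)" "continuous_on UNIV G"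
  shows "\<phi> \<in> borel_measurable borel" "G \<in> borel_measurable borel"
  using C1_continuous assms by (auto intro: borel_measurable_continuous_onI)

context
  fixes \<phi> :: "R2 \<Rightarrow> real" and G :: "R2 \<Rightarrow> R2" and a b c d p :: real
  assumes deriv: "\<And>x. (\<phi> has_derivative (\<lambda>h. G x \<bullet> h)) (at x)" and cont: "continuous_on UNIV G"
    and ab: "a \<le> b" and cd: "c \<le> d" and a0: "0 \<le> a" and p: "p \<ge> 1"
begin

lemma radial_osc:
  assumes "x \<in> {a..b}" "y \<in> {a..b}"
  shows "ennreal (\<bar>\<phi> (polar x \<theta>) - \<phi> (polar y \<theta>)\<bar> powr p)
    \<le> ennreal ((b - a) powr (p - 1)) * (\<integral>\<^sup>+s\<in>{a..b}. ennreal (norm (G (polar s \<theta>)) powr p) \<partial>lborel)"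
proof -
  have "ennreal (\<bar>\<phi> (polar x \<theta>) - \<phi> (polar y \<theta>)\<bar> powr p)
    \<le> ennreal ((b - a) powr (p - 1)) * (\<integral>\<^sup>+s\<in>{a..b}. ennreal (\<bar>G (polar s \<theta>) \<bullet> polar 1 \<theta>\<bar> powr p) \<partial>lborel)"
    by (rule osc_le[OF ab p deriv_polar_radius[OF deriv] _ assms])
      (auto intro!: continuous_intros continuous_on_compose2[OF cont])
  also have "\<dots> \<le> ennreal ((b - a) powr (p - 1)) * (\<integral>\<^sup>+s\<in>{a..b}. ennreal (norm (G (polar s \<theta>)) powr p) \<partial>lborel)"
    using inner_polar_le[of _ 1 \<theta>] p
    by (intro mult_left_mono nn_integral_mono mult_right_mono ennreal_leI powr_mono2) auto
  finally show ?thesis .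
qed

lemma angular_osc:
  assumes "x \<in> {c..d}" "y \<in> {c..d}" "\<rho> \<in> {a..b}"
  shows "ennreal (\<bar>\<phi> (polar \<rho> x) - \<phi> (polar \<rho> y)\<bar> powr p)
    \<le> ennreal ((d - c) powr (p - 1) * b powr p) * (\<integral>\<^sup>+s\<in>{c..d}. ennreal (norm (G (polar \<rho> s)) powr p) \<partial>lborel)"
proof -
  note [measurable] = C1_measurable[OF deriv cont]
  have "ennreal (\<bar>\<phi> (polar \<rho> x) - \<phi> (polar \<rho> y)\<bar> powr p)
    \<le> ennreal ((d - c) powr (p - 1)) * (\<integral>\<^sup>+s\<in>{c..d}. ennreal (\<bar>G (polar \<rho> s) \<bullet> polar \<rho> (s + pi/2)\<bar> powr p) \<partial>lborel)"
    by (rule osc_le[OF cd p deriv_polar_angle[OF deriv] _ assms(1,2)])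
      (auto intro!: continuous_intros continuous_on_compose2[OF cont])
  also have "\<dots> \<le> ennreal ((d - c) powr (p - 1)) * (\<integral>\<^sup>+s\<in>{c..d}. ennreal (b powr p) * ennreal (norm (G (polar \<rho> s)) powr p) \<partial>lborel)"
  proof (intro mult_left_mono nn_integral_mono mult_right_mono)
    fix s
    have "\<bar>G (polar \<rho> s) \<bullet> polar \<rho> (s + pi/2)\<bar> \<le> b * norm (G (polar \<rho> s))"
      using inner_polar_le[of "G (polar \<rho> s)" \<rho> "s + pi/2"] assms a0 mult_right_mono[of \<rho> b "norm (G (polar \<rho> s))"]
      by auto
    then have "\<bar>G (polar \<rho> s) \<bullet> polar \<rho> (s + pi/2)\<bar> powr p \<le> (b * norm (G (polar \<rho> s))) powr p"
      using p by (intro powr_mono2) auto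
    then show "ennreal (\<bar>G (polar \<rho> s) \<bullet> polar \<rho> (s + pi/2)\<bar> powr p) \<le> ennreal (b powr p) * ennreal (norm (G (polar \<rho> s)) powr p)"
      using ab a0 by (simp add: powr_mult flip: ennreal_mult)
  qed auto
  also have "\<dots> = ennreal ((d - c) powr (p - 1)) * (ennreal (b powr p) * (\<integral>\<^sup>+s\<in>{c..d}. ennreal (norm (G (polar \<rho> s)) powr p) \<partial>lborel))"
    by (subst nn_integral_cmult[symmetric]) (auto simp: mult.assoc)
  finally show ?thesis by (simp add: ennreal_mult mult.assoc)
qed

text \<open>Inserts the Jacobian s, which is at least a. This is where radial estimates have to stay
  away from the origin.\<close>

lemma radial_energy_le:
  assumes "a > 0"
  shows "(\<integral>\<^sup>+s\<in>{a..b}. ennreal (norm (G (polar s \<theta>)) powr p) \<partial>lborel)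
    \<le> ennreal (1 / a) * (\<integral>\<^sup>+s\<in>{a..b}. ennreal s * ennreal (norm (G (polar s \<theta>)) powr p) \<partial>lborel)"
proof -
  note [measurable] = C1_measurable[OF deriv cont]
  have "(\<integral>\<^sup>+s\<in>{a..b}. ennreal (norm (G (polar s \<theta>)) powr p) \<partial>lborel)
    \<le> (\<integral>\<^sup>+s. ennreal (1 / a) * (ennreal s * ennreal (norm (G (polar s \<theta>)) powr p) * indicator {a..b} s) \<partial>lborel)"
  proof (intro nn_integral_mono)
    fix s
    have "norm (G (polar s \<theta>)) powr p \<le> 1 / a * (s * norm (G (polar s \<theta>)) powr p)" if "a \<le> s"
      using that assms by (simp add: field_simps mult_right_mono)
    then show "ennreal (norm (G (polar s \<theta>)) powr p) * indicator {a..b} s \<le> ennreal (1 / a) * (ennreal s * ennreal (norm (G (polar s \<theta>)) powr p) * indicator {a..b} s)"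
      using assms by (auto simp: indicator_def intro!: ennreal_leI simp flip: ennreal_mult)
  qed
  then show ?thesis by (subst (asm) nn_integral_cmult) auto
qed

text \<open>The oscillation along each radius is measured against the zero on the arc \<rho> = e.
  The Jacobian is replaced by b on the left and by its minimum a on the right; the resulting factor
  b / a is harmless because it is not raised to the power p.\<close>

lemma poincare_radial:
  assumes a: "a > 0" and e: "e \<in> {a..b}" "\<And>\<theta>. \<theta> \<in> {c..d} \<Longrightarrow> \<phi> (polar e \<theta>) = 0"
  shows "rect_int a b c d (\<lambda>x. ennreal (\<bar>\<phi> x\<bar> powr p)) \<le> ennreal (b / a * (b - a) powr p) * rect_int a b c d (\<lambda>x. ennreal (norm (G x) powr p))"
proof -
  note [measurable] = C1_measurable[OF deriv cont]
  let ?J = "\<lambda>\<theta>. \<integral>\<^sup>+s\<in>{a..b}. ennreal s * ennreal (norm (G (polar s \<theta>)) powr p) \<partial>lborel"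
  have "rect_int a b c d (\<lambda>x. ennreal (\<bar>\<phi> x\<bar> powr p)) \<le> (\<integral>\<^sup>+\<theta>. ennreal (b / a * (b - a) powr p) * (?J \<theta> * indicator {c..d} \<theta>) \<partial>lborel)"
    unfolding rect_int_def
  proof (intro nn_integral_mono)
    fix \<theta>
    have "(\<integral>\<^sup>+\<rho>\<in>{a..b}. ennreal \<rho> * ennreal (\<bar>\<phi> (polar \<rho> \<theta>)\<bar> powr p) \<partial>lborel) \<le> ennreal (b / a * (b - a) powr p) * ?J \<theta>" if t: "\<theta> \<in> {c..d}"
    proof -
      have "(\<integral>\<^sup>+\<rho>\<in>{a..b}. ennreal \<rho> * ennreal (\<bar>\<phi> (polar \<rho> \<theta>)\<bar> powr p) \<partial>lborel) \<le>
        (\<integral>\<^sup>+\<rho>\<in>{a..b}. ennreal b * (ennreal ((b - a) powr (p - 1)) * (ennreal (1 / a) * ?J \<theta>)) \<partial>lborel)"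
      proof (rule nn_integral_mono)
        fix \<rho>
        show "ennreal \<rho> * ennreal (\<bar>\<phi> (polar \<rho> \<theta>)\<bar> powr p) * indicator {a..b} \<rho> \<le> ennreal b * (ennreal ((b - a) powr (p - 1)) * (ennreal (1 / a) * ?J \<theta>)) * indicator {a..b} \<rho>"
          using order_trans[OF radial_osc[of \<rho> e \<theta>] mult_left_mono[OF radial_energy_le[OF a]]] e t
          by (auto simp: indicator_def intro!: mult_mono ennreal_leI)
      qed
      also have "\<dots> = (ennreal b * ennreal ((b - a) powr (p - 1)) * ennreal (1 / a) * ennreal (b - a)) * ?J \<theta>"
        using ab by (subst nn_integral_const_interval) (auto simp: mult_ac)
      also have "ennreal b * ennreal ((b - a) powr (p - 1)) * ennreal (1 / a) * ennreal (b - a) = ennreal (b / a * (b - a) powr p)"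
        using a ab p by (cases "a = b") (auto simp: powr_diff simp flip: ennreal_mult)
      finally show ?thesis .
    qed
    then show "(\<integral>\<^sup>+\<rho>\<in>{a..b}. ennreal \<rho> * ennreal (\<bar>\<phi> (polar \<rho> \<theta>)\<bar> powr p) \<partial>lborel) * indicator {c..d} \<theta> \<le> ennreal (b / a * (b - a) powr p) * (?J \<theta> * indicator {c..d} \<theta>)"
      by (simp add: indicator_def)
  qed
  also have "\<dots> = ennreal (b / a * (b - a) powr p) * rect_int a b c d (\<lambda>x. ennreal (norm (G x) powr p))"
    unfolding rect_int_def by (intro nn_integral_cmult) measurable
  finally show ?thesis .
qed

text \<open>Along an arc the Jacobian \<rho> is constant and cancels, so no factor b / a appears and
  the rectangle may reach the origin. Only the length b * (d - c) of the longest arc enters.\<close>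

lemma poincare_angular:
  assumes e: "e \<in> {c..d}" "\<And>\<rho>. \<rho> \<in> {a..b} \<Longrightarrow> \<phi> (polar \<rho> e) = 0"
  shows "rect_int a b c d (\<lambda>x. ennreal (\<bar>\<phi> x\<bar> powr p)) \<le> ennreal ((b * (d - c)) powr p) * rect_int a b c d (\<lambda>x. ennreal (norm (G x) powr p))"
proof -
  note [measurable] = C1_measurable[OF deriv cont]
  let ?J = "\<lambda>\<rho>. \<integral>\<^sup>+s\<in>{c..d}. ennreal (norm (G (polar \<rho> s)) powr p) \<partial>lborel"
  have k: "(d - c) powr (p - 1) * b powr p * (d - c) = (b * (d - c)) powr p"
    using cd ab a0 p by (cases "c = d") (auto simp: powr_mult powr_diff)
  have "rect_int a b c d (\<lambda>x. ennreal (\<bar>\<phi> x\<bar> powr p)) \<le> (\<integral>\<^sup>+\<rho>. ennreal ((b * (d - c)) powr p) * (ennreal \<rho> * ?J \<rho> * indicator {a..b} \<rho>) \<partial>lborel)"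
  proof (subst rect_int_swap, measurable, intro nn_integral_mono)
    fix \<rho>
    have "(\<integral>\<^sup>+\<theta>\<in>{c..d}. ennreal (\<bar>\<phi> (polar \<rho> \<theta>)\<bar> powr p) \<partial>lborel) \<le> ennreal ((b * (d - c)) powr p) * ?J \<rho>" if t: "\<rho> \<in> {a..b}"
    proof -
      have "(\<integral>\<^sup>+\<theta>\<in>{c..d}. ennreal (\<bar>\<phi> (polar \<rho> \<theta>)\<bar> powr p) \<partial>lborel) \<le>
        (\<integral>\<^sup>+\<theta>\<in>{c..d}. ennreal ((d - c) powr (p - 1) * b powr p) * ?J \<rho> \<partial>lborel)"
        using angular_osc[OF _ e(1) t] e(2)[OF t] by (intro nn_integral_mono) (auto simp: indicator_def)
      also have "\<dots> = (ennreal ((d - c) powr (p - 1) * b powr p) * ennreal (d - c)) * ?J \<rho>"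
        using cd by (subst nn_integral_const_interval) (auto simp: mult_ac)
      also have "ennreal ((d - c) powr (p - 1) * b powr p) * ennreal (d - c) = ennreal ((b * (d - c)) powr p)"
        using cd k by (simp flip: ennreal_mult)
      finally show ?thesis .
    qed
    then show "ennreal \<rho> * (\<integral>\<^sup>+\<theta>\<in>{c..d}. ennreal (\<bar>\<phi> (polar \<rho> \<theta>)\<bar> powr p) \<partial>lborel) * indicator {a..b} \<rho> \<le> ennreal ((b * (d - c)) powr p) * (ennreal \<rho> * ?J \<rho> * indicator {a..b} \<rho>)"
      by (auto simp: indicator_def mult.left_commute intro!: mult_left_mono)
  qed
  also have "\<dots> = ennreal ((b * (d - c)) powr p) * rect_int a b c d (\<lambda>x. ennreal (norm (G x) powr p))"
    by (subst rect_int_swap, measurable, intro nn_integral_cmult) measurable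
  finally show ?thesis .
qed

end

section \<open>Poincare inequalities on polar rectangles\<close>

text \<open>Each use doubles the base of a p-th power. Where bases matter, in the averages over a
  small rectangle, this happens twice and is paid for by the size of the rectangle.\<close>

lemma powr_add_le: "p \<ge> 0 \<Longrightarrow> \<bar>x + y\<bar> powr p \<le> 2 powr p * (\<bar>x\<bar> powr p + \<bar>y\<bar> powr p)" for x y p :: real
proof -
  assume p: "p \<ge> 0"
  have "\<bar>x + y\<bar> powr p \<le> (2 * max \<bar>x\<bar> \<bar>y\<bar>) powr p" using p by (intro powr_mono2) auto
  also have "\<dots> = 2 powr p * max \<bar>x\<bar> \<bar>y\<bar> powr p" by (simp add: powr_mult)
  also have "\<dots> \<le> 2 powr p * (\<bar>x\<bar> powr p + \<bar>y\<bar> powr p)" by (intro mult_left_mono) (auto simp: max_def)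
  finally show ?thesis .
qed

lemma powr_norm_add_le: "p \<ge> 0 \<Longrightarrow> norm (x + y) powr p \<le> 2 powr p * (norm x powr p + norm y powr p)"
  using powr_add_le[of p "norm x" "norm y"] powr_mono2[of p "norm (x + y)" "norm x + norm y"] norm_triangle_ineq[of x y] by auto

text \<open>The flat measure in \<rho> and \<theta>, without the Jacobian. The mean in
  \<open>poincare_mean\<close> refers to it, and \<open>kern\<close> is built to reproduce it by an
  integral over the plane.\<close>

definition rect_measure :: "real \<Rightarrow> real \<Rightarrow> real \<Rightarrow> real \<Rightarrow> (real \<times> real) measure" where
  "rect_measure a b c d = restrict_space (lborel \<Otimes>\<^sub>M lborel) ({a..b} \<times> {c..d})"

lemma nn_integral_rect_measure:
  assumes [measurable]: "f \<in> borel_measurable (borel \<Otimes>\<^sub>M borel)"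
  shows "(\<integral>\<^sup>+z. f z \<partial>rect_measure a b c d) = (\<integral>\<^sup>+s\<in>{a..b}. (\<integral>\<^sup>+t\<in>{c..d}. f (s, t) \<partial>lborel) \<partial>lborel)"
proof -
  have [measurable]: "f \<in> borel_measurable (lborel \<Otimes>\<^sub>M lborel)" by (simp cong: measurable_cong_sets)
  have "(\<integral>\<^sup>+z. f z \<partial>rect_measure a b c d) = (\<integral>\<^sup>+z. f z * indicator ({a..b} \<times> {c..d}) z \<partial>(lborel \<Otimes>\<^sub>M lborel))"
    unfolding rect_measure_def by (subst nn_integral_restrict_space) auto
  also have "\<dots> = (\<integral>\<^sup>+s. \<integral>\<^sup>+t. f (s, t) * indicator ({a..b} \<times> {c..d}) (s, t) \<partial>lborel \<partial>lborel)"
    by (subst lborel.nn_integral_fst[symmetric]) auto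
  also have "\<dots> = (\<integral>\<^sup>+s. (\<integral>\<^sup>+t. f (s, t) * indicator {c..d} t \<partial>lborel) * indicator {a..b} s \<partial>lborel)"
    by (intro nn_integral_cong, subst nn_integral_multc[symmetric])
      (auto simp: indicator_def intro!: nn_integral_cong)
  finally show ?thesis .
qed

lemma borel_measurable_rect_measure:
  assumes "f \<in> borel_measurable (borel \<Otimes>\<^sub>M borel)"
  shows "f \<in> borel_measurable (rect_measure a b c d)"
proof -
  have "f \<in> borel_measurable (lborel \<Otimes>\<^sub>M lborel)" using assms by (simp cong: measurable_cong_sets)
  then show ?thesis unfolding rect_measure_def by (rule measurable_restrict_space1)
qed

lemma measure_rect_measure:
  assumes "a \<le> b" "c \<le> d"
  shows "emeasure (rect_measure a b c d) (space (rect_measure a b c d)) = ennreal ((b - a) * (d - c))"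
    "measure (rect_measure a b c d) (space (rect_measure a b c d)) = (b - a) * (d - c)"
    "finite_measure (rect_measure a b c d)"
proof -
  have "emeasure (rect_measure a b c d) (space (rect_measure a b c d)) = (\<integral>\<^sup>+z. 1 \<partial>rect_measure a b c d)" by simp
  also have "\<dots> = (\<integral>\<^sup>+s\<in>{a..b}. (\<integral>\<^sup>+t\<in>{c..d}. 1 \<partial>lborel) \<partial>lborel)" by (rule nn_integral_rect_measure) simp
  also have "\<dots> = ennreal (d - c) * ennreal (b - a)" using assms by (simp only: nn_integral_const_interval) simp
  finally show *: "emeasure (rect_measure a b c d) (space (rect_measure a b c d)) = ennreal ((b - a) * (d - c))"
    using assms by (simp add: mult.commute flip: ennreal_mult)
  then show "measure (rect_measure a b c d) (space (rect_measure a b c d)) = (b - a) * (d - c)" using assms by (simp add: measure_def)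
  show "finite_measure (rect_measure a b c d)" by (rule finite_measureI) (simp add: *)
qed

lemma integrable_rect_measure:
  assumes "a \<le> b" "c \<le> d" "continuous_on UNIV f"
  shows "integrable (rect_measure a b c d) (\<lambda>z. f z :: real)"
proof -
  interpret finite_measure "rect_measure a b c d" by (rule measure_rect_measure(3)) (use assms in auto)
  have "compact (f ` ({a..b} \<times> {c..d}))"
    using assms by (intro compact_continuous_image compact_Times) (auto intro: continuous_on_subset)
  then obtain B where B: "\<And>z. z \<in> {a..b} \<times> {c..d} \<Longrightarrow> \<bar>f z\<bar> \<le> B"
    using compact_imp_bounded bounded_iff by (metis imageI real_norm_def)
  have "f \<in> borel_measurable borel" using assms by (intro borel_measurable_continuous_onI)
  then have m: "f \<in> borel_measurable (borel \<Otimes>\<^sub>M borel)" by (simp add: borel_prod)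
  show ?thesis
  proof (rule integrable_const_bound[of _ B])
    show "AE z in rect_measure a b c d. norm (f z) \<le> B"
      using B by (intro AE_I2) (auto simp: rect_measure_def space_restrict_space)
  qed (rule borel_measurable_rect_measure[OF m])
qed

text \<open>Two points of the rectangle are joined by a radial segment at the angle of the first and
  then an arc at the radius of the second. The bound splits into A, which depends only on the first
  angle, and B, which depends only on the second radius, so averaging over the second point and
  integrating over the first involve one-dimensional integrals only.\<close>

lemma poincare_mean:
  fixes \<phi> :: "R2 \<Rightarrow> real" and G :: "R2 \<Rightarrow> R2" and a b c d p :: real
  assumes deriv: "\<And>x. (\<phi> has_derivative (\<lambda>h. G x \<bullet> h)) (at x)" and cont: "continuous_on UNIV G"
    and ab: "a < b" and cd: "c < d" and a: "0 < a" and p: "p \<ge> 1"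
  defines "m \<equiv> (\<integral>z. \<phi> (polar (fst z) (snd z)) \<partial>rect_measure a b c d) / ((b - a) * (d - c))"
  shows "rect_int a b c d (\<lambda>x. ennreal (\<bar>\<phi> x - m\<bar> powr p))
    \<le> ennreal (2 powr p * (b / a) * ((b - a) powr p + (b * (d - c)) powr p)) * rect_int a b c d (\<lambda>x. ennreal (norm (G x) powr p))"
proof -
  note [measurable] = C1_measurable[of \<phi> G, OF deriv cont]
  define K where "K = (b - a) * (d - c)"
  have K: "K > 0" using ab cd by (simp add: K_def)
  let ?R = "rect_int a b c d (\<lambda>x. ennreal (norm (G x) powr p))"
  let ?M = "rect_measure a b c d"
  define V where "V s t = \<phi> (polar s t)" for s t
  have contV: "continuous_on UNIV (\<lambda>z. \<phi> (polar (fst z) (snd z)))"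
    by (intro continuous_on_compose2[OF C1_continuous[OF deriv]] continuous_intros) auto
  have Vm[measurable]: "(\<lambda>z. V (fst z) (snd z)) \<in> borel_measurable (borel \<Otimes>\<^sub>M borel)" unfolding V_def by measurable
  define J where "J t = (\<integral>\<^sup>+s\<in>{a..b}. ennreal s * ennreal (norm (G (polar s t)) powr p) \<partial>lborel)" for t
  define L where "L s = (\<integral>\<^sup>+t\<in>{c..d}. ennreal (norm (G (polar s t)) powr p) \<partial>lborel)" for s
  have [measurable]: "J \<in> borel_measurable borel" "L \<in> borel_measurable borel" unfolding J_def L_def by measurable
  define A where "A t = ennreal ((b - a) powr (p - 1) / a) * J t" for t
  define B where "B s = ennreal ((d - c) powr (p - 1) * b powr p) * L s" for s
  have [measurable]: "A \<in> borel_measurable borel" "B \<in> borel_measurable borel" unfolding A_def B_def by measurable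
  have RJ: "?R = (\<integral>\<^sup>+t\<in>{c..d}. J t \<partial>lborel)" unfolding rect_int_def J_def ..
  have RL: "?R = (\<integral>\<^sup>+s\<in>{a..b}. ennreal s * L s \<partial>lborel)" unfolding L_def by (rule rect_int_swap) measurable
  define B1 where "B1 = (\<integral>\<^sup>+s\<in>{a..b}. B s \<partial>lborel)"
  \<comment> \<open>The total of the angular bounds carries no Jacobian; comparing with s / a, which
    is at least 1, puts it back.\<close>
  have B1: "B1 \<le> ennreal ((d - c) powr (p - 1) * b powr p / a) * ?R"
  proof -
    have "B1 \<le> (\<integral>\<^sup>+s. ennreal ((d - c) powr (p - 1) * b powr p / a) * (ennreal s * L s * indicator {a..b} s) \<partial>lborel)"
      unfolding B1_def
    proof (intro nn_integral_mono)
      fix s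
      have "ennreal ((d - c) powr (p - 1) * b powr p) \<le> ennreal ((d - c) powr (p - 1) * b powr p / a) * ennreal s" if "a \<le> s"
      proof -
        have "(d - c) powr (p - 1) * b powr p * 1 \<le> (d - c) powr (p - 1) * b powr p * (s / a)"
          using that a by (intro mult_left_mono) auto
        then show ?thesis using a that by (subst ennreal_mult[symmetric]) (auto intro!: ennreal_leI)
      qed
      then show "B s * indicator {a..b} s \<le> ennreal ((d - c) powr (p - 1) * b powr p / a) * (ennreal s * L s * indicator {a..b} s)"
        by (auto simp: B_def indicator_def mult.assoc[symmetric] intro!: mult_right_mono)
    qed
    also have "\<dots> = ennreal ((d - c) powr (p - 1) * b powr p / a) * ?R" unfolding RL by (intro nn_integral_cmult) measurable
    finally show ?thesis .
  qed
  have pt: "ennreal (\<bar>V s t - V s' t'\<bar> powr p) \<le> ennreal (2 powr p) * (A t + B s')"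
    if "s \<in> {a..b}" "s' \<in> {a..b}" "t \<in> {c..d}" "t' \<in> {c..d}" for s t s' t'
  proof -
    have "ennreal (\<bar>V s t - V s' t'\<bar> powr p) \<le> ennreal (2 powr p) * (ennreal (\<bar>V s t - V s' t\<bar> powr p) + ennreal (\<bar>V s' t - V s' t'\<bar> powr p))"
      using powr_add_le[of p "V s t - V s' t" "V s' t - V s' t'"] p
      by (simp add: ennreal_leI flip: ennreal_mult ennreal_plus)
    also have "\<dots> \<le> ennreal (2 powr p) * (A t + B s')"
    proof (intro mult_left_mono add_mono)
      note prem = deriv cont less_imp_le[OF ab] less_imp_le[OF cd] less_imp_le[OF a] p
      have "ennreal (\<bar>V s t - V s' t\<bar> powr p) \<le> ennreal ((b - a) powr (p - 1)) * (\<integral>\<^sup>+\<sigma>\<in>{a..b}. ennreal (norm (G (polar \<sigma> t)) powr p) \<partial>lborel)"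
        unfolding V_def by (rule radial_osc[OF prem]) (use that in auto)
      also have "\<dots> \<le> ennreal ((b - a) powr (p - 1)) * (ennreal (1 / a) * J t)"
        unfolding J_def by (rule mult_left_mono[OF radial_energy_le[OF prem a]]) simp
      also have "\<dots> = A t"
      proof -
        have "ennreal ((b - a) powr (p - 1)) * ennreal (1 / a) = ennreal ((b - a) powr (p - 1) / a)"
          using a by (simp flip: ennreal_mult)
        then show ?thesis by (simp only: A_def mult.assoc[symmetric])
      qed
      finally show "ennreal (\<bar>V s t - V s' t\<bar> powr p) \<le> A t" .
      show "ennreal (\<bar>V s' t - V s' t'\<bar> powr p) \<le> B s'"
        unfolding V_def B_def L_def by (rule angular_osc[OF prem]) (use that in auto)
    qed auto
    finally show ?thesis .
  qed
  \<comment> \<open>The deviation from the mean is an average of differences, so Jensen reduces it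
    to the two-point bound \<open>pt\<close>.\<close>
  have key: "ennreal (\<bar>V s t - m\<bar> powr p) \<le> ennreal (2 powr p) * (A t + ennreal (1 / (b - a)) * B1)"
    if st: "s \<in> {a..b}" "t \<in> {c..d}" for s t
  proof -
    have int: "integrable ?M (\<lambda>z. V (fst z) (snd z))" unfolding V_def
      using ab cd by (intro integrable_rect_measure contV) auto
    interpret finite_measure ?M by (rule measure_rect_measure(3)) (use ab cd in auto)
    have Mm: "measure ?M (space ?M) = K" "emeasure ?M (space ?M) = ennreal K" using measure_rect_measure ab cd by (auto simp: K_def)
    have "(\<integral>z. V s t - V (fst z) (snd z) \<partial>?M) = K * V s t - K * m"
      using int K by (simp add: Mm m_def V_def K_def[symmetric])
    then have e: "V s t - m = (\<integral>z. V s t - V (fst z) (snd z) \<partial>?M) / K" using K by (simp add: field_simps)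
    have "\<bar>V s t - m\<bar> \<le> (\<integral>z. \<bar>V s t - V (fst z) (snd z)\<bar> \<partial>?M) / K"
      unfolding e using K by (simp add: integral_abs_bound divide_right_mono)
    then have "ennreal (\<bar>V s t - m\<bar> powr p) \<le> ennreal (((\<integral>z. \<bar>V s t - V (fst z) (snd z)\<bar> \<partial>?M) / K) powr p)"
      using p by (intro ennreal_leI powr_mono2) auto
    also have "\<dots> = ennreal (1 / K powr p) * ennreal ((\<integral>z. \<bar>V s t - V (fst z) (snd z)\<bar> \<partial>?M) powr p)"
      using K by (simp add: powr_divide flip: ennreal_mult)
    also have "\<dots> \<le> ennreal (1 / K powr p) * (ennreal (K powr (p - 1)) * (\<integral>\<^sup>+z. ennreal (\<bar>V s t - V (fst z) (snd z)\<bar> powr p) \<partial>?M))"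
      using jensen_powr[of ?M "\<lambda>z. \<bar>V s t - V (fst z) (snd z)\<bar>" p] int p Mm by (intro mult_left_mono) auto
    also have "\<dots> = ennreal (1 / K) * (\<integral>\<^sup>+z. ennreal (\<bar>V s t - V (fst z) (snd z)\<bar> powr p) \<partial>?M)"
    proof -
      have "ennreal (1 / K powr p) * ennreal (K powr (p - 1)) = ennreal (1 / K)"
        using K by (simp add: powr_diff flip: ennreal_mult)
      then show ?thesis by (simp only: mult.assoc[symmetric])
    qed
    finally have le1: "ennreal (\<bar>V s t - m\<bar> powr p) \<le> ennreal (1 / K) * (\<integral>\<^sup>+z. ennreal (\<bar>V s t - V (fst z) (snd z)\<bar> powr p) \<partial>?M)" .
    have "(\<integral>\<^sup>+z. ennreal (\<bar>V s t - V (fst z) (snd z)\<bar> powr p) \<partial>?M) \<le> (\<integral>\<^sup>+z. ennreal (2 powr p) * (A t + B (fst z)) \<partial>?M)"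
      using pt st by (intro nn_integral_mono) (auto simp: rect_measure_def space_restrict_space)
    also have "\<dots> = (\<integral>\<^sup>+s'\<in>{a..b}. (\<integral>\<^sup>+t'\<in>{c..d}. ennreal (2 powr p) * (A t + B s') \<partial>lborel) \<partial>lborel)"
      by (subst nn_integral_rect_measure) auto
    also have "\<dots> = (\<integral>\<^sup>+s'. (ennreal (2 powr p) * ennreal (d - c)) * (A t * indicator {a..b} s' + B s' * indicator {a..b} s') \<partial>lborel)"
      using cd by (subst nn_integral_const_interval) (auto simp: algebra_simps intro!: nn_integral_cong)
    also have "\<dots> = (ennreal (2 powr p) * ennreal (d - c)) * (\<integral>\<^sup>+s'. (A t * indicator {a..b} s' + B s' * indicator {a..b} s') \<partial>lborel)"
      by (intro nn_integral_cmult) measurable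
    also have "(\<integral>\<^sup>+s'. (A t * indicator {a..b} s' + B s' * indicator {a..b} s') \<partial>lborel) = A t * ennreal (b - a) + B1"
      unfolding B1_def using ab by (subst nn_integral_add) (auto simp: nn_integral_cmult_indicator)
    finally have "ennreal (\<bar>V s t - m\<bar> powr p) \<le> ennreal (1 / K) * (ennreal (2 powr p) * ennreal (d - c) * (A t * ennreal (b - a) + B1))"
      using le1 by (meson mult_left_mono order_trans zero_le)
    also have "\<dots> = ennreal (2 powr p) * ((ennreal (1 / K) * ennreal (d - c) * ennreal (b - a)) * A t + (ennreal (1 / K) * ennreal (d - c)) * B1)"
      by (simp only: distrib_left mult_ac)
    also have "\<dots> = ennreal (2 powr p) * (A t + ennreal (1 / (b - a)) * B1)"
    proof -
      have k1: "ennreal (1 / K) * ennreal (d - c) * ennreal (b - a) = 1"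
        using ab cd by (simp add: K_def flip: ennreal_mult)
      have k2: "ennreal (1 / K) * ennreal (d - c) = ennreal (1 / (b - a))"
        using ab cd by (simp add: K_def flip: ennreal_mult)
      show ?thesis unfolding k1 unfolding k2 by (simp only: mult_1)
    qed
    finally show ?thesis .
  qed
  have "rect_int a b c d (\<lambda>x. ennreal (\<bar>\<phi> x - m\<bar> powr p)) \<le>
     (\<integral>\<^sup>+t\<in>{c..d}. (\<integral>\<^sup>+s\<in>{a..b}. ennreal b * (ennreal (2 powr p) * (A t + ennreal (1 / (b - a)) * B1)) \<partial>lborel) \<partial>lborel)"
    unfolding rect_int_def
  proof (rule nn_integral_mono)
    fix t
    have "(\<integral>\<^sup>+s\<in>{a..b}. ennreal s * ennreal (\<bar>\<phi> (polar s t) - m\<bar> powr p) \<partial>lborel) * indicator {c..d} t \<le>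
      (\<integral>\<^sup>+s\<in>{a..b}. ennreal b * (ennreal (2 powr p) * (A t + ennreal (1 / (b - a)) * B1)) \<partial>lborel) * indicator {c..d} t"
      if t: "t \<in> {c..d}"
    proof (rule mult_right_mono, rule nn_integral_mono)
      fix s
      show "ennreal s * ennreal (\<bar>\<phi> (polar s t) - m\<bar> powr p) * indicator {a..b} s \<le> ennreal b * (ennreal (2 powr p) * (A t + ennreal (1 / (b - a)) * B1)) * indicator {a..b} s"
      proof (cases "s \<in> {a..b}")
        case True
        then show ?thesis using mult_mono[OF ennreal_leI[of s b] key[OF True t, unfolded V_def]] by simp
      qed simp
    qed simp
    then show "(\<integral>\<^sup>+s\<in>{a..b}. ennreal s * ennreal (\<bar>\<phi> (polar s t) - m\<bar> powr p) \<partial>lborel) * indicator {c..d} t \<le>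
      (\<integral>\<^sup>+s\<in>{a..b}. ennreal b * (ennreal (2 powr p) * (A t + ennreal (1 / (b - a)) * B1)) \<partial>lborel) * indicator {c..d} t"
      by (cases "t \<in> {c..d}") auto
  qed
  also have "\<dots> = (\<integral>\<^sup>+t. ennreal b * ennreal (2 powr p) * ennreal (b - a) * (A t * indicator {c..d} t + ennreal (1 / (b - a)) * B1 * indicator {c..d} t) \<partial>lborel)"
    using ab by (intro nn_integral_cong, subst nn_integral_const_interval) (auto simp: algebra_simps)
  also have "\<dots> = ennreal b * ennreal (2 powr p) * ennreal (b - a) * ((\<integral>\<^sup>+t\<in>{c..d}. A t \<partial>lborel) + ennreal (1 / (b - a)) * B1 * ennreal (d - c))"
  proof (subst nn_integral_cmult)
    have "(\<integral>\<^sup>+t. (A t * indicator {c..d} t + ennreal (1 / (b - a)) * B1 * indicator {c..d} t) \<partial>lborel) = (\<integral>\<^sup>+t\<in>{c..d}. A t \<partial>lborel) + ennreal (1 / (b - a)) * B1 * ennreal (d - c)"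
      using cd by (subst nn_integral_add) (auto simp: nn_integral_cmult_indicator)
    then show "ennreal b * ennreal (2 powr p) * ennreal (b - a) * (\<integral>\<^sup>+t. (A t * indicator {c..d} t + ennreal (1 / (b - a)) * B1 * indicator {c..d} t) \<partial>lborel)
      = ennreal b * ennreal (2 powr p) * ennreal (b - a) * ((\<integral>\<^sup>+t\<in>{c..d}. A t \<partial>lborel) + ennreal (1 / (b - a)) * B1 * ennreal (d - c))" by (rule arg_cong)
  qed measurable
  finally have le2: "rect_int a b c d (\<lambda>x. ennreal (\<bar>\<phi> x - m\<bar> powr p)) \<le> ennreal b * ennreal (2 powr p) * ennreal (b - a) * ((\<integral>\<^sup>+t\<in>{c..d}. A t \<partial>lborel) + ennreal (1 / (b - a)) * B1 * ennreal (d - c))" .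
  have IA: "(\<integral>\<^sup>+t\<in>{c..d}. A t \<partial>lborel) = ennreal ((b - a) powr (p - 1) / a) * ?R"
    unfolding A_def RJ by (subst nn_integral_cmult[symmetric]) (auto simp: mult.assoc)
  note le2
  also have "ennreal b * ennreal (2 powr p) * ennreal (b - a) * ((\<integral>\<^sup>+t\<in>{c..d}. A t \<partial>lborel) + ennreal (1 / (b - a)) * B1 * ennreal (d - c))
    \<le> ennreal b * ennreal (2 powr p) * ennreal (b - a) * (ennreal ((b - a) powr (p - 1) / a) * ?R + ennreal (1 / (b - a)) * (ennreal ((d - c) powr (p - 1) * b powr p / a) * ?R) * ennreal (d - c))"
    unfolding IA by (intro mult_left_mono add_left_mono mult_right_mono B1) auto
  also have "\<dots> = (ennreal b * ennreal (2 powr p) * ennreal (b - a) * (ennreal ((b - a) powr (p - 1) / a) + ennreal (1 / (b - a)) * ennreal ((d - c) powr (p - 1) * b powr p / a) * ennreal (d - c))) * ?R"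
    by (simp only: distrib_left distrib_right mult_ac)
  also have "\<dots> = ennreal (2 powr p * (b / a) * ((b - a) powr p + (b * (d - c)) powr p)) * ?R"
  proof (rule arg_cong[where f="\<lambda>x. x * ?R"])
    have h: "(b - a) powr (p - 1) * (b - a) = (b - a) powr p" "(d - c) powr (p - 1) * (d - c) = (d - c) powr p"
      using ab cd by (auto simp: powr_diff)
    have "2 powr p * (b / a) * ((b - a) powr p + (b * (d - c)) powr p) =
      b * 2 powr p * (b - a) * ((b - a) powr (p - 1) / a + 1 / (b - a) * ((d - c) powr (p - 1) * b powr p / a) * (d - c))"
    proof -
      have "b * 2 powr p * (b - a) * ((b - a) powr (p - 1) / a + 1 / (b - a) * ((d - c) powr (p - 1) * b powr p / a) * (d - c))
        = 2 powr p * (b / a) * ((b - a) powr (p - 1) * (b - a) + ((b - a) / (b - a)) * (b powr p * ((d - c) powr (p - 1) * (d - c))))"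
        by (simp only: distrib_left divide_inverse mult_ac mult_1)
      then show ?thesis using ab cd a unfolding h by (simp add: powr_mult)
    qed
    moreover have nn: "0 \<le> b" "0 \<le> b - a" "0 \<le> 1 / (b - a)" "0 \<le> d - c" "0 \<le> (b - a) powr (p - 1) / a" "0 \<le> (d - c) powr (p - 1) * b powr p / a"
      using ab cd a by auto
    ultimately show "ennreal b * ennreal (2 powr p) * ennreal (b - a) * (ennreal ((b - a) powr (p - 1) / a) + ennreal (1 / (b - a)) * ennreal ((d - c) powr (p - 1) * b powr p / a) * ennreal (d - c))
      = ennreal (2 powr p * (b / a) * ((b - a) powr p + (b * (d - c)) powr p))"
      by (simp only: ennreal_mult ennreal_plus nn mult_nonneg_nonneg add_nonneg_nonneg powr_ge_zero)
  qed
  finally show ?thesis .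
qed

section \<open>Morrey's inequality\<close>

text \<open>The points x + (r, r t) fill a triangle with vertex x, and r is the Jacobian of this
  parametrisation. Enlarging the triangle to the plane leaves an inequality.\<close>

lemma nn_integral_R2_shift:
  assumes [measurable]: "F \<in> borel_measurable borel"
  shows "(\<integral>\<^sup>+r\<in>{0..h}. (\<integral>\<^sup>+t\<in>{0..1}. ennreal r * F (x + vec2 r (r * t)) \<partial>lborel) \<partial>lborel) \<le> (\<integral>\<^sup>+y. F y \<partial>(lborel::R2 measure))"
proof -
  have "(\<integral>\<^sup>+r\<in>{0..h}. (\<integral>\<^sup>+t\<in>{0..1}. ennreal r * F (x + vec2 r (r * t)) \<partial>lborel) \<partial>lborel) \<le> (\<integral>\<^sup>+r. \<integral>\<^sup>+s. F (vec2 (x$1 + 1 * r) s) \<partial>lborel \<partial>lborel)"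
  proof (rule nn_integral_mono)
    fix r
    show "(\<integral>\<^sup>+t\<in>{0..1}. ennreal r * F (x + vec2 r (r * t)) \<partial>lborel) * indicator {0..h} r \<le> (\<integral>\<^sup>+s. F (vec2 (x$1 + 1 * r) s) \<partial>lborel)"
    proof (cases "r > 0")
      case True
      have e: "x + vec2 r (r * t) = vec2 (x$1 + 1 * r) (x$2 + r * t)" for t by (rule R2_eqI) auto
      have "(\<integral>\<^sup>+t\<in>{0..1}. ennreal r * F (x + vec2 r (r * t)) \<partial>lborel) * indicator {0..h} r \<le> (\<integral>\<^sup>+t\<in>{0..1}. ennreal r * F (x + vec2 r (r * t)) \<partial>lborel)"
        by (auto simp: indicator_def)
      also have "\<dots> \<le> (\<integral>\<^sup>+t. ennreal r * F (vec2 (x$1 + 1 * r) (x$2 + r * t)) \<partial>lborel)"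
        unfolding e by (intro nn_integral_mono) (auto simp: indicator_def)
      also have "\<dots> = ennreal \<bar>r\<bar> * (\<integral>\<^sup>+t. F (vec2 (x$1 + 1 * r) (x$2 + r * t)) \<partial>lborel)"
        using True by (subst nn_integral_cmult) auto
      also have "\<dots> = (\<integral>\<^sup>+s. F (vec2 (x$1 + 1 * r) s) \<partial>lborel)"
        using True by (intro nn_integral_real_affine[symmetric]) auto
      finally show ?thesis .
    next
      case False
      then show ?thesis by (auto simp: indicator_def ennreal_neg)
    qed
  qed
  also have "\<dots> = (\<integral>\<^sup>+r. \<integral>\<^sup>+s. F (vec2 r s) \<partial>lborel \<partial>lborel)"
    using nn_integral_real_affine[of "\<lambda>r. \<integral>\<^sup>+s. F (vec2 r s) \<partial>lborel" 1 "x$1"] by simp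
  also have "\<dots> = (\<integral>\<^sup>+y. F y \<partial>lborel)" by (rule nn_integral_R2[symmetric]) simp
  finally show ?thesis .
qed

text \<open>In this order: the Jensen factor of the interval from 0 to sqrt 2, the p-th power of the
  factor 2 sqrt 2 in the speed bound 2 sqrt 2 s, and the largest value of the surplus
  s^(p-3).\<close>

definition morrey_const :: "real \<Rightarrow> real" where
  "morrey_const p = sqrt 2 powr (p - 1) * ((2 * sqrt 2) powr p * sqrt 2 powr (p - 3))"

text \<open>Along the curves s -> x + s^2 (1, t) the singular weight of the polar
  Jacobian is absorbed by the parametrisation.\<close>
lemma morrey:
  fixes \<phi> :: "R2 \<Rightarrow> real" and G :: "R2 \<Rightarrow> R2"
  assumes deriv: "\<And>x. (\<phi> has_derivative (\<lambda>h. G x \<bullet> h)) (at x)" and cont: "continuous_on UNIV G"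
    and supp: "\<And>x. norm x \<ge> 1 \<Longrightarrow> \<phi> x = 0" and p: "p \<ge> 3"
  shows "ennreal (\<bar>\<phi> x\<bar> powr p) \<le> ennreal (morrey_const p) * (\<integral>\<^sup>+y. ennreal (norm (G y) powr p) \<partial>lborel)"
proof (cases "norm x \<ge> 1")
  case True then show ?thesis using supp p by simp
next
  case False
  note [measurable] = C1_measurable[of \<phi> G, OF deriv cont]
  define F where "F y = ennreal (norm (G y) powr p)" for y
  have [measurable]: "F \<in> borel_measurable borel" unfolding F_def by measurable
  have pt: "ennreal (\<bar>\<phi> x\<bar> powr p) \<le> ennreal (morrey_const p) * (\<integral>\<^sup>+r\<in>{0..2}. ennreal r * F (x + vec2 r (r * t)) \<partial>lborel)"
    if t: "t \<in> {0..1}" for t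
  proof -
    \<comment> \<open>At s = sqrt 2 the curve has moved by 2 in the first coordinate and has left
      the unit disc, so f vanishes there.\<close>
    define f where "f s = \<phi> (x + s\<^sup>2 *\<^sub>R vec2 1 t)" for s
    define f' where "f' s = G (x + s\<^sup>2 *\<^sub>R vec2 1 t) \<bullet> ((2 * s) *\<^sub>R vec2 1 t)" for s
    have d: "(f has_real_derivative f' s) (at s)" for s
    proof -
      have "((\<lambda>s. x + s\<^sup>2 *\<^sub>R vec2 1 t) has_derivative (\<lambda>h. h *\<^sub>R ((2 * s) *\<^sub>R vec2 1 t))) (at s)"
        by (auto intro!: derivative_eq_intros simp: algebra_simps)
      from has_derivative_compose[OF this deriv] show ?thesis
        unfolding has_field_derivative_def f_def f'_def by (rule has_derivative_eq_rhs) (auto simp: mult.commute)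
    qed
    have c: "continuous_on {0..sqrt 2} f'" unfolding f'_def
      by (intro continuous_intros continuous_on_compose2[OF cont]) auto
    have "norm (x + (sqrt 2)\<^sup>2 *\<^sub>R vec2 1 t) \<ge> 1"
    proof -
      have "\<bar>x $ 1\<bar> < 1" using component_le_norm_cart[of x 1] False by linarith
      then have "1 \<le> (x + (sqrt 2)\<^sup>2 *\<^sub>R vec2 1 t) $ 1" by simp
      then show ?thesis using component_le_norm_cart[of "x + (sqrt 2)\<^sup>2 *\<^sub>R vec2 1 t" 1] by linarith
    qed
    then have f0: "f (sqrt 2) = 0" using supp by (simp add: f_def)
    have "ennreal (\<bar>f 0 - f (sqrt 2)\<bar> powr p) \<le> ennreal ((sqrt 2 - 0) powr (p - 1)) * (\<integral>\<^sup>+s\<in>{0..sqrt 2}. ennreal (\<bar>f' s\<bar> powr p) \<partial>lborel)"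
      using p by (intro osc_le c d) auto
    then have le1: "ennreal (\<bar>\<phi> x\<bar> powr p) \<le> ennreal (sqrt 2 powr (p - 1)) * (\<integral>\<^sup>+s\<in>{0..sqrt 2}. ennreal (\<bar>f' s\<bar> powr p) \<partial>lborel)"
      by (simp add: f0) (simp add: f_def)
    have "(\<integral>\<^sup>+s\<in>{0..sqrt 2}. ennreal (\<bar>f' s\<bar> powr p) \<partial>lborel) \<le>
      (\<integral>\<^sup>+s. ennreal ((2 * sqrt 2) powr p * sqrt 2 powr (p - 3)) * ((ennreal (s\<^sup>2) * F (x + vec2 (s\<^sup>2) (s\<^sup>2 * t))) * ennreal (2 * s) * indicator {0..sqrt 2} s) \<partial>lborel)"
    proof (intro nn_integral_mono)
      fix s
      show "ennreal (\<bar>f' s\<bar> powr p) * indicator {0..sqrt 2} s \<le> ennreal ((2 * sqrt 2) powr p * sqrt 2 powr (p - 3)) * ((ennreal (s\<^sup>2) * F (x + vec2 (s\<^sup>2) (s\<^sup>2 * t))) * ennreal (2 * s) * indicator {0..sqrt 2} s)"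
      proof (cases "0 < s \<and> s \<le> sqrt 2")
        case True
        have e: "s\<^sup>2 *\<^sub>R vec2 1 t = vec2 (s\<^sup>2) (s\<^sup>2 * t)" by (rule R2_eqI) auto
        let ?g = "norm (G (x + s\<^sup>2 *\<^sub>R vec2 1 t))"
        have "norm (vec2 1 t) \<le> sqrt 2" using t by (auto simp: norm_R2 power_le_one)
        then have "norm ((2 * s) *\<^sub>R vec2 1 t) \<le> 2 * sqrt 2 * s" using True by (simp add: mult.assoc mult.left_commute)
        then have "\<bar>f' s\<bar> \<le> ?g * (2 * sqrt 2 * s)" unfolding f'_def
          by (intro order_trans[OF Cauchy_Schwarz_ineq2] mult_left_mono) auto
        then have "\<bar>f' s\<bar> powr p \<le> (?g * (2 * sqrt 2 * s)) powr p" using p by (intro powr_mono2) auto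
        also have "\<dots> = (2 * sqrt 2) powr p * ((s powr (p - 3) * s powr 3) * ?g powr p)"
        proof -
          \<comment> \<open>Three of the p powers of s are kept: s^2 becomes the Jacobian r and the
            third the differential of r = s^2. The others are bounded by their value at sqrt 2,
            which asks for p >= 3.\<close>
          have sp: "s powr p = s powr (p - 3) * s powr 3" by (simp only: powr_add[symmetric]) simp
          show ?thesis unfolding sp[symmetric] using True by (simp add: powr_mult mult_ac)
        qed
        also have "\<dots> \<le> (2 * sqrt 2) powr p * ((sqrt 2 powr (p - 3) * s powr 3) * ?g powr p)"
          using True p by (intro mult_left_mono mult_right_mono powr_mono2) auto
        also have "s powr 3 = s\<^sup>2 * s" using True by (simp add: powr_numeral power3_eq_cube power2_eq_square)
        also have "(2 * sqrt 2) powr p * ((sqrt 2 powr (p - 3) * (s\<^sup>2 * s)) * ?g powr p) \<le> (2 * sqrt 2) powr p * ((sqrt 2 powr (p - 3) * (s\<^sup>2 * (2 * s))) * ?g powr p)"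
          using True by (intro mult_left_mono mult_right_mono) auto
        finally have "ennreal (\<bar>f' s\<bar> powr p) \<le> ennreal ((2 * sqrt 2) powr p * ((sqrt 2 powr (p - 3) * (s\<^sup>2 * (2 * s))) * ?g powr p))"
          by (rule ennreal_leI)
        also have "\<dots> = ennreal ((2 * sqrt 2) powr p * sqrt 2 powr (p - 3)) * ((ennreal (s\<^sup>2) * F (x + vec2 (s\<^sup>2) (s\<^sup>2 * t))) * ennreal (2 * s))"
          using True unfolding F_def e by (simp add: mult_ac flip: ennreal_mult)
        finally show ?thesis using True by simp
      next
        case False
        then have "f' s = 0 \<or> s \<notin> {0..sqrt 2}" by (cases "s = 0") (auto simp: f'_def)
        then show ?thesis using p by (auto simp: indicator_def)
      qed
    qed
    also have "\<dots> = ennreal ((2 * sqrt 2) powr p * sqrt 2 powr (p - 3)) * (\<integral>\<^sup>+s. ((ennreal (s\<^sup>2) * F (x + vec2 (s\<^sup>2) (s\<^sup>2 * t))) * ennreal (2 * s) * indicator {0..sqrt 2} s) \<partial>lborel)"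
      by (intro nn_integral_cmult) measurable
    also have "(\<integral>\<^sup>+s. ((ennreal (s\<^sup>2) * F (x + vec2 (s\<^sup>2) (s\<^sup>2 * t))) * ennreal (2 * s) * indicator {0..sqrt 2} s) \<partial>lborel)
       = (\<integral>\<^sup>+r. (ennreal r * F (x + vec2 r (r * t))) * indicator {0\<^sup>2..(sqrt 2)\<^sup>2} r \<partial>lborel)"
      by (intro nn_integral_substitution_aux[symmetric]) (auto intro!: derivative_eq_intros continuous_intros)
    finally have "(\<integral>\<^sup>+s\<in>{0..sqrt 2}. ennreal (\<bar>f' s\<bar> powr p) \<partial>lborel) \<le> ennreal ((2 * sqrt 2) powr p * sqrt 2 powr (p - 3)) * (\<integral>\<^sup>+r\<in>{0..2}. ennreal r * F (x + vec2 r (r * t)) \<partial>lborel)"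
      by simp
    with le1 have "ennreal (\<bar>\<phi> x\<bar> powr p) \<le> ennreal (sqrt 2 powr (p - 1)) * (ennreal ((2 * sqrt 2) powr p * sqrt 2 powr (p - 3)) * (\<integral>\<^sup>+r\<in>{0..2}. ennreal r * F (x + vec2 r (r * t)) \<partial>lborel))"
      by (meson mult_left_mono order_trans zero_le)
    then show ?thesis by (simp only: morrey_const_def ennreal_mult powr_ge_zero mult_nonneg_nonneg mult.assoc)
  qed
  have "ennreal (\<bar>\<phi> x\<bar> powr p) = (\<integral>\<^sup>+t\<in>{0..1::real}. ennreal (\<bar>\<phi> x\<bar> powr p) \<partial>lborel)"
    by (subst nn_integral_const_interval) auto
  also have "\<dots> \<le> (\<integral>\<^sup>+t\<in>{0..1}. ennreal (morrey_const p) * (\<integral>\<^sup>+r\<in>{0..2}. ennreal r * F (x + vec2 r (r * t)) \<partial>lborel) \<partial>lborel)"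
    using pt by (intro nn_integral_mono) (auto simp: indicator_def)
  also have "\<dots> = ennreal (morrey_const p) * (\<integral>\<^sup>+t\<in>{0..1}. (\<integral>\<^sup>+r\<in>{0..2}. ennreal r * F (x + vec2 r (r * t)) \<partial>lborel) \<partial>lborel)"
    by (subst nn_integral_cmult[symmetric]) (auto simp: mult.assoc)
  finally have le2: "ennreal (\<bar>\<phi> x\<bar> powr p) \<le> ennreal (morrey_const p) * (\<integral>\<^sup>+t\<in>{0..1}. (\<integral>\<^sup>+r\<in>{0..2}. ennreal r * F (x + vec2 r (r * t)) \<partial>lborel) \<partial>lborel)" .
  have "(\<integral>\<^sup>+t\<in>{0..1}. (\<integral>\<^sup>+r\<in>{0..2}. ennreal r * F (x + vec2 r (r * t)) \<partial>lborel) \<partial>lborel)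
    = (\<integral>\<^sup>+t. \<integral>\<^sup>+r. ennreal r * F (x + vec2 r (r * t)) * indicator {0..2} r * indicator {0..1} t \<partial>lborel \<partial>lborel)"
    by (subst nn_integral_multc[symmetric]) auto
  also have "\<dots> = (\<integral>\<^sup>+r. \<integral>\<^sup>+t. ennreal r * F (x + vec2 r (r * t)) * indicator {0..2} r * indicator {0..1} t \<partial>lborel \<partial>lborel)"
    by (intro lborel_pair.Fubini') measurable
  also have "\<dots> = (\<integral>\<^sup>+r\<in>{0..2}. (\<integral>\<^sup>+t\<in>{0..1}. ennreal r * F (x + vec2 r (r * t)) \<partial>lborel) \<partial>lborel)"
    by (subst nn_integral_multc[symmetric]) (auto intro!: nn_integral_cong simp: mult_ac)
  also have "\<dots> \<le> (\<integral>\<^sup>+y. F y \<partial>lborel)" by (rule nn_integral_R2_shift) measurable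
  finally show ?thesis using le2 unfolding F_def[symmetric] by (meson mult_left_mono order_trans zero_le)
qed

section \<open>Sobolev functions and their weak gradients\<close>

lemma test_funD:
  assumes "test_fun \<Omega> \<phi> G"
  shows "\<And>x. (\<phi> has_derivative (\<lambda>h. G x \<bullet> h)) (at x)" "continuous_on UNIV G"
    "\<phi> \<in> borel_measurable borel" "G \<in> borel_measurable borel"
  using assms C1_measurable[of \<phi> G] by (auto simp: test_fun_def)

lemma test_fun_outside:
  assumes t: "test_fun \<Omega> \<phi> G" and x: "x \<notin> \<Omega>"
  shows "\<phi> x = 0" "G x = 0"
proof -
  let ?S = "closure {x. \<phi> x \<noteq> 0}"
  have nx: "x \<notin> ?S" using t x by (auto simp: test_fun_def)
  have z: "\<phi> y = 0" if "y \<notin> ?S" for y using that closure_subset[of "{x. \<phi> x \<noteq> 0}"] by blast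
  show "\<phi> x = 0" by (rule z[OF nx])
  have "((\<lambda>_. 0) has_derivative (\<lambda>h. G x \<bullet> h)) (at x)"
    by (rule has_derivative_transform_within_open[OF test_funD(1)[OF t], of "- ?S"]) (rule open_Compl[OF closed_closure], use nx in simp, rule z, simp)
  then have "(\<lambda>h. G x \<bullet> h) = (\<lambda>h. 0)" by (rule has_derivative_unique) simp
  then have "G x \<bullet> G x = 0" by meson
  then show "G x = 0" by simp
qed

lemma integrable_test_fun:
  assumes t: "test_fun \<Omega> \<phi> G" and p: "p > 0" and b: "bounded \<Omega>"
  shows "(\<integral>\<^sup>+x. ennreal (\<bar>\<phi> x\<bar> powr p) \<partial>lebesgue) < \<infinity>" "(\<integral>\<^sup>+x. ennreal (norm (G x) powr p) \<partial>lebesgue) < \<infinity>"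
proof -
  obtain r where r: "\<Omega> \<subseteq> cball 0 r" using b bounded_subset_ballD by (metis ball_subset_cball order_trans)
  have bound: "(\<integral>\<^sup>+x. ennreal (norm (f x) powr p) \<partial>lebesgue) < \<infinity>" if c: "continuous_on UNIV f" and z: "\<And>x. x \<notin> \<Omega> \<Longrightarrow> f x = 0"
    for f :: "R2 \<Rightarrow> 'b::real_normed_vector"
  proof -
    have "compact (f ` cball 0 r)" using c by (intro compact_continuous_image) (auto intro: continuous_on_subset)
    then have "bounded (f ` cball 0 r)" by (rule compact_imp_bounded)
    then obtain B where "\<forall>y\<in>f ` cball 0 r. norm y \<le> B" unfolding bounded_iff ..
    then have B: "\<And>x. x \<in> cball 0 r \<Longrightarrow> norm (f x) \<le> B" by simp
    have "(\<integral>\<^sup>+x. ennreal (norm (f x) powr p) \<partial>lebesgue) \<le> (\<integral>\<^sup>+x. ennreal (B powr p) * indicator (cball 0 r :: R2 set) x \<partial>lebesgue)"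
    proof (rule nn_integral_mono)
      fix x
      show "ennreal (norm (f x) powr p) \<le> ennreal (B powr p) * indicator (cball 0 r) x"
      proof (cases "x \<in> cball 0 r")
        case True then show ?thesis using B[of x] p by (auto intro!: ennreal_leI powr_mono2)
      next
        case False then have "f x = 0" using z r by blast
        then show ?thesis using p by simp
      qed
    qed
    also have "\<dots> = ennreal (B powr p) * emeasure lebesgue (cball 0 r :: R2 set)"
      by (intro nn_integral_cmult_indicator) auto
    also have "\<dots> < \<infinity>" using emeasure_bounded_finite[of "cball 0 r :: R2 set"] by (simp add: ennreal_mult_less_top)
    finally show ?thesis .
  qed
  show "(\<integral>\<^sup>+x. ennreal (\<bar>\<phi> x\<bar> powr p) \<partial>lebesgue) < \<infinity>"
    using bound[of \<phi>] C1_continuous[OF test_funD(1)[OF t]] test_fun_outside[OF t] by simp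
  show "(\<integral>\<^sup>+x. ennreal (norm (G x) powr p) \<partial>lebesgue) < \<infinity>"
    using bound[of G] test_funD(2)[OF t] test_fun_outside[OF t] by simp
qed

section \<open>Extension by zero and dominated approximation by test functions\<close>

definition zext :: "R2 set \<Rightarrow> (R2 \<Rightarrow> 'b::real_vector) \<Rightarrow> R2 \<Rightarrow> 'b" where
  "zext \<Omega> f x = indicator \<Omega> x *\<^sub>R f x"

lemma zext_simps [simp]: "x \<in> \<Omega> \<Longrightarrow> zext \<Omega> f x = f x" "x \<notin> \<Omega> \<Longrightarrow> zext \<Omega> f x = 0"
  by (auto simp: zext_def)

lemma set_nn_integral_zext:
  "p > 0 \<Longrightarrow> (\<integral>\<^sup>+x\<in>\<Omega>. ennreal (\<bar>u x\<bar> powr p) \<partial>M) = (\<integral>\<^sup>+x. ennreal (\<bar>zext \<Omega> u x\<bar> powr p) \<partial>M)"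
  "p > 0 \<Longrightarrow> (\<integral>\<^sup>+x\<in>\<Omega>. ennreal (norm (g x :: 'b::real_normed_vector) powr p) \<partial>M) = (\<integral>\<^sup>+x. ennreal (norm (zext \<Omega> g x) powr p) \<partial>M)"
  by (auto intro!: nn_integral_cong simp: zext_def indicator_def)

lemma sobolev0_measurable:
  "sobolev0 p \<Omega> u g \<Longrightarrow> zext \<Omega> u \<in> borel_measurable lebesgue" "sobolev0 p \<Omega> u g \<Longrightarrow> zext \<Omega> g \<in> borel_measurable lebesgue"
  by (auto simp: sobolev0_def set_borel_measurable_def zext_def[abs_def])

lemma borel_measurable_lebesgue: "f \<in> borel_measurable borel \<Longrightarrow> f \<in> borel_measurable lebesgue"
  by (rule measurable_completion) (simp add: measurable_lborel1)

text \<open>One integrable function H majorises the p-th powers of all approximants and of their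
  gradients, and both sequences converge almost everywhere, so that later passages to the limit are
  dominated convergence. The last clause keeps convergence of the gradients in L^p, which Morrey's
  inequality turns into uniform convergence.\<close>

definition dominated_approx ::
    "real \<Rightarrow> R2 set \<Rightarrow> (R2 \<Rightarrow> real) \<Rightarrow> (R2 \<Rightarrow> R2) \<Rightarrow> (nat \<Rightarrow> R2 \<Rightarrow> real) \<Rightarrow> (nat \<Rightarrow> R2 \<Rightarrow> R2) \<Rightarrow> (R2 \<Rightarrow> real) \<Rightarrow> bool" where
  "dominated_approx p \<Omega> u g \<phi> G H \<longleftrightarrow> (\<forall>n. test_fun \<Omega> (\<phi> n) (G n)) \<and> integrable lebesgue H \<and> (\<forall>x. H x \<ge> 0) \<and>
    (AE x in lebesgue. (\<lambda>n. \<phi> n x) \<longlonglongrightarrow> zext \<Omega> u x \<and> (\<lambda>n. G n x) \<longlonglongrightarrow> zext \<Omega> g x \<and>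
      (\<forall>n. \<bar>\<phi> n x\<bar> powr p \<le> H x \<and> norm (G n x) powr p \<le> H x)) \<and>
    (\<lambda>n. \<integral>\<^sup>+x. ennreal (norm (G n x - zext \<Omega> g x) powr p) \<partial>lebesgue) \<longlonglongrightarrow> 0"

lemma dominated_approxD:
  assumes "dominated_approx p \<Omega> u g \<phi> G H"
  shows "\<And>n. test_fun \<Omega> (\<phi> n) (G n)" "integrable lebesgue H" "\<And>x. H x \<ge> 0"
    "AE x in lebesgue. (\<lambda>n. \<phi> n x) \<longlonglongrightarrow> zext \<Omega> u x \<and> (\<lambda>n. G n x) \<longlonglongrightarrow> zext \<Omega> g x \<and>
      (\<forall>n. \<bar>\<phi> n x\<bar> powr p \<le> H x \<and> norm (G n x) powr p \<le> H x)"
    "(\<lambda>n. \<integral>\<^sup>+x. ennreal (norm (G n x - zext \<Omega> g x) powr p) \<partial>lebesgue) \<longlonglongrightarrow> 0"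
  using assms unfolding dominated_approx_def by auto

text \<open>As in the proof that L^p is complete: along a subsequence with errors below 2^-k the
  p-th powers of the errors have an integrable sum S. Hence the errors tend to 0 almost everywhere,
  and S together with the p-th powers of the limits gives the majorant.\<close>

lemma sobolev0_dominated:
  assumes s: "sobolev0 p \<Omega> u g" and p: "p \<ge> 1"
  shows "\<exists>\<phi> G H. dominated_approx p \<Omega> u g \<phi> G H"
proof -
  let ?U = "zext \<Omega> u" and ?V = "zext \<Omega> g"
  note [measurable] = sobolev0_measurable[OF s]
  obtain \<phi>0 G0 where t0: "\<And>n. test_fun \<Omega> (\<phi>0 n) (G0 n)"
    and l0: "(\<lambda>n. \<integral>\<^sup>+x\<in>\<Omega>. ennreal (\<bar>\<phi>0 n x - u x\<bar> powr p) \<partial>lebesgue) \<longlonglongrightarrow> 0"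
      "(\<lambda>n. \<integral>\<^sup>+x\<in>\<Omega>. ennreal (norm (G0 n x - g x) powr p) \<partial>lebesgue) \<longlonglongrightarrow> 0"
    using s unfolding sobolev0_def by blast
  have e1: "(\<integral>\<^sup>+x\<in>\<Omega>. ennreal (\<bar>\<phi>0 n x - u x\<bar> powr p) \<partial>lebesgue) = (\<integral>\<^sup>+x. ennreal (\<bar>\<phi>0 n x - ?U x\<bar> powr p) \<partial>lebesgue)" for n
    using test_fun_outside(1)[OF t0] p by (intro nn_integral_cong) (auto simp: indicator_def zext_def)
  have e2: "(\<integral>\<^sup>+x\<in>\<Omega>. ennreal (norm (G0 n x - g x) powr p) \<partial>lebesgue) = (\<integral>\<^sup>+x. ennreal (norm (G0 n x - ?V x) powr p) \<partial>lebesgue)" for n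
    using test_fun_outside(2)[OF t0] p by (intro nn_integral_cong) (auto simp: indicator_def zext_def)
  note l = l0[unfolded e1 e2]
  have "\<exists>n. (\<integral>\<^sup>+x. ennreal (\<bar>\<phi>0 n x - ?U x\<bar> powr p) \<partial>lebesgue) < ennreal ((1/2)^k) \<and> (\<integral>\<^sup>+x. ennreal (norm (G0 n x - ?V x) powr p) \<partial>lebesgue) < ennreal ((1/2)^k)" for k
  proof -
    have "eventually (\<lambda>n. (\<integral>\<^sup>+x. ennreal (\<bar>\<phi>0 n x - ?U x\<bar> powr p) \<partial>lebesgue) < ennreal ((1/2)^k)) sequentially"
      "eventually (\<lambda>n. (\<integral>\<^sup>+x. ennreal (norm (G0 n x - ?V x) powr p) \<partial>lebesgue) < ennreal ((1/2)^k)) sequentially"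
      using l by (auto elim!: order_tendstoD)
    from eventually_happens[OF eventually_conj[OF this]] show ?thesis by auto
  qed
  then have "\<forall>k. \<exists>n. (\<integral>\<^sup>+x. ennreal (\<bar>\<phi>0 n x - ?U x\<bar> powr p) \<partial>lebesgue) < ennreal ((1/2)^k) \<and> (\<integral>\<^sup>+x. ennreal (norm (G0 n x - ?V x) powr p) \<partial>lebesgue) < ennreal ((1/2)^k)" ..
  from choice[OF this] obtain r where "\<forall>k. (\<integral>\<^sup>+x. ennreal (\<bar>\<phi>0 (r k) x - ?U x\<bar> powr p) \<partial>lebesgue) < ennreal ((1/2)^k) \<and> (\<integral>\<^sup>+x. ennreal (norm (G0 (r k) x - ?V x) powr p) \<partial>lebesgue) < ennreal ((1/2)^k)" ..
  then have r: "\<And>k. (\<integral>\<^sup>+x. ennreal (\<bar>\<phi>0 (r k) x - ?U x\<bar> powr p) \<partial>lebesgue) < ennreal ((1/2)^k)"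
    "\<And>k. (\<integral>\<^sup>+x. ennreal (norm (G0 (r k) x - ?V x) powr p) \<partial>lebesgue) < ennreal ((1/2)^k)" by auto
  define \<phi> where "\<phi> k = \<phi>0 (r k)" for k
  define G where "G k = G0 (r k)" for k
  have t: "test_fun \<Omega> (\<phi> n) (G n)" for n using t0 by (simp add: \<phi>_def G_def)
  have m: "\<phi> n \<in> borel_measurable borel" "G n \<in> borel_measurable borel" for n using test_funD[OF t] by auto
  note [measurable] = m[THEN borel_measurable_lebesgue]
  define e where "e n x = \<bar>\<phi> n x - ?U x\<bar> powr p + norm (G n x - ?V x) powr p" for n x
  have [measurable]: "e n \<in> borel_measurable lebesgue" for n unfolding e_def by measurable
  define S where "S x = (\<Sum>n. ennreal (e n x))" for x
  have [measurable]: "S \<in> borel_measurable lebesgue" unfolding S_def by measurable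
  have "(\<integral>\<^sup>+x. S x \<partial>lebesgue) = (\<Sum>n. \<integral>\<^sup>+x. ennreal (e n x) \<partial>lebesgue)" unfolding S_def by (rule nn_integral_suminf) measurable
  also have "\<dots> \<le> (\<Sum>n. ennreal (2 * (1/2)^n))"
  proof (intro suminf_le)
    fix n
    have "(\<integral>\<^sup>+x. ennreal (e n x) \<partial>lebesgue) = (\<integral>\<^sup>+x. ennreal (\<bar>\<phi> n x - ?U x\<bar> powr p) \<partial>lebesgue) + (\<integral>\<^sup>+x. ennreal (norm (G n x - ?V x) powr p) \<partial>lebesgue)"
      unfolding e_def by (subst nn_integral_add[symmetric]) (auto simp: ennreal_plus)
    also have "\<dots> \<le> ennreal ((1/2)^n) + ennreal ((1/2)^n)"
      using r[of n] unfolding \<phi>_def G_def by (intro add_mono) auto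
    finally show "(\<integral>\<^sup>+x. ennreal (e n x) \<partial>lebesgue) \<le> ennreal (2 * (1/2)^n)" by (simp flip: ennreal_plus)
  qed auto
  also have "\<dots> < \<infinity>"
    by (subst suminf_ennreal2) (auto intro!: summable_mult summable_geometric)
  finally have Sfin: "(\<integral>\<^sup>+x. S x \<partial>lebesgue) < \<infinity>" .
  then have AS: "AE x in lebesgue. S x \<noteq> \<infinity>" by (intro nn_integral_PInf_AE) auto
  define H where "H x = 2 powr p * (\<bar>?U x\<bar> powr p + norm (?V x) powr p + enn2real (S x))" for x
  have Hnn: "H x \<ge> 0" for x by (simp add: H_def)
  have fin: "(\<integral>\<^sup>+x. ennreal (\<bar>?U x\<bar> powr p) \<partial>lebesgue) < \<infinity>" "(\<integral>\<^sup>+x. ennreal (norm (?V x) powr p) \<partial>lebesgue) < \<infinity>"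
    using s p by (auto simp: sobolev0_def set_nn_integral_zext[symmetric])
  have "integrable lebesgue (\<lambda>x. enn2real (S x))"
  proof (rule integrableI_bounded)
    have "(\<integral>\<^sup>+x. ennreal (norm (enn2real (S x))) \<partial>lebesgue) \<le> (\<integral>\<^sup>+x. S x \<partial>lebesgue)"
      by (intro nn_integral_mono) (auto simp: ennreal_enn2real_if)
    then show "(\<integral>\<^sup>+x. ennreal (norm (enn2real (S x))) \<partial>lebesgue) < \<infinity>" using Sfin by (rule le_less_trans)
  qed measurable
  moreover have "integrable lebesgue (\<lambda>x. \<bar>?U x\<bar> powr p)" "integrable lebesgue (\<lambda>x. norm (?V x) powr p)"
    using fin by (auto intro!: integrableI_bounded)
  ultimately have Hint: "integrable lebesgue H" unfolding H_def by auto
  have AEc: "AE x in lebesgue. (\<lambda>n. \<phi> n x) \<longlonglongrightarrow> ?U x \<and> (\<lambda>n. G n x) \<longlonglongrightarrow> ?V x \<and> (\<forall>n. \<bar>\<phi> n x\<bar> powr p \<le> H x \<and> norm (G n x) powr p \<le> H x)"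
    using AS
  proof eventually_elim
    case (elim x)
    have enn: "e n x \<ge> 0" for n by (simp add: e_def)
    have sm: "summable (\<lambda>n. e n x)" using elim enn by (intro summable_suminf_not_top) (auto simp: S_def)
    have Se: "enn2real (S x) = (\<Sum>n. e n x)" unfolding S_def using sm enn by (subst suminf_ennreal2) (auto simp: suminf_nonneg)
    have e0: "(\<lambda>n. e n x) \<longlonglongrightarrow> 0" using sm by (rule summable_LIMSEQ_zero)
    have eS: "e n x \<le> enn2real (S x)" for n unfolding Se using sum_le_suminf[OF sm, of "{n}"] enn by auto
    have zero: "(\<lambda>n. f n) \<longlonglongrightarrow> 0" if "\<And>n. 0 \<le> f n" "\<And>n. f n powr p \<le> e n x" for f :: "nat \<Rightarrow> real"
    proof -
      have "(\<lambda>n. f n powr p) \<longlonglongrightarrow> 0" using that by (intro tendsto_sandwich[OF _ _ tendsto_const e0]) auto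
      then have "(\<lambda>n. (f n powr p) powr (1/p)) \<longlonglongrightarrow> 0 powr (1/p)" using p by (intro tendsto_powr') auto
      moreover have "(f n powr p) powr (1/p) = f n" for n using p that(1)[of n] by (simp add: powr_powr)
      ultimately show ?thesis by simp
    qed
    have "(\<lambda>n. \<bar>\<phi> n x - ?U x\<bar>) \<longlonglongrightarrow> 0" "(\<lambda>n. norm (G n x - ?V x)) \<longlonglongrightarrow> 0"
      by (rule zero; simp add: e_def)+
    then have c: "(\<lambda>n. \<phi> n x) \<longlonglongrightarrow> ?U x" "(\<lambda>n. G n x) \<longlonglongrightarrow> ?V x"
      by (simp_all add: tendsto_rabs_zero_iff LIM_zero_iff tendsto_norm_zero_iff)
    have "\<bar>\<phi> n x\<bar> powr p \<le> H x" "norm (G n x) powr p \<le> H x" for n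
    proof -
      have "\<bar>\<phi> n x\<bar> powr p \<le> 2 powr p * (\<bar>\<phi> n x - ?U x\<bar> powr p + \<bar>?U x\<bar> powr p)"
        using powr_add_le[of p "\<phi> n x - ?U x" "?U x"] p by simp
      also have "\<dots> \<le> H x" unfolding H_def
      proof (rule mult_left_mono)
        show "\<bar>\<phi> n x - ?U x\<bar> powr p + \<bar>?U x\<bar> powr p \<le> \<bar>?U x\<bar> powr p + norm (?V x) powr p + enn2real (S x)"
          using eS[of n] powr_ge_zero[of "norm (?V x)" p] powr_ge_zero[of "norm (G n x - ?V x)" p]
          unfolding e_def by linarith
      qed simp
      finally show "\<bar>\<phi> n x\<bar> powr p \<le> H x" .
      have "norm (G n x) powr p \<le> 2 powr p * (norm (G n x - ?V x) powr p + norm (?V x) powr p)"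
        using powr_norm_add_le[of p "G n x - ?V x" "?V x"] p by simp
      also have "\<dots> \<le> H x" unfolding H_def
      proof (rule mult_left_mono)
        show "norm (G n x - ?V x) powr p + norm (?V x) powr p \<le> \<bar>?U x\<bar> powr p + norm (?V x) powr p + enn2real (S x)"
          using eS[of n] powr_ge_zero[of "\<bar>?U x\<bar>" p] powr_ge_zero[of "\<bar>\<phi> n x - ?U x\<bar>" p]
          unfolding e_def by linarith
      qed simp
      finally show "norm (G n x) powr p \<le> H x" .
    qed
    then show ?case using c by blast
  qed
  have lim: "(\<lambda>n. \<integral>\<^sup>+x. ennreal (norm (G n x - ?V x) powr p) \<partial>lebesgue) \<longlonglongrightarrow> 0"
  proof (rule tendsto_sandwich[OF _ _ tendsto_const])
    show "\<forall>\<^sub>F n in sequentially. (\<integral>\<^sup>+x. ennreal (norm (G n x - ?V x) powr p) \<partial>lebesgue) \<le> ennreal ((1/2)^n)"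
      using r(2) by (auto simp: G_def less_imp_le)
    show "(\<lambda>n. ennreal ((1/2)^n)) \<longlonglongrightarrow> 0"
      using tendsto_ennrealI[OF LIMSEQ_power_zero[of "1/2::real"]] by simp
  qed auto
  have "dominated_approx p \<Omega> u g \<phi> G H"
    unfolding dominated_approx_def by (intro conjI allI t Hint Hnn AEc lim)
  then show ?thesis by blast
qed

lemma sobolev0_test:
  assumes t: "test_fun \<Omega> \<phi> G" and p: "p > 0" and b: "bounded \<Omega>" and O: "\<Omega> \<in> sets borel"
  shows "sobolev0 p \<Omega> \<phi> G"
proof -
  note [measurable] = test_funD(3,4)[OF t] O
  have "(\<lambda>x. indicator \<Omega> x *\<^sub>R \<phi> x) \<in> borel_measurable borel" "(\<lambda>x. indicator \<Omega> x *\<^sub>R G x) \<in> borel_measurable borel"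
    by measurable
  note meas = this[THEN borel_measurable_lebesgue]
  have le: "(\<integral>\<^sup>+x\<in>\<Omega>. f x \<partial>lebesgue) \<le> (\<integral>\<^sup>+x. f x \<partial>lebesgue)" for f
    by (intro nn_integral_mono) (auto simp: indicator_def)
  have "(\<integral>\<^sup>+x\<in>\<Omega>. ennreal (\<bar>\<phi> x\<bar> powr p) \<partial>lebesgue) < \<infinity>" "(\<integral>\<^sup>+x\<in>\<Omega>. ennreal (norm (G x) powr p) \<partial>lebesgue) < \<infinity>"
    using integrable_test_fun[OF t p b] le_less_trans[OF le] by auto
  then show ?thesis unfolding sobolev0_def set_borel_measurable_def using meas t p
    by (auto intro!: exI[of _ "\<lambda>_. \<phi>"] exI[of _ "\<lambda>_. G"])
qed

lemma sobolev0_diff: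
  assumes s: "sobolev0 p \<Omega> u g" and s': "sobolev0 p \<Omega> u' g'" and p: "p \<ge> 1" and O: "\<Omega> \<in> sets borel"
  shows "sobolev0 p \<Omega> (\<lambda>x. u x - u' x) (\<lambda>x. g x - g' x)"
proof -
  have meas: "set_borel_measurable lebesgue \<Omega> (\<lambda>x. u x - u' x)" "set_borel_measurable lebesgue \<Omega> (\<lambda>x. g x - g' x)"
    using s s' by (auto simp: sobolev0_def set_borel_measurable_def scaleR_diff_right simp del: real_scaleR_def)
  have fin: "(\<integral>\<^sup>+x\<in>\<Omega>. ennreal (norm (f x - f' x) powr p) \<partial>lebesgue) \<le> ennreal (2 powr p) * ((\<integral>\<^sup>+x\<in>\<Omega>. ennreal (norm (f x) powr p) \<partial>lebesgue) + (\<integral>\<^sup>+x\<in>\<Omega>. ennreal (norm (f' x) powr p) \<partial>lebesgue))"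
    if "set_borel_measurable lebesgue \<Omega> f" "set_borel_measurable lebesgue \<Omega> f'" for f f' :: "R2 \<Rightarrow> 'b::{second_countable_topology,real_normed_vector}"
  proof -
    have m: "zext \<Omega> f \<in> borel_measurable lebesgue" "zext \<Omega> f' \<in> borel_measurable lebesgue"
      using that by (auto simp: set_borel_measurable_def zext_def[abs_def])
    note [measurable] = m
    have z: "zext \<Omega> (\<lambda>x. f x - f' x) x = zext \<Omega> f x - zext \<Omega> f' x" for x by (cases "x \<in> \<Omega>") auto
    have "(\<integral>\<^sup>+x. ennreal (norm (zext \<Omega> f x - zext \<Omega> f' x) powr p) \<partial>lebesgue) \<le> (\<integral>\<^sup>+x. ennreal (2 powr p) * (ennreal (norm (zext \<Omega> f x) powr p) + ennreal (norm (zext \<Omega> f' x) powr p)) \<partial>lebesgue)"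
    proof (rule nn_integral_mono)
      fix x
      show "ennreal (norm (zext \<Omega> f x - zext \<Omega> f' x) powr p) \<le> ennreal (2 powr p) * (ennreal (norm (zext \<Omega> f x) powr p) + ennreal (norm (zext \<Omega> f' x) powr p))"
        using powr_norm_add_le[of p "zext \<Omega> f x" "- zext \<Omega> f' x"] p by (simp add: ennreal_leI flip: ennreal_plus ennreal_mult)
    qed
    also have "\<dots> = ennreal (2 powr p) * ((\<integral>\<^sup>+x. ennreal (norm (zext \<Omega> f x) powr p) \<partial>lebesgue) + (\<integral>\<^sup>+x. ennreal (norm (zext \<Omega> f' x) powr p) \<partial>lebesgue))"
      by (subst nn_integral_cmult, measurable, subst nn_integral_add) auto
    finally show ?thesis using p by (simp add: set_nn_integral_zext(2) z)
  qed
  obtain \<phi> G where t1: "\<And>n. test_fun \<Omega> (\<phi> n) (G n)"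
    and l1: "(\<lambda>n. \<integral>\<^sup>+x\<in>\<Omega>. ennreal (\<bar>\<phi> n x - u x\<bar> powr p) \<partial>lebesgue) \<longlonglongrightarrow> 0"
      "(\<lambda>n. \<integral>\<^sup>+x\<in>\<Omega>. ennreal (norm (G n x - g x) powr p) \<partial>lebesgue) \<longlonglongrightarrow> 0"
    using s unfolding sobolev0_def by blast
  obtain \<phi>' G' where t2: "\<And>n. test_fun \<Omega> (\<phi>' n) (G' n)"
    and l2: "(\<lambda>n. \<integral>\<^sup>+x\<in>\<Omega>. ennreal (\<bar>\<phi>' n x - u' x\<bar> powr p) \<partial>lebesgue) \<longlonglongrightarrow> 0"
      "(\<lambda>n. \<integral>\<^sup>+x\<in>\<Omega>. ennreal (norm (G' n x - g' x) powr p) \<partial>lebesgue) \<longlonglongrightarrow> 0"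
    using s' unfolding sobolev0_def by blast
  note t = t1 t2 and l = l1 l2
  have tt: "test_fun \<Omega> (\<lambda>x. \<phi> n x - \<phi>' n x) (\<lambda>x. G n x - G' n x)" for n
  proof -
    have "{x. \<phi> n x - \<phi>' n x \<noteq> 0} \<subseteq> {x. \<phi> n x \<noteq> 0} \<union> {x. \<phi>' n x \<noteq> 0}" by auto
    then have sub: "closure {x. \<phi> n x - \<phi>' n x \<noteq> 0} \<subseteq> closure {x. \<phi> n x \<noteq> 0} \<union> closure {x. \<phi>' n x \<noteq> 0}"
      unfolding closure_Un[symmetric] by (rule closure_mono)
    have c: "compact (closure {x. \<phi> n x \<noteq> 0} \<union> closure {x. \<phi>' n x \<noteq> 0})" "closure {x. \<phi> n x \<noteq> 0} \<union> closure {x. \<phi>' n x \<noteq> 0} \<subseteq> \<Omega>"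
      using t1[of n] t2[of n] by (auto simp: test_fun_def intro!: compact_Un)
    have "compact (closure {x. \<phi> n x - \<phi>' n x \<noteq> 0})"
      using compact_Int_closed[OF c(1) closed_closure[of "{x. \<phi> n x - \<phi>' n x \<noteq> 0}"]] by (simp only: Int_absorb1[OF sub])
    moreover note order_trans[OF sub c(2)]
    ultimately have "compact (closure {x. \<phi> n x - \<phi>' n x \<noteq> 0}) \<and> closure {x. \<phi> n x - \<phi>' n x \<noteq> 0} \<subseteq> \<Omega>" ..
    then show ?thesis using t1[of n] t2[of n]
      by (auto simp: test_fun_def inner_diff_left intro!: has_derivative_diff continuous_on_diff)
  qed
  have lim: "(\<lambda>n. \<integral>\<^sup>+x\<in>\<Omega>. ennreal (norm ((f n x - f' n x) - (v x - v' x)) powr p) \<partial>lebesgue) \<longlonglongrightarrow> 0"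
    if "(\<lambda>n. \<integral>\<^sup>+x\<in>\<Omega>. ennreal (norm (f n x - v x) powr p) \<partial>lebesgue) \<longlonglongrightarrow> 0"
      "(\<lambda>n. \<integral>\<^sup>+x\<in>\<Omega>. ennreal (norm (f' n x - v' x) powr p) \<partial>lebesgue) \<longlonglongrightarrow> 0"
      "\<And>n. set_borel_measurable lebesgue \<Omega> (\<lambda>x. f n x - v x)" "\<And>n. set_borel_measurable lebesgue \<Omega> (\<lambda>x. f' n x - v' x)"
    for f f' :: "nat \<Rightarrow> R2 \<Rightarrow> 'b::{second_countable_topology,real_normed_vector}" and v v'
  proof (rule tendsto_sandwich[OF _ _ tendsto_const])
    have "norm ((f n x - f' n x) - (v x - v' x)) = norm ((f n x - v x) - (f' n x - v' x))" for n x by (simp add: algebra_simps)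
    then show "\<forall>\<^sub>F n in sequentially. (\<integral>\<^sup>+x\<in>\<Omega>. ennreal (norm ((f n x - f' n x) - (v x - v' x)) powr p) \<partial>lebesgue)
      \<le> ennreal (2 powr p) * ((\<integral>\<^sup>+x\<in>\<Omega>. ennreal (norm (f n x - v x) powr p) \<partial>lebesgue) + (\<integral>\<^sup>+x\<in>\<Omega>. ennreal (norm (f' n x - v' x) powr p) \<partial>lebesgue))"
      using fin[OF that(3,4)] by simp
    have "(\<lambda>n. ennreal (2 powr p) * ((\<integral>\<^sup>+x\<in>\<Omega>. ennreal (norm (f n x - v x) powr p) \<partial>lebesgue) + (\<integral>\<^sup>+x\<in>\<Omega>. ennreal (norm (f' n x - v' x) powr p) \<partial>lebesgue))) \<longlonglongrightarrow> ennreal (2 powr p) * (0 + 0)"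
      by (intro ennreal_tendsto_cmult tendsto_add that) auto
    then show "(\<lambda>n. ennreal (2 powr p) * ((\<integral>\<^sup>+x\<in>\<Omega>. ennreal (norm (f n x - v x) powr p) \<partial>lebesgue) + (\<integral>\<^sup>+x\<in>\<Omega>. ennreal (norm (f' n x - v' x) powr p) \<partial>lebesgue))) \<longlonglongrightarrow> 0" by simp
  qed auto
  have sm: "set_borel_measurable lebesgue \<Omega> (\<phi> n)" "set_borel_measurable lebesgue \<Omega> (G n)"
    "set_borel_measurable lebesgue \<Omega> (\<phi>' n)" "set_borel_measurable lebesgue \<Omega> (G' n)" for n
    unfolding set_borel_measurable_def using test_funD(3,4)[OF t(1)] test_funD(3,4)[OF t(2)] O
    by (auto intro!: borel_measurable_lebesgue borel_measurable_scaleR borel_measurable_times borel_measurable_indicator)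
  have smd: "set_borel_measurable lebesgue \<Omega> (\<lambda>x. f x - f' x)" if "set_borel_measurable lebesgue \<Omega> f" "set_borel_measurable lebesgue \<Omega> f'"
    for f f' :: "R2 \<Rightarrow> 'b::{second_countable_topology,real_normed_vector}"
    using that by (auto simp: set_borel_measurable_def scaleR_diff_right)
  show ?thesis unfolding sobolev0_def
  proof (intro conjI meas exI allI)
    show "(\<integral>\<^sup>+x\<in>\<Omega>. ennreal (\<bar>u x - u' x\<bar> powr p) \<partial>lebesgue) < \<infinity>"
      using fin[of u u'] s s' by (auto simp: sobolev0_def ennreal_mult_less_top elim!: order.strict_trans1)
    show "(\<integral>\<^sup>+x\<in>\<Omega>. ennreal (norm (g x - g' x) powr p) \<partial>lebesgue) < \<infinity>"
      using fin[of g g'] s s' by (auto simp: sobolev0_def ennreal_mult_less_top elim!: order.strict_trans1)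
    show "test_fun \<Omega> (\<lambda>x. \<phi> n x - \<phi>' n x) (\<lambda>x. G n x - G' n x)" for n by (rule tt)
    show "(\<lambda>n. \<integral>\<^sup>+x\<in>\<Omega>. ennreal (\<bar>\<phi> n x - \<phi>' n x - (u x - u' x)\<bar> powr p) \<partial>lebesgue) \<longlonglongrightarrow> 0"
      using lim[of \<phi> u \<phi>' u'] l sm s s' by (auto simp: sobolev0_def intro!: smd)
    show "(\<lambda>n. \<integral>\<^sup>+x\<in>\<Omega>. ennreal (norm (G n x - G' n x - (g x - g' x)) powr p) \<partial>lebesgue) \<longlonglongrightarrow> 0"
      using lim[of G g G' g'] l sm s s' by (auto simp: sobolev0_def intro!: smd)
  qed
qed

section \<open>Closability of the gradient and uniqueness of weak gradients\<close>

lemma AE_zero_if_integral_atMost_zero: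
  fixes f :: "R2 \<Rightarrow> real"
  assumes f: "integrable lborel f" and z: "\<And>v. (\<integral>x. indicator {..v} x * f x \<partial>lborel) = 0"
  shows "AE x in lborel. f x = 0"
proof -
  have fm[measurable]: "f \<in> borel_measurable borel" using f by auto
  have fin: "(\<integral>\<^sup>+x. ennreal (f x) * indicator A x \<partial>lborel) < \<infinity>" "(\<integral>\<^sup>+x. ennreal (- f x) * indicator A x \<partial>lborel) < \<infinity>" for A
  proof -
    have b: "(\<integral>\<^sup>+x. ennreal (norm (f x)) \<partial>lborel) < \<infinity>" using f by (simp add: integrable_iff_bounded)
    show "(\<integral>\<^sup>+x. ennreal (f x) * indicator A x \<partial>lborel) < \<infinity>"
      by (rule le_less_trans[OF nn_integral_mono b]) (auto simp: indicator_def intro!: ennreal_leI)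
    show "(\<integral>\<^sup>+x. ennreal (- f x) * indicator A x \<partial>lborel) < \<infinity>"
      by (rule le_less_trans[OF nn_integral_mono b]) (auto simp: indicator_def intro!: ennreal_leI)
  qed
  \<comment> \<open>The positive and the negative part of f are densities of two finite measures.
    They agree on the quadrants, which are stable under intersection and generate the Borel sets, so
    they agree everywhere; testing on the sets where f is positive or negative then gives f =
    0.\<close>
  have "density lborel (\<lambda>x. ennreal (f x)) = density lborel (\<lambda>x. ennreal (- f x))"
  proof (rule measure_eqI_generator_eq[where \<Omega>=UNIV and E="range (\<lambda>v::R2. {..v})" and A="\<lambda>n. {..(\<chi> i. real n)}"])
    show "Int_stable (range (\<lambda>v::R2. {..v}))"
    proof (rule Int_stableI_image)
      fix v w :: R2
      show "\<exists>k\<in>UNIV. {..v} \<inter> {..w} = {..k}"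
        by (intro bexI[of _ "\<chi> i. min (v$i) (w$i)"]) (auto simp: less_eq_vec_def)
    qed
    show "sets (density lborel (\<lambda>x. ennreal (f x))) = sigma_sets UNIV (range (\<lambda>v::R2. {..v}))"
      "sets (density lborel (\<lambda>x. ennreal (- f x))) = sigma_sets UNIV (range (\<lambda>v::R2. {..v}))"
      by (simp_all only: sets_density sets_lborel, simp_all add: borel_eq_atMost[where 'a=R2])
    show "(\<Union>n. {..(\<chi> i. real n)}) = (UNIV :: R2 set)"
    proof (intro set_eqI iffI UNIV_I)
      fix x :: R2
      obtain n :: nat where "norm x \<le> real n" using real_arch_simple by blast
      then have "x $ i \<le> real n" for i using component_le_norm_cart[of x i] by linarith
      then show "x \<in> (\<Union>n. {..(\<chi> i. real n)})" by (auto simp: less_eq_vec_def)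
    qed
    fix X assume "X \<in> range (\<lambda>v::R2. {..v})"
    then obtain v where X: "X = {..v}" by auto
    have i: "integrable lborel (\<lambda>x. indicator {..v} x * f x)" using integrable_mult_indicator[OF _ f, of "{..v}"] by simp
    have e: "ennreal (indicator {..v} x * f x) = ennreal (f x) * indicator {..v} x" "ennreal (- (indicator {..v} x * f x)) = ennreal (- f x) * indicator {..v} x" for x
      by (auto simp: indicator_def)
    have "enn2real (\<integral>\<^sup>+x. ennreal (f x) * indicator {..v} x \<partial>lborel) = enn2real (\<integral>\<^sup>+x. ennreal (- f x) * indicator {..v} x \<partial>lborel)"
      using z[of v] real_lebesgue_integral_def[OF i] by (simp add: e)
    then have "(\<integral>\<^sup>+x. ennreal (f x) * indicator {..v} x \<partial>lborel) = (\<integral>\<^sup>+x. ennreal (- f x) * indicator {..v} x \<partial>lborel)"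
      using fin[of "{..v}"] by (metis ennreal_enn2real less_top infinity_ennreal_def)
    then show "emeasure (density lborel (\<lambda>x. ennreal (f x))) X = emeasure (density lborel (\<lambda>x. ennreal (- f x))) X"
      by (simp add: X emeasure_density)
  next
    show "emeasure (density lborel (\<lambda>x. ennreal (f x))) {..(\<chi> i. real n)} \<noteq> \<infinity>" for n
      using fin(1)[of "{..(\<chi> i. real n)}"] by (simp add: emeasure_density less_top)
  qed auto
  then have dens: "emeasure (density lborel (\<lambda>x. ennreal (f x))) A = emeasure (density lborel (\<lambda>x. ennreal (- f x))) A" for A
    by simp
  have eq: "(\<integral>\<^sup>+x. ennreal (f x) * indicator A x \<partial>lborel) = (\<integral>\<^sup>+x. ennreal (- f x) * indicator A x \<partial>lborel)" if "A \<in> sets borel" for A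
    using dens[of A] that by (simp add: emeasure_density)
  have z1: "(\<integral>\<^sup>+x. ennreal (f x) * indicator {x. f x > 0} x \<partial>lborel) = 0"
  proof (subst eq)
    have z: "ennreal (- f x) * indicator {x. f x > 0} x = 0" for x by (auto simp: indicator_def ennreal_neg)
    show "(\<integral>\<^sup>+x. ennreal (- f x) * indicator {x. f x > 0} x \<partial>lborel) = 0" unfolding z by simp
  qed measurable
  have z2: "(\<integral>\<^sup>+x. ennreal (- f x) * indicator {x. f x < 0} x \<partial>lborel) = 0"
  proof (subst eq[symmetric])
    have z: "ennreal (f x) * indicator {x. f x < 0} x = 0" for x by (auto simp: indicator_def ennreal_neg)
    show "(\<integral>\<^sup>+x. ennreal (f x) * indicator {x. f x < 0} x \<partial>lborel) = 0" unfolding z by simp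
  qed measurable
  have "AE x in lborel. ennreal (f x) * indicator {x. f x > 0} x = 0"
    using z1 by (intro nn_integral_0_iff_AE[THEN iffD1]) auto
  moreover have "AE x in lborel. ennreal (- f x) * indicator {x. f x < 0} x = 0"
    using z2 by (intro nn_integral_0_iff_AE[THEN iffD1]) auto
  ultimately show ?thesis
  proof eventually_elim
    case (elim x)
    then show ?case by (cases "f x" "0::real" rule: linorder_cases) (auto simp: ennreal_eq_0_iff)
  qed
qed

text \<open>Lets both partial derivatives be treated by one argument: r runs along the coordinate i,
  s across it.\<close>

definition vi :: "2 \<Rightarrow> real \<Rightarrow> real \<Rightarrow> R2" where
  "vi i r s = (if i = 1 then vec2 r s else vec2 s r)"

lemma measurable_vi [measurable (raw)]:
  assumes "f \<in> borel_measurable M" "g \<in> borel_measurable M"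
  shows "(\<lambda>z. vi i (f z) (g z)) \<in> borel_measurable M"
  using assms by (cases "i = 1") (auto simp: vi_def)

lemma vi_nth: "vi i r s $ k = (if k = i then r else s)"
  using exhaust_2[of i] exhaust_2[of k] by (auto simp: vi_def)

lemma ex_neq2: "\<exists>k. k \<noteq> (i::2)"
  by (cases "i = 1") (auto intro: exI[of _ 1] exI[of _ 2])

lemma nn_integral_vi:
  assumes [measurable]: "f \<in> borel_measurable borel"
  shows "(\<integral>\<^sup>+x. f x \<partial>(lborel::R2 measure)) = (\<integral>\<^sup>+r. \<integral>\<^sup>+s. f (vi i r s) \<partial>lborel \<partial>lborel)"
proof (cases "i = 1")
  case True
  then show ?thesis using nn_integral_R2[of f] by (simp add: vi_def)
next
  case False
  have "(\<integral>\<^sup>+x. f x \<partial>(lborel::R2 measure)) = (\<integral>\<^sup>+r. \<integral>\<^sup>+s. f (vec2 s r) \<partial>lborel \<partial>lborel)"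
    by (subst nn_integral_R2, simp, rule lborel_pair.Fubini') measurable
  then show ?thesis using False by (simp add: vi_def)
qed

lemma integral_vi:
  fixes f :: "R2 \<Rightarrow> real"
  assumes f: "integrable lborel f"
  shows "(\<integral>x. f x \<partial>lborel) = (\<integral>s. (\<integral>r. f (vi i r s) \<partial>lborel) \<partial>lborel)"
proof -
  have fm[measurable]: "f \<in> borel_measurable borel" using f by auto
  have m: "(\<lambda>z. vec2 (fst z) (snd z)) \<in> lborel \<Otimes>\<^sub>M lborel \<rightarrow>\<^sub>M borel"
    using measurable_vec2 by (simp cong: measurable_cong_sets)
  have e: "(\<integral>x. f x \<partial>lborel) = (\<integral>z. f (vec2 (fst z) (snd z)) \<partial>(lborel \<Otimes>\<^sub>M lborel))"
    by (subst lborel_R2, subst integral_distr[OF m]) auto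
  have i0: "integrable (distr (lborel \<Otimes>\<^sub>M lborel) borel (\<lambda>z. vec2 (fst z) (snd z))) f" using f lborel_R2 by metis
  have i: "integrable (lborel \<Otimes>\<^sub>M lborel) (\<lambda>(a, b). f (vec2 a b))"
    using i0 by (subst (asm) integrable_distr_eq[OF m]) (auto simp: split_beta')
  show ?thesis
  proof (cases "i = 1")
    case True
    then show ?thesis using lborel_pair.integral_snd[OF i] unfolding e by (simp add: vi_def split_beta')
  next
    case False
    then show ?thesis using lborel_pair.integral_fst'[OF i] unfolding e by (simp add: vi_def split_beta')
  qed
qed

lemma deriv_vi:
  assumes "\<And>x. (\<phi> has_derivative (\<lambda>h. G x \<bullet> h)) (at x)"
  shows "((\<lambda>r. \<phi> (vi i r s)) has_real_derivative G (vi i r s) $ i) (at r)"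
proof -
  have e: "vi i r s = r *\<^sub>R axis i 1 + vi i 0 s" for r
    by (simp add: vec_eq_iff vi_nth axis_def)
  have "((\<lambda>r. r *\<^sub>R axis i 1 + vi i 0 s) has_derivative (\<lambda>h. h *\<^sub>R axis i 1)) (at r)"
    by (auto intro!: derivative_eq_intros)
  then have "((\<lambda>r. vi i r s) has_derivative (\<lambda>h. h *\<^sub>R axis i 1)) (at r)" by (simp only: e[symmetric])
  from has_derivative_compose[OF this assms] show ?thesis
    unfolding has_field_derivative_def by (rule has_derivative_eq_rhs) (auto simp: cart_eq_inner_axis mult.commute)
qed

text \<open>Closability is what makes \<^const>\<open>wgrad\<close> unique almost everywhere.\<close>
lemma gradient_closable:
  fixes d :: "nat \<Rightarrow> R2 \<Rightarrow> real" and D :: "nat \<Rightarrow> R2 \<Rightarrow> R2"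
  assumes deriv: "\<And>n x. (d n has_derivative (\<lambda>h. D n x \<bullet> h)) (at x)" and cont: "\<And>n. continuous_on UNIV (D n)"
    and supp: "\<And>n x. norm x \<ge> R \<Longrightarrow> d n x = 0 \<and> D n x = 0"
    and H: "integrable lborel H" and w[measurable]: "w \<in> borel_measurable borel"
    and ae: "AE x in lborel. (\<lambda>n. d n x) \<longlonglongrightarrow> 0 \<and> (\<lambda>n. D n x) \<longlonglongrightarrow> w x \<and> (\<forall>n. \<bar>d n x\<bar> \<le> H x \<and> norm (D n x) \<le> H x)"
  shows "AE x in lborel. w x = 0"
proof -
  have dm[measurable]: "d n \<in> borel_measurable borel" "D n \<in> borel_measurable borel" for n
    using C1_measurable[of "d n" "D n"] deriv cont by auto
  have Hm[measurable]: "H \<in> borel_measurable borel" using H by auto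
  have comp: "AE x in lborel. w x $ i = 0" for i
  proof -
    have cm[measurable]: "(\<lambda>x. D n x $ i) \<in> borel_measurable borel" "(\<lambda>x. w x $ i) \<in> borel_measurable borel" for n
      by (auto simp: cart_eq_inner_axis)
    have aei: "AE x in lborel. (\<lambda>n. D n x $ i) \<longlonglongrightarrow> w x $ i \<and> (\<forall>n. \<bar>D n x $ i\<bar> \<le> H x) \<and> \<bar>w x $ i\<bar> \<le> H x"
      using ae
    proof eventually_elim
      case (elim x)
      have 1: "(\<lambda>n. D n x $ i) \<longlonglongrightarrow> w x $ i" using elim by (auto intro: tendsto_vec_nth)
      have 2: "\<bar>D n x $ i\<bar> \<le> H x" for n using elim component_le_norm_cart[of "D n x" i] order_trans by blast
      have "\<bar>w x $ i\<bar> \<le> H x" by (rule LIMSEQ_le_const2[OF tendsto_rabs[OF 1]]) (use 2 in auto)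
      then show ?case using 1 2 by blast
    qed
    have aew: "AE x in lborel. norm (w x $ i) \<le> norm (H x)" using aei by eventually_elim (simp, linarith)
    have aeD: "AE x in lborel. norm (D n x $ i) \<le> norm (H x)" for n
      using aei by eventually_elim (metis abs_ge_self order_trans real_norm_def)
    have aed: "AE x in lborel. norm (d n x) \<le> norm (H x)" for n
      using ae by eventually_elim (metis abs_ge_self order_trans real_norm_def)
    have wi: "integrable lborel (\<lambda>x. w x $ i)"
      by (rule Bochner_Integration.integrable_bound[OF H _ aew]) simp
    have Di: "integrable lborel (\<lambda>x. D n x $ i)" for n
      by (rule Bochner_Integration.integrable_bound[OF H _ aeD]) simp
    \<comment> \<open>The quadrants of \<open>AE_zero_if_integral_atMost_zero\<close>, written so
      that a bounds the coordinate i and b the other one.\<close>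
    define Q where "Q a b = {x::R2. x $ i \<le> a \<and> (\<forall>k. k \<noteq> i \<longrightarrow> x $ k \<le> b)}" for a b
    have Qv: "vi i r s \<in> Q a b \<longleftrightarrow> r \<le> a \<and> s \<le> b" for r s a b
    proof -
      obtain k where "k \<noteq> i" using ex_neq2 by blast
      then show ?thesis by (auto simp: Q_def vi_nth)
    qed
    have Qm[measurable]: "Q a b \<in> sets borel" for a b
    proof -
      have "closed (Q a b)" unfolding Q_def
        by (intro closed_Collect_conj closed_Collect_all closed_Collect_imp open_Collect_const closed_Collect_le continuous_intros)
      then show ?thesis by simp
    qed
    have zero: "(\<integral>x. indicator (Q a b) x * w x $ i \<partial>lborel) = 0" for a b
    proof -
      \<comment> \<open>\<Gamma> integrates the i-th component of w over a quadrant, as a function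
        of the edge a. For the approximants the fundamental theorem turns it into an integral of d n
        over the edge. By Fatou the L^1 norm of \<Gamma> is at most the limit of the L^1 norms of d
        n, which is 0. So \<Gamma> vanishes almost everywhere, and by continuity from the right
        everywhere.\<close>
      define \<Gamma> where "\<Gamma> a = (\<integral>x. indicator (Q a b) x * w x $ i \<partial>lborel)" for a
      define \<Gamma>n where "\<Gamma>n n a = (\<integral>s. indicator {..b} s * d n (vi i a s) \<partial>lborel)" for n a
      have \<Gamma>n: "(\<integral>x. indicator (Q a b) x * D n x $ i \<partial>lborel) = \<Gamma>n n a" for n a
      proof -
        have "(\<integral>x. indicator (Q a b) x * D n x $ i \<partial>lborel) = (\<integral>s. (\<integral>r. indicator (Q a b) (vi i r s) * D n (vi i r s) $ i \<partial>lborel) \<partial>lborel)"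
          using integrable_mult_indicator[OF _ Di, of "Q a b"] by (intro integral_vi) simp
        also have "\<dots> = \<Gamma>n n a" unfolding \<Gamma>n_def
        proof (rule Bochner_Integration.integral_cong[OF refl])
          fix s
          define R' where "R' = \<bar>R\<bar> + \<bar>a\<bar> + 1"
          have out: "d n (vi i r s) = 0 \<and> D n (vi i r s) = 0" if "r \<le> - R'" for r
            using component_le_norm_cart[of "vi i r s" i] that by (intro supp) (auto simp: vi_nth R'_def)
          have "has_bochner_integral lborel (\<lambda>r. D n (vi i r s) $ i * indicator {- R'..a} r) (d n (vi i a s) - d n (vi i (- R') s))"
          proof (rule has_bochner_integral_FTC_Icc_real)
            show "((\<lambda>r. d n (vi i r s)) has_real_derivative D n (vi i x s) $ i) (at x)" for x by (rule deriv_vi[OF deriv])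
            have "continuous_on UNIV (\<lambda>r. D n (vi i r s) $ i)" unfolding vi_def
              by (cases "i = 1") (auto intro!: continuous_intros continuous_on_compose2[OF cont])
            then show "isCont (\<lambda>r. D n (vi i r s) $ i) x" for x by (simp add: continuous_on_eq_continuous_at)
          qed (simp add: R'_def)
          moreover have "d n (vi i (- R') s) = 0" using out by simp
          ultimately have I: "(\<integral>r. D n (vi i r s) $ i * indicator {- R'..a} r \<partial>lborel) = d n (vi i a s)"
            by (simp add: has_bochner_integral_integral_eq)
          have eq: "indicator (Q a b) (vi i r s) * D n (vi i r s) $ i = indicator {..b} s * (D n (vi i r s) $ i * indicator {- R'..a} r)" for r
            using out[of r] by (auto simp: indicator_def Qv)
          show "(\<integral>r. indicator (Q a b) (vi i r s) * D n (vi i r s) $ i \<partial>lborel) = indicator {..b} s * d n (vi i a s)"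
            unfolding eq using I by simp
        qed
        finally show ?thesis .
      qed
      have lim: "(\<lambda>n. \<Gamma>n n a) \<longlonglongrightarrow> \<Gamma> a" for a
        unfolding \<Gamma>n[symmetric] \<Gamma>_def
      proof (rule integral_dominated_convergence[OF _ _ H])
        show "AE x in lborel. (\<lambda>n. indicator (Q a b) x * D n x $ i) \<longlonglongrightarrow> indicator (Q a b) x * w x $ i"
          using aei by eventually_elim (auto intro: tendsto_mult_left)
        show "AE x in lborel. norm (indicator (Q a b) x * D n x $ i) \<le> H x" for n
          using aei by eventually_elim (auto simp: indicator_def intro: order_trans[OF abs_ge_zero])
      qed measurable
      have [measurable]: "\<Gamma>n n \<in> borel_measurable borel" for n unfolding \<Gamma>n_def by measurable
      have [measurable]: "\<Gamma> \<in> borel_measurable borel" by (rule borel_measurable_LIMSEQ_real[OF lim]) measurable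
      have "(\<integral>\<^sup>+a. ennreal \<bar>\<Gamma> a\<bar> \<partial>lborel) = (\<integral>\<^sup>+a. liminf (\<lambda>n. ennreal \<bar>\<Gamma>n n a\<bar>) \<partial>lborel)"
      proof (rule nn_integral_cong)
        fix a
        have l: "(\<lambda>n. ennreal \<bar>\<Gamma>n n a\<bar>) \<longlonglongrightarrow> ennreal \<bar>\<Gamma> a\<bar>" using lim by (intro tendsto_ennrealI tendsto_rabs)
        show "ennreal \<bar>\<Gamma> a\<bar> = liminf (\<lambda>n. ennreal \<bar>\<Gamma>n n a\<bar>)" by (rule lim_imp_Liminf[OF _ l, symmetric]) simp
      qed
      also have "\<dots> \<le> liminf (\<lambda>n. \<integral>\<^sup>+a. ennreal \<bar>\<Gamma>n n a\<bar> \<partial>lborel)" by (rule nn_integral_liminf) measurable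
      also have "\<dots> \<le> liminf (\<lambda>n. ennreal (\<integral>x. \<bar>d n x\<bar> \<partial>lborel))"
      proof (rule Liminf_mono, rule always_eventually, rule allI)
        fix n
        have "(\<integral>\<^sup>+a. ennreal \<bar>\<Gamma>n n a\<bar> \<partial>lborel) \<le> (\<integral>\<^sup>+a. \<integral>\<^sup>+s. ennreal \<bar>d n (vi i a s)\<bar> \<partial>lborel \<partial>lborel)"
        proof (rule nn_integral_mono)
          fix a
          \<comment> \<open>A section that is not integrable has Bochner integral 0, so the bound
            holds in that case as well.\<close>
          have "ennreal \<bar>\<Gamma>n n a\<bar> \<le> (\<integral>\<^sup>+s. ennreal (norm (indicator {..b} s * d n (vi i a s))) \<partial>lborel)"
            using integral_norm_bound_ennreal[of lborel "\<lambda>s. indicator {..b} s * d n (vi i a s)"]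
              not_integrable_integral_eq[of lborel "\<lambda>s. indicator {..b} s * d n (vi i a s)"]
            unfolding \<Gamma>n_def by (cases "integrable lborel (\<lambda>s. indicator {..b} s * d n (vi i a s))") auto
          also have "\<dots> \<le> (\<integral>\<^sup>+s. ennreal \<bar>d n (vi i a s)\<bar> \<partial>lborel)"
            by (intro nn_integral_mono) (auto simp: indicator_def)
          finally show "ennreal \<bar>\<Gamma>n n a\<bar> \<le> (\<integral>\<^sup>+s. ennreal \<bar>d n (vi i a s)\<bar> \<partial>lborel)" .
        qed
        also have "\<dots> = (\<integral>\<^sup>+x. ennreal \<bar>d n x\<bar> \<partial>lborel)" by (rule nn_integral_vi[symmetric]) measurable
        also have "\<dots> = ennreal (\<integral>x. \<bar>d n x\<bar> \<partial>lborel)"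
        proof (rule nn_integral_eq_integral)
          show "integrable lborel (\<lambda>x. \<bar>d n x\<bar>)"
            by (rule Bochner_Integration.integrable_bound[OF H]) (use aed in auto)
        qed simp
        finally show "(\<integral>\<^sup>+a. ennreal \<bar>\<Gamma>n n a\<bar> \<partial>lborel) \<le> ennreal (\<integral>x. \<bar>d n x\<bar> \<partial>lborel)" .
      qed
      also have "\<dots> = 0"
      proof -
        have "(\<lambda>n. \<integral>x. \<bar>d n x\<bar> \<partial>lborel) \<longlonglongrightarrow> (\<integral>x. 0 \<partial>(lborel :: R2 measure))"
        proof (rule integral_dominated_convergence[OF _ _ H])
          show "AE x in lborel. (\<lambda>n. \<bar>d n x\<bar>) \<longlonglongrightarrow> 0"
            using ae by eventually_elim (auto intro: tendsto_rabs_zero)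
          show "AE x in lborel. norm \<bar>d n x\<bar> \<le> H x" for n
            using ae by eventually_elim auto
        qed measurable
        then have "(\<lambda>n. ennreal (\<integral>x. \<bar>d n x\<bar> \<partial>lborel)) \<longlonglongrightarrow> 0" using tendsto_ennrealI by fastforce
        then show ?thesis by (rule lim_imp_Liminf[rotated]) simp
      qed
      finally have "(\<integral>\<^sup>+a. ennreal \<bar>\<Gamma> a\<bar> \<partial>lborel) = 0" by simp
      then have AE\<Gamma>: "AE a in lborel. \<Gamma> a = 0" by (subst (asm) nn_integral_0_iff_AE) auto
      have "\<exists>c. a < c \<and> c < a + 1 / real (Suc k) \<and> \<Gamma> c = 0" for k
      proof (rule ccontr)
        assume n: "\<not> (\<exists>c. a < c \<and> c < a + 1 / real (Suc k) \<and> \<Gamma> c = 0)"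
        have "AE c in lborel. c \<notin> {a<..<a + 1 / real (Suc k)}"
          using AE\<Gamma> by eventually_elim (use n in auto)
        then have "emeasure lborel {a<..<a + 1 / real (Suc k)} = 0"
          by (subst (asm) AE_iff_measurable[of "{a<..<a + 1 / real (Suc k)}"]) auto
        then show False by simp
      qed
      then have "\<forall>k. \<exists>c. a < c \<and> c < a + 1 / real (Suc k) \<and> \<Gamma> c = 0" ..
      from choice[OF this] obtain c where c: "\<And>k. a < c k" "\<And>k. c k < a + 1 / real (Suc k)" "\<And>k. \<Gamma> (c k) = 0" by blast
      have cl: "c \<longlonglongrightarrow> a"
      proof (rule tendsto_sandwich[OF _ _ tendsto_const])
        show "(\<lambda>k. a + 1 / real (Suc k)) \<longlonglongrightarrow> a" using tendsto_add[OF tendsto_const[of a] LIMSEQ_inverse_real_of_nat] by (simp add: inverse_eq_divide)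
      qed (use c in \<open>auto intro!: always_eventually less_imp_le\<close>)
      have "(\<lambda>k. \<Gamma> (c k)) \<longlonglongrightarrow> \<Gamma> a" unfolding \<Gamma>_def
      proof (rule integral_dominated_convergence[OF _ _ H])
        show "AE x in lborel. (\<lambda>k. indicator (Q (c k) b) x * w x $ i) \<longlonglongrightarrow> indicator (Q a b) x * w x $ i"
        proof (rule AE_I2)
          fix x
          have "eventually (\<lambda>k. x \<in> Q (c k) b \<longleftrightarrow> x \<in> Q a b) sequentially"
          proof (cases "x $ i \<le> a")
            case True
            then have "x $ i \<le> c k" for k using c(1)[of k] by linarith
            then show ?thesis using True by (auto simp: Q_def)
          next
            case False
            then have "eventually (\<lambda>k. c k < x $ i) sequentially" using cl by (intro order_tendstoD) auto
            then show ?thesis by eventually_elim (use False in \<open>auto simp: Q_def\<close>)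
          qed
          then have "eventually (\<lambda>k. indicator (Q (c k) b) x * w x $ i = indicator (Q a b) x * w x $ i) sequentially"
            by eventually_elim (simp add: indicator_def)
          then show "(\<lambda>k. indicator (Q (c k) b) x * w x $ i) \<longlonglongrightarrow> indicator (Q a b) x * w x $ i"
            by (rule tendsto_eventually)
        qed
        show "AE x in lborel. norm (indicator (Q (c k) b) x * w x $ i) \<le> H x" for k
          using aei by eventually_elim (auto simp: indicator_def intro: order_trans[OF abs_ge_zero])
      qed measurable
      then have "\<Gamma> a = 0" using c(3) LIMSEQ_unique by (auto simp: LIMSEQ_const_iff)
      then show ?thesis by (simp add: \<Gamma>_def)
    qed
    show ?thesis
    proof (rule AE_zero_if_integral_atMost_zero[OF wi])
      fix v :: R2
      obtain k where k: "k \<noteq> i" using ex_neq2 by blast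
      have "{..v} = Q (v $ i) (v $ k)" using k exhaust_2[of i] exhaust_2[of k]
        by (auto simp: Q_def less_eq_vec_def forall_2)
      then show "(\<integral>x. indicator {..v} x * w x $ i \<partial>lborel) = 0" using zero by simp
    qed
  qed
  show ?thesis using comp[of 1] comp[of 2] by eventually_elim (auto intro: R2_eqI)
qed

lemma AE_lebesgue_iff: "(AE x in lebesgue. P x) \<longleftrightarrow> (AE x in lborel. P x)"
  by (rule AE_completion_iff)

lemma borel_version_R2:
  fixes f :: "R2 \<Rightarrow> R2"
  assumes f: "f \<in> borel_measurable lebesgue"
  obtains g where "g \<in> borel_measurable borel" "AE x in lborel. f x = g x"
proof -
  have fi: "(\<lambda>x. f x $ i) \<in> borel_measurable lebesgue" for i
    using f by (simp add: cart_eq_inner_axis)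
  obtain g1 where g1: "g1 \<in> borel_measurable lborel" "AE x in lborel. f x $ 1 = g1 x"
    using completion_ex_borel_measurable_real[OF fi] by blast
  obtain g2 where g2: "g2 \<in> borel_measurable lborel" "AE x in lborel. f x $ 2 = g2 x"
    using completion_ex_borel_measurable_real[OF fi] by blast
  show ?thesis
  proof (rule that)
    have "g1 \<in> borel_measurable borel" "g2 \<in> borel_measurable borel" using g1 g2 by simp_all
    then show "(\<lambda>x. vec2 (g1 x) (g2 x)) \<in> borel_measurable borel" by measurable
    show "AE x in lborel. f x = vec2 (g1 x) (g2 x)"
      using g1(2) g2(2) by eventually_elim (auto intro: R2_eqI)
  qed
qed

lemma integrable_borel_version:
  fixes f :: "R2 \<Rightarrow> real"
  assumes f: "integrable lebesgue f"
  obtains g where "integrable lborel g" "AE x in lborel. f x = g x"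
proof -
  obtain g where g: "g \<in> borel_measurable lborel" "AE x in lborel. f x = g x"
    using completion_ex_borel_measurable_real[of f lborel] f by blast
  have "integrable lebesgue g"
    using f g by (subst integrable_cong_AE[of _ _ f])
      (auto simp: AE_lebesgue_iff elim!: eventually_mono intro!: borel_measurable_lebesgue)
  then have "integrable lborel g" using g(1) by (simp add: integrable_completion)
  then show ?thesis using that g by blast
qed

text \<open>The differences of two approximating sequences tend to 0 and their gradients tend to the
  difference of the two candidates, so closability applies. It asks for an L^1 majorant; on a
  bounded domain one is obtained from y <= 1 + y^p.\<close>

lemma sobolev0_unique:
  assumes s: "sobolev0 p \<Omega> u g" and s': "sobolev0 p \<Omega> u g'" and p: "p \<ge> 1" and b: "bounded \<Omega>"
  shows "AE x in lebesgue. zext \<Omega> g x = zext \<Omega> g' x"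
proof -
  obtain \<phi> G H where d: "dominated_approx p \<Omega> u g \<phi> G H" using sobolev0_dominated[OF s p] by blast
  obtain \<phi>' G' H' where d': "dominated_approx p \<Omega> u g' \<phi>' G' H'" using sobolev0_dominated[OF s' p] by blast
  note t = dominated_approxD(1)[OF d] and Hi = dominated_approxD(2)[OF d] and ae = dominated_approxD(4)[OF d]
  note t' = dominated_approxD(1)[OF d'] and Hi' = dominated_approxD(2)[OF d'] and ae' = dominated_approxD(4)[OF d']
  obtain r where r: "\<Omega> \<subseteq> ball 0 r" using b bounded_subset_ballD by metis
  define K where "K x = indicator (cball 0 r) x * (2 + H x + H' x)" for x
  have "integrable lebesgue (\<lambda>x::R2. indicator (cball 0 r) x :: real)"
    using emeasure_bounded_finite[of "cball 0 r :: R2 set"] by (intro integrable_real_indicator) auto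
  then have "integrable lebesgue (\<lambda>x. 2 * indicator (cball 0 r) x + indicator (cball 0 r) x *\<^sub>R H x + indicator (cball 0 r) x *\<^sub>R H' x)"
    by (intro Bochner_Integration.integrable_add integrable_mult_indicator Hi Hi' integrable_mult_right) auto
  then have "integrable lebesgue K" unfolding K_def by (simp add: algebra_simps)
  then obtain K' where K': "integrable lborel K'" "AE x in lborel. K x = K' x" by (rule integrable_borel_version)
  define w0 where "w0 x = zext \<Omega> g x - zext \<Omega> g' x" for x
  have "w0 \<in> borel_measurable lebesgue" unfolding w0_def using sobolev0_measurable[OF s] sobolev0_measurable[OF s'] by measurable
  then obtain w where w: "w \<in> borel_measurable borel" "AE x in lborel. w0 x = w x" by (rule borel_version_R2)
  have young: "y \<le> 1 + y powr p" if "y \<ge> 0" for y :: real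
  proof (cases "y \<le> 1")
    case False
    then have "y powr 1 \<le> y powr p" using p by (intro powr_mono) auto
    then show ?thesis using False by simp
  qed (auto intro: order_trans)
  have "AE x in lborel. w x = 0"
  proof (rule gradient_closable[where d="\<lambda>n x. \<phi> n x - \<phi>' n x" and D="\<lambda>n x. G n x - G' n x" and R=r and H=K'])
    show "((\<lambda>x. \<phi> n x - \<phi>' n x) has_derivative (\<lambda>h. (G n x - G' n x) \<bullet> h)) (at x)" for n x
      using has_derivative_diff[OF test_funD(1)[OF t] test_funD(1)[OF t']] by (simp add: inner_diff_left)
    show "continuous_on UNIV (\<lambda>x. G n x - G' n x)" for n
      using test_funD(2)[OF t] test_funD(2)[OF t'] by (intro continuous_intros)
    show "\<phi> n x - \<phi>' n x = 0 \<and> G n x - G' n x = 0" if "norm x \<ge> r" for n x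
    proof -
      have "x \<notin> \<Omega>" using r that by auto
      then show ?thesis using test_fun_outside[OF t] test_fun_outside[OF t'] by simp
    qed
    show "AE x in lborel. (\<lambda>n. \<phi> n x - \<phi>' n x) \<longlonglongrightarrow> 0 \<and> (\<lambda>n. G n x - G' n x) \<longlonglongrightarrow> w x \<and>
      (\<forall>n. \<bar>\<phi> n x - \<phi>' n x\<bar> \<le> K' x \<and> norm (G n x - G' n x) \<le> K' x)"
      using ae[unfolded AE_lebesgue_iff] ae'[unfolded AE_lebesgue_iff] w(2) K'(2)
    proof eventually_elim
      case (elim x)
      have "(\<lambda>n. \<phi> n x - \<phi>' n x) \<longlonglongrightarrow> zext \<Omega> u x - zext \<Omega> u x" using elim by (intro tendsto_diff) auto
      moreover have "(\<lambda>n. G n x - G' n x) \<longlonglongrightarrow> w x" proof -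
        have "(\<lambda>n. G n x - G' n x) \<longlonglongrightarrow> zext \<Omega> g x - zext \<Omega> g' x" using elim by (intro tendsto_diff) auto
        then show ?thesis using elim by (simp add: w0_def)
      qed
      moreover have "\<bar>\<phi> n x - \<phi>' n x\<bar> \<le> K' x \<and> norm (G n x - G' n x) \<le> K' x" for n
      proof (cases "x \<in> \<Omega>")
        case True
        then have "x \<in> cball 0 r" using r by auto
        then have K: "K' x = 2 + H x + H' x" using elim by (simp add: K_def)
        have "\<bar>\<phi> n x\<bar> \<le> 1 + H x" "norm (G n x) \<le> 1 + H x" "\<bar>\<phi>' n x\<bar> \<le> 1 + H' x" "norm (G' n x) \<le> 1 + H' x"
          using elim young[of "\<bar>\<phi> n x\<bar>"] young[of "norm (G n x)"] young[of "\<bar>\<phi>' n x\<bar>"] young[of "norm (G' n x)"]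
          by (auto intro: order_trans)
        then show ?thesis unfolding K using norm_triangle_ineq4[of "G n x" "G' n x"] by linarith
      next
        case False
        have "H x \<ge> 0" "H' x \<ge> 0" using dominated_approxD(3)[OF d] dominated_approxD(3)[OF d'] by auto
        then have "K x \<ge> 0" by (simp add: K_def)
        then show ?thesis using test_fun_outside[OF t False] test_fun_outside[OF t' False] elim by simp
      qed
      ultimately show ?case by simp
    qed
  qed (use w K' in auto)
  then have "AE x in lborel. w0 x = 0" using w(2) by eventually_elim simp
  then show ?thesis unfolding AE_lebesgue_iff w0_def by eventually_elim simp
qed

lemma sobolev0_wgrad: "sobolev0 p \<Omega> u g \<Longrightarrow> sobolev0 p \<Omega> u (wgrad p \<Omega> u)"
  unfolding wgrad_def by (rule someI[of "sobolev0 p \<Omega> u" g])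

text \<open>\<open>wgrad\<close> is a choice; by uniqueness any gradient at hand may take its place
  in the energy. Finiteness of the integral makes the \<open>enn2real\<close> in
  \<open>energy\<close> faithful.\<close>

lemma energy_eq:
  assumes s: "sobolev0 p \<Omega> u g" and p: "p \<ge> 1" and b: "bounded \<Omega>"
  shows "ennreal (energy p \<Omega> u) = (\<integral>\<^sup>+x. ennreal (norm (zext \<Omega> g x) powr p) \<partial>lebesgue)"
    "energy p \<Omega> u = enn2real (\<integral>\<^sup>+x. ennreal (norm (zext \<Omega> g x) powr p) \<partial>lebesgue)"
proof -
  have "(\<integral>\<^sup>+x\<in>\<Omega>. ennreal (norm (wgrad p \<Omega> u x) powr p) \<partial>lebesgue) = (\<integral>\<^sup>+x. ennreal (norm (zext \<Omega> (wgrad p \<Omega> u) x) powr p) \<partial>lebesgue)"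
    using p by (intro set_nn_integral_zext) auto
  also have "\<dots> = (\<integral>\<^sup>+x. ennreal (norm (zext \<Omega> g x) powr p) \<partial>lebesgue)"
    using sobolev0_unique[OF sobolev0_wgrad[OF s] s p b] by (intro nn_integral_cong_AE) (auto elim: eventually_mono)
  finally have e: "(\<integral>\<^sup>+x\<in>\<Omega>. ennreal (norm (wgrad p \<Omega> u x) powr p) \<partial>lebesgue) = (\<integral>\<^sup>+x. ennreal (norm (zext \<Omega> g x) powr p) \<partial>lebesgue)" .
  moreover have "(\<integral>\<^sup>+x\<in>\<Omega>. ennreal (norm (wgrad p \<Omega> u x) powr p) \<partial>lebesgue) < \<infinity>"
    using sobolev0_wgrad[OF s] by (simp add: sobolev0_def)
  ultimately show "ennreal (energy p \<Omega> u) = (\<integral>\<^sup>+x. ennreal (norm (zext \<Omega> g x) powr p) \<partial>lebesgue)"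
    "energy p \<Omega> u = enn2real (\<integral>\<^sup>+x. ennreal (norm (zext \<Omega> g x) powr p) \<partial>lebesgue)"
    by (simp_all add: energy_def ennreal_enn2real)
qed

lemma energy_nonneg: "energy p \<Omega> u \<ge> 0" by (simp add: energy_def)

text \<open>The constant is crude: the estimate only has to keep the energy bounded near a point of
  an admissible loop.\<close>

lemma energy_triangle:
  assumes u: "sobolev0 p \<Omega> u g" and v: "sobolev0 p \<Omega> v h" and p: "p \<ge> 1" and b: "bounded \<Omega>" and O: "\<Omega> \<in> sets borel"
  shows "energy p \<Omega> u \<le> 2 powr p * (energy p \<Omega> v + energy p \<Omega> (\<lambda>x. u x - v x))"
proof -
  have z: "zext \<Omega> (\<lambda>x. g x - h x) x = zext \<Omega> g x - zext \<Omega> h x" for x by (cases "x \<in> \<Omega>") auto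
  note [measurable] = sobolev0_measurable[OF u] sobolev0_measurable[OF v]
  have "ennreal (energy p \<Omega> u) \<le> (\<integral>\<^sup>+x. ennreal (2 powr p) * (ennreal (norm (zext \<Omega> h x) powr p) + ennreal (norm (zext \<Omega> (\<lambda>x. g x - h x) x) powr p)) \<partial>lebesgue)"
    unfolding energy_eq(1)[OF u p b] z
  proof (rule nn_integral_mono)
    fix x
    show "ennreal (norm (zext \<Omega> g x) powr p) \<le> ennreal (2 powr p) * (ennreal (norm (zext \<Omega> h x) powr p) + ennreal (norm (zext \<Omega> g x - zext \<Omega> h x) powr p))"
      using powr_norm_add_le[of p "zext \<Omega> h x" "zext \<Omega> g x - zext \<Omega> h x"] p by (simp add: ennreal_leI flip: ennreal_plus ennreal_mult)
  qed
  also have "\<dots> = ennreal (2 powr p) * (ennreal (energy p \<Omega> v) + ennreal (energy p \<Omega> (\<lambda>x. u x - v x)))"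
    unfolding energy_eq(1)[OF v p b] energy_eq(1)[OF sobolev0_diff[OF u v p O] p b]
    unfolding z by (subst nn_integral_cmult, measurable, subst nn_integral_add) auto
  also have "\<dots> = ennreal (2 powr p * (energy p \<Omega> v + energy p \<Omega> (\<lambda>x. u x - v x)))"
    by (simp add: ennreal_mult ennreal_plus energy_nonneg)
  finally show ?thesis by (simp add: energy_nonneg)
qed

lemma bounded_sector: "bounded sector"
  by (rule bounded_subset[of "ball 0 1"]) (auto simp: mem_sector)

text \<open>Morrey's inequality for \<phi> n - \<phi> m shows that the approximants are uniformly
  Cauchy. Their limit is u almost everywhere. Since u is continuous, the set where \<phi> n and u
  differ by more than e is open; being null it is empty.\<close>

lemma sobolev0_uniform:
  assumes s: "sobolev0 p sector u g" and p: "p \<ge> 3" and cu: "continuous_on sector u"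
  shows "\<exists>\<phi> G H. dominated_approx p sector u g \<phi> G H \<and>
    (\<forall>e>0. \<forall>\<^sub>F n in sequentially. \<forall>x. \<bar>\<phi> n x - zext sector u x\<bar> \<le> e)"
proof -
  have p1: "p \<ge> 1" using p by simp
  obtain \<phi> G H where d: "dominated_approx p sector u g \<phi> G H" using sobolev0_dominated[OF s p1] by blast
  note t = dominated_approxD(1)[OF d] and ae = dominated_approxD(4)[OF d] and lim = dominated_approxD(5)[OF d]
  define \<delta> where "\<delta> n = (\<integral>\<^sup>+x. ennreal (norm (G n x - zext sector g x) powr p) \<partial>lebesgue)" for n
  note [measurable] = sobolev0_measurable[OF s] test_funD(3,4)[OF t, THEN borel_measurable_lebesgue]
  define C where "C = morrey_const p * 2 powr p"
  have C: "C > 0" by (simp add: C_def morrey_const_def)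
  have osc: "ennreal (\<bar>\<phi> n x - \<phi> m x\<bar> powr p) \<le> ennreal C * (\<delta> n + \<delta> m)" for n m x
  proof -
    have "ennreal (\<bar>\<phi> n x - \<phi> m x\<bar> powr p) \<le> ennreal (morrey_const p) * (\<integral>\<^sup>+y. ennreal (norm (G n y - G m y) powr p) \<partial>lborel)"
    proof (rule morrey[OF _ _ _ p])
      show "((\<lambda>x. \<phi> n x - \<phi> m x) has_derivative (\<lambda>h. (G n x - G m x) \<bullet> h)) (at x)" for x
        using has_derivative_diff[OF test_funD(1)[OF t] test_funD(1)[OF t]] by (simp add: inner_diff_left)
      show "continuous_on UNIV (\<lambda>x. G n x - G m x)"
        using test_funD(2)[OF t] by (intro continuous_intros)
      show "\<phi> n x - \<phi> m x = 0" if "norm x \<ge> 1" for x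
        using test_fun_outside[OF t] that by (simp add: mem_sector)
    qed
    also have "\<dots> \<le> ennreal (morrey_const p) * (\<integral>\<^sup>+y. ennreal (2 powr p) * (ennreal (norm (G n y - zext sector g y) powr p) + ennreal (norm (G m y - zext sector g y) powr p)) \<partial>lebesgue)"
      unfolding nn_integral_completion
    proof (rule mult_left_mono, rule nn_integral_mono)
      fix y
      show "ennreal (norm (G n y - G m y) powr p) \<le> ennreal (2 powr p) * (ennreal (norm (G n y - zext sector g y) powr p) + ennreal (norm (G m y - zext sector g y) powr p))"
        using powr_norm_add_le[of p "G n y - zext sector g y" "- (G m y - zext sector g y)"] p
        unfolding norm_minus_cancel by (simp add: ennreal_leI flip: ennreal_plus ennreal_mult)
    qed simp
    also have "\<dots> = ennreal C * (\<delta> n + \<delta> m)" unfolding \<delta>_def C_def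
      by (subst nn_integral_cmult, measurable, subst nn_integral_add)
        (auto simp: ennreal_mult mult.assoc morrey_const_def)
    finally show ?thesis .
  qed
  have unif: "\<forall>\<^sub>F n in sequentially. \<forall>x. \<bar>\<phi> n x - zext sector u x\<bar> \<le> e" if e: "e > 0" for e
  proof -
    define \<eta> where "\<eta> = e powr p / (2 * C)"
    have \<eta>: "\<eta> > 0" using e C by (simp add: \<eta>_def)
    have "\<forall>\<^sub>F n in sequentially. \<delta> n < ennreal \<eta>" using lim \<eta> unfolding \<delta>_def by (intro order_tendstoD) auto
    then obtain N where N: "\<And>n. n \<ge> N \<Longrightarrow> \<delta> n < ennreal \<eta>" by (auto simp: eventually_sequentially)
    have close: "\<bar>\<phi> n x - \<phi> m x\<bar> \<le> e" if "n \<ge> N" "m \<ge> N" for n m x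
    proof -
      have "ennreal (\<bar>\<phi> n x - \<phi> m x\<bar> powr p) \<le> ennreal C * (ennreal \<eta> + ennreal \<eta>)"
        using N[OF that(1)] N[OF that(2)] by (intro order_trans[OF osc] mult_left_mono add_mono) auto
      also have "\<dots> = ennreal (e powr p)" using \<eta> C by (simp add: \<eta>_def flip: ennreal_plus ennreal_mult)
      finally have "\<bar>\<phi> n x - \<phi> m x\<bar> powr p \<le> e powr p" by simp
      then show ?thesis using powr_less_mono2[of p e "\<bar>\<phi> n x - \<phi> m x\<bar>"] e p by (intro leI) auto
    qed
    have "\<bar>\<phi> n x - zext sector u x\<bar> \<le> e" if n: "n \<ge> N" for n x
    proof (cases "x \<in> sector")
      case False then show ?thesis using test_fun_outside[OF t] e by simp
    next
      case x: True
      let ?B = "{y \<in> sector. e < \<bar>\<phi> n y - u y\<bar>}"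
      have "AE y in lborel. y \<notin> ?B" using ae[unfolded AE_lebesgue_iff]
      proof eventually_elim
        case (elim y)
        have "(\<lambda>m. \<bar>\<phi> n y - \<phi> m y\<bar>) \<longlonglongrightarrow> \<bar>\<phi> n y - zext sector u y\<bar>"
          using elim by (intro tendsto_rabs tendsto_diff tendsto_const) auto
        then have "\<bar>\<phi> n y - zext sector u y\<bar> \<le> e"
          by (rule LIMSEQ_le_const2) (use close n in blast)
        then show ?case by auto
      qed
      moreover have op: "open ?B"
      proof -
        have "continuous_on sector (\<lambda>y. \<bar>\<phi> n y - u y\<bar>)"
          using cu C1_continuous[OF test_funD(1)[OF t]] by (intro continuous_intros) (auto intro: continuous_on_subset)
        then have "open ((\<lambda>y. \<bar>\<phi> n y - u y\<bar>) -` {e<..} \<inter> sector)"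
          unfolding continuous_on_open_vimage[OF open_sector] by simp
        moreover have "(\<lambda>y. \<bar>\<phi> n y - u y\<bar>) -` {e<..} \<inter> sector = ?B" by auto
        ultimately show ?thesis by simp
      qed
      ultimately have "emeasure lborel ?B = 0"
        by (subst (asm) AE_iff_measurable[of ?B]) auto
      then have "?B \<in> null_sets lborel" using op by (intro null_setsI) auto
      then have "negligible ?B" using negligible_iff_null_sets null_sets_completionI by blast
      then have "?B = {}" using op open_not_negligible by blast
      then show ?thesis using x by (auto simp: not_less)
    qed
    then show ?thesis by (auto simp: eventually_sequentially)
  qed
  then show ?thesis using d by blast
qed

section \<open>Poincare inequalities on parts of the sector\<close>

text \<open>1309/2500 is 3.1416/6, and the Taylor polynomial of degree 7 shows that the sine exceeds
  1/2 = sin (pi/6) there. The precision is called for by 0.4592 * pi/8 <= 0.1804 in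
  \<open>poincare_inner\<close>, which amounts to pi <= 22/7.\<close>

lemma pi_less_31416: "pi < 3.1416"
proof -
  define x :: real where "x = 1309 / 2500"
  have "\<bar>sin x - (\<Sum>m<8. sin_coeff m * x ^ m)\<bar> \<le> inverse (fact 8) * \<bar>x\<bar> ^ 8"
    by (rule Maclaurin_sin_bound)
  moreover have "(\<Sum>m<8. sin_coeff m * x ^ m) > 5000009 / 10000000"
    by (simp add: x_def sin_coeff_def lessThan_nat_numeral fact_numeral power_divide)
  moreover have "inverse (fact 8) * \<bar>x\<bar> ^ 8 < 1 / 5000000"
    by (simp add: x_def fact_numeral power_divide)
  ultimately have "sin x > 1/2" by linarith
  then have "sin (pi / 6) < sin x" by (simp add: sin_30)
  then have "\<not> x \<le> pi / 6"
    using sin_monotone_2pi_le[of x "pi/6"] pi_gt_zero by (auto simp: x_def)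
  then show ?thesis by (simp add: x_def)
qed

lemma pi_ge_3: "pi \<ge> 3"
  using sin_x_le_x[of "pi / 6"] by (simp add: sin_30)

text \<open>The closed rectangle adds to the sector only points outside it, where f vanishes; on its
  two straight sides the Jacobian vanishes or the point lies on a bounding ray.\<close>

lemma rect_int_sector:
  assumes f: "f \<in> borel_measurable borel" and z: "\<And>x. x \<notin> sector \<Longrightarrow> f x = 0"
  shows "(\<integral>\<^sup>+x. f x \<partial>lborel) = rect_int 0 1 0 (pi/4) f"
proof -
  have "(\<integral>\<^sup>+x. f x \<partial>lborel) = (\<integral>\<^sup>+x\<in>sector. f x \<partial>lborel)"
    using z by (intro nn_integral_cong) (auto simp: indicator_def)
  also have "\<dots> = (\<integral>\<^sup>+\<theta>. (\<integral>\<^sup>+\<rho>. ennreal \<rho> * f (polar \<rho> \<theta>) * indicator ({0<..<1} \<times> {0<..<pi/4}) (\<rho>, \<theta>) \<partial>lborel) \<partial>lborel)"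
    by (rule nn_integral_sector[OF f])
  also have "\<dots> = (\<integral>\<^sup>+\<theta>. (\<integral>\<^sup>+\<rho>. (ennreal \<rho> * f (polar \<rho> \<theta>) * indicator {0..1} \<rho>) * indicator {0..pi/4} \<theta> \<partial>lborel) \<partial>lborel)"
  proof (rule nn_integral_cong, rule nn_integral_cong)
    fix \<theta> \<rho> :: real
    show "ennreal \<rho> * f (polar \<rho> \<theta>) * indicator ({0<..<1} \<times> {0<..<pi/4}) (\<rho>, \<theta>) = (ennreal \<rho> * f (polar \<rho> \<theta>) * indicator {0..1} \<rho>) * indicator {0..pi/4} \<theta>"
    proof (cases "\<rho> > 0 \<and> polar \<rho> \<theta> \<in> sector \<and> \<theta> \<in> {0..pi/4}")
      case True
      then have "\<rho> < 1" by (auto simp: mem_sector)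
      moreover have "polar \<rho> 0 \<notin> sector" "polar \<rho> (pi/4) \<notin> sector" by (simp_all add: mem_sector polar_def sin_45 cos_45)
      then have "\<theta> \<noteq> 0" "\<theta> \<noteq> pi / 4" using True by metis+
      ultimately show ?thesis using True by (auto simp: indicator_def)
    next
      case False
      then consider "\<rho> \<le> 0" | "polar \<rho> \<theta> \<notin> sector" | "\<theta> \<notin> {0..pi/4}" by force
      then show ?thesis by cases (auto simp: indicator_def z ennreal_neg)
    qed
  qed
  also have "\<dots> = rect_int 0 1 0 (pi/4) f"
    unfolding rect_int_def using f by (subst nn_integral_multc) auto
  finally show ?thesis .
qed

lemma rect_int_split_radius:
  assumes [measurable]: "F \<in> borel_measurable borel"
  shows "rect_int a b c d F \<le> rect_int a m c d F + rect_int m b c d F"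
proof -
  have "rect_int a b c d F \<le> (\<integral>\<^sup>+\<theta>\<in>{c..d}. ((\<integral>\<^sup>+\<rho>\<in>{a..m}. ennreal \<rho> * F (polar \<rho> \<theta>) \<partial>lborel) + (\<integral>\<^sup>+\<rho>\<in>{m..b}. ennreal \<rho> * F (polar \<rho> \<theta>) \<partial>lborel)) \<partial>lborel)"
    unfolding rect_int_def
    by (subst nn_integral_add[symmetric], measurable, intro nn_integral_mono mult_right_mono)
      (auto intro!: nn_integral_mono simp: indicator_def)
  also have "\<dots> = rect_int a m c d F + rect_int m b c d F"
    unfolding rect_int_def by (subst nn_integral_add[symmetric]) (auto simp: distrib_right)
  finally show ?thesis .
qed

lemma rect_int_split_angle:
  assumes [measurable]: "F \<in> borel_measurable borel"
  shows "rect_int a b c d F \<le> rect_int a b c m F + rect_int a b m d F"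
  unfolding rect_int_def
  by (subst nn_integral_add[symmetric], measurable, intro nn_integral_mono) (auto simp: indicator_def)

lemma rect_int_mono:
  assumes "a' \<le> a" "b \<le> b'" "c' \<le> c" "d \<le> d'"
  shows "rect_int a b c d F \<le> rect_int a' b' c' d' F"
  unfolding rect_int_def
  by (rule nn_integral_mono, rule mult_mono, rule nn_integral_mono) (use assms in \<open>auto simp: indicator_def\<close>)

lemma rect_int_zero:
  assumes "\<And>\<rho> \<theta>. \<rho> \<in> {a..b} \<Longrightarrow> \<theta> \<in> {c..d} \<Longrightarrow> F (polar \<rho> \<theta>) = 0"
  shows "rect_int a b c d F = 0"
proof -
  have z: "(\<integral>\<^sup>+\<rho>\<in>{a..b}. ennreal \<rho> * F (polar \<rho> \<theta>) \<partial>lborel) * indicator {c..d} \<theta> = 0" for \<theta>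
  proof (cases "\<theta> \<in> {c..d}")
    case True
    then have e: "ennreal \<rho> * F (polar \<rho> \<theta>) * indicator {a..b} \<rho> = 0" for \<rho> using assms by (auto simp: indicator_def)
    show ?thesis unfolding e by simp
  qed simp
  show ?thesis unfolding rect_int_def z by simp
qed

text \<open>For \<kappa> > 0 this says that the first Dirichlet eigenvalue of D is at least 1 /
  \<kappa>. Stated with test functions, it passes to subsets without further work.\<close>

definition poincare_on :: "real \<Rightarrow> R2 set \<Rightarrow> real \<Rightarrow> bool" where
  "poincare_on p D \<kappa> \<longleftrightarrow> (\<forall>\<phi> G. test_fun D \<phi> G \<longrightarrow>
     (\<integral>\<^sup>+x. ennreal (\<bar>\<phi> x\<bar> powr p) \<partial>lborel) \<le> ennreal \<kappa> * (\<integral>\<^sup>+x. ennreal (norm (G x) powr p) \<partial>lborel))"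

lemma test_fun_mono: "test_fun D \<phi> G \<Longrightarrow> D \<subseteq> E \<Longrightarrow> test_fun E \<phi> G"
  by (auto simp: test_fun_def)

context
  fixes \<phi> :: "R2 \<Rightarrow> real" and G :: "R2 \<Rightarrow> R2" and p :: real
  assumes t: "test_fun sector \<phi> G" and p: "p \<ge> 1"
begin

lemma test_fun_polar_zero:
  "\<phi> (polar \<rho> 0) = 0" "\<phi> (polar \<rho> (pi/4)) = 0" "\<phi> (polar 1 \<theta>) = 0"
  by (intro test_fun_outside(1)[OF t]; simp add: mem_sector; simp add: polar_def sin_45 cos_45)+

lemma total_energy_rect:
  "(\<integral>\<^sup>+x. ennreal (norm (G x) powr p) \<partial>lborel) = rect_int 0 1 0 (pi/4) (\<lambda>x. ennreal (norm (G x) powr p))"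
  "(\<integral>\<^sup>+x. ennreal (\<bar>\<phi> x\<bar> powr p) \<partial>lborel) = rect_int 0 1 0 (pi/4) (\<lambda>x. ennreal (\<bar>\<phi> x\<bar> powr p))"
  using test_funD(3,4)[OF t] test_fun_outside[OF t] p by (auto intro!: rect_int_sector)

lemma rect_angular_le:
  assumes "0 \<le> a" "a \<le> b" "b \<le> 1" "0 \<le> c" "c \<le> d" "d \<le> pi/4"
    and e: "e \<in> {c..d}" "\<And>\<rho>. \<rho> \<in> {a..b} \<Longrightarrow> \<phi> (polar \<rho> e) = 0" and h: "b * (d - c) \<le> h"
  shows "rect_int a b c d (\<lambda>x. ennreal (\<bar>\<phi> x\<bar> powr p)) \<le> ennreal (h powr p) * (\<integral>\<^sup>+x. ennreal (norm (G x) powr p) \<partial>lborel)"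
proof -
  have "rect_int a b c d (\<lambda>x. ennreal (\<bar>\<phi> x\<bar> powr p)) \<le> ennreal ((b * (d - c)) powr p) * rect_int a b c d (\<lambda>x. ennreal (norm (G x) powr p))"
    by (rule poincare_angular[OF test_funD(1,2)[OF t] assms(2) assms(5) assms(1) p e])
  also have "\<dots> \<le> ennreal (h powr p) * (\<integral>\<^sup>+x. ennreal (norm (G x) powr p) \<partial>lborel)"
    unfolding total_energy_rect(1) using assms p
    by (intro mult_mono ennreal_leI powr_mono2 rect_int_mono) auto
  finally show ?thesis .
qed

text \<open>The hypothesis b <= 2 * a caps the Jacobian factor b / a of
  \<open>poincare_radial\<close> at 2.\<close>

lemma rect_radial_le:
  assumes "0 < a" "a \<le> b" "b \<le> 1" "0 \<le> c" "c \<le> d" "d \<le> pi/4"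
    and e: "e \<in> {a..b}" "\<And>\<theta>. \<theta> \<in> {c..d} \<Longrightarrow> \<phi> (polar e \<theta>) = 0" and h: "b - a \<le> h" and r: "b \<le> 2 * a"
  shows "rect_int a b c d (\<lambda>x. ennreal (\<bar>\<phi> x\<bar> powr p)) \<le> ennreal (2 * h powr p) * (\<integral>\<^sup>+x. ennreal (norm (G x) powr p) \<partial>lborel)"
proof -
  have "rect_int a b c d (\<lambda>x. ennreal (\<bar>\<phi> x\<bar> powr p)) \<le> ennreal (b / a * (b - a) powr p) * rect_int a b c d (\<lambda>x. ennreal (norm (G x) powr p))"
    by (rule poincare_radial[OF test_funD(1,2)[OF t] assms(2) assms(5) less_imp_le[OF assms(1)] p assms(1) e])
  also have "\<dots> \<le> ennreal (2 * h powr p) * (\<integral>\<^sup>+x. ennreal (norm (G x) powr p) \<partial>lborel)"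
    unfolding total_energy_rect(1) using assms p
    by (intro mult_mono ennreal_leI powr_mono2 rect_int_mono) (auto simp: field_simps)
  finally show ?thesis .
qed

end

lemma combine_le:
  fixes A B C :: ennreal
  assumes "X \<le> A + B" "A \<le> ennreal a * E" "B \<le> ennreal b * E" "a \<ge> 0" "b \<ge> 0" "a + b = c"
  shows "X \<le> ennreal c * E"
proof -
  have "X \<le> ennreal a * E + ennreal b * E" using assms(1-3) by (meson add_mono order_trans)
  also have "\<dots> = ennreal c * E" using assms by (simp add: distrib_right ennreal_plus flip: assms(6))
  finally show ?thesis .
qed

text \<open>Below radius 0.4592 the arcs from the two sides to the bisector have length at most
  0.4592 * pi/8; above it the radii down from the zero arc at 0.6395 have length 0.1803. Both
  numbers are rounded solutions of x * pi/8 = r - x = (1 - r)/2.\<close>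

lemma poincare_inner:
  assumes p: "p \<ge> 1"
  shows "poincare_on p {x \<in> sector. norm x < 0.6395} (4 * 0.1804 powr p)"
  unfolding poincare_on_def
proof (intro allI impI)
  fix \<phi> G assume t': "test_fun {x \<in> sector. norm x < 0.6395} \<phi> G"
  then have t: "test_fun sector \<phi> G" by (rule test_fun_mono) auto
  have z: "\<phi> (polar \<rho> \<theta>) = 0" if "\<rho> \<ge> 0.6395" for \<rho> \<theta> using that by (intro test_fun_outside(1)[OF t']) auto
  let ?F = "\<lambda>x. ennreal (\<bar>\<phi> x\<bar> powr p)" and ?E = "\<integral>\<^sup>+x. ennreal (norm (G x) powr p) \<partial>lborel"
  have F[measurable]: "?F \<in> borel_measurable borel" using test_funD(3)[OF t] by measurable
  note pis = pi_less_31416 pi_ge_3 and z0 = test_fun_polar_zero[OF t p]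
  have 1: "rect_int 0 0.4592 0 (pi/4) ?F \<le> ennreal (2 * 0.1804 powr p) * ?E"
  proof (rule combine_le[OF rect_int_split_angle[OF F, of _ _ _ _ "pi/8"]])
    show "rect_int 0 0.4592 0 (pi/8) ?F \<le> ennreal (0.1804 powr p) * ?E"
      by (rule rect_angular_le[OF t p, where e=0]) (use pis z0 in auto)
    show "rect_int 0 0.4592 (pi/8) (pi/4) ?F \<le> ennreal (0.1804 powr p) * ?E"
      by (rule rect_angular_le[OF t p, where e="pi/4"]) (use pis z0 in auto)
  qed auto
  have 2: "rect_int 0.4592 1 0 (pi/4) ?F \<le> ennreal (2 * 0.1804 powr p) * ?E"
  proof (rule combine_le[OF rect_int_split_radius[OF F, of _ _ _ _ "0.6395"]])
    show "rect_int 0.4592 0.6395 0 (pi/4) ?F \<le> ennreal (2 * 0.1804 powr p) * ?E"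
      by (rule rect_radial_le[OF t p, where e="0.6395"]) (use pis z in auto)
    show "rect_int 0.6395 1 0 (pi/4) ?F \<le> ennreal 0 * ?E"
      using z p by (subst rect_int_zero) auto
  qed auto
  show "(\<integral>\<^sup>+x. ?F x \<partial>lborel) \<le> ennreal (4 * 0.1804 powr p) * ?E"
    unfolding total_energy_rect(2)[OF t p]
    by (rule combine_le[OF rect_int_split_radius[OF F] 1 2]) auto
qed

text \<open>The layer between the zero arc at 0.6395 and the boundary arc is halved at 0.81975, and
  each half is reached from its own arc along radii of length 0.18025.\<close>

lemma poincare_outer:
  assumes p: "p \<ge> 1"
  shows "poincare_on p {x \<in> sector. norm x > 0.6395} (4 * 0.1804 powr p)"
  unfolding poincare_on_def
proof (intro allI impI)
  fix \<phi> G assume t': "test_fun {x \<in> sector. norm x > 0.6395} \<phi> G"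
  then have t: "test_fun sector \<phi> G" by (rule test_fun_mono) auto
  have z: "\<phi> (polar \<rho> \<theta>) = 0" if "0 \<le> \<rho>" "\<rho> \<le> 0.6395" for \<rho> \<theta> using that by (intro test_fun_outside(1)[OF t']) auto
  let ?F = "\<lambda>x. ennreal (\<bar>\<phi> x\<bar> powr p)" and ?E = "\<integral>\<^sup>+x. ennreal (norm (G x) powr p) \<partial>lborel"
  have F[measurable]: "?F \<in> borel_measurable borel" using test_funD(3)[OF t] by measurable
  note pis = pi_less_31416 pi_ge_3 and z0 = test_fun_polar_zero[OF t p]
  have 1: "rect_int 0 0.6395 0 (pi/4) ?F \<le> ennreal 0 * ?E"
    using z p by (subst rect_int_zero) auto
  have 2: "rect_int 0.6395 1 0 (pi/4) ?F \<le> ennreal (4 * 0.1804 powr p) * ?E"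
  proof (rule combine_le[OF rect_int_split_radius[OF F, of _ _ _ _ "0.81975"]])
    show "rect_int 0.6395 0.81975 0 (pi/4) ?F \<le> ennreal (2 * 0.1804 powr p) * ?E"
      by (rule rect_radial_le[OF t p, where e="0.6395"]) (use pis z in auto)
    show "rect_int 0.81975 1 0 (pi/4) ?F \<le> ennreal (2 * 0.1804 powr p) * ?E"
      by (rule rect_radial_le[OF t p, where e=1]) (use pis z0 in auto)
  qed auto
  show "(\<integral>\<^sup>+x. ?F x \<partial>lborel) \<le> ennreal (4 * 0.1804 powr p) * ?E"
    unfolding total_energy_rect(2)[OF t p]
    by (rule combine_le[OF rect_int_split_radius[OF F] 1 2]) auto
qed

definition sub_sector :: "real set \<Rightarrow> R2 set" where
  "sub_sector T = {polar \<rho> \<theta> |\<rho> \<theta>. 0 < \<rho> \<and> \<rho> < 1 \<and> \<theta> \<in> T \<inter> {0<..<pi/4}}"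

lemma sub_sector_subset: "sub_sector T \<subseteq> sector"
  by (auto simp: sub_sector_def sector_def)

lemma polar_sub_sector:
  assumes "\<theta> \<in> {0..pi/4}" "\<theta> \<notin> T" and that: "\<rho> \<ge> 0"
  shows "polar \<rho> \<theta> \<notin> sub_sector T"
proof
  assume "polar \<rho> \<theta> \<in> sub_sector T"
  then obtain r s where rs: "polar \<rho> \<theta> = polar r s" "0 < r" "s \<in> T" "0 < s" "s < pi/4" by (auto simp: sub_sector_def)
  then have "\<bar>\<rho>\<bar> = \<bar>r\<bar>" by (metis norm_polar)
  then have "\<rho> > 0" using that rs by auto
  then have "\<theta> = s" using polar_inj[OF rs(1)] rs assms pi_ge_3 by auto
  then show False using rs assms by simp
qed

text \<open>Both sides of a half of opening pi/8 carry zeros, so up to radius 0.9 arcs of length at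
  most 0.9 * pi/16, about 0.177, suffice; the rest is a layer of width 0.1 below the boundary arc.
  Rays leave more room than arcs.\<close>

lemma poincare_half:
  assumes p: "p \<ge> 1" and T: "T = {..<pi/8} \<or> T = {pi/8<..}"
  shows "poincare_on p (sub_sector T) (4 * 0.1804 powr p)"
  unfolding poincare_on_def
proof (intro allI impI)
  fix \<phi> G assume t': "test_fun (sub_sector T) \<phi> G"
  then have t: "test_fun sector \<phi> G" using sub_sector_subset by (rule test_fun_mono)
  have z: "\<phi> (polar \<rho> \<theta>) = 0" if "\<rho> \<ge> 0" "\<theta> \<in> {0..pi/4}" "\<theta> \<notin> T" for \<rho> \<theta>
    using that polar_sub_sector by (intro test_fun_outside(1)[OF t']) auto
  let ?F = "\<lambda>x. ennreal (\<bar>\<phi> x\<bar> powr p)" and ?E = "\<integral>\<^sup>+x. ennreal (norm (G x) powr p) \<partial>lborel"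
  have F[measurable]: "?F \<in> borel_measurable borel" using test_funD(3)[OF t] by measurable
  note pis = pi_less_31416 pi_ge_3 and z0 = test_fun_polar_zero[OF t p]
  have half: "rect_int 0 1 c (c + pi/8) ?F \<le> ennreal (4 * 0.1804 powr p) * ?E"
    if c: "0 \<le> c" "c \<le> pi/8" and zz: "\<And>\<rho>. \<rho> \<ge> 0 \<Longrightarrow> \<phi> (polar \<rho> c) = 0" "\<And>\<rho>. \<rho> \<ge> 0 \<Longrightarrow> \<phi> (polar \<rho> (c + pi/8)) = 0" for c
  proof (rule combine_le[OF rect_int_split_radius[OF F, of _ _ _ _ "0.9"]])
    show "rect_int 0 0.9 c (c + pi/8) ?F \<le> ennreal (2 * 0.1804 powr p) * ?E"
    proof (rule combine_le[OF rect_int_split_angle[OF F, of _ _ _ _ "c + pi/16"]])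
      show "rect_int 0 0.9 c (c + pi/16) ?F \<le> ennreal (0.1804 powr p) * ?E"
        by (rule rect_angular_le[OF t p, where e=c]) (use pis zz c in auto)
      show "rect_int 0 0.9 (c + pi/16) (c + pi/8) ?F \<le> ennreal (0.1804 powr p) * ?E"
        by (rule rect_angular_le[OF t p, where e="c + pi/8"]) (use pis zz c in auto)
    qed auto
    show "rect_int 0.9 1 c (c + pi/8) ?F \<le> ennreal (2 * 0.1804 powr p) * ?E"
      by (rule rect_radial_le[OF t p, where e=1]) (use pis z0 c in auto)
  qed auto
  have e8: "pi / 8 + pi / 8 = pi / 4" "0 + pi/8 = pi/8" by auto
  show "(\<integral>\<^sup>+x. ?F x \<partial>lborel) \<le> ennreal (4 * 0.1804 powr p) * ?E"
    unfolding total_energy_rect(2)[OF t p]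
    using T
  proof
    assume T: "T = {..<pi/8}"
    show "rect_int 0 1 0 (pi/4) ?F \<le> ennreal (4 * 0.1804 powr p) * ?E"
    proof (rule combine_le[OF rect_int_split_angle[OF F, of _ _ _ _ "pi/8"]])
      show "rect_int 0 1 0 (pi/8) ?F \<le> ennreal (4 * 0.1804 powr p) * ?E"
        using half[of 0] z z0 T pis by (simp add: e8)
      show "rect_int 0 1 (pi/8) (pi/4) ?F \<le> ennreal 0 * ?E"
        using z p T pis by (subst rect_int_zero) auto
    qed auto
  next
    assume T: "T = {pi/8<..}"
    show "rect_int 0 1 0 (pi/4) ?F \<le> ennreal (4 * 0.1804 powr p) * ?E"
    proof (rule combine_le[OF rect_int_split_angle[OF F, of _ _ _ _ "pi/8"]])
      show "rect_int 0 1 (pi/8) (pi/4) ?F \<le> ennreal (4 * 0.1804 powr p) * ?E"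
        using half[of "pi/8"] z z0 T pis by (simp add: e8)
      show "rect_int 0 1 0 (pi/8) ?F \<le> ennreal 0 * ?E"
        using z p T pis by (subst rect_int_zero) auto
    qed auto
  qed
qed

section \<open>Truncations and bumps\<close>

text \<open>Away from 0 the function is locally a power or 0; at 0 the difference quotient is at
  most |h|^(q-1), which tends to 0.\<close>

lemma DERIV_pos_powr:
  assumes q: "q > (1::real)"
  shows "((\<lambda>s. max 0 s powr q) has_real_derivative q * max 0 s powr (q - 1)) (at s)"
proof (cases s "0::real" rule: linorder_cases)
  case greater
  have "((\<lambda>s. s powr q) has_real_derivative q * s powr (q - 1)) (at s)"
    using greater by (auto intro!: derivative_eq_intros simp: powr_diff)
  moreover have ev: "\<forall>\<^sub>F x in nhds s. x powr q = max 0 x powr q"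
    using eventually_nhds_in_open[of "{0<..}" s] greater by (auto elim!: eventually_mono simp: max_def)
  ultimately have "((\<lambda>s. max 0 s powr q) has_real_derivative q * s powr (q - 1)) (at s)"
    using DERIV_cong_ev[OF refl ev refl] by blast
  then show ?thesis using greater by (simp add: max_def)
next
  case less
  have "((\<lambda>s. 0) has_real_derivative 0) (at s)" by simp
  moreover have ev: "\<forall>\<^sub>F x in nhds s. 0 = max 0 x powr q"
    using eventually_nhds_in_open[of "{..<0}" s] less by (auto elim!: eventually_mono simp: max_def)
  ultimately have "((\<lambda>s. max 0 s powr q) has_real_derivative 0) (at s)"
    using DERIV_cong_ev[OF refl ev refl] by blast
  then show ?thesis using less by (simp add: max_def)
next
  case equal
  have "(\<lambda>h. max 0 h powr q / h) \<midarrow>0\<rightarrow> 0"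
  proof (rule Lim_null_comparison)
    show "\<forall>\<^sub>F h in at 0. norm (max 0 h powr q / h) \<le> \<bar>h\<bar> powr (q - 1)"
      by (rule always_eventually) (auto simp: max_def powr_diff field_simps)
    show "(\<lambda>h::real. \<bar>h\<bar> powr (q - 1)) \<midarrow>0\<rightarrow> 0"
      using q by (intro tendsto_zero_powrI[where b="q - 1"] tendsto_rabs_zero tendsto_ident_at tendsto_const) auto
  qed
  then show ?thesis using equal q by (simp add: DERIV_def)
qed

text \<open>A C^1 substitute for the positive part, below it by at most \<epsilon> and with slope
  between 0 and 1. Test functions are C^1, so positive parts and distances have to be
  smoothed.\<close>

definition softpos :: "real \<Rightarrow> real \<Rightarrow> real" where
  "softpos \<epsilon> s = sqrt (max 0 s powr 2 + \<epsilon>\<^sup>2) - \<epsilon>"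

definition softpos' :: "real \<Rightarrow> real \<Rightarrow> real" where
  "softpos' \<epsilon> s = max 0 s / sqrt (max 0 s powr 2 + \<epsilon>\<^sup>2)"

lemma softpos:
  assumes e: "\<epsilon> > 0"
  shows "(softpos \<epsilon> has_real_derivative softpos' \<epsilon> s) (at s)" "continuous_on S (softpos' \<epsilon>)"
    "0 \<le> softpos \<epsilon> s" "softpos \<epsilon> s \<le> max 0 s" "s \<le> softpos \<epsilon> s + \<epsilon>" "s \<le> 0 \<Longrightarrow> softpos \<epsilon> s = 0"
    "0 \<le> softpos' \<epsilon> s" "softpos' \<epsilon> s \<le> 1" "s \<le> 0 \<Longrightarrow> softpos' \<epsilon> s = 0"
proof -
  have pos: "max 0 s powr 2 + \<epsilon>\<^sup>2 > 0" for s using e by (simp add: add_nonneg_pos)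
  have sq: "max 0 s powr 2 = (max 0 s)\<^sup>2" for s :: real by simp
  have d2: "((\<lambda>s. max 0 s powr 2) has_real_derivative 2 * max 0 s) (at s)"
    using DERIV_pos_powr[of 2 s] by (simp add: max_def)
  show "(softpos \<epsilon> has_real_derivative softpos' \<epsilon> s) (at s)"
    unfolding softpos_def[abs_def] softpos'_def
    using DERIV_diff[OF DERIV_chain2[OF DERIV_real_sqrt[OF pos] DERIV_add[OF d2 DERIV_const]] DERIV_const]
    by (rule DERIV_cong) (simp add: field_simps)
  have "softpos' \<epsilon> = (\<lambda>s. max 0 s / sqrt ((max 0 s)\<^sup>2 + \<epsilon>\<^sup>2))" by (simp add: fun_eq_iff softpos'_def)
  moreover have "sqrt ((max 0 s)\<^sup>2 + \<epsilon>\<^sup>2) \<noteq> 0" for s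
    using pos[of s] unfolding sq by (metis less_irrefl real_sqrt_eq_zero_cancel_iff)
  ultimately show "continuous_on S (softpos' \<epsilon>)" by (auto intro!: continuous_intros)
  have "sqrt (\<epsilon>\<^sup>2) \<le> sqrt (max 0 s powr 2 + \<epsilon>\<^sup>2)" by (intro real_sqrt_le_mono) simp
  then show "0 \<le> softpos \<epsilon> s" using e by (simp add: softpos_def)
  have "sqrt (max 0 s powr 2 + \<epsilon>\<^sup>2) \<le> sqrt ((max 0 s)\<^sup>2) + sqrt (\<epsilon>\<^sup>2)" unfolding sq by (rule sqrt_add_le_add_sqrt) auto
  then show "softpos \<epsilon> s \<le> max 0 s" using e by (simp add: softpos_def)
  have ge: "max 0 s \<le> sqrt (max 0 s powr 2 + \<epsilon>\<^sup>2)" unfolding sq by (rule real_le_rsqrt) simp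
  show "s \<le> softpos \<epsilon> s + \<epsilon>" unfolding softpos_def using ge max.cobounded2[of s 0] by linarith
  show "s \<le> 0 \<Longrightarrow> softpos \<epsilon> s = 0" using e by (simp add: softpos_def max_def)
  show "0 \<le> softpos' \<epsilon> s" by (simp add: softpos'_def)
  show "softpos' \<epsilon> s \<le> 1" using ge pos[of s] by (simp add: softpos'_def)
  show "s \<le> 0 \<Longrightarrow> softpos' \<epsilon> s = 0" by (simp add: softpos'_def max_def)
qed

text \<open>Odd, and zero for |s| <= \<epsilon>: composing a function with it confines the support
  to the set where the function is at least \<epsilon> in modulus, while values change by at most 2
  \<epsilon>.\<close>

definition trunc :: "real \<Rightarrow> real \<Rightarrow> real" where
  "trunc \<epsilon> s = softpos \<epsilon> (s - \<epsilon>) - softpos \<epsilon> (- s - \<epsilon>)"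

definition trunc' :: "real \<Rightarrow> real \<Rightarrow> real" where
  "trunc' \<epsilon> s = softpos' \<epsilon> (s - \<epsilon>) + softpos' \<epsilon> (- s - \<epsilon>)"

lemma trunc:
  assumes e: "\<epsilon> > 0"
  shows "(trunc \<epsilon> has_real_derivative trunc' \<epsilon> s) (at s)" "continuous_on S (trunc' \<epsilon>)"
    "\<bar>s\<bar> \<le> \<epsilon> \<Longrightarrow> trunc \<epsilon> s = 0" "\<bar>s\<bar> \<le> \<epsilon> \<Longrightarrow> trunc' \<epsilon> s = 0" "\<bar>trunc \<epsilon> s\<bar> \<le> \<bar>s\<bar>" "\<bar>trunc \<epsilon> s - s\<bar> \<le> 2 * \<epsilon>"
    "0 \<le> trunc' \<epsilon> s" "trunc' \<epsilon> s \<le> 1"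
proof -
  note sp = softpos[OF e]
  have c1: "((\<lambda>s. softpos \<epsilon> (s - \<epsilon>)) has_real_derivative softpos' \<epsilon> (s - \<epsilon>) * 1) (at s)"
    by (rule DERIV_chain2[OF sp(1)]) (auto intro!: derivative_eq_intros)
  have c2: "((\<lambda>s. softpos \<epsilon> (- s - \<epsilon>)) has_real_derivative softpos' \<epsilon> (- s - \<epsilon>) * (-1)) (at s)"
    by (rule DERIV_chain2[OF sp(1)]) (auto intro!: derivative_eq_intros)
  show "(trunc \<epsilon> has_real_derivative trunc' \<epsilon> s) (at s)"
    unfolding trunc_def[abs_def] trunc'_def using DERIV_diff[OF c1 c2] by simp
  show "continuous_on S (trunc' \<epsilon>)" unfolding trunc'_def[abs_def]
    by (intro continuous_intros continuous_on_compose2[OF sp(2)[of UNIV]]) auto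
  show "\<bar>s\<bar> \<le> \<epsilon> \<Longrightarrow> trunc \<epsilon> s = 0" using sp(6)[of "s - \<epsilon>"] sp(6)[of "- s - \<epsilon>"] by (simp add: trunc_def)
  show "\<bar>s\<bar> \<le> \<epsilon> \<Longrightarrow> trunc' \<epsilon> s = 0" using sp(9)[of "s - \<epsilon>"] sp(9)[of "- s - \<epsilon>"] by (simp add: trunc'_def)
  have A: "s - \<epsilon> \<le> 0 \<or> - s - \<epsilon> \<le> 0" using e by linarith
  show "\<bar>trunc \<epsilon> s\<bar> \<le> \<bar>s\<bar>"
    using A sp(6)[of "s - \<epsilon>"] sp(6)[of "- s - \<epsilon>"] sp(3,4)[of "s - \<epsilon>"] sp(3,4)[of "- s - \<epsilon>"] e
    unfolding trunc_def by (auto simp: max_def split: if_splits)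
  show "\<bar>trunc \<epsilon> s - s\<bar> \<le> 2 * \<epsilon>"
    using A sp(6)[of "s - \<epsilon>"] sp(6)[of "- s - \<epsilon>"] sp(3,4,5)[of "s - \<epsilon>"] sp(3,4,5)[of "- s - \<epsilon>"] e
    unfolding trunc_def by (auto simp: max_def split: if_splits)
  show "0 \<le> trunc' \<epsilon> s" using sp(7) by (simp add: trunc'_def)
  show "trunc' \<epsilon> s \<le> 1" using A sp(8,9)[of "s - \<epsilon>"] sp(8,9)[of "- s - \<epsilon>"] by (auto simp: trunc'_def)
qed

text \<open>A C^1 version of the cone r - dist c y, cut off at 0: the distance is smoothed at the
  centre and the positive part at the rim. The slope stays at most 1 and at most 2 \<epsilon> of the
  height is lost.\<close>

definition bump :: "real \<Rightarrow> R2 \<Rightarrow> real \<Rightarrow> R2 \<Rightarrow> real" where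
  "bump \<epsilon> c r y = softpos \<epsilon> (sqrt (\<epsilon>\<^sup>2 + r\<^sup>2) - sqrt (\<epsilon>\<^sup>2 + (y - c) \<bullet> (y - c)))"

definition bump' :: "real \<Rightarrow> R2 \<Rightarrow> real \<Rightarrow> R2 \<Rightarrow> R2" where
  "bump' \<epsilon> c r y = - (softpos' \<epsilon> (sqrt (\<epsilon>\<^sup>2 + r\<^sup>2) - sqrt (\<epsilon>\<^sup>2 + (y - c) \<bullet> (y - c))) / sqrt (\<epsilon>\<^sup>2 + (y - c) \<bullet> (y - c))) *\<^sub>R (y - c)"

lemma bump:
  assumes e: "\<epsilon> > 0" and r: "r > 0"
  shows "(bump \<epsilon> c r has_derivative (\<lambda>h. bump' \<epsilon> c r y \<bullet> h)) (at y)" "continuous_on UNIV (bump' \<epsilon> c r)"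
    "norm (bump' \<epsilon> c r y) \<le> 1" "dist c y \<ge> r \<Longrightarrow> bump \<epsilon> c r y = 0" "bump \<epsilon> c r y \<ge> r - 2 * \<epsilon> - dist c y" "bump \<epsilon> c r y \<ge> 0"
    "dist c y \<ge> r \<Longrightarrow> bump' \<epsilon> c r y = 0"
proof -
  note sp = softpos[OF e]
  have pos: "\<epsilon>\<^sup>2 + (y - c) \<bullet> (y - c) > 0" for y using e by (simp add: add_pos_nonneg)
  let ?q = "\<lambda>y. sqrt (\<epsilon>\<^sup>2 + (y - c) \<bullet> (y - c))"
  have qpos: "?q y > 0" for y using pos by simp
  have d: "((\<lambda>y. sqrt (\<epsilon>\<^sup>2 + r\<^sup>2) - ?q y) has_derivative (\<lambda>h. - (((y - c) \<bullet> h) / ?q y))) (at y)"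
    using pos[of y] qpos[of y]
    by (auto intro!: derivative_eq_intros simp: inner_commute field_simps)
  show "(bump \<epsilon> c r has_derivative (\<lambda>h. bump' \<epsilon> c r y \<bullet> h)) (at y)"
    unfolding bump_def[abs_def]
    using has_derivative_compose[OF d sp(1)[unfolded has_field_derivative_def]]
    by (rule has_derivative_eq_rhs) (auto simp: bump'_def)
  show "continuous_on UNIV (bump' \<epsilon> c r)" unfolding bump'_def[abs_def]
  proof (intro continuous_intros continuous_on_compose2[OF sp(2)[of UNIV]] ballI)
    show "?q y \<noteq> 0" for y using qpos[of y] by (metis less_irrefl)
  qed auto
  have nq: "norm (y - c) \<le> ?q y" by (simp add: norm_eq_sqrt_inner)
  have "norm (bump' \<epsilon> c r y) = softpos' \<epsilon> (sqrt (\<epsilon>\<^sup>2 + r\<^sup>2) - ?q y) * (norm (y - c) / ?q y)"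
    using sp(7) qpos[of y] by (simp add: bump'_def)
  also have "\<dots> \<le> 1 * 1" using sp(7,8) nq qpos[of y] by (intro mult_mono) auto
  finally show "norm (bump' \<epsilon> c r y) \<le> 1" by simp
  have far: "sqrt (\<epsilon>\<^sup>2 + r\<^sup>2) - ?q y \<le> 0" if "dist c y \<ge> r"
  proof -
    have "r\<^sup>2 \<le> (norm (y - c))\<^sup>2" using that r by (intro power_mono) (auto simp: dist_norm norm_minus_commute)
    then show ?thesis by (simp add: power2_norm_eq_inner)
  qed
  show "dist c y \<ge> r \<Longrightarrow> bump \<epsilon> c r y = 0" using far sp(6) by (simp add: bump_def)
  show "dist c y \<ge> r \<Longrightarrow> bump' \<epsilon> c r y = 0" using far sp(9) by (simp add: bump'_def)
  have "?q y \<le> \<epsilon> + dist c y"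
    using sqrt_add_le_add_sqrt[of "\<epsilon>\<^sup>2" "(y - c) \<bullet> (y - c)"] e by (simp add: dist_norm norm_minus_commute norm_eq_sqrt_inner[symmetric])
  moreover have "r \<le> sqrt (\<epsilon>\<^sup>2 + r\<^sup>2)" using r by (intro real_le_rsqrt) simp
  ultimately show "bump \<epsilon> c r y \<ge> r - 2 * \<epsilon> - dist c y"
    using sp(5)[of "sqrt (\<epsilon>\<^sup>2 + r\<^sup>2) - ?q y"] unfolding bump_def by linarith
  show "bump \<epsilon> c r y \<ge> 0" using sp(3) by (simp add: bump_def)
qed

lemma test_fun_bump:
  assumes e: "\<epsilon> > 0" and r: "r > 0" and sub: "cball c r \<subseteq> \<Omega>"
  shows "test_fun \<Omega> (bump \<epsilon> c r) (bump' \<epsilon> c r)"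
proof -
  have "{y. bump \<epsilon> c r y \<noteq> 0} \<subseteq> cball c r" using bump(4)[OF e r] by (force simp: not_le)
  then have cl: "closure {y. bump \<epsilon> c r y \<noteq> 0} \<subseteq> cball c r" by (rule closure_minimal) simp
  then have "compact (closure {y. bump \<epsilon> c r y \<noteq> 0})"
    using compact_Int_closed[OF compact_cball closed_closure] by (metis Int_absorb1)
  then show ?thesis unfolding test_fun_def using bump(1,2)[OF e r] cl sub by auto
qed

text \<open>The bump has slope at most 1 and height at least r - 3 \<epsilon> on the disc of radius
  \<epsilon>, so its Rayleigh quotient is at most a ratio of areas times (r - 3 \<epsilon>)^-p. This
  is how radii of discs become bounds for eigenvalues.\<close>

lemma bump_integrals:
  assumes e: "\<epsilon> > 0" and r: "r > 3 * \<epsilon>" and p: "p \<ge> 1"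
  shows "(\<integral>\<^sup>+y. ennreal (norm (bump' \<epsilon> c r y) powr p) \<partial>lborel) \<le> emeasure lborel (cball c r)"
    "ennreal ((r - 3 * \<epsilon>) powr p) * emeasure lborel (ball c \<epsilon>) \<le> (\<integral>\<^sup>+y. ennreal (\<bar>bump \<epsilon> c r y\<bar> powr p) * indicator (ball c \<epsilon>) y \<partial>lborel)"
proof -
  have r0: "r > 0" using e r by linarith
  note b = bump[OF e r0]
  have "(\<integral>\<^sup>+y. ennreal (norm (bump' \<epsilon> c r y) powr p) \<partial>lborel) \<le> (\<integral>\<^sup>+y. indicator (cball c r) y \<partial>lborel)"
  proof (rule nn_integral_mono)
    fix y
    have "norm (bump' \<epsilon> c r y) powr p \<le> 1 powr p" using b(3) p by (intro powr_mono2) auto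
    then show "ennreal (norm (bump' \<epsilon> c r y) powr p) \<le> indicator (cball c r) y"
      using b(7)[of c y] p by (cases "y \<in> cball c r") (auto simp: ennreal_le_1)
  qed
  then show "(\<integral>\<^sup>+y. ennreal (norm (bump' \<epsilon> c r y) powr p) \<partial>lborel) \<le> emeasure lborel (cball c r)" by simp
  have "ennreal ((r - 3 * \<epsilon>) powr p) * emeasure lborel (ball c \<epsilon>) = (\<integral>\<^sup>+y. ennreal ((r - 3 * \<epsilon>) powr p) * indicator (ball c \<epsilon>) y \<partial>lborel)"
    by (rule nn_integral_cmult_indicator[symmetric]) simp
  also have "\<dots> \<le> (\<integral>\<^sup>+y. ennreal (\<bar>bump \<epsilon> c r y\<bar> powr p) * indicator (ball c \<epsilon>) y \<partial>lborel)"
  proof (rule nn_integral_mono)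
    fix y
    show "ennreal ((r - 3 * \<epsilon>) powr p) * indicator (ball c \<epsilon>) y \<le> ennreal (\<bar>bump \<epsilon> c r y\<bar> powr p) * indicator (ball c \<epsilon>) y"
      using b(5)[of c y] r p by (auto simp: indicator_def intro!: ennreal_leI powr_mono2)
  qed
  finally show "ennreal ((r - 3 * \<epsilon>) powr p) * emeasure lborel (ball c \<epsilon>) \<le> (\<integral>\<^sup>+y. ennreal (\<bar>bump \<epsilon> c r y\<bar> powr p) * indicator (ball c \<epsilon>) y \<partial>lborel)" .
qed

text \<open>The third premise says that the distance |c$1 - c$2| / sqrt 2 of the centre from the
  diagonal exceeds r, squared to stay within rational arithmetic.\<close>

lemma cball_sector:
  assumes "r > 0" "c$2 > r" "(c$1 - c$2)\<^sup>2 > 2 * r\<^sup>2" "c$1 > c$2" "norm c < 1 - r"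
  shows "cball c r \<subseteq> sector"
proof
  fix x assume "x \<in> cball c r"
  then have n: "norm (x - c) \<le> r" by (simp add: dist_norm norm_minus_commute)
  have 2: "\<bar>x$2 - c$2\<bar> \<le> r" using component_le_norm_cart[of "x - c" 2] n by simp
  have nx: "norm x < 1" using norm_triangle_ineq[of "x - c" c] n assms by simp
  have sq: "(x$1 - c$1)\<^sup>2 + (x$2 - c$2)\<^sup>2 \<le> r\<^sup>2"
  proof -
    have "(norm (x - c))\<^sup>2 \<le> r\<^sup>2" using n by (intro power_mono) auto
    then show ?thesis by (simp add: norm_R2)
  qed
  have "x$1 > x$2"
  proof (rule ccontr)
    assume "\<not> x$1 > x$2"
    then have "c$1 - c$2 \<le> (c$1 - x$1) + (x$2 - c$2)" by simp
    then have "(c$1 - c$2)\<^sup>2 \<le> ((c$1 - x$1) + (x$2 - c$2))\<^sup>2" using assms by (intro power_mono) auto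
    also have "\<dots> \<le> 2 * ((x$1 - c$1)\<^sup>2 + (x$2 - c$2)\<^sup>2)"
      using sum_squares_bound[of "c$1 - x$1" "x$2 - c$2"] by (simp add: power2_eq_square algebra_simps)
    also have "\<dots> \<le> 2 * r\<^sup>2" using sq by (rule mult_left_mono) simp
    finally show False using assms(3) by simp
  qed
  then show "x \<in> sector" using 2 nx assms by (auto simp: mem_sector)
qed

section \<open>Bounds for the second eigenvalue\<close>

text \<open>\<open>Sup\<close> of a set of reals is meaningful only if the set is bounded. Unbounded
  energies would occur along a convergent sequence of the compact sphere, against the continuity of
  h in the Sobolev norm.\<close>

lemma admissible_bdd_above:
  assumes h: "admissible T p sector (h :: 'a::euclidean_space \<Rightarrow> R2 \<Rightarrow> real)" and p: "p \<ge> 1"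
  shows "bdd_above ((\<lambda>x. energy p sector (h x)) ` sphere 0 1)"
proof (rule ccontr)
  assume "\<not> bdd_above ((\<lambda>x. energy p sector (h x)) ` sphere 0 1)"
  then have "\<forall>M. \<exists>x\<in>sphere 0 1. M < energy p sector (h x)"
    unfolding bdd_above_def by (simp add: not_le)
  then have "\<forall>n::nat. \<exists>x. x \<in> sphere 0 1 \<and> energy p sector (h x) > real n" by blast
  from choice[OF this] obtain f where f: "\<And>n. f n \<in> sphere 0 1" "\<And>n. energy p sector (h (f n)) > real n" by blast
  have "compact (sphere (0::'a) 1)" by simp
  then obtain l r where l: "l \<in> sphere 0 1" and r: "strict_mono r" and lim: "(f \<circ> r) \<longlonglongrightarrow> l"
    using f(1) unfolding compact_def by blast
  have "\<forall>e>0. \<exists>d>0. \<forall>y\<in>sphere 0 1. dist y l < d \<longrightarrow> W_norm p sector (\<lambda>z. h y z - h l z) < e"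
    using h l unfolding admissible_def by blast
  then obtain d where d: "d > 0" "\<And>y. y \<in> sphere 0 1 \<Longrightarrow> dist y l < d \<Longrightarrow> W_norm p sector (\<lambda>z. h y z - h l z) < 1"
    using zero_less_one by blast
  have s: "\<exists>g. sobolev0 p sector (h x) g" if "x \<in> sphere 0 1" for x
    using h that by (auto simp: admissible_def Ssph_def in_W0_def)
  obtain g where g: "sobolev0 p sector (h l) g" using s[OF l] ..
  have bound: "energy p sector (h y) \<le> 2 powr p * (energy p sector (h l) + 1)" if y: "y \<in> sphere 0 1" "dist y l < d" for y
  proof -
    obtain gy where gy: "sobolev0 p sector (h y) gy" using s[OF y(1)] ..
    have "(Lp_pow p sector (\<lambda>z. h y z - h l z) + energy p sector (\<lambda>z. h y z - h l z)) powr (1 / p) < 1"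
      using d(2)[OF y] by (simp add: W_norm_def)
    then have "energy p sector (\<lambda>z. h y z - h l z) \<le> 1"
    proof (rule contrapos_pp)
      assume "\<not> energy p sector (\<lambda>z. h y z - h l z) \<le> 1"
      then have "1 \<le> Lp_pow p sector (\<lambda>z. h y z - h l z) + energy p sector (\<lambda>z. h y z - h l z)" by (simp add: Lp_pow_def add_increasing)
      then have "1 \<le> (Lp_pow p sector (\<lambda>z. h y z - h l z) + energy p sector (\<lambda>z. h y z - h l z)) powr (1 / p)"
        using p by (intro ge_one_powr_ge_zero) auto
      then show "\<not> (Lp_pow p sector (\<lambda>z. h y z - h l z) + energy p sector (\<lambda>z. h y z - h l z)) powr (1 / p) < 1" by simp
    qed
    then show ?thesis
      using energy_triangle[OF gy g p bounded_sector sector_borel] by (smt (verit) mult_left_mono powr_ge_zero)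
  qed
  obtain N where N: "\<And>n. n \<ge> N \<Longrightarrow> dist (f (r n)) l < d"
    using lim d(1) unfolding lim_sequentially by (auto simp: o_def)
  obtain M :: nat where M: "2 powr p * (energy p sector (h l) + 1) \<le> real M" using real_arch_simple by blast
  have "real (r (max N M)) < real M" using f(2)[of "r (max N M)"] bound[OF f(1) N, of "max N M"] M by linarith
  moreover have "max N M \<le> r (max N M)" using r by (rule seq_suble)
  ultimately show False by linarith
qed

lemma var_eig_le:
  assumes h: "admissible TYPE('a::euclidean_space) p sector h" and p: "p \<ge> 1"
    and le: "\<And>x. x \<in> sphere (0::'a) 1 \<Longrightarrow> energy p sector (h x) \<le> B"
  shows "var_eig TYPE('a) p sector \<le> B"
proof -
  have ne: "sphere (0::'a) 1 \<noteq> {}" by simp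
  have "var_eig TYPE('a) p sector \<le> Sup ((\<lambda>x. energy p sector (h x)) ` sphere (0::'a) 1)"
    unfolding var_eig_def
  proof (rule cInf_lower)
    show "Sup ((\<lambda>x. energy p sector (h x)) ` sphere (0::'a) 1) \<in> {Sup ((\<lambda>x. energy p sector (h x)) ` sphere (0::'a) 1) |h. admissible TYPE('a) p sector h}"
      using h by blast
    show "bdd_below {Sup ((\<lambda>x. energy p sector (h x)) ` sphere (0::'a) 1) |h. admissible TYPE('a) p sector h}"
    proof (rule bdd_belowI)
      fix y assume "y \<in> {Sup ((\<lambda>x. energy p sector (h x)) ` sphere (0::'a) 1) |h. admissible TYPE('a) p sector h}"
      then obtain k where y: "y = Sup ((\<lambda>x. energy p sector (k x)) ` sphere (0::'a) 1)" and k: "admissible TYPE('a) p sector k" by blast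
      obtain x :: 'a where x: "x \<in> sphere 0 1" using ne by blast
      have "energy p sector (k x) \<le> y" unfolding y
        by (rule cSUP_upper[OF x admissible_bdd_above[OF k p]])
      then show "0 \<le> y" using energy_nonneg[of p sector "k x"] by linarith
    qed
  qed
  also have "\<dots> \<le> B" using ne le by (intro cSUP_least) auto
  finally show ?thesis .
qed

text \<open>The existence of an admissible map is a premise because \<open>Inf\<close> of the empty
  set is an arbitrary number.\<close>

lemma var_eig_ge:
  assumes ne: "\<exists>h. admissible TYPE('a::euclidean_space) p sector h" and p: "p \<ge> 1"
    and ge: "\<And>h. admissible TYPE('a) p sector h \<Longrightarrow> \<exists>x\<in>sphere (0::'a) 1. B \<le> energy p sector (h x)"
  shows "B \<le> var_eig TYPE('a) p sector"
  unfolding var_eig_def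
proof (rule cInf_greatest)
  show "{Sup ((\<lambda>x. energy p sector (h x)) ` sphere (0::'a) 1) |h. admissible TYPE('a) p sector h} \<noteq> {}" using ne by blast
  fix y assume "y \<in> {Sup ((\<lambda>x. energy p sector (h x)) ` sphere (0::'a) 1) |h. admissible TYPE('a) p sector h}"
  then obtain k where y: "y = Sup ((\<lambda>x. energy p sector (k x)) ` sphere (0::'a) 1)" and k: "admissible TYPE('a) p sector k" by blast
  obtain x where x: "x \<in> sphere 0 1" "B \<le> energy p sector (k x)" using ge[OF k] by blast
  have "energy p sector (k x) \<le> y" unfolding y
    by (rule cSUP_upper[OF x(1) admissible_bdd_above[OF k p]])
  then show "B \<le> y" using x(2) by linarith
qed

section \<open>The upper bound: a loop through two bumps with disjoint supports\<close>

definition mass :: "real \<Rightarrow> (R2 \<Rightarrow> 'b::real_normed_vector) \<Rightarrow> real" where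
  "mass p f = enn2real (\<integral>\<^sup>+x. ennreal (norm (f x) powr p) \<partial>lborel)"

lemma mass_eq:
  assumes t: "test_fun sector \<phi> G" and p: "p \<ge> 1"
  shows "ennreal (mass p \<phi>) = (\<integral>\<^sup>+x. ennreal (\<bar>\<phi> x\<bar> powr p) \<partial>lborel)" "ennreal (mass p G) = (\<integral>\<^sup>+x. ennreal (norm (G x) powr p) \<partial>lborel)"
    "Lp_pow p sector \<phi> = mass p \<phi>" "energy p sector \<phi> = mass p G"
proof -
  have p0: "p > 0" using p by simp
  note fin = integrable_test_fun[OF t p0 bounded_sector, unfolded nn_integral_completion]
  show "ennreal (mass p \<phi>) = (\<integral>\<^sup>+x. ennreal (\<bar>\<phi> x\<bar> powr p) \<partial>lborel)" "ennreal (mass p G) = (\<integral>\<^sup>+x. ennreal (norm (G x) powr p) \<partial>lborel)"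
    using fin by (simp_all add: mass_def ennreal_enn2real)
  note s = sobolev0_test[OF t p0 bounded_sector sector_borel]
  have z: "zext sector \<phi> = \<phi>" "zext sector G = G" using test_fun_outside[OF t] by (auto simp: fun_eq_iff zext_def indicator_def)
  show "Lp_pow p sector \<phi> = mass p \<phi>"
    unfolding Lp_pow_def set_nn_integral_zext(1)[OF p0] z mass_def nn_integral_completion by simp
  show "energy p sector \<phi> = mass p G"
    unfolding energy_eq(2)[OF s p bounded_sector] z mass_def nn_integral_completion ..
qed

lemma mass_nonneg: "mass p f \<ge> 0" by (simp add: mass_def)

lemma test_fun_combine:
  assumes t: "test_fun \<Omega> \<phi> G" and t': "test_fun \<Omega> \<phi>' G'"
  shows "test_fun \<Omega> (\<lambda>x. a * \<phi> x + b * \<phi>' x) (\<lambda>x. a *\<^sub>R G x + b *\<^sub>R G' x)"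
proof -
  have "{x. a * \<phi> x + b * \<phi>' x \<noteq> 0} \<subseteq> {x. \<phi> x \<noteq> 0} \<union> {x. \<phi>' x \<noteq> 0}" by auto
  then have sub: "closure {x. a * \<phi> x + b * \<phi>' x \<noteq> 0} \<subseteq> closure {x. \<phi> x \<noteq> 0} \<union> closure {x. \<phi>' x \<noteq> 0}"
    unfolding closure_Un[symmetric] by (rule closure_mono)
  have c: "compact (closure {x. \<phi> x \<noteq> 0} \<union> closure {x. \<phi>' x \<noteq> 0})" "closure {x. \<phi> x \<noteq> 0} \<union> closure {x. \<phi>' x \<noteq> 0} \<subseteq> \<Omega>"
    using t t' by (auto simp: test_fun_def intro!: compact_Un)
  have cc: "compact (closure {x. a * \<phi> x + b * \<phi>' x \<noteq> 0})"
    using compact_Int_closed[OF c(1) closed_closure[of "{x. a * \<phi> x + b * \<phi>' x \<noteq> 0}"]] by (simp only: Int_absorb1[OF sub])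
  have d: "((\<lambda>x. a * \<phi> x + b * \<phi>' x) has_derivative (\<lambda>h. (a *\<^sub>R G x + b *\<^sub>R G' x) \<bullet> h)) (at x)" for x
    using has_derivative_add[OF has_derivative_mult_right[OF test_funD(1)[OF t], of a] has_derivative_mult_right[OF test_funD(1)[OF t'], of b]]
    by (simp add: inner_add_left)
  have g: "continuous_on UNIV (\<lambda>x. a *\<^sub>R G x + b *\<^sub>R G' x)"
    using test_funD(2)[OF t] test_funD(2)[OF t'] by (intro continuous_intros)
  show ?thesis unfolding test_fun_def using d g cc order_trans[OF sub c(2)] by blast
qed

lemma mass_combine:
  assumes t: "test_fun sector \<phi> G" and t': "test_fun sector \<phi>' G'" and p: "p \<ge> 1"
    and disj: "\<And>x. (\<phi> x = 0 \<and> G x = 0) \<or> (\<phi>' x = 0 \<and> G' x = 0)"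
  shows "mass p (\<lambda>x. a * \<phi> x + b * \<phi>' x) = \<bar>a\<bar> powr p * mass p \<phi> + \<bar>b\<bar> powr p * mass p \<phi>'"
    "mass p (\<lambda>x. a *\<^sub>R G x + b *\<^sub>R G' x) = \<bar>a\<bar> powr p * mass p G + \<bar>b\<bar> powr p * mass p G'"
proof -
  note [measurable] = test_funD(3,4)[OF t] test_funD(3,4)[OF t']
  have split: "(\<integral>\<^sup>+x. ennreal (\<bar>a\<bar> powr p) * f x + ennreal (\<bar>b\<bar> powr p) * f' x \<partial>lborel) = ennreal (\<bar>a\<bar> powr p) * (\<integral>\<^sup>+x. f x \<partial>lborel) + ennreal (\<bar>b\<bar> powr p) * (\<integral>\<^sup>+x. f' x \<partial>lborel)"
    if [measurable]: "f \<in> borel_measurable borel" "f' \<in> borel_measurable borel" for f f' :: "R2 \<Rightarrow> ennreal"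
    by (subst nn_integral_add, measurable) (simp add: nn_integral_cmult)
  have "ennreal (mass p (\<lambda>x. a * \<phi> x + b * \<phi>' x)) = (\<integral>\<^sup>+x. ennreal (\<bar>a\<bar> powr p) * ennreal (\<bar>\<phi> x\<bar> powr p) + ennreal (\<bar>b\<bar> powr p) * ennreal (\<bar>\<phi>' x\<bar> powr p) \<partial>lborel)"
    unfolding mass_eq(1)[OF test_fun_combine[OF t t'] p]
  proof (rule nn_integral_cong)
    fix x
    show "ennreal (\<bar>a * \<phi> x + b * \<phi>' x\<bar> powr p) = ennreal (\<bar>a\<bar> powr p) * ennreal (\<bar>\<phi> x\<bar> powr p) + ennreal (\<bar>b\<bar> powr p) * ennreal (\<bar>\<phi>' x\<bar> powr p)"
      using disj[of x] p by (auto simp: abs_mult powr_mult ennreal_mult)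
  qed
  also have "\<dots> = ennreal (\<bar>a\<bar> powr p * mass p \<phi> + \<bar>b\<bar> powr p * mass p \<phi>')"
    by (subst split) (auto simp: mass_eq(1)[OF t p, symmetric] mass_eq(1)[OF t' p, symmetric] ennreal_mult ennreal_plus mass_nonneg)
  finally show "mass p (\<lambda>x. a * \<phi> x + b * \<phi>' x) = \<bar>a\<bar> powr p * mass p \<phi> + \<bar>b\<bar> powr p * mass p \<phi>'"
    by (subst (asm) ennreal_inj) (auto simp: mass_nonneg)
  have "ennreal (mass p (\<lambda>x. a *\<^sub>R G x + b *\<^sub>R G' x)) = (\<integral>\<^sup>+x. ennreal (\<bar>a\<bar> powr p) * ennreal (norm (G x) powr p) + ennreal (\<bar>b\<bar> powr p) * ennreal (norm (G' x) powr p) \<partial>lborel)"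
    unfolding mass_eq(2)[OF test_fun_combine[OF t t'] p]
  proof (rule nn_integral_cong)
    fix x
    show "ennreal (norm (a *\<^sub>R G x + b *\<^sub>R G' x) powr p) = ennreal (\<bar>a\<bar> powr p) * ennreal (norm (G x) powr p) + ennreal (\<bar>b\<bar> powr p) * ennreal (norm (G' x) powr p)"
      using disj[of x] p by (auto simp: powr_mult ennreal_mult)
  qed
  also have "\<dots> = ennreal (\<bar>a\<bar> powr p * mass p G + \<bar>b\<bar> powr p * mass p G')"
    by (subst split) (auto simp: mass_eq(2)[OF t p, symmetric] mass_eq(2)[OF t' p, symmetric] ennreal_mult ennreal_plus mass_nonneg)
  finally show "mass p (\<lambda>x. a *\<^sub>R G x + b *\<^sub>R G' x) = \<bar>a\<bar> powr p * mass p G + \<bar>b\<bar> powr p * mass p G'"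
    by (subst (asm) ennreal_inj) (auto simp: mass_nonneg)
qed

lemma R2_sphere_nonzero: "x \<in> sphere (0::R2) 1 \<Longrightarrow> x$1 \<noteq> 0 \<or> x$2 \<noteq> 0"
  by (metis R2_eqI dist_self norm_eq_zero mem_sphere zero_index zero_neq_one dist_0_norm)

text \<open>The loop sends x to x$1 * \<phi> + x$2 * \<phi>', normalised in L^p. With disjoint
  supports the p-th powers of values and of gradients add without cross terms, so a common bound B
  for the two Rayleigh quotients holds along the whole loop.\<close>

lemma two_bumps_admissible:
  assumes t: "test_fun sector \<phi> G" and t': "test_fun sector \<phi>' G'" and p: "p \<ge> 1"
    and disj: "\<And>x. (\<phi> x = 0 \<and> G x = 0) \<or> (\<phi>' x = 0 \<and> G' x = 0)"
    and m: "mass p \<phi> > 0" "mass p \<phi>' > 0"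
    and E: "mass p G \<le> B * mass p \<phi>" "mass p G' \<le> B * mass p \<phi>'"
  shows "\<exists>h. admissible TYPE(R2) p sector h \<and> (\<forall>x\<in>sphere 0 1. energy p sector (h x) \<le> B)"
proof -
  define S where "S x = \<bar>x$1\<bar> powr p * mass p \<phi> + \<bar>x$2\<bar> powr p * mass p \<phi>'" for x :: R2
  define A where "A x = x$1 / S x powr (1/p)" for x :: R2
  define B' where "B' x = x$2 / S x powr (1/p)" for x :: R2
  define h where "h x = (\<lambda>y. A x * \<phi> y + B' x * \<phi>' y)" for x
  have S: "S x > 0" if "x \<in> sphere 0 1" for x
    using R2_sphere_nonzero[OF that] m unfolding S_def
    by (cases "x$1 = 0") (auto intro: add_pos_nonneg add_nonneg_pos)
  have th: "test_fun sector (h x) (\<lambda>y. A x *\<^sub>R G y + B' x *\<^sub>R G' y)" for x unfolding h_def by (rule test_fun_combine[OF t t'])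
  have pw: "\<bar>c / S x powr (1/p)\<bar> powr p = \<bar>c\<bar> powr p / S x" if "x \<in> sphere 0 1" for x c
    using S[OF that] p by (simp add: abs_divide powr_divide powr_powr)
  have one: "\<bar>x$1\<bar> powr p / S x * mass p \<phi> + \<bar>x$2\<bar> powr p / S x * mass p \<phi>' = 1" if "x \<in> sphere 0 1" for x
  proof -
    have "\<bar>x$1\<bar> powr p / S x * mass p \<phi> + \<bar>x$2\<bar> powr p / S x * mass p \<phi>' = (\<bar>x$1\<bar> powr p * mass p \<phi> + \<bar>x$2\<bar> powr p * mass p \<phi>') / S x"
      by (simp add: add_divide_distrib)
    then show ?thesis using S[OF that] S_def[of x] by simp
  qed
  have Lh: "Lp_pow p sector (h x) = 1" if "x \<in> sphere 0 1" for x
  proof -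
    have "Lp_pow p sector (h x) = \<bar>A x\<bar> powr p * mass p \<phi> + \<bar>B' x\<bar> powr p * mass p \<phi>'"
      unfolding mass_eq(3)[OF th p] unfolding h_def by (rule mass_combine[OF t t' p disj])
    also have "\<dots> = 1" unfolding A_def B'_def pw[OF that] by (rule one[OF that])
    finally show ?thesis .
  qed
  have Eh: "energy p sector (h x) \<le> B" if "x \<in> sphere 0 1" for x
  proof -
    have "energy p sector (h x) = \<bar>A x\<bar> powr p * mass p G + \<bar>B' x\<bar> powr p * mass p G'"
      unfolding mass_eq(4)[OF th p] by (rule mass_combine[OF t t' p disj])
    also have "\<dots> \<le> \<bar>A x\<bar> powr p * (B * mass p \<phi>) + \<bar>B' x\<bar> powr p * (B * mass p \<phi>')"
      by (intro add_mono mult_left_mono E) auto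
    also have "\<dots> = B * (\<bar>x$1\<bar> powr p / S x * mass p \<phi> + \<bar>x$2\<bar> powr p / S x * mass p \<phi>')"
      unfolding A_def B'_def pw[OF that] by (simp only: distrib_left mult_ac)
    finally show ?thesis unfolding one[OF that] by simp
  qed
  have "admissible TYPE(R2) p sector h" unfolding admissible_def
  proof (intro conjI ballI allI impI)
    fix x :: R2 assume x: "x \<in> sphere 0 1"
    have "sobolev0 p sector (h x) (\<lambda>y. A x *\<^sub>R G y + B' x *\<^sub>R G' y)" using p by (intro sobolev0_test th bounded_sector) auto
    then show "h x \<in> Ssph p sector" using Lh[OF x] by (auto simp: Ssph_def in_W0_def)
    show "h (- x) y = - h x y" for y by (simp add: h_def A_def B'_def S_def)
  next
    fix x :: R2 and e :: real assume x: "x \<in> sphere 0 1" and e: "e > 0"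
    \<comment> \<open>The Sobolev distance from h x is an explicit continuous function of the two
      coefficients, and it is 0 at y = x.\<close>
    define W where "W y = (\<bar>A y - A x\<bar> powr p * (mass p \<phi> + mass p G) + \<bar>B' y - B' x\<bar> powr p * (mass p \<phi>' + mass p G')) powr (1 / p)" for y
    have WN: "W_norm p sector (\<lambda>z. h y z - h x z) = W y" for y
    proof -
      have hd: "(\<lambda>z. h y z - h x z) = (\<lambda>z. (A y - A x) * \<phi> z + (B' y - B' x) * \<phi>' z)" by (auto simp: h_def algebra_simps)
      show ?thesis unfolding W_norm_def hd
        unfolding mass_eq(3,4)[OF test_fun_combine[OF t t'] p] mass_combine[OF t t' p disj] W_def
        by (simp add: algebra_simps)
    qed
    have cS: "continuous_on (sphere 0 1) S" unfolding S_def using p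
      by (intro continuous_intros continuous_on_powr') auto
    have cA: "continuous_on (sphere 0 1) A" "continuous_on (sphere 0 1) B'" unfolding A_def B'_def
      using S by (auto intro!: continuous_intros cS simp: less_imp_neq[symmetric])
    have "continuous_on (sphere 0 1) W" unfolding W_def using p
      by (intro continuous_on_powr' continuous_intros cA) (auto intro!: add_nonneg_nonneg mult_nonneg_nonneg simp: mass_nonneg)
    then obtain d where d: "d > 0" "\<And>y. y \<in> sphere 0 1 \<Longrightarrow> dist y x < d \<Longrightarrow> dist (W y) (W x) < e"
      using x e unfolding continuous_on_iff by blast
    moreover have "W x = 0" using p by (simp add: W_def)
    moreover have "W y \<ge> 0" for y by (simp add: W_def)
    ultimately show "\<exists>d>0. \<forall>y\<in>sphere 0 1. dist y x < d \<longrightarrow> W_norm p sector (\<lambda>z. h y z - h x z) < e"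
      unfolding WN by (intro exI[of _ d]) (auto simp: dist_real_def)
  qed
  then show ?thesis using Eh by blast
qed

lemma bump_mass:
  assumes e: "\<epsilon> > 0" and r: "r > 3 * \<epsilon>" and p: "p \<ge> 1" and sub: "cball c r \<subseteq> sector"
  shows "mass p (bump' \<epsilon> c r) \<le> pi * r\<^sup>2" "(r - 3 * \<epsilon>) powr p * (pi * \<epsilon>\<^sup>2) \<le> mass p (bump \<epsilon> c r)"
proof -
  have r0: "r > 0" using e r by linarith
  note t = test_fun_bump[OF e r0 sub]
  have vol: "measure lborel (cball c s) = pi * s\<^sup>2" "measure lborel (ball c s) = pi * s\<^sup>2" if "s > 0" for s
    using content_cball[of s c] content_ball[of s c] that by (simp_all add: unit_ball_vol_2)
  have em: "emeasure lborel (cball c s) = ennreal (pi * s\<^sup>2)" "emeasure lborel (ball c s) = ennreal (pi * s\<^sup>2)" if "s > 0" for s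
    using vol[OF that] emeasure_lborel_cball_finite[of c s] emeasure_lborel_ball_finite[of c s]
    by (simp_all add: emeasure_eq_ennreal_measure less_top)
  have "ennreal (mass p (bump' \<epsilon> c r)) \<le> ennreal (pi * r\<^sup>2)"
    unfolding mass_eq(2)[OF t p] em(1)[OF r0, symmetric] by (rule bump_integrals[OF e r p])
  then show "mass p (bump' \<epsilon> c r) \<le> pi * r\<^sup>2" by simp
  have "ennreal ((r - 3 * \<epsilon>) powr p * (pi * \<epsilon>\<^sup>2)) = ennreal ((r - 3 * \<epsilon>) powr p) * emeasure lborel (ball c \<epsilon>)"
    unfolding em(2)[OF e] by (simp add: ennreal_mult)
  also have "\<dots> \<le> (\<integral>\<^sup>+y. ennreal (\<bar>bump \<epsilon> c r y\<bar> powr p) * indicator (ball c \<epsilon>) y \<partial>lborel)" by (rule bump_integrals[OF e r p])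
  also have "\<dots> \<le> ennreal (mass p (bump \<epsilon> c r))"
    unfolding mass_eq(1)[OF t p] by (intro nn_integral_mono) (auto simp: indicator_def)
  finally show "(r - 3 * \<epsilon>) powr p * (pi * \<epsilon>\<^sup>2) \<le> mass p (bump \<epsilon> c r)" by (simp add: mass_nonneg)
qed

text \<open>The two discs have radius 0.1808, slightly less than the largest radius (about 0.18096) of two
  equal disjoint discs in the sector: each touches the horizontal side, the first one also the other
  side and the second one also the arc.\<close>
lemma lambda2_upper:
  assumes p: "p \<ge> 1"
  shows "\<exists>h. admissible TYPE(R2) p sector h" "lambda2 p sector \<le> 10 ^ 8 / 0.1805 powr p"
proof -
  define c where "c = vec2 0.4367 0.1809"
  define c' where "c' = vec2 0.7983 0.1809"
  have nc: "norm c < 1 - 0.1808" "norm c' < 1 - 0.1808"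
    unfolding norm_R2 c_def c'_def by (rule real_less_lsqrt; simp add: power2_eq_square)+
  have sub: "cball c 0.1808 \<subseteq> sector"
    by (rule cball_sector[OF _ _ _ _ nc(1)]) (auto simp: c_def power2_eq_square)
  have sub': "cball c' 0.1808 \<subseteq> sector"
    by (rule cball_sector[OF _ _ _ _ nc(2)]) (auto simp: c'_def power2_eq_square)
  \<comment> \<open>0.1808 - 3 * 0.0001 is 0.1805, and the ratio of areas (0.1808 / 0.0001)^2, about
    3.3 * 10^6, is below 10^8.\<close>
  let ?e = "0.0001 :: real" and ?r = "0.1808 :: real"
  have e: "?e > 0" and r: "?r > 0" and r3: "?r > 3 * ?e" by auto
  note t = test_fun_bump[OF e r sub] and t' = test_fun_bump[OF e r sub']
  note m = bump_mass[OF e r3 p sub] and m' = bump_mass[OF e r3 p sub']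
  have "norm (c - c') = 0.3616" by (simp add: c_def c'_def norm_R2)
  then have far: "dist c x \<ge> ?r \<or> dist c' x \<ge> ?r" for x
    using dist_triangle[of c c' x] by (auto simp: dist_norm norm_minus_commute)
  have disj: "(bump ?e c ?r x = 0 \<and> bump' ?e c ?r x = 0) \<or> (bump ?e c' ?r x = 0 \<and> bump' ?e c' ?r x = 0)" for x
    using far[of x] bump(4,7)[OF e r] by blast
  define B where "B = 10 ^ 8 / (0.1805::real) powr p"
  have pos: "(?r - 3 * ?e) powr p * (pi * ?e\<^sup>2) > 0" using pi_gt_zero by simp
  have k: "pi * ?r\<^sup>2 \<le> B * ((?r - 3 * ?e) powr p * (pi * ?e\<^sup>2))"
    using pi_gt_zero by (simp add: B_def power2_eq_square)
  have B0: "B \<ge> 0" by (simp add: B_def)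
  have E: "mass p (bump' ?e c ?r) \<le> B * mass p (bump ?e c ?r)" "mass p (bump' ?e c' ?r) \<le> B * mass p (bump ?e c' ?r)"
    using m m' k B0 by (meson mult_left_mono order_trans)+
  have ms: "mass p (bump ?e c ?r) > 0" "mass p (bump ?e c' ?r) > 0"
    using m(2) m'(2) pos by linarith+
  obtain h where h: "admissible TYPE(R2) p sector h" "\<forall>x\<in>sphere 0 1. energy p sector (h x) \<le> B"
    using two_bumps_admissible[OF t t' p disj ms E] by blast
  show "\<exists>h. admissible TYPE(R2) p sector h" using h(1) by blast
  show "lambda2 p sector \<le> 10 ^ 8 / 0.1805 powr p"
    unfolding B_def[symmetric] by (rule var_eig_le[OF h(1) p]) (use h(2) in auto)
qed

section \<open>The lower bound: averages over a small polar rectangle\<close>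

definition core_angle :: real where "core_angle = pi / 4 - 0.36"

text \<open>Integration against this kernel averages over the polar rectangle
  0.674 to 0.735, 0.36 to pi/4 - 0.36 around the incentre; the factor 1 / norm x cancels the Jacobian.\<close>
definition kern :: "R2 \<Rightarrow> real" where
  "kern x = indicator {x \<in> sector. 0.674 \<le> norm x \<and> norm x \<le> 0.735 \<and> x$1 * sin 0.36 \<le> x$2 * cos 0.36 \<and>
     x$2 * cos core_angle \<le> x$1 * sin core_angle} x / norm x"

text \<open>The angles 0.36 and \<open>core_angle\<close> are mirror images in the bisector. The
  rectangle is what arcs and radii of length 0.265 from the boundary leave over: 0.674 * pi/8, 0.735
  * 0.36 and 1 - 0.735 are at most 0.265, whereas its own sides, 0.735 - 0.674 = 0.061 and at most
  0.735 * (\<open>core_angle\<close> - 0.36), are below 0.265 / 4.\<close>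

lemma core_angle: "0.36 < core_angle" "core_angle < pi/4" "0.735 * (core_angle - 0.36) \<le> 0.061"
  using pi_ge_3 pi_less_31416 by (auto simp: core_angle_def)

lemma kern_measurable [measurable]: "kern \<in> borel_measurable borel"
proof -
  have [measurable]: "(\<lambda>x::R2. x $ i) \<in> borel_measurable borel" for i by (simp add: cart_eq_inner_axis)
  show ?thesis unfolding kern_def by measurable
qed

lemma kern_bounds: "0 \<le> kern x" "kern x \<le> 2" "x \<notin> sector \<Longrightarrow> kern x = 0"
proof -
  show "0 \<le> kern x" "x \<notin> sector \<Longrightarrow> kern x = 0" by (auto simp: kern_def)
  show "kern x \<le> 2" by (cases "norm x \<ge> 0.674") (auto simp: kern_def indicator_def divide_simps)
qed

text \<open>The two linear inequalities in \<open>kern\<close> give the signs of cross products,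
  that is of sin (\<theta> - 0.36) and sin (\<open>core_angle\<close> - \<theta>). All angles lie
  between 0 and 1, where the sine of a difference has the sign of the difference.\<close>

lemma kern_polar:
  assumes r: "0 < \<rho>" "\<rho> < 1" and t: "0 < \<theta>" "\<theta> < pi/4"
  shows "\<rho> * kern (polar \<rho> \<theta>) = indicator ({0.674..0.735} \<times> {0.36..core_angle}) (\<rho>, \<theta>)"
proof -
  have s: "polar \<rho> \<theta> \<in> sector" using polar_in_sector[OF r(1) t] r by simp
  have sgn: "0 \<le> sin (x - y) \<longleftrightarrow> y \<le> x" if "0 < x" "x < 1" "0 < y" "y < 1" for x y :: real
  proof (cases "y \<le> x")
    case True
    then have "0 \<le> sin (x - y)" using that pi_ge_3 by (intro sin_ge_zero) auto
    then show ?thesis using True by simp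
  next
    case False
    then have "0 < sin (y - x)" using that pi_ge_3 by (intro sin_gt_zero) auto
    then show ?thesis using False sin_minus[of "x - y"] by simp
  qed
  have t1: "\<theta> < 1" using t pi_less_31416 by simp
  have c1: "0 < core_angle" "core_angle < 1" using core_angle pi_less_31416 by auto
  have 1: "polar \<rho> \<theta> $ 1 * sin 0.36 \<le> polar \<rho> \<theta> $ 2 * cos 0.36 \<longleftrightarrow> 0.36 \<le> \<theta>"
  proof -
    have "polar \<rho> \<theta> $ 2 * cos 0.36 - polar \<rho> \<theta> $ 1 * sin 0.36 = \<rho> * sin (\<theta> - 0.36)"
      by (simp add: polar_def sin_diff algebra_simps)
    then have "polar \<rho> \<theta> $ 1 * sin 0.36 \<le> polar \<rho> \<theta> $ 2 * cos 0.36 \<longleftrightarrow> 0 \<le> \<rho> * sin (\<theta> - 0.36)" by linarith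
    then show ?thesis using sgn[OF t(1) t1, of "0.36"] r by (simp add: zero_le_mult_iff)
  qed
  have 2: "polar \<rho> \<theta> $ 2 * cos core_angle \<le> polar \<rho> \<theta> $ 1 * sin core_angle \<longleftrightarrow> \<theta> \<le> core_angle"
  proof -
    have "polar \<rho> \<theta> $ 1 * sin core_angle - polar \<rho> \<theta> $ 2 * cos core_angle = \<rho> * sin (core_angle - \<theta>)"
      by (simp add: polar_def sin_diff algebra_simps)
    then have "polar \<rho> \<theta> $ 2 * cos core_angle \<le> polar \<rho> \<theta> $ 1 * sin core_angle \<longleftrightarrow> 0 \<le> \<rho> * sin (core_angle - \<theta>)" by linarith
    then show ?thesis using sgn[OF c1 t(1) t1] r by (simp add: zero_le_mult_iff)
  qed
  show ?thesis unfolding kern_def using r s 1 2 by (auto simp: indicator_def)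
qed

lemma nn_integral_kern:
  assumes f[measurable]: "f \<in> borel_measurable borel"
  shows "(\<integral>\<^sup>+x. ennreal (kern x) * f x \<partial>lborel) = (\<integral>\<^sup>+z. f (polar (fst z) (snd z)) \<partial>rect_measure 0.674 0.735 0.36 core_angle)"
proof -
  have "(\<integral>\<^sup>+x. ennreal (kern x) * f x \<partial>lborel) = (\<integral>\<^sup>+x\<in>sector. ennreal (kern x) * f x \<partial>lborel)"
    using kern_bounds(3) by (intro nn_integral_cong) (auto simp: indicator_def)
  also have "\<dots> = (\<integral>\<^sup>+\<theta>. \<integral>\<^sup>+\<rho>. ennreal \<rho> * (ennreal (kern (polar \<rho> \<theta>)) * f (polar \<rho> \<theta>)) * indicator ({0<..<1} \<times> {0<..<pi/4}) (\<rho>, \<theta>) \<partial>lborel \<partial>lborel)"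
    by (rule nn_integral_sector) measurable
  also have "\<dots> = (\<integral>\<^sup>+\<theta>. \<integral>\<^sup>+\<rho>. f (polar \<rho> \<theta>) * indicator ({0.674..0.735} \<times> {0.36..core_angle}) (\<rho>, \<theta>) \<partial>lborel \<partial>lborel)"
  proof (rule nn_integral_cong, rule nn_integral_cong)
    fix \<theta> \<rho> :: real
    show "ennreal \<rho> * (ennreal (kern (polar \<rho> \<theta>)) * f (polar \<rho> \<theta>)) * indicator ({0<..<1} \<times> {0<..<pi/4}) (\<rho>, \<theta>) = f (polar \<rho> \<theta>) * indicator ({0.674..0.735} \<times> {0.36..core_angle}) (\<rho>, \<theta>)"
    proof (cases "0 < \<rho> \<and> \<rho> < 1 \<and> 0 < \<theta> \<and> \<theta> < pi/4")
      case True
      then have "ennreal \<rho> * ennreal (kern (polar \<rho> \<theta>)) = ennreal (indicator ({0.674..0.735} \<times> {0.36..core_angle}) (\<rho>, \<theta>))"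
        using kern_polar[of \<rho> \<theta>] kern_bounds(1) by (simp flip: ennreal_mult)
      then show ?thesis using True by (simp add: mult.assoc[symmetric] mult.commute ennreal_indicator)
    next
      case False
      then show ?thesis using core_angle by (auto simp: indicator_def)
    qed
  qed
  also have "\<dots> = (\<integral>\<^sup>+\<rho>. \<integral>\<^sup>+\<theta>. f (polar \<rho> \<theta>) * indicator ({0.674..0.735} \<times> {0.36..core_angle}) (\<rho>, \<theta>) \<partial>lborel \<partial>lborel)"
    by (rule lborel_pair.Fubini'[symmetric]) measurable
  also have "\<dots> = (\<integral>\<^sup>+\<rho>\<in>{0.674..0.735}. (\<integral>\<^sup>+\<theta>\<in>{0.36..core_angle}. f (polar \<rho> \<theta>) \<partial>lborel) \<partial>lborel)"
    by (intro nn_integral_cong, subst nn_integral_multc[symmetric])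
      (auto simp: indicator_def intro!: nn_integral_cong)
  also have "\<dots> = (\<integral>\<^sup>+z. f (polar (fst z) (snd z)) \<partial>rect_measure 0.674 0.735 0.36 core_angle)"
    by (subst nn_integral_rect_measure) auto
  finally show ?thesis .
qed

lemma integral_kern:
  assumes c: "continuous_on UNIV \<phi>"
  shows "(\<integral>x. kern x * \<phi> x \<partial>lborel) = (\<integral>z. \<phi> (polar (fst z) (snd z)) \<partial>rect_measure 0.674 0.735 0.36 core_angle)"
proof -
  let ?M = "rect_measure 0.674 0.735 0.36 core_angle"
  have [measurable]: "\<phi> \<in> borel_measurable borel" using c by (rule borel_measurable_continuous_onI)
  have iM: "integrable ?M (\<lambda>z. \<phi> (polar (fst z) (snd z)))"
    using core_angle by (intro integrable_rect_measure continuous_on_compose2[OF c] continuous_intros) auto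
  have e: "ennreal (kern x * \<phi> x) = ennreal (kern x) * ennreal (\<phi> x)" "ennreal (- (kern x * \<phi> x)) = ennreal (kern x) * ennreal (- \<phi> x)"
    "ennreal (norm (kern x * \<phi> x)) = ennreal (kern x) * ennreal (norm (\<phi> x))" for x
    using kern_bounds(1)[of x] ennreal_mult'[of "kern x" "\<phi> x"] ennreal_mult'[of "kern x" "- \<phi> x"]
    by (simp_all add: ennreal_mult abs_mult)
  have "(\<integral>\<^sup>+x. ennreal (norm (kern x * \<phi> x)) \<partial>lborel) = (\<integral>\<^sup>+z. ennreal (norm (\<phi> (polar (fst z) (snd z)))) \<partial>?M)"
    unfolding e by (rule nn_integral_kern) measurable
  also have "\<dots> < \<infinity>" using iM unfolding integrable_iff_bounded by simp
  finally have iL: "integrable lborel (\<lambda>x. kern x * \<phi> x)" by (intro integrableI_bounded) auto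
  have k: "(\<integral>\<^sup>+x. ennreal (kern x) * ennreal (\<phi> x) \<partial>lborel) = (\<integral>\<^sup>+z. ennreal (\<phi> (polar (fst z) (snd z))) \<partial>?M)"
    "(\<integral>\<^sup>+x. ennreal (kern x) * ennreal (- \<phi> x) \<partial>lborel) = (\<integral>\<^sup>+z. ennreal (- \<phi> (polar (fst z) (snd z))) \<partial>?M)"
    by (rule nn_integral_kern, measurable)+
  show ?thesis unfolding real_lebesgue_integral_def[OF iL] real_lebesgue_integral_def[OF iM] e k ..
qed

lemma combine_le2:
  fixes A B E R :: ennreal
  assumes "X \<le> A + B" "A \<le> ennreal a * E + R" "B \<le> ennreal b * E + R'" "a \<ge> 0" "b \<ge> 0" "a + b = c"
  shows "X \<le> ennreal c * E + (R + R')"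
proof -
  have "X \<le> (ennreal a * E + R) + (ennreal b * E + R')" using assms(1-3) by (meson add_mono order_trans)
  also have "\<dots> = ennreal c * E + (R + R')" using assms by (simp add: distrib_right ennreal_plus add_ac flip: assms(6))
  finally show ?thesis .
qed

text \<open>Outside the averaging rectangle the zeros on the boundary of the sector suffice; inside,
  \<phi> is split into its mean and the rest. The splitting and \<open>poincare_mean\<close> both
  cost 2^p, so the sides of the rectangle are multiplied by 4. The five pieces contribute 2 + 1 + 4
  + 1 + 2 = 10.\<close>

lemma mean_zero_poincare:
  assumes t: "test_fun sector \<phi> G" and p: "p \<ge> 1"
  shows "mass p \<phi> \<le> 10 * 0.265 powr p * mass p G + 2 powr p * \<bar>(\<integral>x. kern x * \<phi> x \<partial>lborel) / (0.061 * (core_angle - 0.36))\<bar> powr p"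
proof -
  let ?F = "\<lambda>x. ennreal (\<bar>\<phi> x\<bar> powr p)" and ?E = "\<integral>\<^sup>+x. ennreal (norm (G x) powr p) \<partial>lborel"
  let ?a = "0.674 :: real" and ?b = "0.735 :: real" and ?c = "0.36 :: real" and ?d = core_angle and ?h = "0.265 :: real"
  have F[measurable]: "?F \<in> borel_measurable borel" using test_funD(3)[OF t] by measurable
  note [measurable] = test_funD(3,4)[OF t]
  note pis = pi_less_31416 pi_ge_3 core_angle and z0 = test_fun_polar_zero[OF t p]
  define m where "m = (\<integral>x. kern x * \<phi> x \<partial>lborel) / (0.061 * (?d - ?c))"
  have m: "m = (\<integral>z. \<phi> (polar (fst z) (snd z)) \<partial>rect_measure ?a ?b ?c ?d) / ((?b - ?a) * (?d - ?c))"
    unfolding m_def integral_kern[OF C1_continuous[OF test_funD(1)[OF t]]] by simp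
  have mean: "rect_int ?a ?b ?c ?d (\<lambda>x. ennreal (\<bar>\<phi> x - m\<bar> powr p)) \<le>
    ennreal (2 powr p * (?b / ?a) * ((?b - ?a) powr p + (?b * (?d - ?c)) powr p)) * rect_int ?a ?b ?c ?d (\<lambda>x. ennreal (norm (G x) powr p))"
    unfolding m by (rule poincare_mean[OF test_funD(1,2)[OF t] _ _ _ p]) (use core_angle in auto)
  have one: "rect_int ?a ?b ?c ?d (\<lambda>_. 1) \<le> 1"
  proof -
    have "rect_int ?a ?b ?c ?d (\<lambda>_. 1) \<le> (\<integral>\<^sup>+\<theta>\<in>{?c..?d}. (\<integral>\<^sup>+\<rho>\<in>{?a..?b}. 1 \<partial>lborel) \<partial>lborel)"
      unfolding rect_int_def
    proof (rule nn_integral_mono, rule mult_right_mono)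
      show "(\<integral>\<^sup>+\<rho>\<in>{?a..?b}. ennreal \<rho> * 1 \<partial>lborel) \<le> (\<integral>\<^sup>+\<rho>\<in>{?a..?b}. 1 \<partial>lborel)"
        by (rule nn_integral_mono) (auto simp: indicator_def ennreal_le_1)
    qed simp
    also have "\<dots> = ennreal (0.061) * ennreal (?d - ?c)"
      using core_angle by (simp add: nn_integral_const_interval)
    also have "\<dots> \<le> 1" using core_angle by (simp add: ennreal_le_1 flip: ennreal_mult)
    finally show ?thesis .
  qed
  have K: "rect_int ?a ?b ?c ?d ?F \<le> ennreal (4 * ?h powr p) * ?E + ennreal (2 powr p * \<bar>m\<bar> powr p)"
  proof -
    have "rect_int ?a ?b ?c ?d ?F \<le> rect_int ?a ?b ?c ?d (\<lambda>x. ennreal (2 powr p) * ennreal (\<bar>\<phi> x - m\<bar> powr p) + ennreal (2 powr p * \<bar>m\<bar> powr p) * 1)"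
      unfolding rect_int_def
    proof (intro nn_integral_mono mult_right_mono mult_left_mono)
      fix x
      show "?F x \<le> ennreal (2 powr p) * ennreal (\<bar>\<phi> x - m\<bar> powr p) + ennreal (2 powr p * \<bar>m\<bar> powr p) * 1" for x
        using powr_add_le[of p "\<phi> x - m" m] p
        by (simp add: ennreal_leI distrib_left flip: ennreal_plus ennreal_mult)
    qed auto
    also have "\<dots> = ennreal (2 powr p) * rect_int ?a ?b ?c ?d (\<lambda>x. ennreal (\<bar>\<phi> x - m\<bar> powr p)) + ennreal (2 powr p * \<bar>m\<bar> powr p) * rect_int ?a ?b ?c ?d (\<lambda>_. 1)"
    proof -
      have lin: "rect_int a b c d (\<lambda>x. k * f x + l * f' x) = k * rect_int a b c d f + l * rect_int a b c d f'"
        if [measurable]: "f \<in> borel_measurable borel" "f' \<in> borel_measurable borel" for a b c d k l and f f' :: "R2 \<Rightarrow> ennreal"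
      proof -
        have "rect_int a b c d (\<lambda>x. k * f x + l * f' x) = (\<integral>\<^sup>+\<theta>. k * ((\<integral>\<^sup>+\<rho>\<in>{a..b}. ennreal \<rho> * f (polar \<rho> \<theta>) \<partial>lborel) * indicator {c..d} \<theta>) + l * ((\<integral>\<^sup>+\<rho>\<in>{a..b}. ennreal \<rho> * f' (polar \<rho> \<theta>) \<partial>lborel) * indicator {c..d} \<theta>) \<partial>lborel)"
          unfolding rect_int_def
        proof (rule nn_integral_cong)
          fix \<theta>
          have "(\<integral>\<^sup>+\<rho>\<in>{a..b}. ennreal \<rho> * (k * f (polar \<rho> \<theta>) + l * f' (polar \<rho> \<theta>)) \<partial>lborel) = (\<integral>\<^sup>+\<rho>. k * (ennreal \<rho> * f (polar \<rho> \<theta>) * indicator {a..b} \<rho>) + l * (ennreal \<rho> * f' (polar \<rho> \<theta>) * indicator {a..b} \<rho>) \<partial>lborel)"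
            by (intro nn_integral_cong) (simp add: algebra_simps)
          also have "\<dots> = k * (\<integral>\<^sup>+\<rho>\<in>{a..b}. ennreal \<rho> * f (polar \<rho> \<theta>) \<partial>lborel) + l * (\<integral>\<^sup>+\<rho>\<in>{a..b}. ennreal \<rho> * f' (polar \<rho> \<theta>) \<partial>lborel)"
            by (subst nn_integral_add) (auto simp: nn_integral_cmult)
          finally show "(\<integral>\<^sup>+\<rho>\<in>{a..b}. ennreal \<rho> * (k * f (polar \<rho> \<theta>) + l * f' (polar \<rho> \<theta>)) \<partial>lborel) * indicator {c..d} \<theta> =
            k * ((\<integral>\<^sup>+\<rho>\<in>{a..b}. ennreal \<rho> * f (polar \<rho> \<theta>) \<partial>lborel) * indicator {c..d} \<theta>) + l * ((\<integral>\<^sup>+\<rho>\<in>{a..b}. ennreal \<rho> * f' (polar \<rho> \<theta>) \<partial>lborel) * indicator {c..d} \<theta>)"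
            by (simp add: algebra_simps)
        qed
        also have "\<dots> = k * rect_int a b c d f + l * rect_int a b c d f'"
          unfolding rect_int_def by (subst nn_integral_add) (auto simp: nn_integral_cmult)
        finally show ?thesis .
      qed
      show ?thesis by (rule lin) measurable
    qed
    also have "\<dots> \<le> ennreal (2 powr p) * (ennreal (2 powr p * (?b / ?a) * ((?b - ?a) powr p + (?b * (?d - ?c)) powr p)) * ?E) + ennreal (2 powr p * \<bar>m\<bar> powr p) * 1"
      unfolding total_energy_rect(1)[OF t p]
      by (intro add_mono mult_left_mono one order_trans[OF mean] rect_int_mono) (use core_angle in auto)
    also have "\<dots> \<le> ennreal (4 * ?h powr p) * ?E + ennreal (2 powr p * \<bar>m\<bar> powr p)"
    proof -
      have "2 powr p * (2 powr p * (?b / ?a) * ((?b - ?a) powr p + (?b * (?d - ?c)) powr p)) = (?b / ?a) * ((4 * (?b - ?a)) powr p + (4 * (?b * (?d - ?c))) powr p)"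
      proof -
        have q: "(4 * x) powr p = 2 powr p * (2 powr p * x powr p)" if "x \<ge> 0" for x :: real
          using that powr_mult[of 2 2 p] by (simp add: powr_mult)
        have "(4 * (?b - ?a)) powr p = 2 powr p * (2 powr p * (?b - ?a) powr p)" by (rule q) simp
        moreover have "(4 * (?b * (?d - ?c))) powr p = 2 powr p * (2 powr p * (?b * (?d - ?c)) powr p)" using core_angle by (intro q) simp
        ultimately show ?thesis by (simp only: distrib_left mult_ac)
      qed
      also have "\<dots> \<le> 2 * (?h powr p + ?h powr p)"
        using core_angle p by (intro mult_mono add_mono powr_mono2) auto
      finally have "2 powr p * (2 powr p * (?b / ?a) * ((?b - ?a) powr p + (?b * (?d - ?c)) powr p)) \<le> 4 * ?h powr p" by simp
      then have "ennreal (2 powr p) * ennreal (2 powr p * (?b / ?a) * ((?b - ?a) powr p + (?b * (?d - ?c)) powr p)) \<le> ennreal (4 * ?h powr p)"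
        by (subst ennreal_mult[symmetric]) (auto intro: ennreal_leI)
      then show ?thesis by (simp only: mult.assoc[symmetric] mult_1_right) (intro add_mono mult_right_mono, auto)
    qed
    finally show ?thesis .
  qed
  have A1: "rect_int 0 ?a 0 (pi/4) ?F \<le> ennreal (2 * ?h powr p) * ?E + 0"
    unfolding add_0_right
  proof (rule combine_le[OF rect_int_split_angle[OF F, of _ _ _ _ "pi/8"]])
    show "rect_int 0 ?a 0 (pi/8) ?F \<le> ennreal (?h powr p) * ?E"
      by (rule rect_angular_le[OF t p, where e=0]) (use pis z0 in auto)
    show "rect_int 0 ?a (pi/8) (pi/4) ?F \<le> ennreal (?h powr p) * ?E"
      by (rule rect_angular_le[OF t p, where e="pi/4"]) (use pis z0 in auto)
  qed auto
  have A2: "rect_int ?a ?b 0 ?c ?F \<le> ennreal (1 * ?h powr p) * ?E + 0"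
    unfolding add_0_right mult_1 by (rule rect_angular_le[OF t p, where e=0]) (use pis z0 in auto)
  have A3: "rect_int ?a ?b ?d (pi/4) ?F \<le> ennreal (1 * ?h powr p) * ?E + 0"
    unfolding add_0_right mult_1 by (rule rect_angular_le[OF t p, where e="pi/4"]) (use pis z0 in \<open>auto simp: core_angle_def\<close>)
  have A4: "rect_int ?b 1 0 (pi/4) ?F \<le> ennreal (2 * ?h powr p) * ?E + 0"
    unfolding add_0_right by (rule rect_radial_le[OF t p, where e=1]) (use pis z0 in auto)
  let ?R = "ennreal (2 powr p * \<bar>m\<bar> powr p)"
  have "rect_int ?a ?b ?c (pi/4) ?F \<le> ennreal (5 * ?h powr p) * ?E + (?R + 0)"
    by (rule combine_le2[OF rect_int_split_angle[OF F] K A3]) auto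
  then have "rect_int ?a ?b 0 (pi/4) ?F \<le> ennreal (6 * ?h powr p) * ?E + (0 + (?R + 0))"
    by (rule combine_le2[OF rect_int_split_angle[OF F] A2]) auto
  from combine_le2[OF rect_int_split_radius[OF F] this A4]
  have "rect_int ?a 1 0 (pi/4) ?F \<le> ennreal (8 * ?h powr p) * ?E + (0 + (?R + 0) + 0)" by auto
  from combine_le2[OF rect_int_split_radius[OF F] A1 this]
  have "rect_int 0 1 0 (pi/4) ?F \<le> ennreal (10 * ?h powr p) * ?E + (0 + (0 + (?R + 0) + 0))" by auto
  then have "ennreal (mass p \<phi>) \<le> ennreal (10 * ?h powr p) * ennreal (mass p G) + ?R"
    unfolding mass_eq(1,2)[OF t p] total_energy_rect(2)[OF t p] by simp
  also have "\<dots> = ennreal (10 * ?h powr p * mass p G + 2 powr p * \<bar>m\<bar> powr p)"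
    by (simp add: ennreal_mult ennreal_plus mass_nonneg)
  finally show ?thesis unfolding m_def[symmetric]
    by (subst (asm) ennreal_le_iff) (auto simp: mass_nonneg)
qed

definition kern_mean :: "(R2 \<Rightarrow> real) \<Rightarrow> real" where
  "kern_mean u = (\<integral>x. kern x * zext sector u x \<partial>lebesgue)"

lemma kern_measurable_lebesgue [measurable]: "kern \<in> borel_measurable lebesgue"
  using kern_measurable by (rule borel_measurable_lebesgue)

lemma Lp_pow_integral:
  assumes s: "sobolev0 p \<Omega> u g" and p: "p > 0"
  shows "Lp_pow p \<Omega> u = (\<integral>x. \<bar>zext \<Omega> u x\<bar> powr p \<partial>lebesgue)" "integrable lebesgue (\<lambda>x. \<bar>zext \<Omega> u x\<bar> powr p)"
    "integrable lebesgue (\<lambda>x. norm (zext \<Omega> g x) powr p)"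
proof -
  note [measurable] = sobolev0_measurable[OF s]
  show "Lp_pow p \<Omega> u = (\<integral>x. \<bar>zext \<Omega> u x\<bar> powr p \<partial>lebesgue)"
    unfolding Lp_pow_def set_nn_integral_zext(1)[OF p] by (subst integral_eq_nn_integral) auto
  show "integrable lebesgue (\<lambda>x. \<bar>zext \<Omega> u x\<bar> powr p)"
    using s p by (intro integrableI_bounded) (auto simp: sobolev0_def set_nn_integral_zext(1))
  show "integrable lebesgue (\<lambda>x. norm (zext \<Omega> g x) powr p)"
    using s p by (intro integrableI_bounded) (auto simp: sobolev0_def set_nn_integral_zext(2))
qed

lemma energy_integral:
  assumes s: "sobolev0 p \<Omega> u g" and p: "p \<ge> 1" and b: "bounded \<Omega>"
  shows "energy p \<Omega> u = (\<integral>x. norm (zext \<Omega> g x) powr p \<partial>lebesgue)"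
  unfolding energy_eq(2)[OF s p b] using sobolev0_measurable(2)[OF s] by (subst integral_eq_nn_integral) auto

lemma mass_integral:
  assumes "f \<in> borel_measurable borel"
  shows "mass p f = (\<integral>x. norm (f x) powr p \<partial>lebesgue)"
proof -
  have [measurable]: "f \<in> borel_measurable lebesgue" using assms by (rule borel_measurable_lebesgue)
  have "(\<integral>\<^sup>+x. ennreal (norm (f x) powr p) \<partial>lborel) = (\<integral>\<^sup>+x. ennreal (norm (f x) powr p) \<partial>lebesgue)"
    by (simp add: nn_integral_completion)
  then show ?thesis unfolding mass_def by (subst integral_eq_nn_integral) auto
qed

lemma sector_measure: "emeasure lebesgue sector < \<infinity>" "measure lebesgue sector \<le> 4" "sector \<in> sets lebesgue"
proof -
  have s: "sector \<subseteq> ball 0 1" by (auto simp: mem_sector)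
  show m: "sector \<in> sets lebesgue" using sector_borel by simp
  have "emeasure lebesgue sector \<le> emeasure lebesgue (ball 0 1 :: R2 set)" using s by (intro emeasure_mono) auto
  also have "\<dots> < \<infinity>" using emeasure_lborel_ball_finite[of "0::R2" 1] by simp
  finally show "emeasure lebesgue sector < \<infinity>" .
  have "measure lebesgue sector \<le> measure lebesgue (ball 0 1 :: R2 set)"
    by (rule measure_mono_fmeasurable[OF s m lmeasurable_ball])
  also have "\<dots> = pi" using content_ball[of 1 "0::R2"] by (simp add: unit_ball_vol_2)
  finally show "measure lebesgue sector \<le> 4" using pi_less_31416 by simp
qed

text \<open>Split at y = \<eta>. The first power is controlled by the p-th at the price of an
  arbitrarily small constant, which on a domain of finite measure replaces Hoelder's
  inequality.\<close>

lemma le_young: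
  fixes y \<eta> p :: real
  assumes "\<eta> > 0" "p \<ge> 1" "y \<ge> 0"
  shows "y \<le> \<eta> + \<eta> powr (1 - p) * y powr p"
proof (cases "y \<le> \<eta>")
  case False
  have y: "y > 0" using False assms by simp
  have "y = y powr (1 - p) * y powr p" using y by (simp flip: powr_add)
  also have "\<dots> \<le> \<eta> powr (1 - p) * y powr p"
    using assms False by (intro mult_right_mono powr_mono2') auto
  finally show ?thesis using assms by linarith
qed (use assms in \<open>auto intro: add_increasing2\<close>)

text \<open>For fixed \<eta> the second term is small when u is small in L^p, which makes the
  average continuous. The 8 is the bound 2 for \<open>kern\<close> times the bound 4 for the area of
  the sector.\<close>

lemma kern_mean_bound:
  assumes s: "sobolev0 p sector u g" and p: "p \<ge> 1" and \<eta>: "\<eta> > 0"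
  shows "integrable lebesgue (\<lambda>x. kern x * zext sector u x)"
    "\<bar>kern_mean u\<bar> \<le> 8 * \<eta> + 2 * \<eta> powr (1 - p) * Lp_pow p sector u"
proof -
  note [measurable] = sobolev0_measurable[OF s] sector_measure(3)
  have p0: "p > 0" using p by simp
  let ?D = "\<lambda>x. 2 * (\<eta> * indicator sector x + \<eta> powr (1 - p) * \<bar>zext sector u x\<bar> powr p)"
  have i: "integrable lebesgue (\<lambda>x. indicator sector x :: real)" using sector_measure by (intro integrable_real_indicator) auto
  have D: "integrable lebesgue ?D"
    by (intro integrable_mult_right Bochner_Integration.integrable_add i Lp_pow_integral(2)[OF s p0])
  have le: "norm (kern x * zext sector u x) \<le> ?D x" for x
  proof (cases "x \<in> sector")
    case True
    have "norm (kern x * zext sector u x) \<le> 2 * \<bar>zext sector u x\<bar>"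
      using kern_bounds[of x] by (simp add: abs_mult mult_right_mono)
    also have "\<dots> \<le> ?D x" using le_young[OF \<eta> p, of "\<bar>zext sector u x\<bar>"] True by (simp del: zext_simps)
    finally show ?thesis .
  qed (use p in auto)
  show I: "integrable lebesgue (\<lambda>x. kern x * zext sector u x)"
    by (rule Bochner_Integration.integrable_bound[OF D]) (use le in \<open>auto intro!: AE_I2 intro: order_trans[OF _ abs_ge_self]\<close>)
  have "\<bar>kern_mean u\<bar> \<le> (\<integral>x. ?D x \<partial>lebesgue)"
    using order_trans[OF integral_norm_bound integral_mono[OF integrable_norm[OF I] D le]]
    unfolding kern_mean_def by (simp only: real_norm_def)
  also have "\<dots> = 2 * (\<eta> * measure lebesgue sector + \<eta> powr (1 - p) * Lp_pow p sector u)"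
    unfolding Lp_pow_integral(1)[OF s p0] using i Lp_pow_integral(2)[OF s p0] by simp
  also have "\<dots> \<le> 2 * (\<eta> * 4 + \<eta> powr (1 - p) * Lp_pow p sector u)"
    using sector_measure(2) \<eta> by (intro mult_left_mono add_right_mono) auto
  finally show "\<bar>kern_mean u\<bar> \<le> 8 * \<eta> + 2 * \<eta> powr (1 - p) * Lp_pow p sector u" by (simp add: algebra_simps)
qed

lemma kern_mean_diff:
  assumes "sobolev0 p sector u g" "sobolev0 p sector v h" "p \<ge> 1"
  shows "kern_mean (\<lambda>x. u x - v x) = kern_mean u - kern_mean v"
proof -
  have "kern x * zext sector (\<lambda>x. u x - v x) x = kern x * zext sector u x - kern x * zext sector v x" for x
    by (cases "x \<in> sector") (auto simp: right_diff_distrib)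
  then show ?thesis unfolding kern_mean_def
    using kern_mean_bound(1)[OF assms(1,3), of 1] kern_mean_bound(1)[OF assms(2,3), of 1] by simp
qed

lemma kern_mean_poincare:
  assumes s: "sobolev0 p sector u g" and p: "p \<ge> 1"
  shows "Lp_pow p sector u \<le> 10 * 0.265 powr p * energy p sector u + 2 powr p * \<bar>kern_mean u / (0.061 * (core_angle - 0.36))\<bar> powr p"
proof -
  have p0: "p > 0" using p by simp
  obtain \<phi> G H where d: "dominated_approx p sector u g \<phi> G H" using sobolev0_dominated[OF s p] by blast
  note t = dominated_approxD(1)[OF d] and H = dominated_approxD(2,3)[OF d] and ae = dominated_approxD(4)[OF d]
  have m[measurable]: "\<phi> n \<in> borel_measurable lebesgue" "G n \<in> borel_measurable lebesgue" for n
    using test_funD(3,4)[OF t] by (auto intro: borel_measurable_lebesgue)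
  note [measurable] = sobolev0_measurable[OF s] sector_measure(3)
  have L1: "(\<lambda>n. mass p (\<phi> n)) \<longlonglongrightarrow> Lp_pow p sector u"
    unfolding mass_integral[OF test_funD(3)[OF t]] Lp_pow_integral(1)[OF s p0] real_norm_def
  proof (rule integral_dominated_convergence[OF _ _ H(1)])
    show "AE x in lebesgue. (\<lambda>n. \<bar>\<phi> n x\<bar> powr p) \<longlonglongrightarrow> \<bar>zext sector u x\<bar> powr p"
      using ae by eventually_elim (use p in \<open>auto intro!: tendsto_powr' tendsto_rabs tendsto_const\<close>)
    show "AE x in lebesgue. norm (\<bar>\<phi> n x\<bar> powr p) \<le> H x" for n using ae by eventually_elim auto
  qed measurable
  have L2: "(\<lambda>n. mass p (G n)) \<longlonglongrightarrow> energy p sector u"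
    unfolding mass_integral[OF test_funD(4)[OF t]] energy_integral[OF s p bounded_sector]
  proof (rule integral_dominated_convergence[OF _ _ H(1)])
    show "AE x in lebesgue. (\<lambda>n. norm (G n x) powr p) \<longlonglongrightarrow> norm (zext sector g x) powr p"
      using ae by eventually_elim (use p in \<open>auto intro!: tendsto_powr' tendsto_norm tendsto_const\<close>)
    show "AE x in lebesgue. norm (norm (G n x) powr p) \<le> H x" for n using ae by eventually_elim auto
  qed measurable
  have "(\<lambda>n. \<integral>x. kern x * \<phi> n x \<partial>lebesgue) \<longlonglongrightarrow> kern_mean u"
    unfolding kern_mean_def
  proof (rule integral_dominated_convergence)
    show "integrable lebesgue (\<lambda>x. 2 * (indicator sector x + H x))"
      using H(1) sector_measure by (intro integrable_mult_right Bochner_Integration.integrable_add integrable_real_indicator) auto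
    show "AE x in lebesgue. (\<lambda>n. kern x * \<phi> n x) \<longlonglongrightarrow> kern x * zext sector u x"
      using ae by eventually_elim (auto intro: tendsto_mult_left)
    show "AE x in lebesgue. norm (kern x * \<phi> n x) \<le> 2 * (indicator sector x + H x)" for n
      using ae
    proof eventually_elim
      case (elim x)
      show ?case
      proof (cases "x \<in> sector")
        case True
        have "norm (kern x * \<phi> n x) \<le> 2 * \<bar>\<phi> n x\<bar>" using kern_bounds[of x] by (simp add: abs_mult mult_right_mono)
        also have "\<dots> \<le> 2 * (indicator sector x + H x)"
        proof -
          have "\<bar>\<phi> n x\<bar> powr p \<le> H x" using elim by blast
          then show ?thesis using le_young[of 1 p "\<bar>\<phi> n x\<bar>"] p True by simp
        qed
        finally show ?thesis .
      qed (use kern_bounds(3) H(2)[of x] in simp)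
    qed
  qed measurable
  moreover have "(\<integral>x. kern x * \<phi> n x \<partial>lebesgue) = (\<integral>x. kern x * \<phi> n x \<partial>lborel)" for n
    using test_funD(3)[OF t] kern_measurable
    by (intro integral_completion borel_measurable_times) (simp_all add: measurable_lborel1)
  ultimately have L3: "(\<lambda>n. \<integral>x. kern x * \<phi> n x \<partial>lborel) \<longlonglongrightarrow> kern_mean u" by simp
  show ?thesis
  proof (rule LIMSEQ_le[OF L1])
    show "(\<lambda>n. 10 * 0.265 powr p * mass p (G n) + 2 powr p * \<bar>(\<integral>x. kern x * \<phi> n x \<partial>lborel) / (0.061 * (core_angle - 0.36))\<bar> powr p)
      \<longlonglongrightarrow> 10 * 0.265 powr p * energy p sector u + 2 powr p * \<bar>kern_mean u / (0.061 * (core_angle - 0.36))\<bar> powr p"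
      using core_angle p by (intro tendsto_intros tendsto_powr' L2 L3) auto
    show "\<exists>N. \<forall>n\<ge>N. mass p (\<phi> n) \<le> 10 * 0.265 powr p * mass p (G n) + 2 powr p * \<bar>(\<integral>x. kern x * \<phi> n x \<partial>lborel) / (0.061 * (core_angle - 0.36))\<bar> powr p"
      using mean_zero_poincare[OF t p] by blast
  qed
qed

text \<open>The average is continuous and odd along the loop and the circle is connected, so it
  takes the value 0 between two antipodal points.\<close>

lemma admissible_kern_mean_zero:
  assumes h: "admissible TYPE(R2) p sector h" and p: "p \<ge> 1"
  shows "\<exists>x\<in>sphere 0 1. kern_mean (h x) = 0"
proof -
  have s: "\<exists>g. sobolev0 p sector (h x) g" if "x \<in> sphere 0 1" for x
    using h that by (auto simp: admissible_def Ssph_def in_W0_def)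
  have odd: "kern_mean (h (- x)) = - kern_mean (h x)" if "x \<in> sphere 0 1" for x
  proof -
    have "kern y * zext sector (h (- x)) y = - (kern y * zext sector (h x) y)" for y
      using h that by (cases "y \<in> sector") (auto simp: admissible_def)
    then show ?thesis by (simp add: kern_mean_def)
  qed
  have cont: "continuous_on (sphere 0 1) (\<lambda>x. kern_mean (h x))"
    unfolding continuous_on_iff
  proof (intro ballI allI impI)
    fix x :: R2 and e :: real assume x: "x \<in> sphere 0 1" and e: "e > 0"
    \<comment> \<open>With this \<eta> and the next \<kappa>, each of the two terms in
      \<open>kern_mean_bound\<close> is at most e / 4.\<close>
    define \<eta> where "\<eta> = e / 32"
    define \<kappa> where "\<kappa> = e / (8 * \<eta> powr (1 - p))"
    have \<eta>: "\<eta> > 0" and \<kappa>: "\<kappa> > 0" using e by (auto simp: \<eta>_def \<kappa>_def)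
    have "\<forall>e>0. \<exists>d>0. \<forall>y\<in>sphere 0 1. dist y x < d \<longrightarrow> W_norm p sector (\<lambda>z. h y z - h x z) < e"
      using h x unfolding admissible_def by blast
    moreover have "\<kappa> powr (1 / p) > 0" using \<kappa> by simp
    ultimately obtain d where d: "d > 0" "\<And>y. y \<in> sphere 0 1 \<Longrightarrow> dist y x < d \<Longrightarrow> W_norm p sector (\<lambda>z. h y z - h x z) < \<kappa> powr (1 / p)"
      by blast
    obtain g where g: "sobolev0 p sector (h x) g" using s[OF x] ..
    have "dist (kern_mean (h y)) (kern_mean (h x)) < e" if y: "y \<in> sphere 0 1" "dist y x < d" for y
    proof -
      obtain gy where gy: "sobolev0 p sector (h y) gy" using s[OF y(1)] ..
      let ?L = "Lp_pow p sector (\<lambda>z. h y z - h x z)" and ?E = "energy p sector (\<lambda>z. h y z - h x z)"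
      have nn: "?L \<ge> 0" "?E \<ge> 0" by (auto simp: Lp_pow_def energy_nonneg)
      have "(?L + ?E) powr (1 / p) < \<kappa> powr (1 / p)" using d(2)[OF y] by (simp add: W_norm_def)
      then have "?L + ?E < \<kappa>" using powr_mono2[of "1 / p" \<kappa> "?L + ?E"] \<kappa> p by (intro not_le_imp_less) auto
      then have "2 * \<eta> powr (1 - p) * ?L \<le> 2 * \<eta> powr (1 - p) * \<kappa>" using nn by (intro mult_left_mono) auto
      also have "\<dots> = e / 4" using \<eta> by (simp add: \<kappa>_def)
      finally have "\<bar>kern_mean (\<lambda>z. h y z - h x z)\<bar> \<le> e / 4 + e / 4"
        using kern_mean_bound(2)[OF sobolev0_diff[OF gy g p sector_borel] p \<eta>] by (simp add: \<eta>_def)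
      then show ?thesis using e unfolding kern_mean_diff[OF gy g p] by (simp add: dist_real_def)
    qed
    then show "\<exists>d>0. \<forall>x'\<in>sphere 0 1. dist x' x < d \<longrightarrow> dist (kern_mean (h x')) (kern_mean (h x)) < e" using d(1) by blast
  qed
  have conn: "connected ((\<lambda>x. kern_mean (h x)) ` sphere 0 1)"
    by (rule connected_continuous_image[OF cont], rule connected_sphere) simp
  obtain x :: R2 where x: "x \<in> sphere 0 1" by (metis equals0I sphere_eq_empty not_one_less_zero)
  then have x': "- x \<in> sphere 0 1" by simp
  have mem: "kern_mean (h x) \<in> (\<lambda>x. kern_mean (h x)) ` sphere 0 1" "- kern_mean (h x) \<in> (\<lambda>x. kern_mean (h x)) ` sphere 0 1"
    using x x' by (blast, intro image_eqI[of _ _ "- x"]) (simp_all add: odd[OF x])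
  have "0 \<in> (\<lambda>x. kern_mean (h x)) ` sphere 0 1"
  proof (cases "kern_mean (h x) \<ge> 0")
    case True
    then show ?thesis using connectedD_interval[OF conn mem(2,1), of 0] by simp
  next
    case False
    then show ?thesis using connectedD_interval[OF conn mem(1,2), of 0] by simp
  qed
  then show ?thesis by auto
qed

lemma lambda2_lower:
  assumes p: "p \<ge> 1"
  shows "1 / (10 * 0.265 powr p) \<le> lambda2 p sector"
proof (rule var_eig_ge[OF lambda2_upper(1)[OF p] p])
  fix h assume h: "admissible TYPE(R2) p sector h"
  obtain x where x: "x \<in> sphere 0 1" "kern_mean (h x) = 0" using admissible_kern_mean_zero[OF h p] by blast
  then have "h x \<in> Ssph p sector" using h by (simp add: admissible_def)
  then obtain g where g: "sobolev0 p sector (h x) g" "Lp_pow p sector (h x) = 1" by (auto simp: Ssph_def in_W0_def)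
  have "1 \<le> 10 * 0.265 powr p * energy p sector (h x)"
    using kern_mean_poincare[OF g(1) p] g(2) x(2) p by simp
  then have "1 / (10 * 0.265 powr p) \<le> energy p sector (h x)" by (simp add: field_simps)
  then show "\<exists>x\<in>sphere 0 1. 1 / (10 * 0.265 powr p) \<le> energy p sector (h x)" using x(1) by blast
qed

section \<open>Nodal domains\<close>

text \<open>The left side is at most the p-th power of the larger of a and b. It provides integrable
  majorants for the flux and the source term.\<close>

lemma powr_mixed_le:
  fixes a b p :: real
  assumes "a \<ge> 0" "b \<ge> 0" "p \<ge> 1"
  shows "a powr (p - 1) * b \<le> a powr p + b powr p"
proof (cases "b \<le> a")
  case True
  have "a powr (p - 1) * b \<le> a powr (p - 1) * a" using True by (intro mult_left_mono) auto
  also have "\<dots> = a powr p" using assms powr_mult_base[of a "p - 1"] by (simp add: mult.commute)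
  finally show ?thesis by (simp add: add_increasing2)
next
  case False
  have "a powr (p - 1) * b \<le> b powr (p - 1) * b" using False assms by (intro mult_right_mono powr_mono2) auto
  also have "\<dots> = b powr p" using assms powr_mult_base[of b "p - 1"] by (simp add: mult.commute)
  finally show ?thesis by (simp add: add_increasing)
qed

lemma integrable_test_powr:
  assumes t: "test_fun sector \<phi> G" and p: "p \<ge> 1"
  shows "integrable lebesgue (\<lambda>x. \<bar>\<phi> x\<bar> powr p)" "integrable lebesgue (\<lambda>x. norm (G x) powr p)"
proof -
  have [measurable]: "\<phi> \<in> borel_measurable lebesgue" "G \<in> borel_measurable lebesgue"
    using test_funD(3,4)[OF t] by (auto intro: borel_measurable_lebesgue)
  show "integrable lebesgue (\<lambda>x. \<bar>\<phi> x\<bar> powr p)" "integrable lebesgue (\<lambda>x. norm (G x) powr p)"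
    using integrable_test_fun[OF t _ bounded_sector, of p] p by (auto intro!: integrableI_bounded)
qed

text \<open>lam is abstract because the locale is entered for \<psi> and again for - \<psi>; the
  numerical bounds on lam appear only in the last section. The condition p >= 3 comes from Morrey's
  inequality.\<close>

locale sector_eigen =
  fixes p lam :: real and \<psi> :: "R2 \<Rightarrow> real"
  assumes p3: "p \<ge> 3" and lam: "lam \<ge> 0" and eig: "eigenfunction p sector lam \<psi>" and cont: "continuous_on sector \<psi>"
begin

abbreviation "U \<equiv> zext sector \<psi>"
abbreviation "g \<equiv> zext sector (wgrad p sector \<psi>)"

lemma p1: "p \<ge> 1" "p > 0" using p3 by auto

lemma sob: "sobolev0 p sector \<psi> (wgrad p sector \<psi>)"
  using eig by (auto simp: eigenfunction_def in_W0_def intro: sobolev0_wgrad)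

lemma Ug_measurable [measurable]: "U \<in> borel_measurable lebesgue" "g \<in> borel_measurable lebesgue"
  using sobolev0_measurable[OF sob] .

lemma approx:
  "\<exists>\<phi> G H. dominated_approx p sector \<psi> (wgrad p sector \<psi>) \<phi> G H \<and>
    (\<forall>e>0. \<forall>\<^sub>F n in sequentially. \<forall>x. \<bar>\<phi> n x - U x\<bar> \<le> e)"
  by (rule sobolev0_uniform[OF sob p3 cont])

text \<open>A uniform limit of test functions. Continuity across the boundary of the sector is the
  pointwise form of the Dirichlet condition.\<close>

lemma U_cont: "continuous_on UNIV U"
proof -
  obtain \<phi> G H where d: "dominated_approx p sector \<psi> (wgrad p sector \<psi>) \<phi> G H"
    and u: "\<forall>e>0. \<forall>\<^sub>F n in sequentially. \<forall>x. \<bar>\<phi> n x - U x\<bar> \<le> e" using approx by blast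
  show ?thesis
  proof (rule uniform_limit_theorem)
    show "\<forall>\<^sub>F n in sequentially. continuous_on UNIV (\<phi> n)"
      using C1_continuous[OF test_funD(1)[OF dominated_approxD(1)[OF d]]] by simp
    show "uniform_limit UNIV \<phi> U sequentially"
    proof (rule uniform_limitI)
      fix e :: real assume e: "e > 0"
      have "\<forall>\<^sub>F n in sequentially. \<forall>x. \<bar>\<phi> n x - U x\<bar> \<le> e / 2" by (rule u[rule_format]) (use e in simp)
      then show "\<forall>\<^sub>F n in sequentially. \<forall>x\<in>UNIV. dist (\<phi> n x) (U x) < e"
      proof eventually_elim
        case (elim n)
        have "dist (\<phi> n x) (U x) < e" for x using elim[rule_format, of x] e by (simp add: dist_real_def)
        then show ?case by simp
      qed
    qed
  qed simp
qed

lemma weak: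
  assumes "test_fun sector \<phi> G"
  shows "(\<integral>x. norm (g x) powr (p - 2) * (g x \<bullet> G x) \<partial>lebesgue) = lam * (\<integral>x. \<bar>U x\<bar> powr (p - 2) * U x * \<phi> x \<partial>lebesgue)"
proof -
  have 1: "indicator sector x *\<^sub>R (norm (wgrad p sector \<psi> x) powr (p - 2) * (wgrad p sector \<psi> x \<bullet> G x)) = norm (g x) powr (p - 2) * (g x \<bullet> G x)" for x
    by (cases "x \<in> sector") auto
  have 2: "indicator sector x *\<^sub>R (\<bar>\<psi> x\<bar> powr (p - 2) * \<psi> x * \<phi> x) = \<bar>U x\<bar> powr (p - 2) * U x * \<phi> x" for x
    by (cases "x \<in> sector") auto
  have "(\<integral>x\<in>sector. norm (wgrad p sector \<psi> x) powr (p - 2) * (wgrad p sector \<psi> x \<bullet> G x) \<partial>lebesgue)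
    = lam * (\<integral>x\<in>sector. \<bar>\<psi> x\<bar> powr (p - 2) * \<psi> x * \<phi> x \<partial>lebesgue)"
    using eig assms unfolding eigenfunction_def by blast
  then show ?thesis unfolding set_lebesgue_integral_def 1 2 .
qed

lemma flux_le: "\<bar>norm (v::R2) powr (p - 2) * (v \<bullet> w)\<bar> \<le> norm v powr (p - 1) * norm w"
proof -
  have "\<bar>norm v powr (p - 2) * (v \<bullet> w)\<bar> \<le> norm v powr (p - 2) * (norm v * norm w)"
    by (simp add: abs_mult mult_left_mono Cauchy_Schwarz_ineq2)
  also have "\<dots> = norm v powr (p - 1) * norm w" using powr_mult_base[of "norm v" "p - 2"] by (simp add: mult_ac)
  finally show ?thesis .
qed

lemma flux_self: "norm (v::R2) powr (p - 2) * (v \<bullet> v) = norm v powr p"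
  using powr_mult_base[of "norm v" "p - 2"] powr_mult_base[of "norm v" "p - 1"]
  by (simp add: power2_norm_eq_inner[symmetric] power2_eq_square mult_ac)

lemma flux_bound: "\<bar>norm (g x) powr (p - 2) * (g x \<bullet> w)\<bar> \<le> norm (g x) powr p + norm w powr p"
  by (rule order_trans[OF flux_le powr_mixed_le]) (use p1 in auto)

lemma source_bound: "\<bar>\<bar>U x\<bar> powr (p - 2) * U x * y\<bar> \<le> \<bar>U x\<bar> powr p + \<bar>y\<bar> powr p"
proof -
  have "\<bar>\<bar>U x\<bar> powr (p - 2) * U x * y\<bar> = \<bar>U x\<bar> powr (p - 1) * \<bar>y\<bar>"
    using powr_mult_base[of "\<bar>U x\<bar>" "p - 2"] by (simp add: abs_mult mult_ac)
  also have "\<dots> \<le> \<bar>U x\<bar> powr p + \<bar>y\<bar> powr p" using p1 by (intro powr_mixed_le) auto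
  finally show ?thesis .
qed

lemma dominated_AE:
  assumes d: "dominated_approx p sector \<psi> (wgrad p sector \<psi>) \<phi> G H"
  shows "AE x in lebesgue. (\<lambda>n. \<phi> n x) \<longlonglongrightarrow> U x \<and> (\<lambda>n. G n x) \<longlonglongrightarrow> g x \<and>
    (\<forall>n. \<bar>\<phi> n x\<bar> powr p \<le> H x \<and> norm (G n x) powr p \<le> H x) \<and> \<bar>U x\<bar> powr p \<le> H x \<and> norm (g x) powr p \<le> H x"
  using dominated_approxD(4)[OF d]
proof eventually_elim
  case (elim x)
  have "(\<lambda>n. \<bar>\<phi> n x\<bar> powr p) \<longlonglongrightarrow> \<bar>U x\<bar> powr p" "(\<lambda>n. norm (G n x) powr p) \<longlonglongrightarrow> norm (g x) powr p"
    using elim p1 by (auto intro!: tendsto_powr' tendsto_rabs tendsto_norm tendsto_const)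
  then have "\<bar>U x\<bar> powr p \<le> H x" "norm (g x) powr p \<le> H x"
    using elim by (auto intro: LIMSEQ_le_const2)
  then show ?case using elim by blast
qed

text \<open>Testing the equation with psi restricted to D. By Morrey the approximants converge uniformly, so
  after truncation near zero their restrictions to D are admissible test functions.\<close>
lemma nodal_domain_eigenvalue:
  assumes D: "open D" "D \<subseteq> sector" and bd: "\<And>x. x \<in> closure D \<Longrightarrow> x \<notin> D \<Longrightarrow> U x = 0"
    and nz: "\<exists>x\<in>D. \<psi> x \<noteq> 0" and poin: "poincare_on p D \<kappa>" and \<kappa>: "\<kappa> \<ge> 0"
  shows "1 \<le> \<kappa> * lam"
proof -
  obtain \<phi> G H where d: "dominated_approx p sector \<psi> (wgrad p sector \<psi>) \<phi> G H"
    and u: "\<forall>e>0. \<forall>\<^sub>F n in sequentially. \<forall>x. \<bar>\<phi> n x - U x\<bar> \<le> e" using approx by blast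
  note t = dominated_approxD(1)[OF d] and H = dominated_approxD(2,3)[OF d] and ae0 = dominated_approxD(4)[OF d]
  have [measurable]: "\<phi> n \<in> borel_measurable lebesgue" "G n \<in> borel_measurable lebesgue" for n
    using test_funD(3,4)[OF t] by (auto intro: borel_measurable_lebesgue)
  have Dm[measurable]: "D \<in> sets lebesgue" using D(1) by simp
  note ae = dominated_AE[OF d]
  define A where "A = (\<integral>x. indicator D x * \<bar>U x\<bar> powr p \<partial>lebesgue)"
  have iH2: "integrable lebesgue (\<lambda>x. 2 * H x)" using H by simp
  have iA: "integrable lebesgue (\<lambda>x. indicator D x * \<bar>U x\<bar> powr p)"
    using integrable_mult_indicator[OF Dm Lp_pow_integral(2)[OF sob p1(2)]] by simp
  have step: "(\<integral>x. indicator D x * \<bar>trunc \<epsilon> (U x)\<bar> powr p \<partial>lebesgue) \<le> \<kappa> * (lam * A)" if e: "\<epsilon> > 0" for \<epsilon>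
  proof -
    note tr = trunc[OF e]
    define v where "v n x = indicator D x * trunc \<epsilon> (\<phi> n x)" for n x
    define V where "V n x = (indicator D x * trunc' \<epsilon> (\<phi> n x)) *\<^sub>R G n x" for n x
    have ctr: "continuous_on UNIV (trunc \<epsilon>)" using tr(1) by (meson DERIV_isCont continuous_at_imp_continuous_on)
    have [measurable]: "trunc \<epsilon> \<in> borel_measurable borel" "trunc' \<epsilon> \<in> borel_measurable borel"
      using ctr tr(2)[of UNIV] by (auto intro: borel_measurable_continuous_onI)
    have "\<forall>\<^sub>F n in sequentially. \<forall>x. \<bar>\<phi> n x - U x\<bar> \<le> \<epsilon> / 2" by (rule u[rule_format]) (use e in simp)
    \<comment> \<open>The support of v n lies in the closure of D and, \<phi> n being within
      \<epsilon> / 2 of U, in the closed set |U| >= \<epsilon> / 2. Since U vanishes on the boundary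
      of D, the support stays inside D, and v n is C^1 although it is cut off along that
      boundary.\<close>
    then have tv: "\<forall>\<^sub>F n in sequentially. test_fun D (v n) (V n)"
    proof eventually_elim
      case (elim n)
      let ?K = "{x. \<bar>U x\<bar> \<ge> \<epsilon> / 2}" and ?S = "closure {x. v n x \<noteq> 0}"
      have clK: "closed ?K" using U_cont by (intro closed_Collect_le continuous_intros) auto
      have sub: "{x. v n x \<noteq> 0} \<subseteq> D \<inter> ?K"
      proof
        fix x assume x: "x \<in> {x. v n x \<noteq> 0}"
        then have "x \<in> D" by (auto simp: v_def indicator_def)
        moreover have "\<not> \<bar>\<phi> n x\<bar> \<le> \<epsilon>" using x tr(3)[of "\<phi> n x"] by (auto simp: v_def)
        then have "\<bar>U x\<bar> \<ge> \<epsilon> / 2" using elim[rule_format, of x] by linarith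
        ultimately show "x \<in> D \<inter> ?K" by simp
      qed
      then have SD: "?S \<subseteq> closure D" "?S \<subseteq> ?K" using closure_mono[OF sub] closure_minimal[OF _ clK] by (auto intro: closure_mono[THEN subsetD])
      have SsubD: "?S \<subseteq> D"
      proof
        fix x assume x: "x \<in> ?S"
        then have "\<bar>U x\<bar> \<ge> \<epsilon> / 2" "x \<in> closure D" using SD by auto
        then show "x \<in> D" using bd[of x] e by (cases "x \<in> D") auto
      qed
      have comp: "compact ?S"
        using SsubD D(2) bounded_subset[OF bounded_sector, of ?S] by (simp add: compact_eq_bounded_closed)
      have zero: "V n x = 0" "v n x = 0" if "x \<notin> ?S" for x
      proof -
        show vz: "v n x = 0" using that closure_subset[of "{x. v n x \<noteq> 0}"] by auto
        show "V n x = 0"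
        proof (cases "x \<in> D")
          case True
          have "trunc \<epsilon> (\<phi> n y) = 0" if "y \<in> D \<inter> - ?S" for y
          proof -
            have "v n y = 0" using that closure_subset[of "{x. v n x \<noteq> 0}"] by auto
            then show ?thesis using that by (simp add: v_def)
          qed
          then have "((\<lambda>_. 0) has_derivative (\<lambda>h. trunc' \<epsilon> (\<phi> n x) * (G n x \<bullet> h))) (at x)"
          proof -
            assume z: "\<And>y. y \<in> D \<inter> - ?S \<Longrightarrow> trunc \<epsilon> (\<phi> n y) = 0"
            have "((\<lambda>x. trunc \<epsilon> (\<phi> n x)) has_derivative (\<lambda>h. trunc' \<epsilon> (\<phi> n x) * (G n x \<bullet> h))) (at x)"
              using has_derivative_compose[OF test_funD(1)[OF t] tr(1)[unfolded has_field_derivative_def]] .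
            then show ?thesis
              by (rule has_derivative_transform_within_open[OF _ open_Int[OF D(1) open_Compl[OF closed_closure]]])
                (use z that True in auto)
          qed
          then have "(\<lambda>h. trunc' \<epsilon> (\<phi> n x) * (G n x \<bullet> h)) = (\<lambda>h. 0)" by (rule has_derivative_unique) simp
          then have "trunc' \<epsilon> (\<phi> n x) * (G n x \<bullet> G n x) = 0" by meson
          then show ?thesis by (auto simp: V_def)
        qed (simp add: V_def)
      qed
      have deriv: "(v n has_derivative (\<lambda>h. V n x \<bullet> h)) (at x)" for x
      proof (cases "x \<in> D")
        case True
        have "((\<lambda>x. trunc \<epsilon> (\<phi> n x)) has_derivative (\<lambda>h. trunc' \<epsilon> (\<phi> n x) * (G n x \<bullet> h))) (at x)"
          using has_derivative_compose[OF test_funD(1)[OF t] tr(1)[unfolded has_field_derivative_def]] .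
        then have "(v n has_derivative (\<lambda>h. trunc' \<epsilon> (\<phi> n x) * (G n x \<bullet> h))) (at x)"
          by (rule has_derivative_transform_within_open[OF _ D(1) True]) (simp add: v_def)
        then show ?thesis using True by (simp add: V_def)
      next
        case False
        then have x: "x \<in> - ?S" using SsubD by auto
        have "((\<lambda>_. 0::real) has_derivative (\<lambda>h. 0)) (at x)" by simp
        then have "(v n has_derivative (\<lambda>h. 0)) (at x)"
          by (rule has_derivative_transform_within_open[OF _ open_Compl[OF closed_closure] x]) (rule zero(2)[symmetric], rule ComplD)
        then show ?thesis using False by (simp add: V_def)
      qed
      have cV: "continuous_on UNIV (V n)"
      proof -
        have "continuous_on D (V n) \<longleftrightarrow> continuous_on D (\<lambda>x. trunc' \<epsilon> (\<phi> n x) *\<^sub>R G n x)"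
          by (intro continuous_on_cong) (auto simp: V_def)
        moreover have "continuous_on D (\<lambda>x. trunc' \<epsilon> (\<phi> n x) *\<^sub>R G n x)"
          by (intro continuous_intros continuous_on_compose2[OF tr(2)[of UNIV]]
              continuous_on_subset[OF C1_continuous[OF test_funD(1)[OF t]]] continuous_on_subset[OF test_funD(2)[OF t]]) auto
        moreover have "continuous_on (- ?S) (V n) \<longleftrightarrow> continuous_on (- ?S) (\<lambda>x. 0 :: R2)"
          by (intro continuous_on_cong) (use zero(1) in auto)
        ultimately have "continuous_on (D \<union> - ?S) (V n)" using D(1) by (intro continuous_on_open_Un) auto
        moreover have "D \<union> - ?S = UNIV" using SsubD by auto
        ultimately show ?thesis by simp
      qed
      show ?case unfolding test_fun_def using deriv cV comp SsubD by blast
    qed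
    have L1: "(\<lambda>n. mass p (v n)) \<longlonglongrightarrow> (\<integral>x. indicator D x * \<bar>trunc \<epsilon> (U x)\<bar> powr p \<partial>lebesgue)"
    proof -
      have "(\<lambda>n. \<integral>x. indicator D x * \<bar>trunc \<epsilon> (\<phi> n x)\<bar> powr p \<partial>lebesgue) \<longlonglongrightarrow> (\<integral>x. indicator D x * \<bar>trunc \<epsilon> (U x)\<bar> powr p \<partial>lebesgue)"
      proof (rule integral_dominated_convergence[OF _ _ H(1)])
        show "AE x in lebesgue. (\<lambda>n. indicator D x * \<bar>trunc \<epsilon> (\<phi> n x)\<bar> powr p) \<longlonglongrightarrow> indicator D x * \<bar>trunc \<epsilon> (U x)\<bar> powr p"
          using ae
        proof eventually_elim
          case (elim x)
          have "(\<lambda>n. trunc \<epsilon> (\<phi> n x)) \<longlonglongrightarrow> trunc \<epsilon> (U x)"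
            using elim ctr by (intro continuous_on_tendsto_compose[OF ctr]) auto
          then show ?case using p1 by (auto intro!: tendsto_mult_left tendsto_powr' tendsto_rabs)
        qed
        show "AE x in lebesgue. norm (indicator D x * \<bar>trunc \<epsilon> (\<phi> n x)\<bar> powr p) \<le> H x" for n
          using ae
        proof eventually_elim
          case (elim x)
          have "\<bar>trunc \<epsilon> (\<phi> n x)\<bar> powr p \<le> \<bar>\<phi> n x\<bar> powr p" using tr(5) p1 by (intro powr_mono2) auto
          then show ?case using elim H(2)[of x] by (auto simp: indicator_def intro: order_trans)
        qed
      qed measurable
      moreover have "mass p (v n) = (\<integral>x. indicator D x * \<bar>trunc \<epsilon> (\<phi> n x)\<bar> powr p \<partial>lebesgue)" for n
      proof -
        have "v n \<in> borel_measurable borel" unfolding v_def[abs_def]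
          by (intro borel_measurable_times borel_measurable_indicator measurable_compose[OF test_funD(3)[OF t] borel_measurable_continuous_onI[OF ctr]]) (use D(1) in auto)
        then show ?thesis using p1 by (subst mass_integral) (auto intro!: Bochner_Integration.integral_cong simp: v_def indicator_def)
      qed
      ultimately show ?thesis by simp
    qed
    note gG = flux_bound
    \<comment> \<open>The weak equation produces \<open>trunc'\<close> to the first power, the
      energy of v n contains it to the power p. Since \<open>trunc'\<close> lies between 0 and 1 the
      energy is the smaller of the two in the limit, and I bounds it.\<close>
    define I where "I = (\<integral>x. indicator D x * trunc' \<epsilon> (U x) * norm (g x) powr p \<partial>lebesgue)"
    have trl: "(\<lambda>n. trunc' \<epsilon> (\<phi> n x)) \<longlonglongrightarrow> trunc' \<epsilon> (U x)" if "(\<lambda>n. \<phi> n x) \<longlonglongrightarrow> U x" for x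
      using that by (intro continuous_on_tendsto_compose[OF tr(2)[of UNIV]]) auto
    have c01: "0 \<le> indicator D x * trunc' \<epsilon> y" "indicator D x * trunc' \<epsilon> y \<le> 1" for x y
      using tr(7,8) by (auto simp: indicator_def)
    have L2: "(\<lambda>n. \<integral>x. indicator D x * trunc' \<epsilon> (\<phi> n x) * norm (G n x) powr p \<partial>lebesgue) \<longlonglongrightarrow> I"
      unfolding I_def
    proof (rule integral_dominated_convergence[OF _ _ H(1)])
      show "AE x in lebesgue. (\<lambda>n. indicator D x * trunc' \<epsilon> (\<phi> n x) * norm (G n x) powr p) \<longlonglongrightarrow> indicator D x * trunc' \<epsilon> (U x) * norm (g x) powr p"
        using ae by eventually_elim (use p1 in \<open>auto intro!: tendsto_mult tendsto_powr' tendsto_norm trl tendsto_const\<close>)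
      show "AE x in lebesgue. norm (indicator D x * trunc' \<epsilon> (\<phi> n x) * norm (G n x) powr p) \<le> H x" for n
        using ae
      proof eventually_elim
        case (elim x)
        have "norm (indicator D x * trunc' \<epsilon> (\<phi> n x) * norm (G n x) powr p) \<le> 1 * norm (G n x) powr p"
          using c01[of x "\<phi> n x"] mult_right_mono[OF c01(2)[of x "\<phi> n x"] powr_ge_zero[of "norm (G n x)" p]]
          by (simp only: real_norm_def abs_of_nonneg mult_nonneg_nonneg powr_ge_zero)
        then show ?case using elim by (auto intro: order_trans)
      qed
    qed measurable
    have L3: "(\<lambda>n. \<integral>x. norm (g x) powr (p - 2) * (g x \<bullet> V n x) \<partial>lebesgue) \<longlonglongrightarrow> I"
      unfolding I_def
    proof (rule integral_dominated_convergence[OF _ _ iH2])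
      show "AE x in lebesgue. (\<lambda>n. norm (g x) powr (p - 2) * (g x \<bullet> V n x)) \<longlonglongrightarrow> indicator D x * trunc' \<epsilon> (U x) * norm (g x) powr p"
        using ae
      proof eventually_elim
        case (elim x)
        have "(\<lambda>n. norm (g x) powr (p - 2) * (g x \<bullet> V n x)) \<longlonglongrightarrow> norm (g x) powr (p - 2) * (g x \<bullet> ((indicator D x * trunc' \<epsilon> (U x)) *\<^sub>R g x))"
          unfolding V_def using elim by (intro tendsto_intros trl) auto
        then show ?case using flux_self[of "g x"] by (simp add: mult_ac)
      qed
      show "AE x in lebesgue. norm (norm (g x) powr (p - 2) * (g x \<bullet> V n x)) \<le> 2 * H x" for n
        using ae
      proof eventually_elim
        case (elim x)
        have "norm (V n x) powr p \<le> norm (G n x) powr p"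
          using c01[of x "\<phi> n x"] p1 by (intro powr_mono2) (auto simp: V_def mult_left_le_one_le)
        moreover have "norm (G n x) powr p \<le> H x" "norm (g x) powr p \<le> H x" using elim by auto
        ultimately show ?case using gG[of x "V n x"] unfolding real_norm_def by linarith
      qed
      show "(\<lambda>x. norm (g x) powr (p - 2) * (g x \<bullet> V n x)) \<in> borel_measurable lebesgue" for n unfolding V_def by measurable
    qed measurable
    define J where "J = (\<integral>x. \<bar>U x\<bar> powr (p - 2) * U x * (indicator D x * trunc \<epsilon> (U x)) \<partial>lebesgue)"
    note UU = source_bound
    have L4: "(\<lambda>n. \<integral>x. \<bar>U x\<bar> powr (p - 2) * U x * v n x \<partial>lebesgue) \<longlonglongrightarrow> J"
      unfolding J_def
    proof (rule integral_dominated_convergence[OF _ _ iH2])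
      show "AE x in lebesgue. (\<lambda>n. \<bar>U x\<bar> powr (p - 2) * U x * v n x) \<longlonglongrightarrow> \<bar>U x\<bar> powr (p - 2) * U x * (indicator D x * trunc \<epsilon> (U x))"
        using ae
      proof eventually_elim
        case (elim x)
        have "(\<lambda>n. trunc \<epsilon> (\<phi> n x)) \<longlonglongrightarrow> trunc \<epsilon> (U x)"
          using elim ctr by (intro continuous_on_tendsto_compose[OF ctr]) auto
        then show ?case unfolding v_def by (intro tendsto_intros)
      qed
      show "AE x in lebesgue. norm (\<bar>U x\<bar> powr (p - 2) * U x * v n x) \<le> 2 * H x" for n
        using ae
      proof eventually_elim
        case (elim x)
        have "\<bar>v n x\<bar> powr p \<le> \<bar>\<phi> n x\<bar> powr p"
          using tr(5)[of "\<phi> n x"] p1 by (intro powr_mono2) (auto simp: v_def indicator_def)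
        moreover have "\<bar>\<phi> n x\<bar> powr p \<le> H x" "\<bar>U x\<bar> powr p \<le> H x" using elim by auto
        ultimately show ?case using UU[of x "v n x"] unfolding real_norm_def by linarith
      qed
      show "(\<lambda>x. \<bar>U x\<bar> powr (p - 2) * U x * v n x) \<in> borel_measurable lebesgue" for n unfolding v_def by measurable
    qed measurable
    have ev: "\<forall>\<^sub>F n in sequentially. (\<integral>x. norm (g x) powr (p - 2) * (g x \<bullet> V n x) \<partial>lebesgue) = lam * (\<integral>x. \<bar>U x\<bar> powr (p - 2) * U x * v n x \<partial>lebesgue)"
      using tv by eventually_elim (rule weak, rule test_fun_mono[OF _ D(2)])
    have "(\<lambda>n. \<integral>x. norm (g x) powr (p - 2) * (g x \<bullet> V n x) \<partial>lebesgue) \<longlonglongrightarrow> lam * J"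
      by (rule Lim_transform_eventually[OF tendsto_mult_left[OF L4] eventually_mono[OF ev]]) (rule sym)
    then have IJ: "I = lam * J" by (rule LIMSEQ_unique[OF L3])
    have "J \<le> A" unfolding J_def A_def
    proof (rule integral_mono[OF _ iA])
      show "integrable lebesgue (\<lambda>x. \<bar>U x\<bar> powr (p - 2) * U x * (indicator D x * trunc \<epsilon> (U x)))"
      proof (rule Bochner_Integration.integrable_bound[OF iH2])
        show "AE x in lebesgue. norm (\<bar>U x\<bar> powr (p - 2) * U x * (indicator D x * trunc \<epsilon> (U x))) \<le> norm (2 * H x)"
          using ae
        proof eventually_elim
          case (elim x)
          have "\<bar>indicator D x * trunc \<epsilon> (U x)\<bar> powr p \<le> \<bar>U x\<bar> powr p"
            using tr(5)[of "U x"] p1 by (intro powr_mono2) (auto simp: indicator_def)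
          moreover have "\<bar>U x\<bar> powr p \<le> H x" using elim by auto
          ultimately show ?case using UU[of x "indicator D x * trunc \<epsilon> (U x)"] unfolding real_norm_def by linarith
        qed
      qed measurable
      fix x
      have "\<bar>U x\<bar> powr (p - 2) * U x * trunc \<epsilon> (U x) \<le> \<bar>U x\<bar> powr (p - 2) * (\<bar>U x\<bar> * \<bar>U x\<bar>)"
        using tr(5)[of "U x"] abs_ge_self[of "U x * trunc \<epsilon> (U x)"] mult_left_mono[OF tr(5)[of "U x"] abs_ge_zero[of "U x"]]
        by (simp only: mult.assoc) (intro mult_left_mono, auto simp: abs_mult)
      also have "\<dots> = \<bar>U x\<bar> powr p"
        using powr_mult_base[of "\<bar>U x\<bar>" "p - 2"] powr_mult_base[of "\<bar>U x\<bar>" "p - 1"] by (simp only: mult_ac) simp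
      finally show "\<bar>U x\<bar> powr (p - 2) * U x * (indicator D x * trunc \<epsilon> (U x)) \<le> indicator D x * \<bar>U x\<bar> powr p"
        by (simp add: indicator_def)
    qed
    then have "\<kappa> * I \<le> \<kappa> * (lam * A)" unfolding IJ using lam \<kappa> by (intro mult_left_mono) auto
    moreover have "(\<integral>x. indicator D x * \<bar>trunc \<epsilon> (U x)\<bar> powr p \<partial>lebesgue) \<le> \<kappa> * I"
    proof (rule LIMSEQ_le[OF L1 tendsto_mult_left[OF L2]])
      have "\<forall>\<^sub>F n in sequentially. mass p (v n) \<le> \<kappa> * (\<integral>x. indicator D x * trunc' \<epsilon> (\<phi> n x) * norm (G n x) powr p \<partial>lebesgue)"
        using tv
      proof eventually_elim
        case (elim n)
        note ts = test_fun_mono[OF elim D(2)]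
        have "ennreal (mass p (v n)) \<le> ennreal \<kappa> * ennreal (mass p (V n))"
          using poin elim unfolding poincare_on_def mass_eq(1,2)[OF ts p1(1)] by blast
        then have "mass p (v n) \<le> \<kappa> * mass p (V n)" using \<kappa> by (simp add: mass_nonneg flip: ennreal_mult)
        also have "mass p (V n) \<le> (\<integral>x. indicator D x * trunc' \<epsilon> (\<phi> n x) * norm (G n x) powr p \<partial>lebesgue)"
          unfolding mass_integral[OF test_funD(4)[OF elim]]
        proof (rule integral_mono)
          show "integrable lebesgue (\<lambda>x. norm (V n x) powr p)" by (rule integrable_test_powr(2)[OF ts p1(1)])
          have iG: "integrable lebesgue (\<lambda>x. norm (G n x) powr p)" by (rule integrable_test_powr(2)[OF t p1(1)])
          show "integrable lebesgue (\<lambda>x. indicator D x * trunc' \<epsilon> (\<phi> n x) * norm (G n x) powr p)"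
          proof (rule Bochner_Integration.integrable_bound[OF iG])
            have "norm (indicator D x * trunc' \<epsilon> (\<phi> n x) * norm (G n x) powr p) \<le> norm (norm (G n x) powr p)" for x
              using c01[of x "\<phi> n x"] mult_right_mono[OF c01(2)[of x "\<phi> n x"] powr_ge_zero[of "norm (G n x)" p]]
              by (simp only: real_norm_def abs_of_nonneg mult_nonneg_nonneg powr_ge_zero mult_1)
            then show "AE x in lebesgue. norm (indicator D x * trunc' \<epsilon> (\<phi> n x) * norm (G n x) powr p) \<le> norm (norm (G n x) powr p)"
              by (rule AE_I2)
          qed measurable
          fix x
          have "(indicator D x * trunc' \<epsilon> (\<phi> n x)) powr p \<le> (indicator D x * trunc' \<epsilon> (\<phi> n x)) powr 1"
            using c01[of x "\<phi> n x"] p1 by (intro powr_mono') auto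
          then show "norm (V n x) powr p \<le> indicator D x * trunc' \<epsilon> (\<phi> n x) * norm (G n x) powr p"
            using c01[of x "\<phi> n x"] by (simp add: V_def powr_mult mult_right_mono)
        qed
        finally show ?case using \<kappa> by (simp add: mult_left_mono)
      qed
      then show "\<exists>N. \<forall>n\<ge>N. mass p (v n) \<le> \<kappa> * (\<integral>x. indicator D x * trunc' \<epsilon> (\<phi> n x) * norm (G n x) powr p \<partial>lebesgue)"
        by (simp add: eventually_sequentially)
    qed
    ultimately show ?thesis by linarith
  qed
  have lim: "(\<lambda>k. \<integral>x. indicator D x * \<bar>trunc (1 / real (Suc k)) (U x)\<bar> powr p \<partial>lebesgue) \<longlonglongrightarrow> A"
    unfolding A_def
  proof (rule integral_dominated_convergence[OF _ _ iA])
    have e: "1 / real (Suc k) > 0" for k by simp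
    show "(\<lambda>x. indicator D x * \<bar>trunc (1 / real (Suc k)) (U x)\<bar> powr p) \<in> borel_measurable lebesgue" for k
    proof -
      have "continuous_on UNIV (trunc (1 / real (Suc k)))" using trunc(1)[OF e] by (meson DERIV_isCont continuous_at_imp_continuous_on)
      then have [measurable]: "trunc (1 / real (Suc k)) \<in> borel_measurable borel" by (rule borel_measurable_continuous_onI)
      show ?thesis by measurable
    qed
    have "(\<lambda>k. trunc (1 / real (Suc k)) y) \<longlonglongrightarrow> y" for y
    proof (rule LIM_zero_cancel, rule tendsto_rabs_zero_cancel, rule tendsto_sandwich[OF _ _ tendsto_const])
      show "\<forall>\<^sub>F k in sequentially. \<bar>trunc (1 / real (Suc k)) y - y\<bar> \<le> 2 * (1 / real (Suc k))"
        using trunc(6)[OF e] by (intro always_eventually allI)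
      show "(\<lambda>k. 2 * (1 / real (Suc k))) \<longlonglongrightarrow> 0"
        using tendsto_mult_right_zero[OF LIMSEQ_inverse_real_of_nat, of 2] by (simp add: inverse_eq_divide)
    qed simp
    then show "AE x in lebesgue. (\<lambda>k. indicator D x * \<bar>trunc (1 / real (Suc k)) (U x)\<bar> powr p) \<longlonglongrightarrow> indicator D x * \<bar>U x\<bar> powr p"
      using p1 by (intro AE_I2 tendsto_mult_left tendsto_powr' tendsto_rabs tendsto_const) auto
    show "AE x in lebesgue. norm (indicator D x * \<bar>trunc (1 / real (Suc k)) (U x)\<bar> powr p) \<le> indicator D x * \<bar>U x\<bar> powr p" for k
      using trunc(5)[OF e] p1 by (intro AE_I2) (auto simp: indicator_def intro!: powr_mono2)
  qed measurable
  have AA: "A \<le> \<kappa> * (lam * A)"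
    by (rule LIMSEQ_le_const2[OF lim]) (use step in auto)
  \<comment> \<open>Otherwise the nonempty open set of points of D with U different from 0 would be
    null.\<close>
  have "A > 0"
  proof (rule ccontr)
    assume "\<not> A > 0"
    moreover have "A \<ge> 0" unfolding A_def by (intro Bochner_Integration.integral_nonneg) auto
    ultimately have "A = 0" by simp
    then have "AE x in lebesgue. indicator D x * \<bar>U x\<bar> powr p = 0"
      unfolding A_def by (subst (asm) integral_nonneg_eq_0_iff_AE[OF iA]) auto
    then have "AE x in lborel. x \<notin> {x \<in> D. U x \<noteq> 0}" unfolding AE_lebesgue_iff by eventually_elim auto
    moreover have op: "open {x \<in> D. U x \<noteq> 0}"
    proof -
      have "open (D \<inter> {x. U x \<noteq> 0})" using D(1) U_cont by (intro open_Int open_Collect_neq continuous_intros) auto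
      then show ?thesis by (simp add: Collect_conj_eq)
    qed
    ultimately have "emeasure lborel {x \<in> D. U x \<noteq> 0} = 0"
      by (subst (asm) AE_iff_measurable[of "{x \<in> D. U x \<noteq> 0}"]) auto
    then have "{x \<in> D. U x \<noteq> 0} \<in> null_sets lborel" using op by (intro null_setsI) auto
    then have "negligible {x \<in> D. U x \<noteq> 0}" using negligible_iff_null_sets null_sets_completionI by blast
    then have "{x \<in> D. U x \<noteq> 0} = {}" using op open_not_negligible by blast
    then show False using nz D(2) by force
  qed
  then have "1 * A \<le> (\<kappa> * lam) * A" using AA by (simp add: mult.assoc)
  then show ?thesis using \<open>A > 0\<close> by (rule mult_right_le_imp_le)
qed

end

section \<open>Nonnegative eigenfunctions\<close>

text \<open>A finite sum of scaled bumps over a cover of K. With smoothing parameter r / 4 a bump of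
  radius r is at least r - 2 r / 4 - r / 4 = r / 4 on the disc of radius r / 4, so the factor 4 / r
  lifts it to 1 there.\<close>

lemma test_fun_cutoff:
  assumes K: "compact K" "K \<subseteq> \<Omega>" and O: "open \<Omega>"
  shows "\<exists>\<eta> Z. test_fun \<Omega> \<eta> Z \<and> (\<forall>x. \<eta> x \<ge> 0) \<and> (\<forall>x\<in>K. \<eta> x \<ge> 1)"
proof -
  have "\<forall>x\<in>K. \<exists>r>0. cball x r \<subseteq> \<Omega>" using K O open_contains_cball by blast
  from bchoice[OF this] obtain r where r: "\<And>x. x \<in> K \<Longrightarrow> r x > 0" "\<And>x. x \<in> K \<Longrightarrow> cball x (r x) \<subseteq> \<Omega>" by blast
  have "\<exists>T\<subseteq>K. finite T \<and> K \<subseteq> (\<Union>x\<in>T. ball x (r x / 4))"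
  proof (rule compactE_image[OF K(1), of K "\<lambda>x. ball x (r x / 4)"])
    show "K \<subseteq> (\<Union>x\<in>K. ball x (r x / 4))" using r(1) by force
  qed auto
  then obtain T where T: "T \<subseteq> K" "finite T" "K \<subseteq> (\<Union>x\<in>T. ball x (r x / 4))" by blast
  have "\<exists>\<eta> Z. test_fun \<Omega> \<eta> Z \<and> (\<forall>x. \<eta> x \<ge> 0) \<and> (\<forall>y\<in>(\<Union>x\<in>T. ball x (r x / 4)). \<eta> y \<ge> 1)"
    using T(2,1)
  proof (induction T rule: finite_induct)
    case empty
    have "test_fun \<Omega> (\<lambda>_. 0) (\<lambda>_. 0)" by (simp add: test_fun_def)
    then show ?case by (intro exI[of _ "\<lambda>_. 0"]) auto
  next
    case (insert c T)
    then have "\<exists>\<eta> Z. test_fun \<Omega> \<eta> Z \<and> (\<forall>x. \<eta> x \<ge> 0) \<and> (\<forall>y\<in>(\<Union>x\<in>T. ball x (r x / 4)). \<eta> y \<ge> 1)" by blast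
    then obtain \<eta> Z where \<eta>: "test_fun \<Omega> \<eta> Z" "\<And>x. \<eta> x \<ge> 0" "\<And>y. y \<in> (\<Union>x\<in>T. ball x (r x / 4)) \<Longrightarrow> \<eta> y \<ge> 1" by blast
    have rc: "r c > 0" "cball c (r c) \<subseteq> \<Omega>" using r insert.prems by auto
    then have e: "r c / 4 > 0" by simp
    note b = bump[OF e rc(1), of c]
    have t: "test_fun \<Omega> (\<lambda>x. 1 * \<eta> x + (4 / r c) * bump (r c / 4) c (r c) x) (\<lambda>x. 1 *\<^sub>R Z x + (4 / r c) *\<^sub>R bump' (r c / 4) c (r c) x)"
      by (rule test_fun_combine[OF \<eta>(1) test_fun_bump[OF e rc]])
    have nn: "(4 / r c) * bump (r c / 4) c (r c) x \<ge> 0" for x using b(6) rc(1) by simp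
    have "1 * \<eta> y + (4 / r c) * bump (r c / 4) c (r c) y \<ge> 1" if y: "y \<in> (\<Union>x\<in>insert c T. ball x (r x / 4))" for y
    proof (cases "y \<in> ball c (r c / 4)")
      case True
      then have "bump (r c / 4) c (r c) y \<ge> r c / 4" using b(5)[of y] by simp
      then have "(4 / r c) * bump (r c / 4) c (r c) y \<ge> 1" using rc(1) by (simp add: field_simps)
      then show ?thesis using \<eta>(2)[of y] by linarith
    next
      case False
      then have "\<eta> y \<ge> 1" using y by (intro \<eta>(3)) auto
      then show ?thesis using nn[of y] by linarith
    qed
    moreover have "1 * \<eta> y + (4 / r c) * bump (r c / 4) c (r c) y \<ge> 0" for y using nn[of y] \<eta>(2)[of y] by linarith
    ultimately show ?case using t by blast
  qed
  then show ?thesis using T(3) by blast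
qed

lemma test_fun_bounded:
  assumes t: "test_fun sector \<phi> G"
  shows "\<exists>B\<ge>0. \<forall>x. \<bar>\<phi> x\<bar> \<le> B"
proof -
  have "compact (\<phi> ` cball 0 1)"
    using C1_continuous[OF test_funD(1)[OF t]] by (intro compact_continuous_image) (auto intro: continuous_on_subset)
  then have "bounded (\<phi> ` cball 0 1)" by (rule compact_imp_bounded)
  then obtain B where "\<forall>y\<in>\<phi> ` cball 0 1. norm y \<le> B" unfolding bounded_iff ..
  then have B: "\<bar>\<phi> x\<bar> \<le> B" if "x \<in> cball 0 1" for x using that by simp
  have "B \<ge> 0" using B[of 0] by simp
  moreover have "\<bar>\<phi> x\<bar> \<le> B" for x
  proof (cases "x \<in> sector")
    case True then show ?thesis using B by (simp add: mem_sector)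
  next
    case False then show ?thesis using test_fun_outside(1)[OF t] \<open>B \<ge> 0\<close> by simp
  qed
  ultimately show ?thesis by blast
qed

lemma test_fun_powr:
  assumes t: "test_fun \<Omega> \<eta> Z" and nn: "\<And>x. \<eta> x \<ge> 0" and p: "p > 1"
  shows "test_fun \<Omega> (\<lambda>x. \<eta> x powr p) (\<lambda>x. (p * \<eta> x powr (p - 1)) *\<^sub>R Z x)"
proof -
  have mx: "max 0 (\<eta> x) = \<eta> x" for x using nn by simp
  have d: "((\<lambda>x. \<eta> x powr p) has_derivative (\<lambda>h. ((p * \<eta> x powr (p - 1)) *\<^sub>R Z x) \<bullet> h)) (at x)" for x
    using has_derivative_compose[OF test_funD(1)[OF t] DERIV_pos_powr[OF p, unfolded has_field_derivative_def], of x]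
    unfolding mx by simp
  have c: "continuous_on UNIV (\<lambda>x. (p * \<eta> x powr (p - 1)) *\<^sub>R Z x)"
    using p nn by (intro continuous_intros continuous_on_powr' C1_continuous[OF test_funD(1)[OF t]] test_funD(2)[OF t]) auto
  have "{x. \<eta> x powr p \<noteq> 0} = {x. \<eta> x \<noteq> 0}" by auto
  then show ?thesis using t d c by (simp add: test_fun_def)
qed

section \<open>Picone's inequality and the gradient of the logarithm\<close>

lemma powr_tangent:
  fixes X Y p :: real
  assumes "X \<ge> 0" "Y \<ge> 0" "p > 1"
  shows "p * X powr (p - 1) * Y \<le> (p - 1) * X powr p + Y powr p"
proof (cases "X = 0 \<or> Y = 0")
  case False
  then have X: "X > 0" "Y > 0" using assms by auto
  have "Y powr p - X powr p \<ge> (p * X powr (p - 1)) * (Y - X)"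
  proof (rule convex_on_imp_above_tangent[where A = "{0<..}"])
    show "convex_on {0<..} (\<lambda>x. x powr p)" using assms by (intro powr_convex) auto
    show "((\<lambda>x. x powr p) has_field_derivative p * X powr (p - 1)) (at X within {0<..})"
      using X by (auto intro!: derivative_eq_intros simp: powr_diff)
  qed (use X in \<open>auto simp: interior_open connected_Ioi\<close>)
  then have "Y powr p - X powr p \<ge> p * X powr (p - 1) * Y - p * (X powr (p - 1) * X)" by (simp only: right_diff_distrib mult.assoc)
  moreover have "X powr (p - 1) * X = X powr p" using X powr_mult_base[of X "p - 1"] by (simp add: mult.commute)
  ultimately show ?thesis by (simp add: left_diff_distrib)
qed (use assms in auto)

text \<open>Spends only half of (p - 1) X^p, unlike the tangent inequality; the other half survives
  and bounds the gradient of the logarithm.\<close>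

lemma powr_young_half:
  fixes X Y p :: real
  assumes "X \<ge> 0" "Y \<ge> 0" "p > 1"
  shows "p * X powr (p - 1) * Y \<le> (p - 1) / 2 * X powr p + p * ((p - 1) / (2 * p)) powr (1 - p) * Y powr p"
proof -
  \<comment> \<open>Chosen so that p * t = (p - 1) / 2, which settles the case Y <= t * X.\<close>
  define t where "t = (p - 1) / (2 * p)"
  have t: "t > 0" using assms by (simp add: t_def)
  show ?thesis
  proof (cases "Y \<le> t * X")
    case True
    have "p * X powr (p - 1) * Y \<le> p * X powr (p - 1) * (t * X)" using True assms by (intro mult_left_mono) auto
    also have "\<dots> = (p - 1) / 2 * X powr p"
      using assms powr_mult_base[of X "p - 1"] by (simp add: t_def field_simps)
    finally show ?thesis using assms by (simp add: add_increasing2)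
  next
    case False
    then have XY: "X \<le> Y / t" using t by (simp add: field_simps)
    have "p * X powr (p - 1) * Y \<le> p * (Y / t) powr (p - 1) * Y" using XY assms by (intro mult_right_mono mult_left_mono powr_mono2) auto
    also have "\<dots> = p * t powr (1 - p) * (Y powr (p - 1) * Y)"
      using t assms powr_minus[of t "p - 1"] by (simp add: powr_divide field_simps)
    also have "Y powr (p - 1) * Y = Y powr p" using assms powr_mult_base[of Y "p - 1"] by (simp add: mult.commute)
    finally show ?thesis unfolding t_def using assms by (simp add: add_increasing)
  qed
qed

context sector_eigen
begin

text \<open>A reindexed tail of the approximating sequence. Closeness for every n keeps \<phi> n +
  \<delta> positive, so that its negative powers and its logarithm are smooth.\<close>

lemma approx_close:
  assumes e: "e > 0"
  shows "\<exists>\<phi> G H. dominated_approx p sector \<psi> (wgrad p sector \<psi>) \<phi> G H \<and> (\<forall>n x. \<bar>\<phi> n x - U x\<bar> \<le> e)"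
proof -
  obtain \<phi> G H where d: "dominated_approx p sector \<psi> (wgrad p sector \<psi>) \<phi> G H"
    and u: "\<forall>e>0. \<forall>\<^sub>F n in sequentially. \<forall>x. \<bar>\<phi> n x - U x\<bar> \<le> e" using approx by blast
  obtain N where N: "\<And>n x. n \<ge> N \<Longrightarrow> \<bar>\<phi> n x - U x\<bar> \<le> e" using u e unfolding eventually_sequentially by blast
  have "dominated_approx p sector \<psi> (wgrad p sector \<psi>) (\<lambda>n. \<phi> (n + N)) (\<lambda>n. G (n + N)) H"
    unfolding dominated_approx_def
  proof (intro conjI allI)
    show "AE x in lebesgue. (\<lambda>n. \<phi> (n + N) x) \<longlonglongrightarrow> U x \<and> (\<lambda>n. G (n + N) x) \<longlonglongrightarrow> g x \<and>
      (\<forall>n. \<bar>\<phi> (n + N) x\<bar> powr p \<le> H x \<and> norm (G (n + N) x) powr p \<le> H x)"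
      using dominated_approxD(4)[OF d]
      by eventually_elim (auto intro: LIMSEQ_ignore_initial_segment[of "\<lambda>n. \<phi> n _"] LIMSEQ_ignore_initial_segment[of "\<lambda>n. G n _"])
    show "(\<lambda>n. \<integral>\<^sup>+x. ennreal (norm (G (n + N) x - g x) powr p) \<partial>lebesgue) \<longlonglongrightarrow> 0"
      using LIMSEQ_ignore_initial_segment[OF dominated_approxD(5)[OF d], of N] by simp
  qed (use dominated_approxD(1-3)[OF d] in auto)
  then show ?thesis using N by (intro exI[of _ "\<lambda>n. \<phi> (n + N)"] exI[of _ "\<lambda>n. G (n + N)"] exI[of _ H]) auto
qed

text \<open>The equation tested with \<zeta> (U + \<delta>)^(1-p). With \<phi> n in place of U this
  is an admissible test function, since \<phi> n + \<delta> >= \<delta> / 2; F is the limit of the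
  flux integrands.\<close>

lemma test_quotient:
  assumes pos: "\<And>x. U x \<ge> 0" and t\<zeta>: "test_fun sector \<zeta> Z" and \<delta>: "\<delta> > 0"
  defines "F \<equiv> \<lambda>x. norm (g x) powr (p - 2) * (g x \<bullet> ((U x + \<delta>) powr (1 - p) *\<^sub>R Z x + ((1 - p) * \<zeta> x * (U x + \<delta>) powr (- p)) *\<^sub>R g x))"
  shows "integrable lebesgue F" "(\<integral>x. F x \<partial>lebesgue) = lam * (\<integral>x. \<bar>U x\<bar> powr (p - 2) * U x * (\<zeta> x * (U x + \<delta>) powr (1 - p)) \<partial>lebesgue)"
proof -
  have \<delta>2: "\<delta> / 2 > 0" using \<delta> by simp
  obtain \<phi> G H where d: "dominated_approx p sector \<psi> (wgrad p sector \<psi>) \<phi> G H"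
    and close: "\<forall>n x. \<bar>\<phi> n x - U x\<bar> \<le> \<delta> / 2" using approx_close[OF \<delta>2] by blast
  note t = dominated_approxD(1)[OF d] and H = dominated_approxD(2,3)[OF d] and ae = dominated_AE[OF d]
  have [measurable]: "\<phi> n \<in> borel_measurable lebesgue" "G n \<in> borel_measurable lebesgue" for n
    using test_funD(3,4)[OF t] by (auto intro: borel_measurable_lebesgue)
  have [measurable]: "\<zeta> \<in> borel_measurable lebesgue" "Z \<in> borel_measurable lebesgue"
    using test_funD(3,4)[OF t\<zeta>] by (auto intro: borel_measurable_lebesgue)
  have low: "\<phi> n x + \<delta> \<ge> \<delta> / 2" for n x using close[rule_format, of n x] pos[of x] by linarith
  have lowp: "\<phi> n x + \<delta> > 0" for n x using low[of n x] \<delta> by linarith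
  define v where "v n x = \<zeta> x * (\<phi> n x + \<delta>) powr (1 - p)" for n x
  define V where "V n x = (\<phi> n x + \<delta>) powr (1 - p) *\<^sub>R Z x + ((1 - p) * \<zeta> x * (\<phi> n x + \<delta>) powr (- p)) *\<^sub>R G n x" for n x
  have tv: "test_fun sector (v n) (V n)" for n
  proof -
    have "{x. v n x \<noteq> 0} = {x. \<zeta> x \<noteq> 0}" using lowp[of n] by (auto simp: v_def) (metis less_irrefl)
    moreover have "(v n has_derivative (\<lambda>h. V n x \<bullet> h)) (at x)" for x
    proof -
      have "((\<lambda>s. (s + \<delta>) powr (1 - p)) has_real_derivative (1 - p) * (\<phi> n x + \<delta>) powr (1 - p - 1) * 1) (at (\<phi> n x))"
        by (rule DERIV_chain2[where f="\<lambda>z. z powr (1 - p)" and g="\<lambda>s. s + \<delta>" and x="\<phi> n x", OF has_real_derivative_powr[OF lowp]]) (auto intro!: derivative_eq_intros)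
      then have "((\<lambda>s. (s + \<delta>) powr (1 - p)) has_derivative (*) ((1 - p) * (\<phi> n x + \<delta>) powr (- p))) (at (\<phi> n x))"
        by (simp add: has_field_derivative_def)
      from has_derivative_compose[OF test_funD(1)[OF t] this]
      have "((\<lambda>x. (\<phi> n x + \<delta>) powr (1 - p)) has_derivative (\<lambda>h. (1 - p) * (\<phi> n x + \<delta>) powr (- p) * (G n x \<bullet> h))) (at x)" .
      from has_derivative_mult[OF test_funD(1)[OF t\<zeta>] this] show ?thesis
        unfolding v_def[abs_def] V_def by (rule has_derivative_eq_rhs) (auto simp: inner_add_left algebra_simps)
    qed
    moreover have "continuous_on UNIV (V n)" unfolding V_def[abs_def]
      by (intro continuous_intros C1_continuous[OF test_funD(1)[OF t]] C1_continuous[OF test_funD(1)[OF t\<zeta>]] test_funD(2)[OF t] test_funD(2)[OF t\<zeta>] ballI)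
        (use lowp[of n] in \<open>metis less_irrefl\<close>)+
    ultimately show ?thesis using t\<zeta> by (simp add: test_fun_def)
  qed
  obtain B where B: "B \<ge> 0" "\<And>x. \<bar>\<zeta> x\<bar> \<le> B" using test_fun_bounded[OF t\<zeta>] by blast
  define c1 where "c1 = (\<delta> / 2) powr (1 - p)"
  define c2 where "c2 = (p - 1) * B * (\<delta> / 2) powr (- p)"
  have c: "c1 \<ge> 0" "c2 \<ge> 0" using B p1 by (auto simp: c1_def c2_def)
  have b1: "(\<phi> n x + \<delta>) powr (1 - p) \<le> c1" "(\<phi> n x + \<delta>) powr (- p) \<le> (\<delta> / 2) powr (- p)" for n x
    unfolding c1_def using low[of n x] \<delta> p1 by (auto intro!: powr_mono2')
  define D where "D x = H x + 2 powr p * (c1 powr p * norm (Z x) powr p + c2 powr p * H x)" for x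
  have iD: "integrable lebesgue D" unfolding D_def
    using H(1) integrable_test_powr(2)[OF t\<zeta> p1(1)] by (intro Bochner_Integration.integrable_add integrable_mult_right) auto
  have Vb: "norm (V n x) powr p \<le> 2 powr p * (c1 powr p * norm (Z x) powr p + c2 powr p * norm (G n x) powr p)" for n x
  proof -
    have "norm (V n x) powr p \<le> 2 powr p * (norm ((\<phi> n x + \<delta>) powr (1 - p) *\<^sub>R Z x) powr p + norm (((1 - p) * \<zeta> x * (\<phi> n x + \<delta>) powr (- p)) *\<^sub>R G n x) powr p)"
      unfolding V_def using p1 by (intro powr_norm_add_le) auto
    also have "\<dots> \<le> 2 powr p * ((c1 * norm (Z x)) powr p + (c2 * norm (G n x)) powr p)"
    proof (intro mult_left_mono add_mono powr_mono2)
      show "norm ((\<phi> n x + \<delta>) powr (1 - p) *\<^sub>R Z x) \<le> c1 * norm (Z x)" using b1 by (simp add: mult_right_mono)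
      have "\<bar>1 - p\<bar> * \<bar>\<zeta> x\<bar> * (\<phi> n x + \<delta>) powr (- p) \<le> c2"
        unfolding c2_def using B b1(2)[of n x] p1 by (intro mult_mono) auto
      then show "norm (((1 - p) * \<zeta> x * (\<phi> n x + \<delta>) powr (- p)) *\<^sub>R G n x) \<le> c2 * norm (G n x)"
        by (simp add: abs_mult mult_right_mono)
    qed (use p1 in auto)
    also have "\<dots> = 2 powr p * (c1 powr p * norm (Z x) powr p + c2 powr p * norm (G n x) powr p)"
      using c by (simp add: powr_mult)
    finally show ?thesis .
  qed
  have lim\<phi>: "(\<lambda>n. (\<phi> n x + \<delta>) powr a) \<longlonglongrightarrow> (U x + \<delta>) powr a" if "(\<lambda>n. \<phi> n x) \<longlonglongrightarrow> U x" for x a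
    using that pos[of x] \<delta> by (intro tendsto_intros) auto
  have Fm: "F \<in> borel_measurable lebesgue" unfolding F_def by measurable
  have Vm: "(\<lambda>x. norm (g x) powr (p - 2) * (g x \<bullet> V n x)) \<in> borel_measurable lebesgue" for n unfolding V_def by measurable
  have aeF: "AE x in lebesgue. (\<lambda>n. norm (g x) powr (p - 2) * (g x \<bullet> V n x)) \<longlonglongrightarrow> F x"
    using ae by eventually_elim (auto simp: V_def F_def intro!: tendsto_intros lim\<phi>)
  have aeb: "AE x in lebesgue. norm (norm (g x) powr (p - 2) * (g x \<bullet> V n x)) \<le> D x" for n
    using ae
  proof eventually_elim
    case (elim x)
    have "norm (norm (g x) powr (p - 2) * (g x \<bullet> V n x)) \<le> norm (g x) powr p + norm (V n x) powr p" using flux_bound[of x "V n x"] by simp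
    also have "\<dots> \<le> H x + 2 powr p * (c1 powr p * norm (Z x) powr p + c2 powr p * norm (G n x) powr p)"
      using elim Vb by (intro add_mono) auto
    also have "\<dots> \<le> D x" unfolding D_def using elim by (intro add_left_mono mult_left_mono) auto
    finally show ?case .
  qed
  show "integrable lebesgue F" by (rule integrable_dominated_convergence[OF Fm Vm iD aeF aeb])
  have L1: "(\<lambda>n. \<integral>x. norm (g x) powr (p - 2) * (g x \<bullet> V n x) \<partial>lebesgue) \<longlonglongrightarrow> (\<integral>x. F x \<partial>lebesgue)"
    by (rule integral_dominated_convergence[OF Fm Vm iD aeF aeb])
  have L2: "(\<lambda>n. \<integral>x. \<bar>U x\<bar> powr (p - 2) * U x * v n x \<partial>lebesgue) \<longlonglongrightarrow> (\<integral>x. \<bar>U x\<bar> powr (p - 2) * U x * (\<zeta> x * (U x + \<delta>) powr (1 - p)) \<partial>lebesgue)"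
  proof (rule integral_dominated_convergence)
    show "integrable lebesgue (\<lambda>x. H x + c1 powr p * \<bar>\<zeta> x\<bar> powr p)"
      using H(1) integrable_test_powr(1)[OF t\<zeta> p1(1)] by (intro Bochner_Integration.integrable_add integrable_mult_right) auto
    show "AE x in lebesgue. (\<lambda>n. \<bar>U x\<bar> powr (p - 2) * U x * v n x) \<longlonglongrightarrow> \<bar>U x\<bar> powr (p - 2) * U x * (\<zeta> x * (U x + \<delta>) powr (1 - p))"
      using ae by eventually_elim (auto simp: v_def intro!: tendsto_mult_left lim\<phi>)
    show "AE x in lebesgue. norm (\<bar>U x\<bar> powr (p - 2) * U x * v n x) \<le> H x + c1 powr p * \<bar>\<zeta> x\<bar> powr p" for n
      using ae
    proof eventually_elim
      case (elim x)
      have "\<bar>v n x\<bar> \<le> c1 * \<bar>\<zeta> x\<bar>" using mult_left_mono[OF b1(1)[of n x] abs_ge_zero[of "\<zeta> x"]]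
        by (simp add: v_def abs_mult mult.commute)
      then have "\<bar>v n x\<bar> powr p \<le> (c1 * \<bar>\<zeta> x\<bar>) powr p" using p1 by (intro powr_mono2) auto
      then have "\<bar>v n x\<bar> powr p \<le> c1 powr p * \<bar>\<zeta> x\<bar> powr p" using c by (simp add: powr_mult)
      moreover have "\<bar>U x\<bar> powr p \<le> H x" using elim by blast
      ultimately show ?case using source_bound[of x "v n x"] unfolding real_norm_def by linarith
    qed
    show "(\<lambda>x. \<bar>U x\<bar> powr (p - 2) * U x * v n x) \<in> borel_measurable lebesgue" for n unfolding v_def by measurable
  qed measurable
  show "(\<integral>x. F x \<partial>lebesgue) = lam * (\<integral>x. \<bar>U x\<bar> powr (p - 2) * U x * (\<zeta> x * (U x + \<delta>) powr (1 - p)) \<partial>lebesgue)"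
    using L1 tendsto_mult_left[OF L2, of lam] unfolding weak[OF tv] by (rule LIMSEQ_unique)
qed

text \<open>The test function is \<eta>^p (U + \<delta>)^(1-p). With X = \<eta> |g| / (U + \<delta>)
  the flux integrand is at most p X^(p-1) |Y| - (p - 1) X^p. The tangent inequality bounds this by
  |Y|^p, which is Picone's inequality; the halved Young inequality leaves -(p - 1) / 2 X^p, which
  bounds the logarithmic gradient independently of \<delta>.\<close>

lemma
  assumes pos: "\<And>x. U x \<ge> 0" and t: "test_fun sector \<eta> Y" and nn: "\<And>x. \<eta> x \<ge> 0" and \<delta>: "\<delta> > 0"
  shows picone_delta: "lam * (\<integral>x. \<eta> x powr p * (U x / (U x + \<delta>)) powr (p - 1) \<partial>lebesgue) \<le> mass p Y"
    and log_gradient: "(\<integral>x. \<eta> x powr p * (norm (g x) / (U x + \<delta>)) powr p \<partial>lebesgue) \<le> 2 / (p - 1) * (p * ((p - 1) / (2 * p)) powr (1 - p) * mass p Y)"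
proof -
  have p: "p > 1" using p3 by simp
  have Ud: "U x + \<delta> > 0" for x using pos[of x] \<delta> by linarith
  have [measurable]: "\<eta> \<in> borel_measurable lebesgue" "Y \<in> borel_measurable lebesgue"
    using test_funD(3,4)[OF t] by (auto intro: borel_measurable_lebesgue)
  define X where "X x = \<eta> x * (norm (g x) / (U x + \<delta>))" for x
  have X0: "X x \<ge> 0" for x using nn Ud[of x] by (simp add: X_def)
  let ?F = "\<lambda>x. norm (g x) powr (p - 2) * (g x \<bullet> ((U x + \<delta>) powr (1 - p) *\<^sub>R ((p * \<eta> x powr (p - 1)) *\<^sub>R Y x) + ((1 - p) * \<eta> x powr p * (U x + \<delta>) powr (- p)) *\<^sub>R g x))"
  note tq = test_quotient[OF pos test_fun_powr[OF t nn p] \<delta>]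
  have XX: "X x powr p = \<eta> x powr p * (norm (g x) / (U x + \<delta>)) powr p" for x
    unfolding X_def by (subst powr_mult) (use nn[of x] Ud[of x] in \<open>auto intro!: divide_nonneg_pos\<close>)
  have Fle: "?F x \<le> p * X x powr (p - 1) * norm (Y x) - (p - 1) * X x powr p" for x
  proof -
    have "?F x = (U x + \<delta>) powr (1 - p) * (p * \<eta> x powr (p - 1)) * (norm (g x) powr (p - 2) * (g x \<bullet> Y x)) + ((1 - p) * \<eta> x powr p * (U x + \<delta>) powr (- p)) * (norm (g x) powr (p - 2) * (g x \<bullet> g x))"
      by (simp add: inner_add_right algebra_simps)
    also have "\<dots> \<le> (U x + \<delta>) powr (1 - p) * (p * \<eta> x powr (p - 1)) * (norm (g x) powr (p - 1) * norm (Y x)) + ((1 - p) * \<eta> x powr p * (U x + \<delta>) powr (- p)) * norm (g x) powr p"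
      unfolding flux_self using p abs_le_D1[OF flux_le[of "g x" "Y x"]] by (intro add_right_mono mult_left_mono) auto
    also have "(U x + \<delta>) powr (1 - p) * (p * \<eta> x powr (p - 1)) * (norm (g x) powr (p - 1) * norm (Y x)) = p * X x powr (p - 1) * norm (Y x)"
      using nn Ud[of x] powr_minus[of "U x + \<delta>" "p - 1"] by (simp add: X_def powr_mult powr_divide field_simps)
    also have "((1 - p) * \<eta> x powr p * (U x + \<delta>) powr (- p)) * norm (g x) powr p = - ((p - 1) * X x powr p)"
    proof -
      have "X x powr p = \<eta> x powr p * (norm (g x) powr p * (U x + \<delta>) powr (- p))"
        using Ud[of x] by (simp add: XX powr_divide powr_minus_divide)
      then show ?thesis by (simp add: algebra_simps)
    qed
    finally show ?thesis by simp
  qed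
  have iY: "integrable lebesgue (\<lambda>x. norm (Y x) powr p)" by (rule integrable_test_powr(2)[OF t p1(1)])
  have mY: "mass p Y = (\<integral>x. norm (Y x) powr p \<partial>lebesgue)" by (rule mass_integral[OF test_funD(4)[OF t]])
  have rhs: "\<bar>U x\<bar> powr (p - 2) * U x * (\<eta> x powr p * (U x + \<delta>) powr (1 - p)) = \<eta> x powr p * (U x / (U x + \<delta>)) powr (p - 1)" for x
  proof -
    have "\<bar>U x\<bar> powr (p - 2) * U x = U x powr (p - 1)" using pos[of x] powr_mult_base[of "U x" "p - 2"] by (simp add: mult.commute)
    then show ?thesis using pos[of x] Ud[of x] powr_minus[of "U x + \<delta>" "p - 1"] by (simp add: powr_divide field_simps)
  qed
  have eq: "(\<integral>x. ?F x \<partial>lebesgue) = lam * (\<integral>x. \<eta> x powr p * (U x / (U x + \<delta>)) powr (p - 1) \<partial>lebesgue)"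
    using tq(2) unfolding rhs .
  have "(\<integral>x. ?F x \<partial>lebesgue) \<le> mass p Y" unfolding mY
  proof (rule integral_mono[OF tq(1) iY])
    fix x show "?F x \<le> norm (Y x) powr p" using Fle[of x] powr_tangent[OF X0 norm_ge_zero p, of x "Y x"] by linarith
  qed
  then show "lam * (\<integral>x. \<eta> x powr p * (U x / (U x + \<delta>)) powr (p - 1) \<partial>lebesgue) \<le> mass p Y" using eq by simp
  define C where "C = p * ((p - 1) / (2 * p)) powr (1 - p)"
  obtain B where B: "B \<ge> 0" "\<And>x. \<bar>\<eta> x\<bar> \<le> B" using test_fun_bounded[OF t] by blast
  have iX: "integrable lebesgue (\<lambda>x. X x powr p)"
  proof (rule Bochner_Integration.integrable_bound[OF integrable_mult_right[OF Lp_pow_integral(3)[OF sob p1(2)], of "(B / \<delta>) powr p"]])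
    show "AE x in lebesgue. norm (X x powr p) \<le> norm ((B / \<delta>) powr p * norm (g x) powr p)"
    proof (rule AE_I2)
      fix x
      have "X x \<le> B * (norm (g x) / \<delta>)" unfolding X_def
        using B(2)[of x] nn[of x] pos[of x] \<delta> Ud[of x] B(1) by (intro mult_mono divide_left_mono) auto
      then have "X x powr p \<le> (B * (norm (g x) / \<delta>)) powr p" using X0 p by (intro powr_mono2) auto
      also have "\<dots> = (B / \<delta>) powr p * norm (g x) powr p" using B(1) \<delta> by (simp add: powr_mult powr_divide)
      finally show "norm (X x powr p) \<le> norm ((B / \<delta>) powr p * norm (g x) powr p)" by simp
    qed
    show "(\<lambda>x. X x powr p) \<in> borel_measurable lebesgue" unfolding X_def by measurable
  qed
  have "0 \<le> (\<integral>x. ?F x \<partial>lebesgue)" unfolding eq using lam by (intro mult_nonneg_nonneg Bochner_Integration.integral_nonneg) auto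
  also have "\<dots> \<le> (\<integral>x. C * norm (Y x) powr p - (p - 1) / 2 * X x powr p \<partial>lebesgue)"
  proof (rule integral_mono[OF tq(1)])
    show "integrable lebesgue (\<lambda>x. C * norm (Y x) powr p - (p - 1) / 2 * X x powr p)"
      by (intro Bochner_Integration.integrable_diff integrable_mult_right iX iY)
    fix x show "?F x \<le> C * norm (Y x) powr p - (p - 1) / 2 * X x powr p"
      using Fle[of x] powr_young_half[OF X0 norm_ge_zero p, of x "Y x"] unfolding C_def by (simp add: field_simps)
  qed
  also have "\<dots> = C * mass p Y - (p - 1) / 2 * (\<integral>x. X x powr p \<partial>lebesgue)" unfolding mY using iX iY by simp
  finally have "(\<integral>x. X x powr p \<partial>lebesgue) \<le> 2 / (p - 1) * (C * mass p Y)" using p by (simp add: field_simps)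
  then show "(\<integral>x. \<eta> x powr p * (norm (g x) / (U x + \<delta>)) powr p \<partial>lebesgue) \<le> 2 / (p - 1) * (p * ((p - 1) / (2 * p)) powr (1 - p) * mass p Y)"
    unfolding XX C_def .
qed

text \<open>Let \<delta> tend to 0 in \<open>picone_delta\<close>: U / (U + \<delta>) tends to 1 at
  every point of the sector because \<psi> is positive there. So lam lies below the Rayleigh
  quotient of every nonnegative test function.\<close>

lemma picone:
  assumes pos: "\<And>x. x \<in> sector \<Longrightarrow> \<psi> x > 0" and t: "test_fun sector \<eta> Y" and nn: "\<And>x. \<eta> x \<ge> 0"
  shows "lam * mass p \<eta> \<le> mass p Y"
proof -
  have U0: "U x \<ge> 0" for x using pos by (cases "x \<in> sector") (auto intro: less_imp_le)
  have [measurable]: "\<eta> \<in> borel_measurable lebesgue" using test_funD(3)[OF t] by (auto intro: borel_measurable_lebesgue)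
  have "(\<lambda>k. \<integral>x. \<eta> x powr p * (U x / (U x + 1 / real (Suc k))) powr (p - 1) \<partial>lebesgue) \<longlonglongrightarrow> (\<integral>x. \<bar>\<eta> x\<bar> powr p \<partial>lebesgue)"
  proof (rule integral_dominated_convergence[OF _ _ integrable_test_powr(1)[OF t p1(1)]])
    show "AE x in lebesgue. (\<lambda>k. \<eta> x powr p * (U x / (U x + 1 / real (Suc k))) powr (p - 1)) \<longlonglongrightarrow> \<bar>\<eta> x\<bar> powr p"
    proof (rule AE_I2)
      fix x
      show "(\<lambda>k. \<eta> x powr p * (U x / (U x + 1 / real (Suc k))) powr (p - 1)) \<longlonglongrightarrow> \<bar>\<eta> x\<bar> powr p"
      proof (cases "x \<in> sector")
        case True
        then have U: "U x > 0" using pos by simp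
        have "(\<lambda>k. 1 / real (Suc k)) \<longlonglongrightarrow> 0" using LIMSEQ_inverse_real_of_nat by (simp add: inverse_eq_divide)
        then have "(\<lambda>k. \<eta> x powr p * (U x / (U x + 1 / real (Suc k))) powr (p - 1)) \<longlonglongrightarrow> \<eta> x powr p * (U x / (U x + 0)) powr (p - 1)"
          using U by (intro tendsto_intros) auto
        then show ?thesis using U nn[of x] by simp
      next
        case False
        then show ?thesis using test_fun_outside(1)[OF t] by simp
      qed
    qed
    show "AE x in lebesgue. norm (\<eta> x powr p * (U x / (U x + 1 / real (Suc k))) powr (p - 1)) \<le> \<bar>\<eta> x\<bar> powr p" for k
    proof (rule AE_I2)
      fix x
      have "(U x / (U x + 1 / real (Suc k))) powr (p - 1) \<le> 1 powr (p - 1)"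
        using U0[of x] p1 by (intro powr_mono2) (auto simp: divide_le_eq_1 add_nonneg_pos)
      then show "norm (\<eta> x powr p * (U x / (U x + 1 / real (Suc k))) powr (p - 1)) \<le> \<bar>\<eta> x\<bar> powr p"
        using nn[of x] by (simp add: abs_mult mult_left_le)
    qed
  qed measurable
  then have "(\<lambda>k. lam * (\<integral>x. \<eta> x powr p * (U x / (U x + 1 / real (Suc k))) powr (p - 1) \<partial>lebesgue)) \<longlonglongrightarrow> lam * mass p \<eta>"
    unfolding mass_integral[OF test_funD(3)[OF t]] real_norm_def by (rule tendsto_mult_left)
  then show ?thesis
    by (rule LIMSEQ_le_const2) (use picone_delta[OF U0 t nn] in auto)
qed

end

section \<open>A maximum principle from the oscillation of the logarithm\<close>

lemma rect_int_le:
  assumes "\<And>\<rho> \<theta>. \<rho> \<in> {a..b} \<Longrightarrow> \<theta> \<in> {c..d} \<Longrightarrow> F (polar \<rho> \<theta>) \<le> F' (polar \<rho> \<theta>)"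
  shows "rect_int a b c d F \<le> rect_int a b c d F'"
  unfolding rect_int_def
proof (rule nn_integral_mono)
  fix \<theta>
  show "(\<integral>\<^sup>+\<rho>\<in>{a..b}. ennreal \<rho> * F (polar \<rho> \<theta>) \<partial>lborel) * indicator {c..d} \<theta> \<le> (\<integral>\<^sup>+\<rho>\<in>{a..b}. ennreal \<rho> * F' (polar \<rho> \<theta>) \<partial>lborel) * indicator {c..d} \<theta>"
  proof (cases "\<theta> \<in> {c..d}")
    case True
    have "(\<integral>\<^sup>+\<rho>\<in>{a..b}. ennreal \<rho> * F (polar \<rho> \<theta>) \<partial>lborel) \<le> (\<integral>\<^sup>+\<rho>\<in>{a..b}. ennreal \<rho> * F' (polar \<rho> \<theta>) \<partial>lborel)"
    proof (rule nn_integral_mono)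
      fix \<rho>
      show "ennreal \<rho> * F (polar \<rho> \<theta>) * indicator {a..b} \<rho> \<le> ennreal \<rho> * F' (polar \<rho> \<theta>) * indicator {a..b} \<rho>"
        using assms[OF _ True, of \<rho>] by (auto simp: indicator_def intro: mult_left_mono)
    qed
    then show ?thesis by (rule mult_right_mono) simp
  qed simp
qed

lemma rect_int_lower:
  assumes "0 \<le> a" "a \<le> b" "c \<le> d" "0 \<le> t" and le: "\<And>\<rho> \<theta>. \<rho> \<in> {a..b} \<Longrightarrow> \<theta> \<in> {c..d} \<Longrightarrow> ennreal t \<le> F (polar \<rho> \<theta>)"
  shows "ennreal (t * (a * (b - a) * (d - c))) \<le> rect_int a b c d F"
proof -
  have "ennreal (t * (a * (b - a) * (d - c))) = ennreal (a * t) * ennreal (b - a) * ennreal (d - c)"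
    using assms(1-4) by (simp add: mult_ac flip: ennreal_mult)
  also have "\<dots> = (\<integral>\<^sup>+\<theta>\<in>{c..d}. (\<integral>\<^sup>+\<rho>\<in>{a..b}. ennreal (a * t) \<partial>lborel) \<partial>lborel)"
    using assms(2,3) by (simp only: nn_integral_const_interval)
  also have "\<dots> \<le> rect_int a b c d F" unfolding rect_int_def
  proof (rule nn_integral_mono)
    fix \<theta>
    show "(\<integral>\<^sup>+\<rho>\<in>{a..b}. ennreal (a * t) \<partial>lborel) * indicator {c..d} \<theta> \<le> (\<integral>\<^sup>+\<rho>\<in>{a..b}. ennreal \<rho> * F (polar \<rho> \<theta>) \<partial>lborel) * indicator {c..d} \<theta>"
    proof (cases "\<theta> \<in> {c..d}")
      case True
      have "(\<integral>\<^sup>+\<rho>\<in>{a..b}. ennreal (a * t) \<partial>lborel) \<le> (\<integral>\<^sup>+\<rho>\<in>{a..b}. ennreal \<rho> * F (polar \<rho> \<theta>) \<partial>lborel)"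
      proof (rule nn_integral_mono)
        fix \<rho>
        have "ennreal (a * t) \<le> ennreal \<rho> * F (polar \<rho> \<theta>)" if r: "\<rho> \<in> {a..b}"
        proof -
          have "ennreal (a * t) = ennreal a * ennreal t" using assms by (simp add: ennreal_mult)
          also have "\<dots> \<le> ennreal \<rho> * F (polar \<rho> \<theta>)" using le[OF r True] r by (intro mult_mono ennreal_leI) auto
          finally show ?thesis .
        qed
        then show "ennreal (a * t) * indicator {a..b} \<rho> \<le> ennreal \<rho> * F (polar \<rho> \<theta>) * indicator {a..b} \<rho>"
          by (auto simp: indicator_def)
      qed
      then show ?thesis by (rule mult_right_mono) simp
    qed simp
  qed
  finally show ?thesis .
qed

text \<open>Chebyshev's inequality: if every point violated the bound, the integral would be at
  least S + 1, because the rectangle has measure at least a * (b - a) * (d - c). The summand 1 makes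
  the contradiction strict.\<close>

lemma rect_int_point:
  assumes ab: "0 < a" "a < b" "c < d" and p: "p \<ge> 1" and S: "S \<ge> 0" and le: "rect_int a b c d (\<lambda>x. ennreal (\<bar>v x - m\<bar> powr p)) \<le> ennreal S"
  shows "\<exists>\<rho>\<in>{a..b}. \<exists>\<theta>\<in>{c..d}. \<bar>v (polar \<rho> \<theta>) - m\<bar> \<le> ((S + 1) / (a * (b - a) * (d - c))) powr (1 / p)"
proof (rule ccontr)
  define \<mu> where "\<mu> = a * (b - a) * (d - c)"
  have \<mu>: "\<mu> > 0" using ab by (simp add: \<mu>_def)
  assume "\<not> (\<exists>\<rho>\<in>{a..b}. \<exists>\<theta>\<in>{c..d}. \<bar>v (polar \<rho> \<theta>) - m\<bar> \<le> ((S + 1) / (a * (b - a) * (d - c))) powr (1 / p))"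
  then have n: "((S + 1) / \<mu>) powr (1 / p) \<le> \<bar>v (polar \<rho> \<theta>) - m\<bar>" if "\<rho> \<in> {a..b}" "\<theta> \<in> {c..d}" for \<rho> \<theta>
    using that unfolding \<mu>_def by (meson linear)
  have "ennreal ((S + 1) / \<mu>) \<le> ennreal (\<bar>v (polar \<rho> \<theta>) - m\<bar> powr p)" if "\<rho> \<in> {a..b}" "\<theta> \<in> {c..d}" for \<rho> \<theta>
  proof -
    have "(((S + 1) / \<mu>) powr (1 / p)) powr p \<le> \<bar>v (polar \<rho> \<theta>) - m\<bar> powr p" using n[OF that] p by (intro powr_mono2) auto
    then show ?thesis using p S \<mu> by (intro ennreal_leI) (simp add: powr_powr)
  qed
  then have "ennreal ((S + 1) / \<mu> * (a * (b - a) * (d - c))) \<le> ennreal S"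
    using ab S \<mu> by (intro order_trans[OF rect_int_lower le]) auto
  then show False using \<mu> S unfolding \<mu>_def[symmetric] by simp
qed

context sector_eigen
begin

text \<open>A weak form of the strong maximum principle. The functions ln (psi + delta) have gradients
  bounded in L^p on compact sets, uniformly in delta, so that their oscillation over a polar rectangle
  stays bounded; if psi vanished on one subrectangle and not on another, it would blow up.\<close>
lemma no_zero_rectangle:
  assumes pos: "\<And>x. U x \<ge> 0"
    and K: "0 < a" "b < 1" "0 < c" "d < pi/4"
    and R0: "a \<le> a0" "a0 < b0" "b0 \<le> b" "c \<le> c0" "c0 < d0" "d0 \<le> d"
    and z: "\<And>\<rho> \<theta>. \<rho> \<in> {a0..b0} \<Longrightarrow> \<theta> \<in> {c0..d0} \<Longrightarrow> U (polar \<rho> \<theta>) = 0"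
    and R1: "a \<le> a1" "a1 < b1" "b1 \<le> b" "c \<le> c1" "c1 < d1" "d1 \<le> d"
    and nz: "\<And>\<rho> \<theta>. \<rho> \<in> {a1..b1} \<Longrightarrow> \<theta> \<in> {c1..d1} \<Longrightarrow> U (polar \<rho> \<theta>) > 0"
  shows False
proof -
  have ab: "a < b" "c < d" using R0 by auto
  let ?K = "(\<lambda>z. polar (fst z) (snd z)) ` ({a..b} \<times> {c..d})"
  have Kc: "compact ?K" by (intro compact_continuous_image continuous_intros compact_Times) auto
  have Ks: "?K \<subseteq> sector" using K polar_in_sector by force
  obtain \<eta> Y where \<eta>: "test_fun sector \<eta> Y" and \<eta>0: "\<And>x. \<eta> x \<ge> 0" and \<eta>1: "\<And>x. x \<in> ?K \<Longrightarrow> \<eta> x \<ge> 1"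
    using test_fun_cutoff[OF Kc Ks open_sector] by blast
  \<comment> \<open>M does not involve \<delta>, and neither do S, T0 and T1 below, so \<delta> can
    be chosen after all of them.\<close>
  define M where "M = 2 / (p - 1) * (p * ((p - 1) / (2 * p)) powr (1 - p) * mass p Y)"
  note logg = log_gradient[OF pos \<eta> \<eta>0, folded M_def]
  have M0: "M \<ge> 0" using p3 by (simp add: M_def mass_nonneg)
  have "\<exists>\<kappa>>0. \<forall>\<rho>\<in>{a1..b1}. \<forall>\<theta>\<in>{c1..d1}. \<kappa> \<le> U (polar \<rho> \<theta>)"
  proof -
    have c: "compact ({a1..b1} \<times> {c1..d1})" and ne: "{a1..b1} \<times> {c1..d1} \<noteq> {}" using R1 by (auto intro: compact_Times)
    have ct: "continuous_on ({a1..b1} \<times> {c1..d1}) (\<lambda>z. U (polar (fst z) (snd z)))"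
      by (intro continuous_on_compose2[OF U_cont] continuous_intros) auto
    from continuous_attains_inf[OF c ne ct] obtain w where w0: "w \<in> {a1..b1} \<times> {c1..d1}"
      "\<forall>z\<in>{a1..b1} \<times> {c1..d1}. U (polar (fst w) (snd w)) \<le> U (polar (fst z) (snd z))" ..
    note w = w0(1) w0(2)[rule_format]
    have "U (polar (fst w) (snd w)) > 0" using w(1) by (intro nz) auto
    moreover have "\<forall>\<rho>\<in>{a1..b1}. \<forall>\<theta>\<in>{c1..d1}. U (polar (fst w) (snd w)) \<le> U (polar \<rho> \<theta>)" using w(2)[of "(_, _)"] by auto
    ultimately show ?thesis by blast
  qed
  then obtain \<kappa> where \<kappa>: "\<kappa> > 0" "\<And>\<rho> \<theta>. \<rho> \<in> {a1..b1} \<Longrightarrow> \<theta> \<in> {c1..d1} \<Longrightarrow> \<kappa> \<le> U (polar \<rho> \<theta>)" by blast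
  define S where "S = 2 powr p * (b / a) * ((b - a) powr p + (b * (d - c)) powr p) * (M + 1)"
  have S0: "S \<ge> 0" unfolding S_def using K ab M0 by auto
  define T0 where "T0 = ((S + 1) / (a0 * (b0 - a0) * (d0 - c0))) powr (1 / p)"
  define T1 where "T1 = ((S + 1) / (a1 * (b1 - a1) * (d1 - c1))) powr (1 / p)"
  \<comment> \<open>Gives ln (2 * \<delta>) = ln \<kappa> - T0 - T1 - 1. The logarithm then takes
    values in the two rectangles that are further apart than T0 + T1, although both are close to the
    same mean m.\<close>
  define \<delta> where "\<delta> = \<kappa> * exp (- T0 - T1 - 1) / 2"
  have \<delta>: "\<delta> > 0" and \<delta>2: "\<delta> / 2 > 0" using \<kappa> by (auto simp: \<delta>_def)
  obtain \<phi> G H where dom: "dominated_approx p sector \<psi> (wgrad p sector \<psi>) \<phi> G H"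
    and close: "\<forall>n x. \<bar>\<phi> n x - U x\<bar> \<le> \<delta> / 2" using approx_close[OF \<delta>2] by blast
  note t = dominated_approxD(1)[OF dom] and H = dominated_approxD(2,3)[OF dom] and ae = dominated_AE[OF dom]
  have [measurable]: "\<phi> n \<in> borel_measurable lebesgue" "G n \<in> borel_measurable lebesgue" for n
    using test_funD(3,4)[OF t] by (auto intro: borel_measurable_lebesgue)
  have [measurable]: "\<eta> \<in> borel_measurable lebesgue" using test_funD(3)[OF \<eta>] by (auto intro: borel_measurable_lebesgue)
  have low: "\<phi> n x + \<delta> \<ge> \<delta> / 2" for n x using close[rule_format, of n x] pos[of x] by linarith
  have lowp: "\<phi> n x + \<delta> > 0" for n x using low[of n x] \<delta> by linarith
  obtain B where B: "B \<ge> 0" "\<And>x. \<bar>\<eta> x\<bar> \<le> B" using test_fun_bounded[OF \<eta>] by blast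
  define q where "q n x = \<eta> x powr p * (norm (G n x) / (\<phi> n x + \<delta>)) powr p" for n x
  have iD: "integrable lebesgue (\<lambda>x. B powr p * ((2 / \<delta>) powr p * H x))" using H by simp
  have qm: "q n \<in> borel_measurable lebesgue" for n unfolding q_def by measurable
  have qb: "AE x in lebesgue. norm (q n x) \<le> B powr p * ((2 / \<delta>) powr p * H x)" for n
    using ae
  proof eventually_elim
    case (elim x)
    have "norm (G n x) / (\<phi> n x + \<delta>) \<le> norm (G n x) / (\<delta> / 2)" using low[of n x] \<delta> by (intro divide_left_mono) auto
    then have "(norm (G n x) / (\<phi> n x + \<delta>)) powr p \<le> (norm (G n x) / (\<delta> / 2)) powr p" using lowp[of n x] p1 by (intro powr_mono2) auto
    also have "\<dots> = (2 / \<delta>) powr p * norm (G n x) powr p"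
    proof -
      have "norm (G n x) / (\<delta> / 2) = (2 / \<delta>) * norm (G n x)" by simp
      then show ?thesis using \<delta> by (simp only: powr_mult)
    qed
    also have "\<dots> \<le> (2 / \<delta>) powr p * H x" using elim by (intro mult_left_mono) auto
    finally have 1: "(norm (G n x) / (\<phi> n x + \<delta>)) powr p \<le> (2 / \<delta>) powr p * H x" .
    have "\<eta> x powr p \<le> B powr p" using \<eta>0[of x] B(2)[of x] p1 by (intro powr_mono2) auto
    then have "q n x \<le> B powr p * ((2 / \<delta>) powr p * H x)" unfolding q_def using 1 by (intro mult_mono) auto
    moreover have "q n x \<ge> 0" by (simp add: q_def)
    ultimately show ?case by simp
  qed
  have "(\<lambda>n. \<integral>x. q n x \<partial>lebesgue) \<longlonglongrightarrow> (\<integral>x. \<eta> x powr p * (norm (g x) / (U x + \<delta>)) powr p \<partial>lebesgue)"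
  proof (rule integral_dominated_convergence[OF _ qm iD _ qb])
    show "AE x in lebesgue. (\<lambda>n. q n x) \<longlonglongrightarrow> \<eta> x powr p * (norm (g x) / (U x + \<delta>)) powr p"
      using ae
    proof eventually_elim
      case (elim x)
      have "U x + \<delta> \<noteq> 0" using pos[of x] \<delta> by linarith
      then show ?case unfolding q_def using elim p1 lowp pos[of x] \<delta>
        by (intro tendsto_mult_left tendsto_powr' tendsto_divide tendsto_norm tendsto_add tendsto_const) (auto intro!: always_eventually divide_nonneg_pos)
    qed
  qed measurable
  moreover have "(\<integral>x. \<eta> x powr p * (norm (g x) / (U x + \<delta>)) powr p \<partial>lebesgue) < M + 1" using logg[OF \<delta>] by linarith
  ultimately have "\<forall>\<^sub>F n in sequentially. (\<integral>x. q n x \<partial>lebesgue) < M + 1" by (rule order_tendstoD(2))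
  \<comment> \<open>The bound M belongs to \<psi>; one approximant with the weaker bound M + 1 is
    enough, and its logarithm is C^1 as \<open>poincare_mean\<close> requires.\<close>
  then obtain n where n: "(\<integral>x. q n x \<partial>lebesgue) < M + 1" using eventually_happens by fastforce
  define v where "v x = ln (\<phi> n x + \<delta>)" for x
  define V where "V x = (1 / (\<phi> n x + \<delta>)) *\<^sub>R G n x" for x
  have dv: "(v has_derivative (\<lambda>h. V x \<bullet> h)) (at x)" for x
  proof -
    have "((\<lambda>s. ln (s + \<delta>)) has_real_derivative 1 / (\<phi> n x + \<delta>)) (at (\<phi> n x))"
      using lowp[of n x] by (auto intro!: derivative_eq_intros)
    from has_derivative_compose[OF test_funD(1)[OF t] this[unfolded has_field_derivative_def]] show ?thesis
      unfolding v_def[abs_def] V_def by (rule has_derivative_eq_rhs) auto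
  qed
  have cV: "continuous_on UNIV V" unfolding V_def[abs_def]
  proof (intro continuous_intros C1_continuous[OF test_funD(1)[OF t]] test_funD(2)[OF t] ballI)
    show "\<phi> n x + \<delta> \<noteq> 0" for x using lowp[of n x] by linarith
  qed
  define m where "m = (\<integral>z. v (polar (fst z) (snd z)) \<partial>rect_measure a b c d) / ((b - a) * (d - c))"
  have nV: "norm (V x) = norm (G n x) / (\<phi> n x + \<delta>)" for x using lowp[of n x] by (simp add: V_def)
  have "rect_int a b c d (\<lambda>x. ennreal (norm (V x) powr p)) \<le> rect_int a b c d (\<lambda>x. ennreal (q n x))"
  proof (rule rect_int_le)
    fix \<rho> \<theta> assume "\<rho> \<in> {a..b}" "\<theta> \<in> {c..d}"
    then have "\<eta> (polar \<rho> \<theta>) \<ge> 1" by (intro \<eta>1) force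
    then have "\<eta> (polar \<rho> \<theta>) powr p \<ge> 1" using p1 by (intro ge_one_powr_ge_zero) auto
    then have "1 * norm (V (polar \<rho> \<theta>)) powr p \<le> q n (polar \<rho> \<theta>)" unfolding q_def nV by (intro mult_right_mono) auto
    then show "ennreal (norm (V (polar \<rho> \<theta>)) powr p) \<le> ennreal (q n (polar \<rho> \<theta>))" by (intro ennreal_leI) simp
  qed
  also have "\<dots> \<le> rect_int 0 1 0 (pi/4) (\<lambda>x. ennreal (q n x))" using K by (intro rect_int_mono) auto
  also have "\<dots> = (\<integral>\<^sup>+x. ennreal (q n x) \<partial>lborel)"
  proof (rule rect_int_sector[symmetric])
    have [measurable]: "\<phi> n \<in> borel_measurable borel" "G n \<in> borel_measurable borel" "\<eta> \<in> borel_measurable borel"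
      using test_funD(3,4)[OF t] test_funD(3)[OF \<eta>] by auto
    show "(\<lambda>x. ennreal (q n x)) \<in> borel_measurable borel" unfolding q_def by measurable
    show "ennreal (q n x) = 0" if "x \<notin> sector" for x using test_fun_outside(1)[OF \<eta> that] by (simp add: q_def)
  qed
  also have "\<dots> = ennreal (\<integral>x. q n x \<partial>lebesgue)"
  proof -
    have "integrable lebesgue (q n)"
      by (rule Bochner_Integration.integrable_bound[OF iD qm]) (use qb[of n] in \<open>eventually_elim, auto\<close>)
    then have "(\<integral>\<^sup>+x. ennreal (q n x) \<partial>lebesgue) = ennreal (\<integral>x. q n x \<partial>lebesgue)"
      by (rule nn_integral_eq_integral) (simp add: q_def)
    then show ?thesis by (simp add: nn_integral_completion)
  qed
  also have "\<dots> \<le> ennreal (M + 1)" using n by (intro ennreal_leI) simp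
  finally have RV: "rect_int a b c d (\<lambda>x. ennreal (norm (V x) powr p)) \<le> ennreal (M + 1)" .
  have "rect_int a b c d (\<lambda>x. ennreal (\<bar>v x - m\<bar> powr p)) \<le> ennreal (2 powr p * (b / a) * ((b - a) powr p + (b * (d - c)) powr p)) * rect_int a b c d (\<lambda>x. ennreal (norm (V x) powr p))"
    unfolding m_def by (rule poincare_mean[OF dv cV ab K(1) p1(1)])
  also have "\<dots> \<le> ennreal (2 powr p * (b / a) * ((b - a) powr p + (b * (d - c)) powr p)) * ennreal (M + 1)"
    by (intro mult_left_mono RV) simp
  also have "\<dots> = ennreal S" unfolding S_def using M0 K ab by (subst ennreal_mult[symmetric]) auto
  finally have RS: "rect_int a b c d (\<lambda>x. ennreal (\<bar>v x - m\<bar> powr p)) \<le> ennreal S" .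
  have "\<exists>\<rho>\<in>{a0..b0}. \<exists>\<theta>\<in>{c0..d0}. \<bar>v (polar \<rho> \<theta>) - m\<bar> \<le> T0" unfolding T0_def
    using K R0 by (intro rect_int_point[OF _ _ _ p1(1) S0] order_trans[OF rect_int_mono RS]) auto
  then obtain r0 s0 where 0: "r0 \<in> {a0..b0}" "s0 \<in> {c0..d0}" "\<bar>v (polar r0 s0) - m\<bar> \<le> T0" by blast
  have "\<exists>\<rho>\<in>{a1..b1}. \<exists>\<theta>\<in>{c1..d1}. \<bar>v (polar \<rho> \<theta>) - m\<bar> \<le> T1" unfolding T1_def
    using K R1 by (intro rect_int_point[OF _ _ _ p1(1) S0] order_trans[OF rect_int_mono RS]) auto
  then obtain r1 s1 where 1: "r1 \<in> {a1..b1}" "s1 \<in> {c1..d1}" "\<bar>v (polar r1 s1) - m\<bar> \<le> T1" by blast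
  have "v (polar r0 s0) \<le> ln (2 * \<delta>)"
    unfolding v_def using close[rule_format, of n "polar r0 s0"] z[OF 0(1,2)] lowp[of n "polar r0 s0"] \<delta> by (intro ln_mono) auto
  also have "\<dots> = ln \<kappa> - T0 - T1 - 1" using \<kappa>(1) by (simp add: \<delta>_def ln_mult)
  finally have v0: "v (polar r0 s0) \<le> ln \<kappa> - T0 - T1 - 1" .
  have "\<kappa> \<le> \<phi> n (polar r1 s1) + \<delta>" using close[rule_format, of n "polar r1 s1"] \<kappa>(2)[OF 1(1,2)] \<delta> by linarith
  then have "ln \<kappa> \<le> v (polar r1 s1)" unfolding v_def using \<kappa>(1) by (intro ln_mono) auto
  then show False using v0 0(3) 1(3) by linarith
qed

text \<open>\<open>wgrad\<close> is chosen separately for \<psi> and - \<psi>, so the two gradients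
  are opposite only almost everywhere, by uniqueness.\<close>

lemma sector_eigen_minus: "sector_eigen p lam (\<lambda>x. - \<psi> x)"
proof
  have s0: "sobolev0 p sector (\<lambda>x. 0 - \<psi> x) (\<lambda>x. 0 - wgrad p sector \<psi> x)"
  proof (rule sobolev0_diff[OF _ sob p1(1) sector_borel])
    have "test_fun sector (\<lambda>_. 0) (\<lambda>_. 0)" by (simp add: test_fun_def)
    then show "sobolev0 p sector (\<lambda>_. 0) (\<lambda>_. 0)" using p1 by (intro sobolev0_test bounded_sector) auto
  qed
  then have s: "sobolev0 p sector (\<lambda>x. - \<psi> x) (\<lambda>x. - wgrad p sector \<psi> x)" by simp
  have "AE x in lebesgue. zext sector (wgrad p sector (\<lambda>x. - \<psi> x)) x = zext sector (\<lambda>x. - wgrad p sector \<psi> x) x"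
    by (rule sobolev0_unique[OF sobolev0_wgrad[OF s] s p1(1) bounded_sector])
  then have ae: "AE x in lebesgue. x \<in> sector \<longrightarrow> wgrad p sector (\<lambda>x. - \<psi> x) x = - wgrad p sector \<psi> x"
    by eventually_elim auto
  show "eigenfunction p sector lam (\<lambda>x. - \<psi> x)"
    unfolding eigenfunction_def
  proof (intro conjI allI impI)
    show "in_W0 p sector (\<lambda>x. - \<psi> x)" using s by (auto simp: in_W0_def)
    show "\<not> (AE x\<in>sector in lebesgue. - \<psi> x = 0)" using eig by (simp add: eigenfunction_def)
    fix \<phi> G assume t: "test_fun sector \<phi> G"
    have [measurable]: "G \<in> borel_measurable lebesgue" using test_funD(4)[OF t] by (rule borel_measurable_lebesgue)
    let ?w = "wgrad p sector (\<lambda>x. - \<psi> x)"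
    have gm: "zext sector ?w \<in> borel_measurable lebesgue" by (rule sobolev0_measurable(2)[OF sobolev0_wgrad[OF s]])
    note [measurable] = gm
    have e: "indicator sector x *\<^sub>R (norm (?w x) powr (p - 2) * (?w x \<bullet> G x)) = norm (zext sector ?w x) powr (p - 2) * (zext sector ?w x \<bullet> G x)" for x
      by (cases "x \<in> sector") auto
    have "(\<integral>x\<in>sector. norm (?w x) powr (p - 2) * (?w x \<bullet> G x) \<partial>lebesgue) = (\<integral>x. - (norm (g x) powr (p - 2) * (g x \<bullet> G x)) \<partial>lebesgue)"
      unfolding set_lebesgue_integral_def e
    proof (rule integral_cong_AE)
      show "AE x in lebesgue. norm (zext sector ?w x) powr (p - 2) * (zext sector ?w x \<bullet> G x) = - (norm (g x) powr (p - 2) * (g x \<bullet> G x))"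
        using ae
      proof eventually_elim
        case (elim x)
        then show ?case by (cases "x \<in> sector") auto
      qed
    qed measurable
    also have "\<dots> = - (lam * (\<integral>x. \<bar>U x\<bar> powr (p - 2) * U x * \<phi> x \<partial>lebesgue))" using weak[OF t] by simp
    also have "\<dots> = lam * (\<integral>x\<in>sector. \<bar>- \<psi> x\<bar> powr (p - 2) * - \<psi> x * \<phi> x \<partial>lebesgue)"
    proof -
      have "indicator sector x *\<^sub>R (\<bar>- \<psi> x\<bar> powr (p - 2) * - \<psi> x * \<phi> x) = - (\<bar>U x\<bar> powr (p - 2) * U x * \<phi> x)" for x
        by (cases "x \<in> sector") auto
      then show ?thesis unfolding set_lebesgue_integral_def by (simp only: Bochner_Integration.integral_minus mult_minus_right minus_minus)
    qed
    finally show "(\<integral>x\<in>sector. norm (?w x) powr (p - 2) * (?w x \<bullet> G x) \<partial>lebesgue) = lam * (\<integral>x\<in>sector. \<bar>- \<psi> x\<bar> powr (p - 2) * - \<psi> x * \<phi> x \<partial>lebesgue)" .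
  qed
  show "continuous_on sector (\<lambda>x. - \<psi> x)" using cont by (intro continuous_intros)
qed (use p3 lam in auto)

end

section \<open>Nodal sets made of rays and arcs\<close>

lemma poincare_on_mono: "poincare_on p E \<kappa> \<Longrightarrow> D \<subseteq> E \<Longrightarrow> poincare_on p D \<kappa>"
  unfolding poincare_on_def using test_fun_mono by blast

lemma ex_powr_small:
  assumes x: "0 < x" "x < (1::real)" and c: "c > 0"
  shows "\<exists>P. \<forall>p>P. c * x powr p < 1"
proof (intro exI allI impI)
  fix p assume "p > ln c / (- ln x)"
  moreover have "- ln x > 0" using x by simp
  ultimately have "ln c < p * (- ln x)" by (subst (asm) pos_divide_less_eq) auto
  then have "ln c + p * ln x < 0" by simp
  then have "exp (ln c + p * ln x) < 1" by simp
  then show "c * x powr p < 1" using x c by (simp add: exp_add powr_def)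
qed

lemma sin_diff_pos_iff:
  assumes "0 < s" "s < pi/4" "0 < t" "t < pi/4"
  shows "0 < sin (s - t) \<longleftrightarrow> t < s" "sin (s - t) = 0 \<longleftrightarrow> s = t"
proof -
  have p: "0 < sin (x - y)" if "y < x" "0 < y" "x < pi/4" for x y
    using that by (intro sin_gt_zero) auto
  have m: "sin (s - t) = - sin (t - s)" using sin_minus[of "s - t"] by simp
  show "0 < sin (s - t) \<longleftrightarrow> t < s"
    using p[of t s] p[of s t] m assms by (cases s t rule: linorder_cases) auto
  show "sin (s - t) = 0 \<longleftrightarrow> s = t"
    using p[of t s] p[of s t] m assms by (cases s t rule: linorder_cases) auto
qed

lemma polar_angle_diff: "(polar \<rho> s)$2 * cos t - (polar \<rho> s)$1 * sin t = \<rho> * sin (s - t)"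
  by (simp add: polar_def sin_diff algebra_simps)

lemma sector_polar:
  assumes "x \<in> sector"
  obtains \<theta> where "0 < \<theta>" "\<theta> < pi/4" "x = polar (norm x) \<theta>" "0 < norm x" "norm x < 1"
proof -
  from assms have a: "0 < x$2" "x$2 < x$1" "norm x < 1" by (auto simp: mem_sector)
  obtain \<theta> where t: "0 < \<theta>" "\<theta> < pi/4" "x = polar (norm x) \<theta>" using polar_surj[OF a(1,2)] .
  have "0 < norm x" using a by auto
  from that[OF t this a(3)] show thesis .
qed

context sector_eigen
begin

definition ray_zero :: "real \<Rightarrow> bool" where
  "ray_zero \<theta> \<longleftrightarrow> (\<forall>\<rho>. 0 < \<rho> \<and> \<rho> < 1 \<longrightarrow> \<psi> (polar \<rho> \<theta>) = 0)"

definition arc_zero :: "real \<Rightarrow> bool" where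
  "arc_zero \<rho> \<longleftrightarrow> (\<forall>\<theta>. 0 < \<theta> \<and> \<theta> < pi/4 \<longrightarrow> \<psi> (polar \<rho> \<theta>) = 0)"

context
  assumes small: "4 * 0.1804 powr p * lam < 1"
begin

text \<open>A nonzero value in D would make D carry the eigenvalue, so that 1 <= 4 * 0.1804^p * lam,
  against the standing assumption \<open>small\<close>.\<close>

lemma zero_on:
  assumes "open D" "D \<subseteq> sector" "\<And>x. x \<in> closure D \<Longrightarrow> x \<notin> D \<Longrightarrow> U x = 0" "D \<subseteq> E" "poincare_on p E (4 * 0.1804 powr p)" "x \<in> D"
  shows "\<psi> x = 0"
proof (rule ccontr)
  assume "\<psi> x \<noteq> 0"
  then have "\<exists>x\<in>D. \<psi> x \<noteq> 0" using assms(6) by blast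
  from nodal_domain_eigenvalue[OF assms(1-3) this poincare_on_mono[OF assms(5,4)]] small show False by simp
qed

text \<open>For r <= 0.6395 the inside of the arc is thin enough for \<open>poincare_inner\<close>,
  for larger r the outside is thin enough for \<open>poincare_outer\<close>.\<close>

lemma arc_zero_sides:
  assumes r: "arc_zero r"
  shows "(\<forall>x\<in>sector. norm x < r \<longrightarrow> \<psi> x = 0) \<or> (\<forall>x\<in>sector. norm x > r \<longrightarrow> \<psi> x = 0)"
proof -
  have z: "U x = 0" if "norm x = r" for x
  proof (cases "x \<in> sector")
    case True
    then obtain \<theta> where p: "0 < \<theta>" "\<theta> < pi/4" "x = polar (norm x) \<theta>" by (rule sector_polar)
    have "\<psi> (polar (norm x) \<theta>) = 0" using r p(1,2) unfolding that arc_zero_def by blast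
    then show ?thesis using True p(3) by simp
  qed simp
  have out: "U x = 0" if "x \<notin> sector" for x using that by simp
  show ?thesis
  proof (cases "r \<le> 0.6395")
    case True
    let ?D = "{x \<in> sector. norm x < r}"
    have "open (sector \<inter> {x. norm x < r})" by (intro open_Int open_sector open_Collect_less continuous_intros)
    then have o: "open ?D" by (simp add: Collect_conj_eq)
    have cl: "closure ?D \<subseteq> {x. norm x \<le> r}"
      by (rule closure_minimal) (auto intro!: closed_Collect_le continuous_intros)
    have "\<psi> x = 0" if "x \<in> ?D" for x
    proof (rule zero_on[OF o _ _ _ poincare_inner[OF p1(1)] that])
      fix y assume y: "y \<in> closure ?D" "y \<notin> ?D"
      then have "norm y \<le> r" using cl by blast
      then show "U y = 0" using y(2) z[of y] out[of y] by (cases "y \<in> sector") auto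
    qed (use True in auto)
    then show ?thesis by blast
  next
    case False
    let ?D = "{x \<in> sector. norm x > r}"
    have "open (sector \<inter> {x. r < norm x})" by (intro open_Int open_sector open_Collect_less continuous_intros)
    then have o: "open ?D" by (simp add: Collect_conj_eq)
    have cl: "closure ?D \<subseteq> {x. r \<le> norm x}"
      by (rule closure_minimal) (auto intro!: closed_Collect_le continuous_intros)
    have "\<psi> x = 0" if "x \<in> ?D" for x
    proof (rule zero_on[OF o _ _ _ poincare_outer[OF p1(1)] that])
      fix y assume y: "y \<in> closure ?D" "y \<notin> ?D"
      then have "r \<le> norm y" using cl by blast
      then show "U y = 0" using y(2) z[of y] out[of y] by (cases "y \<in> sector") auto
    qed (use False in auto)
    then show ?thesis by blast
  qed
qed

text \<open>The sign of the cross product \<open>?f\<close> of x with the direction of the ray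
  separates its two sides. The side of smaller opening lies in a half of the sector, where
  \<open>poincare_half\<close> makes \<psi> vanish.\<close>

lemma ray_zero_sides:
  assumes t: "ray_zero t" "0 < t" "t < pi/4"
  shows "(\<forall>\<rho> \<theta>. 0 < \<rho> \<and> \<rho> < 1 \<and> 0 < \<theta> \<and> \<theta> < t \<longrightarrow> \<psi> (polar \<rho> \<theta>) = 0) \<or>
    (\<forall>\<rho> \<theta>. 0 < \<rho> \<and> \<rho> < 1 \<and> t < \<theta> \<and> \<theta> < pi/4 \<longrightarrow> \<psi> (polar \<rho> \<theta>) = 0)"
proof -
  let ?f = "\<lambda>x::R2. x$2 * cos t - x$1 * sin t"
  have f: "(0 < ?f x \<longleftrightarrow> t < \<theta>) \<and> (?f x < 0 \<longleftrightarrow> \<theta> < t) \<and> (?f x = 0 \<longleftrightarrow> \<theta> = t)"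
    if "x = polar \<rho> \<theta>" "0 < \<rho>" "0 < \<theta>" "\<theta> < pi/4" for x \<rho> \<theta>
  proof -
    have "?f x = \<rho> * sin (\<theta> - t)" unfolding that(1) by (rule polar_angle_diff)
    moreover have "sin (\<theta> - t) = - sin (t - \<theta>)" using sin_minus[of "\<theta> - t"] by simp
    ultimately show ?thesis using sin_diff_pos_iff[OF that(3,4) t(2,3)] sin_diff_pos_iff[OF t(2,3) that(3,4)] that(2)
      by (auto simp: zero_less_mult_iff mult_less_0_iff)
  qed
  have cf: "continuous_on UNIV ?f" by (intro continuous_intros)
  have z: "U x = 0" if "?f x = 0" for x
  proof (cases "x \<in> sector")
    case True
    then obtain \<theta> where p: "0 < \<theta>" "\<theta> < pi/4" "x = polar (norm x) \<theta>" "0 < norm x" "norm x < 1" by (rule sector_polar)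
    have "\<theta> = t" using f[OF p(3,4,1,2)] that by blast
    then have "\<psi> (polar (norm x) \<theta>) = 0" using t(1) p(4,5) unfolding ray_zero_def by blast
    then show ?thesis using True p(3) by simp
  qed simp
  have out: "U x = 0" if "x \<notin> sector" for x using that by simp
  show ?thesis
  proof (cases "t \<le> pi/8")
    case True
    let ?D = "{x \<in> sector. ?f x < 0}"
    have "open (sector \<inter> {x. ?f x < 0})" by (intro open_Int open_sector open_Collect_less continuous_intros)
    then have o: "open ?D" by (simp add: Collect_conj_eq)
    have cl: "closure ?D \<subseteq> {x. ?f x \<le> 0}"
      by (rule closure_minimal) (auto intro!: closed_Collect_le continuous_intros)
    have sub: "?D \<subseteq> sub_sector {..<pi/8}"
    proof
      fix x assume x: "x \<in> ?D"
      then have "x \<in> sector" by simp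
      then obtain \<theta> where p: "0 < \<theta>" "\<theta> < pi/4" "x = polar (norm x) \<theta>" "0 < norm x" "norm x < 1" by (rule sector_polar)
      have "\<theta> < t" using f[OF p(3,4,1,2)] x by blast
      then show "x \<in> sub_sector {..<pi/8}" unfolding sub_sector_def using p True by force
    qed
    have D0: "\<psi> x = 0" if "x \<in> ?D" for x
    proof (rule zero_on[OF o _ _ sub poincare_half[OF p1(1)] that])
      fix y assume y: "y \<in> closure ?D" "y \<notin> ?D"
      then have "?f y \<le> 0" using cl by blast
      then show "U y = 0" using y(2) z[of y] out[of y] by (cases "y \<in> sector") auto
    qed auto
    have "\<psi> (polar \<rho> \<theta>) = 0" if "0 < \<rho> \<and> \<rho> < 1 \<and> 0 < \<theta> \<and> \<theta> < t" for \<rho> \<theta>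
    proof (rule D0)
      have "polar \<rho> \<theta> \<in> sector" using that t polar_in_sector[of \<rho> \<theta>] by simp
      moreover have "?f (polar \<rho> \<theta>) < 0" using f[OF refl, of \<rho> \<theta>] that t by auto
      ultimately show "polar \<rho> \<theta> \<in> ?D" by simp
    qed
    then show ?thesis by blast
  next
    case False
    let ?D = "{x \<in> sector. 0 < ?f x}"
    have "open (sector \<inter> {x. 0 < ?f x})" by (intro open_Int open_sector open_Collect_less continuous_intros)
    then have o: "open ?D" by (simp add: Collect_conj_eq)
    have cl: "closure ?D \<subseteq> {x. 0 \<le> ?f x}"
      by (rule closure_minimal) (auto intro!: closed_Collect_le continuous_intros)
    have sub: "?D \<subseteq> sub_sector {pi/8<..}"
    proof
      fix x assume x: "x \<in> ?D"
      then have "x \<in> sector" by simp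
      then obtain \<theta> where p: "0 < \<theta>" "\<theta> < pi/4" "x = polar (norm x) \<theta>" "0 < norm x" "norm x < 1" by (rule sector_polar)
      have "t < \<theta>" using f[OF p(3,4,1,2)] x by blast
      then show "x \<in> sub_sector {pi/8<..}" unfolding sub_sector_def using p False by force
    qed
    have D0: "\<psi> x = 0" if "x \<in> ?D" for x
    proof (rule zero_on[OF o _ _ sub poincare_half[OF p1(1)] that])
      fix y assume y: "y \<in> closure ?D" "y \<notin> ?D"
      then have "0 \<le> ?f y" using cl by blast
      then show "U y = 0" using y(2) z[of y] out[of y] by (cases "y \<in> sector") auto
    qed auto
    have "\<psi> (polar \<rho> \<theta>) = 0" if "0 < \<rho> \<and> \<rho> < 1 \<and> t < \<theta> \<and> \<theta> < pi/4" for \<rho> \<theta>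
    proof (rule D0)
      have "polar \<rho> \<theta> \<in> sector" using that t polar_in_sector[of \<rho> \<theta>] by simp
      moreover have "0 < ?f (polar \<rho> \<theta>)" using f[OF refl, of \<rho> \<theta>] that t by auto
      ultimately show "polar \<rho> \<theta> \<in> ?D" by simp
    qed
    then show ?thesis by blast
  qed
qed

text \<open>Every zero ray or zero arc has psi = 0 on one side of it, which leaves a polar rectangle on
  which psi has no zeros.\<close>
lemma one_signed:
  assumes struct: "\<And>\<rho> \<theta>. 0 < \<rho> \<Longrightarrow> \<rho> < 1 \<Longrightarrow> 0 < \<theta> \<Longrightarrow> \<theta> < pi/4 \<Longrightarrow> \<psi> (polar \<rho> \<theta>) = 0 \<Longrightarrow> ray_zero \<theta> \<or> arc_zero \<rho>"
  shows "(\<forall>x\<in>sector. \<psi> x \<ge> 0) \<or> (\<forall>x\<in>sector. \<psi> x \<le> 0)"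
proof -
  \<comment> \<open>The angles and radii whose ray or arc is not entirely zero. By
    \<open>struct\<close>, \<psi> has no zeros where both conditions hold, and it vanishes at all
    other points of the sector.\<close>
  define V where "V = {\<theta>. 0 < \<theta> \<and> \<theta> < pi/4 \<and> \<not> ray_zero \<theta>}"
  define W where "W = {\<rho>. 0 < \<rho> \<and> \<rho> < 1 \<and> \<not> arc_zero \<rho>}"
  have nz: "\<psi> (polar \<rho> \<theta>) \<noteq> 0" if "\<rho> \<in> W" "\<theta> \<in> V" for \<rho> \<theta>
    using struct[of \<rho> \<theta>] that by (auto simp: V_def W_def)
  have nzc: "\<rho> \<in> W \<and> \<theta> \<in> V" if "0 < \<rho>" "\<rho> < 1" "0 < \<theta>" "\<theta> < pi/4" "\<psi> (polar \<rho> \<theta>) \<noteq> 0" for \<rho> \<theta>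
    using that by (auto simp: V_def W_def ray_zero_def arc_zero_def)
  show ?thesis
  proof (cases "W = {} \<or> V = {}")
    case True
    have "\<psi> x = 0" if x: "x \<in> sector" for x
    proof -
      obtain \<theta> where p: "0 < \<theta>" "\<theta> < pi/4" "x = polar (norm x) \<theta>" "0 < norm x" "norm x < 1" using x by (rule sector_polar)
      have "\<psi> (polar (norm x) \<theta>) = 0" using nzc[OF p(4,5,1,2)] True by blast
      then show ?thesis using p(3) by simp
    qed
    then show ?thesis by simp
  next
    case False
    then obtain \<rho>1 \<theta>1 where 1: "\<rho>1 \<in> W" "\<theta>1 \<in> V" by blast
    \<comment> \<open>An angle missing between two elements of V carries a zero ray. \<psi> then
      vanishes on one side of it, hence at the radius \<rho>1 for one of the two given angles, where
      it is known to be nonzero.\<close>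
    have Vi: "s \<in> V" if "s1 \<in> V" "s2 \<in> V" "s1 \<le> s" "s \<le> s2" for s1 s s2
    proof (rule ccontr)
      assume n: "s \<notin> V"
      then have s: "0 < s" "s < pi/4" "s1 < s" "s < s2" using that by (auto simp: V_def less_le)
      then have "ray_zero s" using n by (simp add: V_def)
      from ray_zero_sides[OF this s(1,2)] show False
        using nz[OF 1(1) that(1)] nz[OF 1(1) that(2)] s that 1 by (auto simp: V_def W_def)
    qed
    have Wi: "s \<in> W" if "s1 \<in> W" "s2 \<in> W" "s1 \<le> s" "s \<le> s2" for s1 s s2
    proof (rule ccontr)
      assume n: "s \<notin> W"
      then have s: "0 < s" "s < 1" "s1 < s" "s < s2" using that by (auto simp: W_def less_le)
      then have "arc_zero s" using n by (simp add: W_def)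
      moreover have "polar s1 \<theta>1 \<in> sector" "polar s2 \<theta>1 \<in> sector" "norm (polar s1 \<theta>1) < s" "norm (polar s2 \<theta>1) > s"
        using polar_in_sector[of s1 \<theta>1] polar_in_sector[of s2 \<theta>1] s that 1 by (auto simp: V_def W_def)
      ultimately show False using arc_zero_sides nz[OF that(1) 1(2)] nz[OF that(2) 1(2)] by blast
    qed
    have "is_interval V" unfolding is_interval_1 by (intro ballI allI impI; elim conjE) (rule Vi)
    moreover have "is_interval W" unfolding is_interval_1 by (intro ballI allI impI; elim conjE) (rule Wi)
    ultimately have "connected V" "connected W" by (simp_all add: is_interval_connected)
    then have "connected (W \<times> V)" by (rule connected_Times[rotated])
    moreover have "continuous_on (W \<times> V) (\<lambda>z. U (polar (fst z) (snd z)))"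
      by (intro continuous_on_compose2[OF U_cont] continuous_intros) auto
    ultimately have conn: "connected ((\<lambda>z. U (polar (fst z) (snd z))) ` (W \<times> V))" by (rule connected_continuous_image[rotated])
    have Us: "U (polar \<rho> \<theta>) = \<psi> (polar \<rho> \<theta>)" if "\<rho> \<in> W" "\<theta> \<in> V" for \<rho> \<theta>
      using that polar_in_sector[of \<rho> \<theta>] by (auto simp: V_def W_def)
    have n0: "0 \<notin> (\<lambda>z. U (polar (fst z) (snd z))) ` (W \<times> V)" using nz Us by force
    have val: "\<psi> x = 0 \<or> \<psi> x \<in> (\<lambda>z. U (polar (fst z) (snd z))) ` (W \<times> V)" if x: "x \<in> sector" for x
    proof (cases "\<psi> x = 0")
      case False
      obtain \<theta> where p: "0 < \<theta>" "\<theta> < pi/4" "x = polar (norm x) \<theta>" "0 < norm x" "norm x < 1" using x by (rule sector_polar)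
      have "\<psi> (polar (norm x) \<theta>) \<noteq> 0" using False p(3) by simp
      then have m: "norm x \<in> W" "\<theta> \<in> V" using nzc[OF p(4,5,1,2)] by blast+
      have "\<psi> x = U (polar (fst (norm x, \<theta>)) (snd (norm x, \<theta>)))" using Us[OF m] p(3) by simp
      then show ?thesis using m by blast
    qed simp
    show ?thesis
    proof (rule ccontr)
      assume "\<not> ?thesis"
      then obtain x y where xy: "x \<in> sector" "y \<in> sector" "\<psi> x < 0" "0 < \<psi> y" by (auto simp: not_le)
      then have "\<psi> x \<in> (\<lambda>z. U (polar (fst z) (snd z))) ` (W \<times> V)" "\<psi> y \<in> (\<lambda>z. U (polar (fst z) (snd z))) ` (W \<times> V)"
        using val by force+
      then have "0 \<in> (\<lambda>z. U (polar (fst z) (snd z))) ` (W \<times> V)"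
        using connectedD_interval[OF conn, of "\<psi> x" "\<psi> y" 0] xy by auto
      then show False using n0 by simp
    qed
  qed
qed

text \<open>One zero brings a whole zero ray or zero arc, and this fills one of its sides with
  zeros. That side contains a polar rectangle, which \<open>no_zero_rectangle\<close> excludes as
  soon as \<psi> is positive on another one.\<close>

lemma positive_if_structured:
  assumes struct: "\<And>\<rho> \<theta>. 0 < \<rho> \<Longrightarrow> \<rho> < 1 \<Longrightarrow> 0 < \<theta> \<Longrightarrow> \<theta> < pi/4 \<Longrightarrow> \<psi> (polar \<rho> \<theta>) = 0 \<Longrightarrow> ray_zero \<theta> \<or> arc_zero \<rho>"
    and nonneg: "\<And>x. x \<in> sector \<Longrightarrow> \<psi> x \<ge> 0" and x: "x \<in> sector"
  shows "\<psi> x > 0"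
proof (rule ccontr)
  assume "\<not> \<psi> x > 0"
  then have x0: "\<psi> x = 0" using nonneg[OF x] by simp
  have pos: "U y \<ge> 0" for y using nonneg by (cases "y \<in> sector") auto
  have "\<exists>y\<in>sector. \<psi> y \<noteq> 0"
  proof (rule ccontr)
    assume "\<not> (\<exists>y\<in>sector. \<psi> y \<noteq> 0)"
    then have "AE x\<in>sector in lebesgue. \<psi> x = 0" by (intro AE_I2) auto
    then show False using eig by (simp add: eigenfunction_def)
  qed
  then obtain y where y: "y \<in> sector" "\<psi> y \<noteq> 0" by blast
  obtain s1 where s1: "0 < s1" "s1 < pi/4" "y = polar (norm y) s1" "0 < norm y" "norm y < 1" using y(1) by (rule sector_polar)
  let ?r1 = "norm y"
  have Uy: "U (polar ?r1 s1) > 0" using y s1(3) nonneg[OF y(1)] by simp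
  have "continuous_on UNIV (\<lambda>z. U (polar (fst z) (snd z)))"
    by (intro continuous_on_compose2[OF U_cont] continuous_intros) auto
  then have "open {z. 0 < U (polar (fst z) (snd z))}" by (intro open_Collect_less continuous_intros)
  moreover have "(?r1, s1) \<in> {z. 0 < U (polar (fst z) (snd z))}" using Uy by simp
  ultimately obtain A B where AB: "open A" "open B" "(?r1, s1) \<in> A \<times> B" "A \<times> B \<subseteq> {z. 0 < U (polar (fst z) (snd z))}"
    using open_prod_elim by blast
  obtain e1 where e1: "e1 > 0" "cball ?r1 e1 \<subseteq> A" using AB open_contains_cball by blast
  obtain e2 where e2: "e2 > 0" "cball s1 e2 \<subseteq> B" using AB open_contains_cball by blast
  define b1 where "b1 = min (?r1 + e1) ((?r1 + 1) / 2)"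
  define d1 where "d1 = min (s1 + e2) ((s1 + pi/4) / 2)"
  have b1: "?r1 < b1" "b1 < 1" using e1(1) s1(5) by (simp_all add: b1_def min_less_iff_disj)
  have "(s1 + pi/4) / 2 < pi/4" using s1(2) by (simp add: field_simps)
  moreover have "d1 \<le> (s1 + pi/4) / 2" unfolding d1_def by (rule min.cobounded2)
  moreover have "s1 < d1" using e2(1) s1(2) by (simp add: d1_def)
  ultimately have d1: "s1 < d1" "d1 < pi/4" by linarith+
  have nz: "U (polar \<rho> \<theta>) > 0" if "\<rho> \<in> {?r1..b1}" "\<theta> \<in> {s1..d1}" for \<rho> \<theta>
  proof -
    have "\<rho> \<in> cball ?r1 e1" "\<theta> \<in> cball s1 e2" using that by (auto simp: b1_def d1_def dist_real_def)
    then have "(\<rho>, \<theta>) \<in> A \<times> B" using e1 e2 by auto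
    then show ?thesis using AB(4) by auto
  qed
  obtain t where t: "0 < t" "t < pi/4" "x = polar (norm x) t" "0 < norm x" "norm x < 1" using x by (rule sector_polar)
  have "\<psi> (polar (norm x) t) = 0" using x0 t(3) by simp
  from struct[OF t(4,5,1,2) this]
  have "\<exists>a0 b0 c0 d0. 0 < a0 \<and> a0 < b0 \<and> b0 < 1 \<and> 0 < c0 \<and> c0 < d0 \<and> d0 < pi/4 \<and>
    (\<forall>\<rho>\<in>{a0..b0}. \<forall>\<theta>\<in>{c0..d0}. \<psi> (polar \<rho> \<theta>) = 0)"
  proof
    assume "ray_zero t"
    from ray_zero_sides[OF this t(1,2)] show ?thesis
    proof
      assume "\<forall>\<rho> \<theta>. 0 < \<rho> \<and> \<rho> < 1 \<and> 0 < \<theta> \<and> \<theta> < t \<longrightarrow> \<psi> (polar \<rho> \<theta>) = 0"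
      then show ?thesis using t by (intro exI[of _ "1/3"] exI[of _ "1/2"] exI[of _ "t/3"] exI[of _ "t/2"]) auto
    next
      assume "\<forall>\<rho> \<theta>. 0 < \<rho> \<and> \<rho> < 1 \<and> t < \<theta> \<and> \<theta> < pi/4 \<longrightarrow> \<psi> (polar \<rho> \<theta>) = 0"
      then show ?thesis using t by (intro exI[of _ "1/3"] exI[of _ "1/2"] exI[of _ "(2 * t + pi/4)/3"] exI[of _ "(t + pi/2)/3"]) auto
    qed
  next
    assume "arc_zero (norm x)"
    from arc_zero_sides[OF this] show ?thesis
    proof
      assume a: "\<forall>z\<in>sector. norm z < norm x \<longrightarrow> \<psi> z = 0"
      have "\<psi> (polar \<rho> \<theta>) = 0" if "\<rho> \<in> {norm x / 3..norm x / 2}" "\<theta> \<in> {pi/16..pi/8}" for \<rho> \<theta>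
      proof -
        have b: "0 < \<rho>" "\<rho> < 1" "0 < \<theta>" "\<theta> < pi/4" "\<rho> < norm x"
          using that t(4,5) pi_gt_zero unfolding atLeastAtMost_iff by linarith+
        then show ?thesis using a[rule_format, of "polar \<rho> \<theta>"] polar_in_sector[OF b(1,3,4)] by simp
      qed
      then show ?thesis using t by (intro exI[of _ "norm x / 3"] exI[of _ "norm x / 2"] exI[of _ "pi/16"] exI[of _ "pi/8"]) auto
    next
      assume a: "\<forall>z\<in>sector. norm z > norm x \<longrightarrow> \<psi> z = 0"
      have "\<psi> (polar \<rho> \<theta>) = 0" if "\<rho> \<in> {(2 * norm x + 1) / 3..(norm x + 2) / 3}" "\<theta> \<in> {pi/16..pi/8}" for \<rho> \<theta>
      proof -
        have c: "2 * norm x + 1 \<le> 3 * \<rho>" "3 * \<rho> \<le> norm x + 2" using that(1) by simp_all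
        have b: "0 < \<rho>" "\<rho> < 1" "0 < \<theta>" "\<theta> < pi/4" "norm x < \<rho>"
          using that(2) c t(4,5) pi_gt_zero unfolding atLeastAtMost_iff by linarith+
        then show ?thesis using a[rule_format, of "polar \<rho> \<theta>"] polar_in_sector[OF b(1,3,4)] by simp
      qed
      moreover have "0 < (2 * r + 1) / 3 \<and> (2 * r + 1) / 3 < (r + 2) / 3 \<and> (r + 2) / 3 < 1" if "0 < r" "r < 1" for r :: real
        using that by simp
      note this[OF t(4,5)]
      moreover have "0 < pi/16" "pi/16 < pi/8" "pi/8 < pi/4" by simp_all
      ultimately show ?thesis by blast
    qed
  qed
  then obtain a0 b0 c0 d0 where R0: "0 < a0" "a0 < b0" "b0 < 1" "0 < c0" "c0 < d0" "d0 < pi/4"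
    and z0: "\<And>\<rho> \<theta>. \<rho> \<in> {a0..b0} \<Longrightarrow> \<theta> \<in> {c0..d0} \<Longrightarrow> \<psi> (polar \<rho> \<theta>) = 0" by blast
  have z: "U (polar \<rho> \<theta>) = 0" if "\<rho> \<in> {a0..b0}" "\<theta> \<in> {c0..d0}" for \<rho> \<theta>
    using z0[OF that] by (cases "polar \<rho> \<theta> \<in> sector") auto
  show False
    by (rule no_zero_rectangle[OF pos, of "min a0 ?r1" "max b0 b1" "min c0 s1" "max d0 d1" a0 b0 c0 d0 ?r1 b1 s1 d1, OF _ _ _ _ _ _ _ _ _ _ z _ _ _ _ _ _ nz])
      (use R0 s1 b1 d1 in auto)
qed

end

text \<open>The disc of radius 0.27 about c, a point close to the incentre, gives lam <= (0.27 /
  0.001)^2 / 0.267^p by \<open>picone\<close>, where 0.267 = 0.27 - 3 * 0.001. Against the lower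
  bound 1 / (10 * 0.265^p) this leaves the factor 10 * 72900 = 729000.\<close>

lemma unstructured:
  assumes small: "4 * 0.1804 powr p * lam < 1" and large: "729000 * (0.265 / 0.267) powr p < 1" "1 / (10 * 0.265 powr p) \<le> lam"
    and struct: "\<And>\<rho> \<theta>. 0 < \<rho> \<Longrightarrow> \<rho> < 1 \<Longrightarrow> 0 < \<theta> \<Longrightarrow> \<theta> < pi/4 \<Longrightarrow> \<psi> (polar \<rho> \<theta>) = 0 \<Longrightarrow> ray_zero \<theta> \<or> arc_zero \<rho>"
    and nonneg: "\<And>x. x \<in> sector \<Longrightarrow> \<psi> x \<ge> 0"
  shows False
proof -
  define c where "c = vec2 0.6540 0.2705"
  have nc: "norm c < 1 - 0.27"
    unfolding norm_R2 c_def by (rule real_less_lsqrt; simp add: power2_eq_square)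
  have sub: "cball c 0.27 \<subseteq> sector"
    by (rule cball_sector[OF _ _ _ _ nc]) (auto simp: c_def power2_eq_square)
  let ?e = "0.001 :: real" and ?r = "0.27 :: real"
  have e: "?e > 0" and r: "?r > 0" and r3: "?r > 3 * ?e" by auto
  note m = bump_mass[OF e r3 p1(1) sub]
  have "lam * mass p (bump ?e c ?r) \<le> mass p (bump' ?e c ?r)"
    by (rule picone[OF _ test_fun_bump[OF e r sub] bump(6)[OF e r]]) (rule positive_if_structured[OF small struct nonneg])
  then have "lam * ((?r - 3 * ?e) powr p * (pi * ?e\<^sup>2)) \<le> pi * ?r\<^sup>2"
    using m mult_left_mono[OF m(2) lam] by linarith
  then have "pi * (lam * ((?r - 3 * ?e) powr p * ?e\<^sup>2)) \<le> pi * ?r\<^sup>2" by (simp only: mult_ac)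
  then have 1: "lam * ((?r - 3 * ?e) powr p * ?e\<^sup>2) \<le> ?r\<^sup>2" by (rule mult_left_le_imp_le) simp
  define A B :: real where AB: "A = 0.265 powr p" "B = 0.267 powr p"
  have AB0: "A > 0" "B > 0" by (simp_all add: AB)
  have "(0.265 / 0.267) powr p = A / B" unfolding AB by (rule powr_divide)
  then have "729000 * (A / B) < 1" using large(1) by (simp only:)
  then have l: "729000 * A < B" using AB0 by (simp add: field_simps)
  have "?r - 3 * ?e = 0.267" by simp
  then have 2: "lam * (B * ?e\<^sup>2) \<le> ?r\<^sup>2" using 1 unfolding AB by (simp only:)
  have "1 / (10 * A) * (B * ?e\<^sup>2) \<le> lam * (B * ?e\<^sup>2)"
    using large(2) AB0 unfolding AB(1)[symmetric] by (intro mult_right_mono) auto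
  then have "1 / (10 * A) * (B * ?e\<^sup>2) \<le> ?r\<^sup>2" using 2 by (rule order_trans)
  then have "B \<le> 729000 * A" using AB0 by (simp add: field_simps power2_eq_square)
  then show False using l by linarith
qed

end

section \<open>The reflected function and its zero set\<close>

lemma sector_data_sector:
  assumes x: "x \<in> sector" "x = polar \<rho> \<theta>" "0 < \<rho>" "0 < \<theta>" "\<theta> < pi/4"
  shows "sector_data x r s j \<longleftrightarrow> r = \<rho> \<and> s = \<theta> \<and> j = 0"
proof
  assume d: "sector_data x r s j"
  then have j: "j < 8" "0 < r" "r < 1" "real j * pi / 4 < s" "s < (real j + 1) * pi / 4" "x = polar r s" by (auto simp: sector_data_def)
  have s0: "0 < s" using j(4) by (rule le_less_trans[rotated]) simp
  have "(real j + 1) * pi \<le> 8 * pi" using j(1) by (intro mult_right_mono) auto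
  then have s2: "s < 2 * pi" using j(5) by linarith
  have e: "polar \<rho> \<theta> = polar r s" using x j by simp
  \<comment> \<open>\<open>sector_data\<close> allows angles up to 2 pi; those above pi are shifted
    by 2 pi into the range in which \<open>polar_inj\<close> gives uniqueness.\<close>
  have "s \<le> pi"
  proof (rule ccontr)
    assume "\<not> s \<le> pi"
    then have "polar \<rho> \<theta> = polar r (s - 2 * pi)" "s - 2 * pi \<in> {-pi<..pi}" using e s2 by (auto simp: polar_def sin_diff cos_diff)
    then have "\<theta> = s - 2 * pi" using polar_inj[of \<rho> \<theta> r "s - 2 * pi"] x j(2) by auto
    then show False using s2 x by simp
  qed
  then have rs: "\<rho> = r" "\<theta> = s" using polar_inj[OF e] x j(2) s0 by auto
  have "real j * pi < 1 * pi" using j(4) rs(2) x(5) by linarith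
  then have "real j < 1" using pi_gt_zero by (simp only: mult_less_cancel_right_pos)
  then show "r = \<rho> \<and> s = \<theta> \<and> j = 0" using rs by simp
next
  assume "r = \<rho> \<and> s = \<theta> \<and> j = 0"
  then show "sector_data x r s j" using x polar_in_sector[of \<rho> \<theta>] by (simp add: sector_data_def)
qed

lemma reflect8_sector:
  assumes x: "x \<in> sector"
  shows "reflect8 \<psi> x = \<psi> x"
proof -
  obtain \<theta> where p: "0 < \<theta>" "\<theta> < pi/4" "x = polar (norm x) \<theta>" "0 < norm x" "norm x < 1" using x by (rule sector_polar)
  note d = sector_data_sector[OF x p(3,4,1,2)]
  have ex: "\<exists>\<rho> \<theta> j. sector_data x \<rho> \<theta> j" using d by blast
  have "(SOME (\<rho>, \<theta>, j). sector_data x \<rho> \<theta> j) = (norm x, \<theta>, 0)"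
    by (rule some_equality) (auto simp: d)
  then show ?thesis using ex p(3) unfolding reflect8_def by simp
qed

text \<open>q is the imaginary part of (x$1 + i x$2)^4, that is \<rho>^4 sin (4 \<theta>), whatever
  polar representation is used. It vanishes on these diameters but at no point described by
  \<open>sector_data\<close>, so the default value 0 of \<open>reflect8\<close> applies.\<close>

lemma reflect8_diameter:
  "reflect8 \<psi> (polar t (real j * pi / 4)) = 0"
proof -
  define q where "q x = 4 * x$1 * x$2 * ((x$1)\<^sup>2 - (x$2)\<^sup>2)" for x :: R2
  have q: "q (polar \<rho> \<theta>) = \<rho> ^ 4 * sin (4 * \<theta>)" for \<rho> \<theta>
  proof -
    have "sin (4 * \<theta>) = 2 * sin (2 * \<theta>) * cos (2 * \<theta>)" using sin_double[of "2 * \<theta>"] by simp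
    also have "\<dots> = 4 * sin \<theta> * cos \<theta> * ((cos \<theta>)\<^sup>2 - (sin \<theta>)\<^sup>2)" by (simp add: sin_double cos_double)
    finally have e: "sin (4 * \<theta>) = \<dots>" .
    show ?thesis unfolding e by (simp add: q_def polar_def power4_eq_xxxx power2_eq_square algebra_simps)
  qed
  have "\<not> sector_data (polar t (real j * pi / 4)) \<rho> \<theta> i" for \<rho> \<theta> i
  proof
    assume d: "sector_data (polar t (real j * pi / 4)) \<rho> \<theta> i"
    then have i: "0 < \<rho>" "real i * pi / 4 < \<theta>" "\<theta> < (real i + 1) * pi / 4" "polar t (real j * pi / 4) = polar \<rho> \<theta>" by (auto simp: sector_data_def)
    have "\<rho> ^ 4 * sin (4 * \<theta>) = t ^ 4 * sin (4 * (real j * pi / 4))" using arg_cong[OF i(4), of q] unfolding q by simp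
    also have "\<dots> = 0" by simp
    finally have "sin (4 * \<theta>) = 0" using i(1) by simp
    then obtain k :: int where k: "4 * \<theta> = real_of_int k * pi" by (auto simp: sin_zero_iff_int2)
    have "real i * pi < real_of_int k * pi" "real_of_int k * pi < (real i + 1) * pi" using i(2,3) k by linarith+
    then have "real i < real_of_int k" "real_of_int k < real i + 1" using mult_less_cancel_right_pos[OF pi_gt_zero] by blast+
    then have "real_of_int (int i) < real_of_int k" "real_of_int k < real_of_int (int i + 1)" by simp_all
    then show False unfolding of_int_less_iff by linarith
  qed
  then show ?thesis by (simp add: reflect8_def)
qed

lemma polar_scale: "polar (k * \<rho>) \<theta> = k *\<^sub>R polar \<rho> \<theta>"
  by (rule R2_eqI) (auto simp: polar_def)

text \<open>A diameter or circle in the zero set that meets the sector contains the whole ray or arc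
  through the common point. Parameters of a diameter may be negative, so only |t| = \<rho> is known,
  and the ray is reached by scaling.\<close>

lemma zero_set_structured:
  assumes Z: "{x \<in> ball 0 1. reflect8 \<psi> x = 0} = (\<Union>\<alpha>\<in>A. diameter \<alpha>) \<union> (\<Union>r\<in>R. sphere 0 r)"
    and p: "0 < \<rho>" "\<rho> < 1" "0 < \<theta>" "\<theta> < pi/4" and z: "\<psi> (polar \<rho> \<theta>) = 0"
  shows "(\<forall>s. 0 < s \<and> s < 1 \<longrightarrow> \<psi> (polar s \<theta>) = 0) \<or> (\<forall>t. 0 < t \<and> t < pi/4 \<longrightarrow> \<psi> (polar \<rho> t) = 0)"
proof -
  have sec: "polar s t \<in> sector" if "0 < s" "s < 1" "0 < t" "t < pi/4" for s t using polar_in_sector that by simp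
  have zeros: "\<psi> y = 0" if "y \<in> sector" "y \<in> (\<Union>\<alpha>\<in>A. diameter \<alpha>) \<union> (\<Union>r\<in>R. sphere 0 r)" for y
    using that reflect8_sector[of y \<psi>] unfolding Z[symmetric] by simp
  let ?x = "polar \<rho> \<theta>"
  have "?x \<in> {x \<in> ball 0 1. reflect8 \<psi> x = 0}" using reflect8_sector[OF sec[OF p], of \<psi>] z p by simp
  then consider \<alpha> where "\<alpha> \<in> A" "?x \<in> diameter \<alpha>" | r where "r \<in> R" "?x \<in> sphere 0 r" unfolding Z by blast
  then show ?thesis
  proof cases
    case 1
    then obtain t where t: "?x = polar t \<alpha>" "-1 < t" "t < 1" by (auto simp: diameter_def)
    have nt: "\<bar>t\<bar> = \<rho>" using arg_cong[OF t(1), of norm] p by simp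
    have "\<psi> (polar s \<theta>) = 0" if s: "0 < s" "s < 1" for s
    proof (rule zeros)
      show "polar s \<theta> \<in> sector" using sec s p by simp
      have "polar s \<theta> = polar (s / \<rho> * \<rho>) \<theta>" using p by simp
      also have "\<dots> = polar (s / \<rho> * t) \<alpha>" unfolding polar_scale t(1) ..
      finally have e: "polar s \<theta> = polar (s / \<rho> * t) \<alpha>" .
      have "\<bar>s / \<rho> * t\<bar> = s" using nt p s by (simp add: abs_mult)
      then have "polar s \<theta> \<in> diameter \<alpha>" unfolding diameter_def e using s by (intro CollectI exI[of _ "s / \<rho> * t"]) auto
      then show "polar s \<theta> \<in> (\<Union>\<alpha>\<in>A. diameter \<alpha>) \<union> (\<Union>r\<in>R. sphere 0 r)" using 1 by blast
    qed
    then show ?thesis by blast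
  next
    case 2
    then have "r = \<rho>" using p by simp
    have "\<psi> (polar \<rho> t) = 0" if "0 < t" "t < pi/4" for t
    proof (rule zeros)
      show "polar \<rho> t \<in> sector" using sec p that by simp
      have "polar \<rho> t \<in> sphere 0 r" using p \<open>r = \<rho>\<close> by simp
      then show "polar \<rho> t \<in> (\<Union>\<alpha>\<in>A. diameter \<alpha>) \<union> (\<Union>r\<in>R. sphere 0 r)" using 2 by blast
    qed
    then show ?thesis by blast
  qed
qed

theorem theorem1p7:
  "\<exists>pstar > 1. \<forall>p > pstar. \<forall>\<psi>.
     eigenfunction p sector (lambda2 p sector) \<psi> \<and> continuous_on sector \<psi> \<longrightarrow>
     (let Z = {x \<in> ball 0 1. reflect8 \<psi> x = 0} in
        (\<Union>j<4. diameter (real j * pi / 4)) \<subseteq> Z \<and>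
        \<not> (\<exists>A R. R \<subseteq> {0<..<1} \<and>
               Z = (\<Union>\<alpha>\<in>A. diameter \<alpha>) \<union> (\<Union>r\<in>R. sphere 0 r)))"
proof -
  obtain P1 where P1: "\<And>p. p > P1 \<Longrightarrow> (4 * 10 ^ 8) * (0.1804 / 0.1805 :: real) powr p < 1"
    using ex_powr_small[of "0.1804 / 0.1805" "4 * 10 ^ 8"] by auto
  obtain P2 where P2: "\<And>p. p > P2 \<Longrightarrow> 729000 * (0.265 / 0.267 :: real) powr p < 1"
    using ex_powr_small[of "0.265 / 0.267" 729000] by auto
  \<comment> \<open>3 serves Morrey's inequality, P1 the comparison of 0.1804 with 0.1805 and P2
    that of 0.265 with 0.267.\<close>
  define pstar where "pstar = max 3 (max P1 P2)"
  show ?thesis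
  proof (intro exI[of _ pstar] conjI allI impI)
    show "pstar > 1" by (simp add: pstar_def)
    fix p \<psi> assume p: "p > pstar" and a: "eigenfunction p sector (lambda2 p sector) \<psi> \<and> continuous_on sector \<psi>"
    have p3: "p \<ge> 3" "p \<ge> 1" and pP: "p > P1" "p > P2" using p by (auto simp: pstar_def)
    have lower: "1 / (10 * 0.265 powr p) \<le> lambda2 p sector" by (rule lambda2_lower[OF p3(2)])
    have upper: "lambda2 p sector \<le> 10 ^ 8 / 0.1805 powr p" by (rule lambda2_upper(2)[OF p3(2)])
    have "(0::real) \<le> 1 / (10 * 0.265 powr p)" by simp
    then have l0: "0 \<le> lambda2 p sector" using lower by linarith
    interpret sector_eigen p "lambda2 p sector" \<psi> using p3 l0 a by unfold_locales auto
    have small: "4 * 0.1804 powr p * lambda2 p sector < 1"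
    proof -
      have "4 * 0.1804 powr p * lambda2 p sector \<le> 4 * 0.1804 powr p * (10 ^ 8 / 0.1805 powr p)"
        by (intro mult_left_mono upper) simp
      also have "\<dots> = (4 * 10 ^ 8) * (0.1804 / 0.1805) powr p"
        unfolding powr_divide by (simp only: times_divide_eq_right times_divide_eq_left mult_ac)
      also have "\<dots> < 1" by (rule P1[OF pP(1)])
      finally show ?thesis .
    qed
    \<comment> \<open>A or R may be empty, so unions of diameters alone and of circles alone are
      excluded as well.\<close>
    have not_structured: "\<not> (\<exists>A R. {x \<in> ball 0 1. reflect8 \<psi> x = 0} = (\<Union>\<alpha>\<in>A. diameter \<alpha>) \<union> (\<Union>r\<in>R. sphere 0 r))"
    proof
      assume "\<exists>A R. {x \<in> ball 0 1. reflect8 \<psi> x = 0} = (\<Union>\<alpha>\<in>A. diameter \<alpha>) \<union> (\<Union>r\<in>R. sphere 0 r)"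
      then obtain A R where Z: "{x \<in> ball 0 1. reflect8 \<psi> x = 0} = (\<Union>\<alpha>\<in>A. diameter \<alpha>) \<union> (\<Union>r\<in>R. sphere 0 r)" by blast
      have struct: "ray_zero \<theta> \<or> arc_zero \<rho>" if "0 < \<rho>" "\<rho> < 1" "0 < \<theta>" "\<theta> < pi/4" "\<psi> (polar \<rho> \<theta>) = 0" for \<rho> \<theta>
        using zero_set_structured[OF Z that] unfolding ray_zero_def arc_zero_def .
      from one_signed[OF small struct] show False
      proof
        assume "\<forall>x\<in>sector. 0 \<le> \<psi> x"
        then show False using unstructured[OF small P2[OF pP(2)] lower struct] by blast
      next
        assume n: "\<forall>x\<in>sector. \<psi> x \<le> 0"
        interpret neg: sector_eigen p "lambda2 p sector" "\<lambda>x. - \<psi> x" by (rule sector_eigen_minus)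
        have "neg.ray_zero \<theta> \<or> neg.arc_zero \<rho>" if "0 < \<rho>" "\<rho> < 1" "0 < \<theta>" "\<theta> < pi/4" "- \<psi> (polar \<rho> \<theta>) = 0" for \<rho> \<theta>
          using struct[OF that(1-4)] that(5) by (simp add: neg.ray_zero_def neg.arc_zero_def ray_zero_def arc_zero_def)
        then show False using neg.unstructured[OF small P2[OF pP(2)] lower] n by simp
      qed
    qed
    have "(\<Union>j<4. diameter (real j * pi / 4)) \<subseteq> {x \<in> ball 0 1. reflect8 \<psi> x = 0}"
      using reflect8_diameter by (auto simp: diameter_def)
    then show "let Z = {x \<in> ball 0 1. reflect8 \<psi> x = 0} in
        (\<Union>j<4. diameter (real j * pi / 4)) \<subseteq> Z \<and>
        \<not> (\<exists>A R. R \<subseteq> {0<..<1} \<and>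
               Z = (\<Union>\<alpha>\<in>A. diameter \<alpha>) \<union> (\<Union>r\<in>R. sphere 0 r))"
      unfolding Let_def using not_structured by blast
  qed
qed

end
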